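(* For every integer $k>1$, $$\lim_{\ell\to\infty}\lambda_\ell^k=\inf_{\nu\in S^{m-1}}Z^\nu .$$ In particular, when $A_{12}\nabla_\xi W$ is not equal to $0$ a.e. in $\omega_2$, this common limit is strictly lower than $\mu_1$.
   Context: Let $m\ge 2$, $p\ge 1$, and let $\omega_1\subset\mathbb{R}^m$, $\omega_2\subset\mathbb{R}^p$ be bounded domains (nonempty, open, connected) with $C^1$ boundary, with $0\in\omega_1$. Points of $\mathbb{R}^{m+p}$ are written $x=(X,\xi)$ with $X\in\mathbb{R}^m$, $\xi\in\mathbb{R}^p$. For $\ell>0$ set $\Omega_\ell=\ell\omega_1\times\omega_2$, $\Gamma_\ell=\partial(\ell\omega_1)\times\omega_2$, $\gamma_\ell=\ell\omega_1\times\partial\omega_2$. Let $$A=A(\xi)=\begin{pmatrix}A_{11}(\xi)&A_{12}(\xi)\\ A_{12}^T(\xi)&A_{22}(\xi)\end{pmatrix}$$ be a symmetric $(m+p)\times(m+p)$ matrix with measurable bounded entries on $\omega_2$ ($A_{11}$ of size $m\times m$, $A_{12}$ of size $m\times p$, $A_{22}$ of size $p\times p$), such that for some constants $c_A,C_A>0$: $(A(\xi)y)\cdot y\ge c_A\|y\|^2$ for all $y\in\mathbb{R}^{m+p}$ and $\|A(\xi)\|\le C_A$ (operator norm), for a.e. $\xi\in\omega_2$. $\lambda_\ell^k$ denotes the $k$-th eigenvalue $\sigma$ (in nondecreasing order, counted with multiplicity) of the mixed Neumann–Dirichlet problem (understood in the weak sense) $$-\operatorname{div}(A\nabla u)=\sigma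 u\ \text{in }\Omega_\ell,\qquad u=0\ \text{on }\gamma_\ell,\qquad (A\nabla u)\cdot\tilde\nu=0\ \text{on }\Gamma_\ell,$$ where $\tilde\nu$ is the outward unit normal to $\Gamma_\ell$. Equivalently, for $k\ge2$, $$\lambda_\ell^k=\inf\left\{\frac{\int_{\Omega_\ell}(A\nabla u)\cdot\nabla u}{\int_{\Omega_\ell}u^2}:\ 0\ne u\in H^1(\Omega_\ell),\ u=0\text{ on }\gamma_\ell,\ \int_{\Omega_\ell}u\,u_\ell^i=0\text{ for }1\le i\le k-1\right\},$$ where $u_\ell^i$ is an eigenfunction corresponding to $\lambda_\ell^i$ (chosen mutually orthogonal in $L^2(\Omega_\ell)$), and $\lambda_\ell^1$ is given by the same infimum without orthogonality constraints. $\mu_1$ denotes the first eigenvalue, and $W$ the unique positive eigenfunction normalized by $\int_{\omega_2}W^2=1$, of the problem $-\operatorname{div}_\xi(A_{22}\nabla_\xi W)=\mu_1W$ in $\omega_2$, $W=0$ on $\partial\omega_2$. $S^{m-1}$ is the unit sphere of $\mathbb{R}^m$. For $\nu\in S^{m-1}$ (column vector) let $A_\nu(\xi)$ be the $(p+1)\times(p+1)$ matrix $$A_\nu=\begin{pmatrix}(A_{11}\nu)\cdot\nu&\nu^TA_{12}\\(\nu^TA_{12})^T&A_{22}\end{pmatrix},$$ and $$Z^\nu=\inf\left\{\frac{\int_{(-\infty,0)\times\omega_2}(A_\nu\nabla u)\cdot\nabla u}{\int_{(-\infty,0)\times\omega_2}u^2}:\ 0\neq u\in H^1((-\infty,0)\times\omega_2),\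 u=0\text{ on }(-\infty,0)\times\partial\omega_2\right\},$$ where $\nabla u=(\partial_{x_1}u,\nabla_\xi u)$ for $u=u(x_1,\xi)$. *)

theory Defs
  imports "HOL-Analysis.Analysis"
begin

section \<open>Domains with \<open>C\<^sup>1\<close> boundary\<close>

text \<open>For \<open>k + 1\<close>: Frechet differentiable, with every directional derivative of class \<open>C\<^sup>k\<close>.\<close>

primrec Ck :: "nat \<Rightarrow> ('a::real_normed_vector \<Rightarrow> real) \<Rightarrow> bool" where
  "Ck 0 f \<longleftrightarrow> continuous_on UNIV f"
| "Ck (Suc k) f \<longleftrightarrow> (\<forall>x. f differentiable (at x)) \<and>
      (\<forall>v. Ck k (\<lambda>x. frechet_derivative f (at x) v))"

text \<open>Near each boundary point, the set is the strict subgraph of a \<open>C\<^sup>1\<close> function over the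
  hyperplane orthogonal to some unit vector \<open>e\<close>; a function on that hyperplane is encoded as a
  function on the whole space that is invariant in direction \<open>e\<close>.\<close>

definition C1_boundary :: "'a::euclidean_space set \<Rightarrow> bool" where
  "C1_boundary \<Omega> \<longleftrightarrow> (\<forall>z\<in>frontier \<Omega>. \<exists>r>0. \<exists>e h. norm e = 1 \<and> Ck 1 h \<and>
      (\<forall>y t. h (y + t *\<^sub>R e) = h y) \<and>
      \<Omega> \<inter> ball z r = {y \<in> ball z r. y \<bullet> e < h y})"

definition bounded_C1_domain :: "'a::euclidean_space set \<Rightarrow> bool" where
  "bounded_C1_domain \<Omega> \<longleftrightarrow>
     \<Omega> \<noteq> {} \<and> open \<Omega> \<and> connected \<Omega> \<and> bounded \<Omega> \<and> C1_boundary \<Omega>"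


section \<open>Sobolev spaces\<close>

definition L2_on :: "'a::euclidean_space set \<Rightarrow> ('a \<Rightarrow> 'b::euclidean_space) \<Rightarrow> bool" where
  "L2_on \<Omega> f \<longleftrightarrow> f \<in> borel_measurable (lebesgue_on \<Omega>) \<and>
      integrable (lebesgue_on \<Omega>) (\<lambda>x. (norm (f x))\<^sup>2)"

definition supp :: "('a::euclidean_space \<Rightarrow> real) \<Rightarrow> 'a set" where
  "supp \<phi> = closure {x. \<phi> x \<noteq> 0}"

definition test_functions :: "('a::euclidean_space \<Rightarrow> real) set" where
  "test_functions = {\<phi>. (\<forall>k. Ck k \<phi>) \<and> compact (supp \<phi>)}"

definition has_weak_gradient ::
    "'a::euclidean_space set \<Rightarrow> ('a \<Rightarrow> real) \<Rightarrow> ('a \<Rightarrow> 'a) \<Rightarrow> bool" where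
  "has_weak_gradient \<Omega> u g \<longleftrightarrow> L2_on \<Omega> u \<and> L2_on \<Omega> g \<and>
     (\<forall>\<phi>\<in>test_functions. supp \<phi> \<subseteq> \<Omega> \<longrightarrow>
        (\<forall>v. (LINT x|lebesgue_on \<Omega>. u x * frechet_derivative \<phi> (at x) v)
             = - (LINT x|lebesgue_on \<Omega>. (g x \<bullet> v) * \<phi> x)))"

definition H1 :: "'a::euclidean_space set \<Rightarrow> ('a \<Rightarrow> real) set" where
  "H1 \<Omega> = {u. \<exists>g. has_weak_gradient \<Omega> u g}"

text \<open>The weak gradient is unique only up to null sets; it is used below only in ways that do not
  depend on the representative.\<close>

definition weak_gradient :: "'a::euclidean_space set \<Rightarrow> ('a \<Rightarrow> real) \<Rightarrow> 'a \<Rightarrow> 'a" where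
  "weak_gradient \<Omega> u = (SOME g. has_weak_gradient \<Omega> u g)"

definition H1_norm_sq :: "'a::euclidean_space set \<Rightarrow> ('a \<Rightarrow> real) \<Rightarrow> real" where
  "H1_norm_sq \<Omega> u = (LINT x|lebesgue_on \<Omega>. (u x)\<^sup>2)
      + (LINT x|lebesgue_on \<Omega>. (norm (weak_gradient \<Omega> u x))\<^sup>2)"

text \<open>The functions in \<open>H\<^sup>1(\<Omega>)\<close> vanishing on the part \<open>\<gamma>\<close> of the boundary: the closure in
  \<open>H\<^sup>1(\<Omega>)\<close> of the restrictions to \<open>\<Omega>\<close> of test functions on the whole space whose support does not
  meet the closure of \<open>\<gamma>\<close>. For \<open>\<gamma> = frontier \<Omega>\<close> this is the usual \<open>H\<^sub>0\<^sup>1(\<Omega>)\<close>.\<close>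

definition H1_vanishing :: "'a::euclidean_space set \<Rightarrow> 'a set \<Rightarrow> ('a \<Rightarrow> real) set" where
  "H1_vanishing \<Omega> \<gamma> = {u \<in> H1 \<Omega>. \<forall>\<epsilon>>0. \<exists>\<phi>\<in>test_functions.
      supp \<phi> \<inter> closure \<gamma> = {} \<and> H1_norm_sq \<Omega> (\<lambda>x. u x - \<phi> x) < \<epsilon>}"


section \<open>Eigenvalues of mixed problems\<close>

definition energy ::
    "'a::euclidean_space set \<Rightarrow> ('a \<Rightarrow> 'a \<Rightarrow> 'a) \<Rightarrow> ('a \<Rightarrow> real) \<Rightarrow> ('a \<Rightarrow> real) \<Rightarrow> real" where
  "energy \<Omega> A u v =
     (LINT x|lebesgue_on \<Omega>. A x (weak_gradient \<Omega> u x) \<bullet> weak_gradient \<Omega> v x)"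

text \<open>Weak solutions of \<open>- div (A \<nabla>u) = \<sigma> u\<close> in \<open>\<Omega>\<close>, with \<open>u = 0\<close> on \<open>\<gamma>\<close> and the natural boundary
  condition \<open>(A \<nabla>u) \<bullet> \<nu> = 0\<close> on the rest of the boundary.\<close>

definition weak_eigenfunction ::
    "'a::euclidean_space set \<Rightarrow> 'a set \<Rightarrow> ('a \<Rightarrow> 'a \<Rightarrow> 'a) \<Rightarrow> real \<Rightarrow> ('a \<Rightarrow> real) \<Rightarrow> bool" where
  "weak_eigenfunction \<Omega> \<gamma> A \<sigma> u \<longleftrightarrow>
     u \<in> H1_vanishing \<Omega> \<gamma> \<and> \<not> (AE x in lebesgue_on \<Omega>. u x = 0) \<and>
     (\<forall>v\<in>H1_vanishing \<Omega> \<gamma>. energy \<Omega> A u v = \<sigma> * (LINT x|lebesgue_on \<Omega>. u x * v x))"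

text \<open>The \<open>k\<close>-th eigenvalue (\<open>k \<ge> 1\<close>) in nondecreasing order with multiplicity: the smallest
  eigenvalue \<open>\<sigma>\<close> such that there are \<open>k\<close> eigenfunctions, linearly independent modulo null sets, with
  eigenvalues at most \<open>\<sigma>\<close>. As eigenspaces of distinct eigenvalues are independent, this says that the
  multiplicities of the eigenvalues up to \<open>\<sigma>\<close> add up to at least \<open>k\<close>.\<close>

definition kth_eigenvalue ::
    "'a::euclidean_space set \<Rightarrow> 'a set \<Rightarrow> ('a \<Rightarrow> 'a \<Rightarrow> 'a) \<Rightarrow> nat \<Rightarrow> real" where
  "kth_eigenvalue \<Omega> \<gamma> A k = Inf {\<sigma>. (\<exists>w. weak_eigenfunction \<Omega> \<gamma> A \<sigma> w) \<and>
     (\<exists>(s::nat \<Rightarrow> real) u.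
        (\<forall>i<k. s i \<le> \<sigma> \<and> weak_eigenfunction \<Omega> \<gamma> A (s i) (u i)) \<and>
        (\<forall>c::nat \<Rightarrow> real. (AE x in lebesgue_on \<Omega>. (\<Sum>i<k. c i * u i x) = 0) \<longrightarrow> (\<forall>i<k. c i = 0)))}"

definition rayleigh_inf ::
    "'a::euclidean_space set \<Rightarrow> 'a set \<Rightarrow> ('a \<Rightarrow> 'a \<Rightarrow> 'a) \<Rightarrow> real" where
  "rayleigh_inf \<Omega> \<gamma> A = Inf {energy \<Omega> A u u / (LINT x|lebesgue_on \<Omega>. (u x)\<^sup>2) | u.
      u \<in> H1_vanishing \<Omega> \<gamma> \<and> \<not> (AE x in lebesgue_on \<Omega>. u x = 0)}"


section \<open>The cylinder problems\<close>

definition block_map ::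
    "real^'m^'m \<Rightarrow> real^'p^'m \<Rightarrow> real^'p^'p \<Rightarrow> (real^'m) \<times> (real^'p) \<Rightarrow> (real^'m) \<times> (real^'p)" where
  "block_map A11 A12 A22 = (\<lambda>(Y, \<eta>). (A11 *v Y + A12 *v \<eta>, transpose A12 *v Y + A22 *v \<eta>))"

definition directional_map ::
    "real^'m \<Rightarrow> real^'m^'m \<Rightarrow> real^'p^'m \<Rightarrow> real^'p^'p \<Rightarrow> real \<times> (real^'p) \<Rightarrow> real \<times> (real^'p)" where
  "directional_map \<nu> A11 A12 A22 =
     (\<lambda>(s, \<eta>). (((A11 *v \<nu>) \<bullet> \<nu>) * s + (\<nu> v* A12) \<bullet> \<eta>, s *\<^sub>R (\<nu> v* A12) + A22 *v \<eta>))"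

definition lambda_cyl ::
    "(real^'m) set \<Rightarrow> (real^'p) set \<Rightarrow> (real^'p \<Rightarrow> real^'m^'m) \<Rightarrow> (real^'p \<Rightarrow> real^'p^'m)
      \<Rightarrow> (real^'p \<Rightarrow> real^'p^'p) \<Rightarrow> real \<Rightarrow> nat \<Rightarrow> real" where
  "lambda_cyl \<omega>1 \<omega>2 A11 A12 A22 l k =
     kth_eigenvalue (((*\<^sub>R) l ` \<omega>1) \<times> \<omega>2) (((*\<^sub>R) l ` \<omega>1) \<times> frontier \<omega>2)
       (\<lambda>(X, \<xi>). block_map (A11 \<xi>) (A12 \<xi>) (A22 \<xi>)) k"

definition mu1 :: "(real^'p) set \<Rightarrow> (real^'p \<Rightarrow> real^'p^'p) \<Rightarrow> real" where
  "mu1 \<omega>2 A22 = kth_eigenvalue \<omega>2 (frontier \<omega>2) (\<lambda>\<xi> \<eta>. A22 \<xi> *v \<eta>) 1"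

definition first_eigenfunction ::
    "(real^'p) set \<Rightarrow> (real^'p \<Rightarrow> real^'p^'p) \<Rightarrow> (real^'p \<Rightarrow> real) \<Rightarrow> bool" where
  "first_eigenfunction \<omega>2 A22 W \<longleftrightarrow>
     weak_eigenfunction \<omega>2 (frontier \<omega>2) (\<lambda>\<xi> \<eta>. A22 \<xi> *v \<eta>) (mu1 \<omega>2 A22) W \<and>
     (AE \<xi> in lebesgue_on \<omega>2. W \<xi> > 0) \<and> (LINT \<xi>|lebesgue_on \<omega>2. (W \<xi>)\<^sup>2) = 1"

definition Z_dir ::
    "(real^'p) set \<Rightarrow> (real^'p \<Rightarrow> real^'m^'m) \<Rightarrow> (real^'p \<Rightarrow> real^'p^'m)
      \<Rightarrow> (real^'p \<Rightarrow> real^'p^'p) \<Rightarrow> real^'m \<Rightarrow> real" where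
  "Z_dir \<omega>2 A11 A12 A22 \<nu> =
     rayleigh_inf ({..<0::real} \<times> \<omega>2) ({..<0} \<times> frontier \<omega>2)
       (\<lambda>(x, \<xi>). directional_map \<nu> (A11 \<xi>) (A12 \<xi>) (A22 \<xi>))"

end

theory Submission
 imports Defs "HOL-Library.Diagonal_Subsequence"
begin

text \<open>Lower bound. A function on the cylinder is localised by cut-offs at scale \<open>R\<close>, a small multiple of
  \<open>\<ell>\<close>. In each localisation the boundary of \<open>\<ell>\<omega>\<^sub>1\<close> is a graph with almost constant gradient, and with \<open>\<nu>\<close>
  its normal, the square root of the \<open>L\<^sup>2\<close> mass of the function over the translates of the graph is a
  competitor for \<open>Z\<^sup>\<nu>\<close>; its energy is almost bounded by the energy of the function, since
  tangential derivatives of the square integrate to zero. Upper bound. At a point of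
  the closure of \<open>\<omega>\<^sub>1\<close> where \<open>X \<bullet> \<nu>\<close> is maximal the normal is \<open>\<nu>\<close>, and the domain blows up to a half space.
  Near minimisers of \<open>Z\<^sup>\<nu>\<close> times wide tangential cut-offs, shifted tangentially (here \<open>m \<ge> 2\<close> enters),
  give any number of disjoint trial functions. Gap. Test \<open>Z\<^sup>\<nu>\<close> with \<open>f(t) W(\<xi>) + s \<psi>(t) \<phi>(\<xi>)\<close>, where \<open>f(0) = 1\<close>
  and \<open>f\<close> decays slowly: relative to \<open>\<mu>\<^sub>1\<close> the energy tends to
  \<open>\<integral> W \<nu> \<bullet> A\<^sub>1\<^sub>2 \<nabla>W + 2 s \<integral> \<phi> \<nu> \<bullet> A\<^sub>1\<^sub>2 \<nabla>W + O(s\<^sup>2)\<close>, where the first term is nonpositive for \<open>\<nu>\<close> or \<open>-\<nu>\<close>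
  and the second has either sign.\<close>

notation scaleR (infixr "*R" 75)

abbreviation nn_integral_lborel :: "('a::euclidean_space => ennreal) => ennreal" (binder "NI " 10)
 where "nn_integral_lborel f == nn_integral lborel f"

abbreviation integral_lborel :: "('a::euclidean_space => 'b::{banach, second_countable_topology}) => 'b" (binder "LI " 10)
 where "integral_lborel f == lebesgue_integral lborel f"

abbreviation "BM == borel_measurable borel"

abbreviation "contU == continuous_on UNIV"

lemmas bm_cont = borel_measurable_continuous_onI

section \<open>Continuously differentiable functions\<close>

text \<open>Trial functions are taken of class \<open>C\<^sup>1\<close> with compact support and carry their gradient: unlike the
  test functions, they are closed under the constructions below (square roots, averages), and
  mollification shows that they have the same closure in \<open>H\<^sup>1\<close>.\<close>

definition C1g :: "('a::euclidean_space => real) => ('a => 'a) => bool" where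
 "C1g u g \<longleftrightarrow> (ALL x. (u has_derivative (%h. g x \<bullet> h)) (at x)) & contU g"

definition C1c :: "('a::euclidean_space => real) => ('a => 'a) => bool" where
 "C1c u g \<longleftrightarrow> C1g u g & compact (supp u)"

lemma C1gD: "C1g u g ==> (u has_derivative (%h. g x \<bullet> h)) (at x)"
 by (simp add: C1g_def)

lemma C1g_cont: "C1g u g ==> contU g"
 by (simp add: C1g_def)

lemma C1g_cont_fun: "C1g u g ==> contU u"
 unfolding C1g_def by (meson has_derivative_continuous continuous_at_imp_continuous_on)

lemma C1g_const: "C1g (%x. c) (%x. 0)"
 unfolding C1g_def by (auto intro!: derivative_eq_intros)

lemma C1g_norm2: "C1g (%x. x \<bullet> x) (%x. 2 *R x)"
 unfolding C1g_def by (auto intro!: derivative_eq_intros continuous_intros simp: inner_commute)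

lemma C1g_add: "C1g u g ==> C1g v k ==> C1g (%x. u x + v x) (%x. g x + k x)"
 unfolding C1g_def by (auto intro!: derivative_eq_intros continuous_intros simp: inner_add_left)

lemma C1g_diff: "C1g u g ==> C1g v k ==> C1g (%x. u x - v x) (%x. g x - k x)"
 unfolding C1g_def by (auto intro!: derivative_eq_intros continuous_intros simp: inner_diff_left)

lemma C1g_mult: "C1g u g ==> C1g v k ==> C1g (%x. u x * v x) (%x. u x *R k x + v x *R g x)"
 using C1g_cont_fun[of u g] C1g_cont_fun[of v k]
 unfolding C1g_def by (auto intro!: derivative_eq_intros continuous_intros simp: inner_add_left mult.commute)

lemma C1g_scale: "C1g u g ==> C1g (%x. c * u x) (%x. c *R g x)"
 using C1g_mult[OF C1g_const] by fastforce

lemma C1g_comp_real: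
 assumes "C1g u g" "!!t. (f has_real_derivative f' t) (at t)" "contU f'"
 shows "C1g (%x. f (u x)) (%x. f' (u x) *R g x)"
proof -
 have "((%x. f (u x)) has_derivative (%h. (f' (u x) *R g x) \<bullet> h)) (at x)" for x
  by (rule has_derivative_eq_rhs[OF DERIV_compose_FDERIV[OF assms(2) C1gD[OF assms(1)]]]) 
   (simp add: fun_eq_iff)
 moreover have "contU (%x. f' (u x))"
  using continuous_on_compose2[OF assms(3) C1g_cont_fun[OF assms(1)]] by auto
 ultimately show ?thesis
  using continuous_on_scaleR[OF _ C1g_cont[OF assms(1)]] unfolding C1g_def by blast
qed

lemma C1g_comp:
 assumes "C1g u g" "!!x. (T has_derivative T' x) (at x)"
  "!!x h. g (T x) \<bullet> T' x h = k x \<bullet> h" "contU k"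
 shows "C1g (%x. u (T x)) k"
proof -
 have "((%x. u (T x)) has_derivative (%h. g (T x) \<bullet> T' x h)) (at x)" for x
  using has_derivative_compose[OF assms(2) C1gD[OF assms(1)]] .
 thus ?thesis using assms unfolding C1g_def by auto
qed

lemma C1g_unique:
 assumes "C1g u g" "C1g u k" shows "g = k"
proof
 fix x
 have "(%h. g x \<bullet> h) = (%h. k x \<bullet> h)"
  using has_derivative_unique[OF C1gD[OF assms(1)] C1gD[OF assms(2)]] .
 hence "g x \<bullet> h = k x \<bullet> h" for h by metis
 thus "g x = k x" by (metis vector_eq_rdot inner_commute)
qed

lemma supp_subset: "{x. u x ~= 0} \<subseteq> supp u" 
 unfolding supp_def by (rule closure_subset)

lemma not_supp: "x \<notin> supp u ==> u x = 0"
 using supp_subset by blast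

lemma supp_mono: "(!!x. u x ~= 0 ==> v x ~= 0) ==> supp u \<subseteq> supp v"
 unfolding supp_def by (rule closure_mono) auto

lemma closed_supp: "closed (supp u)" unfolding supp_def by simp

lemma supp_leI: "closed K ==> (!!x. u x ~= 0 ==> x \<in> K) ==> supp u \<subseteq> K"
 unfolding supp_def by (rule closure_minimal) auto

lemma compact_suppI: "compact K ==> (!!x. u x ~= 0 ==> x \<in> K) ==> compact (supp u)"
 by (metis closed_supp compact_Int_closed compact_imp_closed inf.absorb_iff2 supp_leI)

lemma C1c_C1g: "C1c u g ==> C1g u g" by (simp add: C1c_def)

lemma C1g_zero_outside_supp:
 assumes "C1g u g" "x \<notin> supp u" shows "g x = 0"
proof -
 have op: "open (- supp u)" using closed_supp by auto
 have "((%x. 0) has_derivative (%h. 0)) (at x)" by simp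
 hence "(u has_derivative (%h. 0)) (at x)"
  by (rule has_derivative_transform_within_open[OF _ op]) (use assms(2) in \<open>auto simp: not_supp\<close>)
 hence "(%h. g x \<bullet> h) = (%h. 0)" using has_derivative_unique C1gD[OF assms(1)] by blast
 hence "g x \<bullet> g x = 0" by metis
 thus ?thesis by simp
qed

lemma C1c_add: "C1c u g ==> C1c v k ==> C1c (%x. u x + v x) (%x. g x + k x)"
 unfolding C1c_def using C1g_add
 by (auto intro!: compact_suppI[of "supp u \<union> supp v"] dest: not_supp simp: compact_Un) (metis add_0 not_supp)

lemma C1c_mult: "C1c u g ==> C1g v k ==> C1c (%x. u x * v x) (%x. u x *R k x + v x *R g x)"
 unfolding C1c_def using C1g_mult
 by (auto intro!: compact_suppI[of "supp u"] dest: not_supp) (metis not_supp)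

lemma C1c_scale: "C1c u g ==> C1c (%x. c * u x) (%x. c *R g x)"
 unfolding C1c_def using C1g_scale
 by (auto intro!: compact_suppI[of "supp u"] dest: not_supp) (metis not_supp)

lemma C1c_bounded:
 assumes "C1c u g" obtains B where "B > 0" "!!x. \<bar>u x\<bar> <= B" "!!x. norm (g x) <= B"
proof -
 have c: "C1g u g" "compact (supp u)" using assms unfolding C1c_def by auto
 have "bounded (u ` supp u)" "bounded (g ` supp u)"
  using c by (auto intro!: compact_imp_bounded compact_continuous_image 
    intro: continuous_on_subset[OF C1g_cont] continuous_on_subset[OF C1g_cont_fun])
 then obtain a b where ab: "!!x. x \<in> supp u ==> norm (u x) <= a" "!!x. x \<in> supp u ==> norm (g x) <= b"
  unfolding bounded_iff by blast
 show ?thesis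
 proof (rule that[of "\<bar>a\<bar> + \<bar>b\<bar> + 1"])
  show "\<bar>u x\<bar> <= \<bar>a\<bar> + \<bar>b\<bar> + 1" for x
   using ab(1)[of x] not_supp[of x u] by (cases "x \<in> supp u") auto
  show "norm (g x) <= \<bar>a\<bar> + \<bar>b\<bar> + 1" for x
   using ab(2)[of x] C1g_zero_outside_supp[OF c(1), of x] by (cases "x \<in> supp u") auto
 qed auto
qed

definition pos2 :: "real => real" where "pos2 t = (max 0 t)^2"

lemma pos2_deriv: "(pos2 has_real_derivative 2 * max 0 t) (at t)"
proof -
 consider "t > 0" | "t < 0" | "t = 0" by linarith
 thus ?thesis
 proof cases
  case 1
  have "((%t. t^2) has_real_derivative 2 * max 0 t) (at t)"
   using 1 by (auto intro!: derivative_eq_intros)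
  thus ?thesis
   by (rule has_field_derivative_transform_within_open[of _ _ _ "{0<..}"]) (use 1 in \<open>auto simp: pos2_def\<close>)
 next
  case 2
  have "((%t. 0) has_real_derivative 2 * max 0 t) (at t)"
   using 2 by (auto intro!: derivative_eq_intros)
  thus ?thesis
   by (rule has_field_derivative_transform_within_open[of _ _ _ "{..<0}"]) (use 2 in \<open>auto simp: pos2_def\<close>)
 next
  case 3
  have "((%h. (pos2 (0 + h) - pos2 0) / h) \<longlongrightarrow> 0) (at 0)"
  proof (rule Lim_null_comparison)
   show "\<forall>\<^sub>F h in at 0. norm ((pos2 (0 + h) - pos2 0) / h) <= \<bar>h\<bar>"
    by (rule eventuallyI) (auto simp: pos2_def max_def power2_eq_square abs_if)
   show "((%h::real. \<bar>h\<bar>) \<longlongrightarrow> 0) (at 0)" by (auto intro!: tendsto_eq_intros)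
  qed
  thus ?thesis using 3 by (simp add: DERIV_def)
 qed
qed

lemma C1g_pos2: "C1g u g ==> C1g (%x. pos2 (u x)) (%x. (2 * max 0 (u x)) *R g x)"
 by (rule C1g_comp_real[OF _ pos2_deriv]) (auto intro!: continuous_intros)

lemma pos2_nonneg: "0 <= pos2 t" by (simp add: pos2_def)

section \<open>Smooth functions\<close>

lemma Ck_family:
 assumes "!!f. f \<in> F ==> EX D. (ALL x. (f has_derivative D x) (at x)) & (ALL v. (%x. D x v) \<in> F)"
 shows "f \<in> F ==> Ck k f"
proof (induction k arbitrary: f)
 case 0
 then obtain D where "!!x. (f has_derivative D x) (at x)" using assms by blast
 thus ?case
  by (auto intro!: continuous_at_imp_continuous_on dest: has_derivative_continuous)
next
 case (Suc k)
 then obtain D where D: "!!x. (f has_derivative D x) (at x)" "!!v. (%x. D x v) \<in> F" using assms by blast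
 hence "frechet_derivative f (at x) = D x" for x using frechet_derivative_at by metis
 thus ?case using D Suc.IH by (auto simp: differentiable_def)
qed

definition bump_h :: "nat => real => real" where
 "bump_h n t = (if t > 0 then (1 / t) ^ n * exp (- 1 / t) else 0)"

lemma bump_h_lim: "(bump_h n \<longlongrightarrow> 0) (at 0)"
proof -
 have "((%x::real. x ^ n / exp x) \<longlongrightarrow> 0) at_top" by (rule tendsto_power_div_exp_0)
 hence "((%t::real. (inverse t) ^ n / exp (inverse t)) \<longlongrightarrow> 0) (at_right 0)"
  using filterlim_compose filterlim_inverse_at_top_right by blast
 hence "(bump_h n \<longlongrightarrow> 0) (at_right 0)"
  by (rule Lim_transform_eventually)
   (auto simp: bump_h_def eventually_at_filter exp_minus field_simps)
 moreover have "(bump_h n \<longlongrightarrow> 0) (at_left 0)"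
  by (rule Lim_transform_eventually[of "%_. 0"]) (auto simp: bump_h_def eventually_at_filter)
 ultimately show ?thesis by (simp add: filterlim_split_at)
qed

lemma bump_h_deriv:
 "(bump_h n has_real_derivative (bump_h (n + 2) t - real n * bump_h (n + 1) t)) (at t)"
proof -
 consider "t > 0" | "t < 0" | "t = 0" by linarith
 thus ?thesis
 proof cases
  case 1
  have "((%t. (1 / t) ^ n * exp (- 1 / t)) has_real_derivative (bump_h (n + 2) t - real n * bump_h (n + 1) t)) (at t)"
  proof -
   have "((%t. (1 / t) ^ n) has_real_derivative - real n * (1 / t) ^ (n + 1)) (at t)"
   proof (induction n)
    case (Suc n)
    have "((%t. 1 / t) has_real_derivative - 1 / t^2) (at t)"
     using 1 by (auto intro!: derivative_eq_intros simp: power2_eq_square)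
    from DERIV_mult[OF this Suc] show ?case
     using 1
     by (auto elim!: DERIV_cong simp: field_simps power2_eq_square)
   qed auto
   moreover have "((%t. exp (- 1 / t)) has_real_derivative (1 / t)\<^sup>2 * exp (- 1 / t)) (at t)"
    using 1 by (auto intro!: derivative_eq_intros simp: power2_eq_square)
   ultimately show ?thesis using 1 DERIV_mult
    by (fastforce elim!: DERIV_cong simp: bump_h_def algebra_simps power2_eq_square)
  qed
  thus ?thesis
   by (rule has_field_derivative_transform_within_open[of _ _ _ "{0<..}"]) (use 1 in \<open>auto simp: bump_h_def\<close>)
 next
  case 2
  have "((%t. 0) has_real_derivative (bump_h (n + 2) t - real n * bump_h (n + 1) t)) (at t)"
   using 2 by (auto intro!: derivative_eq_intros simp: bump_h_def)
  thus ?thesis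
   by (rule has_field_derivative_transform_within_open[of _ _ _ "{..<0}"]) (use 2 in \<open>auto simp: bump_h_def\<close>)
 next
  case 3
  have "((%h. (bump_h n (0 + h) - bump_h n 0) / h) \<longlongrightarrow> 0) (at 0)"
   by (rule Lim_transform_eventually[OF bump_h_lim[of "n+1"]]) 
    (auto simp: bump_h_def eventually_at_filter)
  thus ?thesis using 3 by (simp add: DERIV_def bump_h_def)
 qed
qed

inductive_set bump_alg :: "('a::euclidean_space => real) set" where
 h: "(%x. bump_h n (1 - x \<bullet> x)) \<in> bump_alg"
| c: "(%x. a) \<in> bump_alg"
| l: "(%x. x \<bullet> v) \<in> bump_alg"
| a: "f \<in> bump_alg ==> g \<in> bump_alg ==> (%x. f x + g x) \<in> bump_alg"
| m: "f \<in> bump_alg ==> g \<in> bump_alg ==> (%x. f x * g x) \<in> bump_alg"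

lemma bump_alg_deriv:
 assumes "f \<in> bump_alg"
 shows "EX D. (ALL x. (f has_derivative D x) (at x)) & (ALL v. (%x. D x v) \<in> bump_alg)"
 using assms
proof induction
 case (h n)
 let ?D = "%x v. (bump_h (n + 2) (1 - x \<bullet> x) + (- real n) * bump_h (n + 1) (1 - x \<bullet> x)) * ((-2) * (x \<bullet> v))"
 have "((%x. bump_h n (1 - x \<bullet> x)) has_derivative ?D x) (at x)" for x
  by (rule has_derivative_eq_rhs[OF DERIV_compose_FDERIV[OF bump_h_deriv]])
   (auto intro!: derivative_eq_intros simp: inner_commute fun_eq_iff)
 moreover have "(%x. ?D x v) \<in> bump_alg" for v
  by (intro bump_alg.intros)
 ultimately show ?case by (intro exI[of _ ?D]) auto
next
 case (c a)
 show ?case by (rule exI[of _ "%x v. 0"]) (auto intro: bump_alg.intros)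
next
 case (l v)
 show ?case by (rule exI[of _ "%x w. w \<bullet> v"]) (auto intro!: bump_alg.intros derivative_eq_intros)
next
 case (a f g)
 then obtain D E where "!!x. (f has_derivative D x) (at x)" "!!v. (%x. D x v) \<in> bump_alg"
  "!!x. (g has_derivative E x) (at x)" "!!v. (%x. E x v) \<in> bump_alg" by blast
 thus ?case
  by (intro exI[of _ "%x v. D x v + E x v"]) (auto intro!: bump_alg.intros derivative_eq_intros)
next
 case (m f g)
 then obtain D E where "!!x. (f has_derivative D x) (at x)" "!!v. (%x. D x v) \<in> bump_alg"
  "!!x. (g has_derivative E x) (at x)" "!!v. (%x. E x v) \<in> bump_alg" by blast
 with m show ?case
  by (intro exI[of _ "%x v. f x * E x v + D x v * g x"]) (auto intro!: bump_alg.intros derivative_eq_intros)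
qed

definition bump :: "'a::euclidean_space => real" where
 "bump x = bump_h 0 (1 - x \<bullet> x)"

lemma bump_Ck: "Ck k bump"
 unfolding bump_def[abs_def] by (rule Ck_family[OF bump_alg_deriv bump_alg.h])

lemma bump_nonneg: "bump x >= 0" by (simp add: bump_def bump_h_def)
lemma bump_supp: "bump x ~= 0 ==> norm x < 1"
 by (auto simp: bump_def bump_h_def dot_square_norm power2_eq_square split: if_splits)
  (metis abs_norm_cancel abs_square_less_1 power2_eq_square)

lemma test_functionI: "(!!k. Ck k f) ==> compact K ==> (!!x. f x ~= 0 ==> x \<in> K) ==> f \<in> test_functions"
 unfolding test_functions_def using compact_suppI by blast

lemma bump_test: "bump \<in> test_functions"
 by (rule test_functionI[of _ "cball 0 1"]) (auto simp: bump_Ck dest!: bump_supp)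

lemma Ck_deriv:
 assumes "!!k. Ck k f" shows "Ck k (%x. frechet_derivative f (at x) v)"
 using assms[of "Suc k"] by simp

lemma Ck_has_derivative:
 assumes "!!k. Ck k f" shows "(f has_derivative frechet_derivative f (at x)) (at x)"
 using assms[of "Suc 0"] by (auto simp: frechet_derivative_works)

lemma test_function_C1c:
 assumes "f \<in> test_functions"
 obtains g where "C1c f g" "!!x v. frechet_derivative f (at x) v = g x \<bullet> v"
proof -
 have ck: "!!k. Ck k f" and cs: "compact (supp f)" using assms by (auto simp: test_functions_def)
 define g where "g x = (\<Sum>b\<in>Basis. frechet_derivative f (at x) b *R b)" for x
 have lin: "linear (frechet_derivative f (at x))" for x
  using Ck_has_derivative[OF ck] has_derivative_linear by blast
 have eq: "frechet_derivative f (at x) v = g x \<bullet> v" for x v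
 proof -
  have "frechet_derivative f (at x) v = frechet_derivative f (at x) (\<Sum>b\<in>Basis. (v \<bullet> b) *R b)"
   by (simp add: euclidean_representation)
  also have "... = (\<Sum>b\<in>Basis. (v \<bullet> b) * frechet_derivative f (at x) b)"
   by (simp add: linear_sum[OF lin] linear_scale[OF lin])
  also have "... = g x \<bullet> v"
   unfolding g_def inner_sum_left by (rule sum.cong) (simp_all add: inner_commute mult.commute)
  finally show ?thesis .
 qed
 have "contU (%x. frechet_derivative f (at x) b)" for b
  using Ck_deriv[OF ck, of 0 b] by simp
 hence "contU g" unfolding g_def by (intro continuous_intros)
 moreover have "(f has_derivative (%h. g x \<bullet> h)) (at x)" for x
  by (rule has_derivative_eq_rhs[OF Ck_has_derivative[OF ck]]) (simp add: eq fun_eq_iff)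
 ultimately have "C1c f g" using cs unfolding C1c_def C1g_def by auto
 thus thesis using eq that by blast
qed

lemma test_function_deriv:
 assumes "f \<in> test_functions"
 shows "(%x. frechet_derivative f (at x) v) \<in> test_functions"
proof -
 obtain g where g: "C1c f g" "!!x v. frechet_derivative f (at x) v = g x \<bullet> v"
  using test_function_C1c assms by blast
 show ?thesis
 proof (rule test_functionI)
  show "Ck k (%x. frechet_derivative f (at x) v)" for k
   by (rule Ck_deriv) (use assms in \<open>auto simp: test_functions_def\<close>)
  show "compact (supp f)" using g C1c_def by auto
  show "x \<in> supp f" if "frechet_derivative f (at x) v ~= 0" for x
   using that g(2) C1g_zero_outside_supp[OF C1c_C1g[OF g(1)]] by force
 qed
qed

section \<open>Integrals of compactly supported functions\<close>

lemma integrable_continuous_compact: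
 fixes f :: "'a::euclidean_space => 'b::{banach, second_countable_topology}"
 assumes "contU f" "compact K" "!!x. x \<notin> K ==> f x = 0"
 shows "integrable lborel f"
proof -
 have "integrable lborel (%x. indicator K x *R f x)"
  by (rule borel_integrable_compact[OF assms(2)]) (use assms(1) continuous_on_subset in blast)
 moreover have "(%x. indicator K x *R f x) = f"
  using assms(3) by (auto simp: indicator_def fun_eq_iff)
 ultimately show ?thesis by simp
qed

lemma integral_continuous_cbox:
 fixes f :: "'a::euclidean_space => 'b::euclidean_space"
 assumes "contU f" "K \<subseteq> cbox a b" "!!x. x \<notin> K ==> f x = 0"
 shows "integral\<^sup>L lborel f = integral (cbox a b) f"
proof -
 have "integrable lborel f"
  by (rule integrable_continuous_compact[OF assms(1), of "cbox a b"]) (use assms in auto)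
 hence "integral\<^sup>L lborel f = integral UNIV f" by (simp add: integral_lborel)
 also have "... = integral UNIV (%x. if x \<in> cbox a b then f x else 0)"
  by (rule integral_cong) (use assms in auto)
 also have "... = integral (cbox a b) f" by (rule integral_restrict_UNIV)
 finally show ?thesis .
qed

lemma bounded_cbox_sym:
 fixes K :: "'a::euclidean_space set"
 assumes "bounded K" obtains a b where "K \<subseteq> cbox a b"
 using bounded_subset_cbox_symmetric[OF assms] by metis

lemma continuous_param_slice:
 assumes "contU (%(a, b). F a b)" shows "continuous_on S (%a. F a b)"
proof -
 have "continuous_on S (%a. (%(a, b). F a b) (a, b))"
  by (rule continuous_on_compose2[OF assms]) (auto intro!: continuous_intros)
 thus ?thesis by simp
qed

lemma continuous_integral_param:
 fixes F :: "'a::euclidean_space => 'b::euclidean_space => 'c::euclidean_space"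
 assumes cF: "contU (%(a, b). F a b)"
  and supp: "!!R. EX K. compact K & (ALL a b. norm b < R --> a \<notin> K --> F a b = 0)"
 shows "contU (%b. LI a. F a b)"
proof -
 have "continuous_on (ball 0 R) (%b. LI a. F a b)" for R
 proof -
  obtain K where K: "compact K" "!!a b. norm b < R ==> a \<notin> K ==> F a b = 0" using supp by blast
  obtain l u where lu: "K \<subseteq> cbox l u" using K(1) bounded_cbox_sym compact_imp_bounded by blast
  have "continuous_on (ball 0 R) (%b. integral (cbox l u) (%a. F a b))"
  proof (rule integral_continuous_on_param)
   have "continuous_on (ball 0 R \<times> cbox l u) (%p. (%(a, b). F a b) (snd p, fst p))"
    by (rule continuous_on_compose2[OF cF]) (auto intro!: continuous_intros)
   thus "continuous_on (ball 0 R \<times> cbox l u) (%(b, a). F a b)" by (simp add: case_prod_unfold)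
  qed
  thus ?thesis
   by (subst continuous_on_cong[OF refl integral_continuous_cbox[OF continuous_param_slice[OF cF] lu]])
    (use K in auto)
 qed
 hence "isCont (%b. LI a. F a b) x" for x
  using continuous_on_interior[of "ball 0 (norm x + 1)"] by fastforce
 thus ?thesis by (auto intro: continuous_at_imp_continuous_on)
qed

lemma C1g_integral_param:
 fixes F :: "'a::euclidean_space => 'b::euclidean_space => real"
 assumes dF: "!!a b. (F a has_derivative (%h. G a b \<bullet> h)) (at b)"
  and cF: "contU (%(a, b). F a b)" and cG: "contU (%(a, b). G a b)"
  and supp: "!!R. EX K. compact K & (ALL a b. norm b < R --> a \<notin> K --> F a b = 0)"
 shows "C1g (%b. LI a. F a b) (%b. LI a. G a b)"
proof -
 have suppG: "EX K. compact K & (ALL a b. norm b < R --> a \<notin> K --> G a b = 0)" for R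
 proof -
  obtain K where K: "compact K" "!!a b. norm b < R ==> a \<notin> K ==> F a b = 0" using supp by blast
  have "G a b = 0" if "norm b < R" "a \<notin> K" for a b
  proof -
   have "((%x. 0) has_derivative (%h. 0)) (at b)" by simp
   hence "(F a has_derivative (%h. 0)) (at b)"
    by (rule has_derivative_transform_within_open[of _ _ _ _ "ball 0 R"]) (use that K in auto)
   hence "(%h. G a b \<bullet> h) = (%h. 0)" using has_derivative_unique dF by blast
   hence "G a b \<bullet> G a b = 0" by metis
   thus ?thesis by simp
  qed
  thus ?thesis using K(1) by blast
 qed
 have "((%b. LI a. F a b) has_derivative (%h. (LI a. G a x) \<bullet> h)) (at x)" for x
 proof -
  let ?R = "norm x + 1"
  let ?U = "ball 0 ?R :: 'b set"
  obtain K where K: "compact K" "!!a b. norm b < ?R ==> a \<notin> K ==> F a b = 0" using supp by blast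
  obtain K2 where K2: "compact K2" "!!a b. norm b < ?R ==> a \<notin> K2 ==> G a b = 0" using suppG by blast
  have "bounded (K \<union> K2)" using K(1) K2(1) compact_imp_bounded by auto
  then obtain l u where lu: "K \<union> K2 \<subseteq> cbox l u" using bounded_cbox_sym by blast
  have xU: "x \<in> ?U" by simp
  have "((%b. integral (cbox l u) (%a. F a b)) has_derivative
    blinfun_apply (integral (cbox l u) (%a. blinfun_inner_right (G a x)))) (at x within ?U)"
  proof (rule leibniz_rule[where fx = "%b a. blinfun_inner_right (G a b)"])
   show "((%b. F t b) has_derivative blinfun_apply (blinfun_inner_right (G t b))) (at b within ?U)" for b t
    using dF by (auto intro: has_derivative_at_withinI)
   show "(%a. F a b) integrable_on cbox l u" for b
    by (rule integrable_continuous[OF continuous_param_slice[OF cF]])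
   have "continuous_on (?U \<times> cbox l u) (%p. (%(a, b). G a b) (snd p, fst p))"
    by (rule continuous_on_compose2[OF cG]) (auto intro!: continuous_intros)
   thus "continuous_on (?U \<times> cbox l u) (%(b, a). blinfun_inner_right (G a b))"
    by (auto simp: case_prod_unfold intro!: bounded_linear.continuous_on[OF bounded_linear_blinfun_inner_right])
  qed (use xU in auto)
  hence "((%b. integral (cbox l u) (%a. F a b)) has_derivative
    blinfun_apply (integral (cbox l u) (%a. blinfun_inner_right (G a x)))) (at x)"
   using at_within_open[OF xU] by simp
  hence "((%b. LI a. F a b) has_derivative
    blinfun_apply (integral (cbox l u) (%a. blinfun_inner_right (G a x)))) (at x)"
  proof (rule has_derivative_transform_within_open[OF _ open_ball xU])
   show "integral (cbox l u) (%a. F a b) = (LI a. F a b)" if "b \<in> ?U" for b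
    by (subst integral_continuous_cbox[OF continuous_param_slice[OF cF], of K l u]) (use lu K that in auto)
  qed
  moreover have "integral (cbox l u) (%a. blinfun_inner_right (G a x)) = blinfun_inner_right (integral (cbox l u) (%a. G a x))"
   using integral_linear[OF integrable_continuous[OF continuous_param_slice[OF cG]] bounded_linear_blinfun_inner_right]
   by (simp add: o_def)
  moreover have "integral (cbox l u) (%a. G a x) = (LI a. G a x)"
   by (subst integral_continuous_cbox[OF continuous_param_slice[OF cG], of K2 l u]) (use lu K2 xU in auto)
  ultimately show ?thesis by simp
 qed
 thus ?thesis using continuous_integral_param[OF cG suppG] unfolding C1g_def by blast
qed

lemma C1c_integrable:
 assumes "C1c u g" shows "integrable lborel u" "integrable lborel g"
 using assms C1g_zero_outside_supp[of u g]
 by (auto intro!: integrable_continuous_compact[of _ "supp u"] C1g_cont_fun C1g_cont simp: C1c_def dest: not_supp)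

lemma lborel_integral_translate:
 fixes f :: "'a::euclidean_space => 'b::{banach, second_countable_topology}"
 assumes "f \<in> BM"
 shows "(LI x. f (x + c)) = integral\<^sup>L lborel f"
proof -
 have "integral\<^sup>L lborel f = integral\<^sup>L (distr lborel borel ((+) c)) f" by (simp add: lborel_distr_plus)
 also have "... = (LI x. f (c + x))" by (rule integral_distr) (use assms in auto)
 finally show ?thesis by (simp add: add.commute)
qed

lemma lborel_integral_reflect:
 fixes f :: "'a::euclidean_space => 'b::{banach, second_countable_topology}"
 assumes "f \<in> BM"
 shows "(LI x. f (c - x)) = integral\<^sup>L lborel f"
proof -
 have "integral\<^sup>L lborel f = integral\<^sup>L (density (distr lborel borel (%x. c + (-1) *R x)) (%_. 1)) f"
  using lborel_affine[of "-1" c] by simp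
 also have "... = (LI x. f (c - x))"
  using assms by (simp add: density_1 integral_distr)
 finally show ?thesis by simp
qed

lemma has_derivative_shift:
 assumes "C1g u g"
 shows "((%b. u (a + b)) has_derivative (%h. g (a + b) \<bullet> h)) (at b)"
  "((%b. u (b - a)) has_derivative (%h. g (b - a) \<bullet> h)) (at b)"
  by (rule has_derivative_compose[where f = "%b. a + b" and f' = "%h. h", OF _ C1gD[OF assms]];
    auto intro!: derivative_eq_intros)
  (rule has_derivative_compose[where f = "%b. b - a" and f' = "%h. h", OF _ C1gD[OF assms]];
    auto intro!: derivative_eq_intros)

lemma continuous_on_add_arg:
 fixes u :: "'a::real_normed_vector => 'b::topological_space"
 assumes "contU u" shows "contU (%(a, b). u (a + b))"
 unfolding case_prod_unfold by (rule continuous_on_compose2[OF assms]) (auto intro!: continuous_intros)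

lemma integral_gradient_zero:
 assumes "C1c u g" shows "(LI x. g x) = 0"
proof -
 have g: "C1g u g" and cs: "compact (supp u)" using assms by (auto simp: C1c_def)
 obtain B where B: "!!x. x \<in> supp u ==> norm x <= B" using cs compact_imp_bounded bounded_iff by metis
 note cu = continuous_on_add_arg[OF C1g_cont_fun[OF g]] and cg = continuous_on_add_arg[OF C1g_cont[OF g]]
 have "C1g (%b. LI a. u (a + b)) (%b. LI a. g (a + b))"
 proof (rule C1g_integral_param[OF _ cu cg])
  show "((%b. u (a + b)) has_derivative (%h. g (a + b) \<bullet> h)) (at b)" for a b
   by (rule has_derivative_shift[OF g])
  show "EX K. compact K & (ALL a b. norm b < R --> a \<notin> K --> u (a + b) = 0)" for R
  proof (intro exI[of _ "cball 0 (B + R)"] conjI allI impI)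
   fix a b :: 'a assume *: "norm b < R" "a \<notin> cball 0 (B + R)"
   have "norm a <= norm (a + b) + norm b" by (metis add_diff_cancel norm_triangle_ineq4)
   hence "norm (a + b) > B" using * by auto
   thus "u (a + b) = 0" using B[of "a + b"] not_supp by fastforce
  qed auto
 qed
 moreover have "(%b. LI a. u (a + b)) = (%b. LI a. u a)"
  using bm_cont[OF C1g_cont_fun[OF g]] by (simp add: lborel_integral_translate)
 ultimately have "C1g (%b. LI a. u a) (%b. LI a. g a)"
  using bm_cont[OF C1g_cont[OF g]] by (simp add: lborel_integral_translate)
 from C1g_unique[OF this C1g_const] show ?thesis by metis
qed

section \<open>Mollification\<close>

lemma test_function_scale:
 assumes "f \<in> test_functions" "a ~= 0" shows "(%x. c * f (a *R x)) \<in> test_functions"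
proof (rule test_functionI)
 show "compact ((%x. (1/a) *R x) ` supp f)"
  using assms by (auto simp: test_functions_def intro!: compact_scaling)
 show "x \<in> (%x. (1/a) *R x) ` supp f" if "c * f (a *R x) ~= 0" for x
  using that not_supp[of "a *R x" f] assms(2) by (auto intro!: image_eqI[of _ _ "a *R x"])
 let ?F = "{%x. c * f (a *R x) | c f. f \<in> (test_functions :: ('a => real) set)}"
 show "Ck k (%x. c * f (a *R x))" for k
 proof (rule Ck_family[of ?F])
  fix h assume "h \<in> ?F"
  then obtain c f where h: "h = (%x. c * f (a *R x))" "f \<in> test_functions" by blast
  have d: "(f has_derivative frechet_derivative f (at x)) (at x)" for x
   using h(2) by (intro Ck_has_derivative) (auto simp: test_functions_def)
  have lin: "linear (frechet_derivative f (at x))" for x using d has_derivative_linear by blast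
  have "(h has_derivative (%v. c * a * frechet_derivative f (at (a *R x)) v)) (at x)" for x
  proof -
   have "((%x. f (a *R x)) has_derivative (%v. frechet_derivative f (at (a *R x)) (a *R v))) (at x)"
    by (rule has_derivative_compose[OF _ d]) (auto intro!: derivative_eq_intros)
   thus ?thesis unfolding h(1) 
    by (auto intro!: derivative_eq_intros simp: linear_scale[OF lin])
  qed
  moreover have "(%x. c * a * frechet_derivative f (at (a *R x)) v) \<in> ?F" for v
   using test_function_deriv[OF h(2), of v]
   by (intro CollectI exI[of _ "c * a"] exI[of _ "%x. frechet_derivative f (at x) v"]) auto
  ultimately show "EX D. (ALL x. (h has_derivative D x) (at x)) & (ALL v. (%x. D x v) \<in> ?F)"
   by (intro exI[of _ "%x v. c * a * frechet_derivative f (at (a *R x)) v"]) auto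
 qed (use assms in blast)
qed

lemma bump_continuous: "contU (bump :: 'a::euclidean_space => real)"
 using bump_Ck[of 0] by simp

lemma bump_integral_pos: "(LI x. bump (x::'a::euclidean_space)) > 0"
proof -
 have int: "integrable lborel (bump :: 'a => real)"
  by (rule integrable_continuous_compact[OF bump_continuous, of "cball 0 1"]) (use bump_supp in fastforce)+
 have nn: "AE x in lborel. 0 <= bump (x::'a)" by (simp add: bump_nonneg)
 have "(LI x. bump (x::'a)) ~= 0"
 proof
  assume "(LI x. bump (x::'a)) = 0"
  hence "AE x in lborel. bump (x::'a) = 0" using integral_nonneg_eq_0_iff_AE[OF int nn] by simp
  hence "AE x in lborel. x \<notin> ball (0::'a) 1"
   by eventually_elim (auto simp: bump_def bump_h_def dot_square_norm power_less_one_iff split: if_splits)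
  hence "ball (0::'a) 1 \<in> null_sets lborel" by (simp add: AE_iff_null_sets)
  hence "emeasure lborel (ball (0::'a) 1) = 0" by auto
  thus False using content_ball_pos[of 1 "0::'a"] by (simp add: measure_def)
 qed
 thus ?thesis using integral_nonneg_AE[OF nn] by linarith
qed

definition mollifier :: "real => 'a::euclidean_space => real" where
 "mollifier d x = (1 / (LI z. bump (((1/d) *R z)::'a))) * bump ((1/d) *R x)"

definition mollify :: "real => ('a::euclidean_space => 'b::euclidean_space) => 'a => 'b" where
 "mollify d u x = (LI z. mollifier d z *R u (x - z))"

context
 fixes d :: real assumes d: "d > 0"
begin

lemma mollifier_test: "mollifier d \<in> test_functions"
 unfolding mollifier_def[abs_def] by (rule test_function_scale[OF bump_test]) (use d in simp)

lemma mollifier_nonneg: "mollifier d x >= 0"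
 unfolding mollifier_def by (intro mult_nonneg_nonneg) (auto intro!: integral_nonneg_AE simp: bump_nonneg)

lemma mollifier_supp: "mollifier d x ~= 0 ==> norm x <= d"
 unfolding mollifier_def using d bump_supp[of "(1/d) *R x"] by (auto simp: field_simps)

lemma mollifier_cont: "contU (mollifier d :: 'a::euclidean_space => real)"
 using mollifier_test[where 'a='a] by (auto simp: test_functions_def dest: spec[of _ 0])

lemma mollifier_integrable: "integrable lborel (mollifier d :: 'a::euclidean_space => real)"
 by (rule integrable_continuous_compact[OF mollifier_cont, of "cball 0 d"]) (use mollifier_supp in fastforce)+

lemma mollifier_integral: "(LI x. mollifier d (x::'a::euclidean_space)) = 1"
proof -
 have "(LI z. bump (((1/d) *R z)::'a)) = \<bar>d\<bar>^DIM('a) * (LI z. bump (z::'a))"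
 proof -
  have m [measurable]: "(bump :: 'a => real) \<in> BM"
   by (rule bm_cont[OF bump_continuous])
  have "(LI z. bump (((1/d) *R z)::'a)) = 
   (\<integral>z. bump (((1/d) *R z)::'a) \<partial>density (distr lborel borel (%x. 0 + d *R x)) (%_. \<bar>d\<bar>^DIM('a)))"
   using lborel_affine[of d "0::'a"] d by simp
  also have "... = \<bar>d\<bar>^DIM('a) * (LI z. bump (z::'a))"
   using d by (subst integral_density) (auto simp: integral_distr)
  finally show ?thesis .
 qed
 hence "(LI z. bump (((1/d) *R z)::'a)) > 0" using d bump_integral_pos[where 'a='a] by simp
 thus ?thesis unfolding mollifier_def by simp
qed

lemma mollify_test:
 fixes u :: "'a::euclidean_space => real"
 assumes cu: "contU u" and cs: "compact (supp u)"
 shows "mollify d u \<in> test_functions" "supp (mollify d u) \<subseteq> {x + y | x y. x \<in> supp u & y \<in> cball 0 d}"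
proof -
 let ?K = "{x + y | x y. x \<in> supp u & y \<in> cball 0 d}"
 have cK: "compact ?K" by (rule compact_sums[OF cs]) auto
 have z: "x \<in> ?K" if "mollify d u x ~= 0" for x
 proof (rule ccontr)
  assume "x \<notin> ?K"
  have "mollifier d z *R u (x - z) = 0" for z
  proof (rule ccontr)
   assume "mollifier d z *R u (x - z) ~= 0"
   hence "norm z <= d" "x - z \<in> supp u" using mollifier_supp not_supp by auto
   moreover have "x = (x - z) + z" by simp
   ultimately have "x \<in> ?K" by (metis (mono_tags, lifting) mem_Collect_eq mem_cball_0)
   thus False using \<open>x \<notin> ?K\<close> by blast
  qed
  hence "(%z. mollifier d z *R u (x - z)) = (%z. 0)" by (rule ext)
  hence "mollify d u x = 0" unfolding mollify_def by simp
  with that show False by simp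
 qed
 show "supp (mollify d u) \<subseteq> ?K" by (rule supp_leI) (use z cK compact_imp_closed in auto)
 let ?F = "{%x. (LI y. u y * f (x - y)) | f. f \<in> (test_functions :: ('a => real) set)}"
 have "Ck k (mollify d u)" for k
 proof (rule Ck_family[of ?F])
  have "mollify d u x = (LI y. u y * mollifier d (x - y))" for x
  proof -
   have "contU (%z. u z * mollifier d (x - z))"
    by (intro continuous_intros cu continuous_on_compose2[OF mollifier_cont]) auto
   hence "(LI z. u (x - z) * mollifier d (x - (x - z))) = (LI y. u y * mollifier d (x - y))"
    by (intro lborel_integral_reflect bm_cont)
   thus ?thesis by (simp add: mollify_def mult.commute)
  qed
  thus "mollify d u \<in> ?F" using mollifier_test by blast
 next
  fix h assume "h \<in> ?F"
  then obtain f where f: "h = (%x. LI y. u y * f (x - y))" "f \<in> test_functions" by blast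
  obtain g where g: "C1c f g" "!!x v. frechet_derivative f (at x) v = g x \<bullet> v"
   using test_function_C1c f(2) by blast
  have gf: "C1g f g" using g C1c_C1g by blast
  have "C1g h (%x. LI y. u y *R g (x - y))"
   unfolding f(1)
  proof (rule C1g_integral_param)
   show "((%b. u a * f (b - a)) has_derivative (%h. (u a *R g (b - a)) \<bullet> h)) (at b)" for a b
    by (rule has_derivative_eq_rhs[OF has_derivative_mult_right[OF has_derivative_shift(2)[OF gf]]]) simp
   show "contU (%(a, b). u a * f (b - a))"
    by (auto simp: case_prod_unfold intro!: continuous_intros continuous_on_compose2[OF cu] continuous_on_compose2[OF C1g_cont_fun[OF gf]])
   show "contU (%(a, b). u a *R g (b - a))"
    by (auto simp: case_prod_unfold intro!: continuous_intros continuous_on_compose2[OF cu] continuous_on_compose2[OF C1g_cont[OF gf]])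
   show "EX K. compact K & (ALL a b. norm b < R --> a \<notin> K --> u a * f (b - a) = 0)" for R
    using cs not_supp[of _ u] by (intro exI[of _ "supp u"]) auto
  qed
  hence *: "(h has_derivative (%v. (LI y. u y *R g (x - y)) \<bullet> v)) (at x)" for x
   using C1gD by blast
  have "(LI y. u y *R g (x - y)) \<bullet> v = (LI y. u y * frechet_derivative f (at (x - y)) v)" for x v
  proof -
   have "integrable lborel (%y. u y *R g (x - y))"
    by (rule integrable_continuous_compact[of _ "supp u"])
     (auto simp: not_supp cs intro!: continuous_intros cu continuous_on_compose2[OF C1g_cont[OF gf]])
   thus ?thesis using g(2) by (subst integral_inner_left[symmetric]) auto
  qed
  hence "(%x. (LI y. u y *R g (x - y)) \<bullet> v) \<in> ?F" for v
   using test_function_deriv[OF f(2), of v] by auto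
  with * show "EX D. (ALL x. (h has_derivative D x) (at x)) & (ALL v. (%x. D x v) \<in> ?F)"
   by (intro exI[of _ "%x v. (LI y. u y *R g (x - y)) \<bullet> v"]) auto
 qed
 thus "mollify d u \<in> test_functions" using z cK test_functionI by blast
qed

lemma mollify_close:
 fixes u :: "'a::euclidean_space => 'b::euclidean_space"
 assumes cu: "contU u"
  and close: "!!x y. norm (x - y) <= d ==> norm (u x - u y) <= e"
 shows "norm (mollify d u x - u x) <= e"
proof -
 have i1: "integrable lborel (%z. mollifier d z *R u (x - z))"
  by (rule integrable_continuous_compact[of _ "cball 0 d"])
   (use mollifier_supp in \<open>auto intro!: continuous_intros mollifier_cont continuous_on_compose2[OF cu]\<close>)
 have i2: "integrable lborel (%z. mollifier d z *R u x)"
  using mollifier_integrable by auto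
 have "mollify d u x - u x = (LI z. mollifier d z *R (u (x - z) - u x))"
  unfolding scaleR_diff_right Bochner_Integration.integral_diff[OF i1 i2]
  using mollifier_integral[where 'a='a] mollifier_integrable[where 'a='a] by (simp add: mollify_def)
 also have "norm ... <= (LI z. e * mollifier d (z::'a))"
 proof (rule Bochner_Integration.integral_norm_bound_integral)
  show "integrable lborel (%z. mollifier d z *R (u (x - z) - u x))"
   using Bochner_Integration.integrable_diff[OF i1 i2] by (simp add: scaleR_diff_right)
  show "integrable lborel (%z. e * mollifier d (z::'a))" using mollifier_integrable[where 'a='a] by simp
  show "norm (mollifier d z *R (u (x - z) - u x)) <= e * mollifier d z" for z
   using mollifier_supp[of z] close[of "x - z" x] mollifier_nonneg[of z]
   by (cases "mollifier d z = 0") (auto simp: mult.commute mult_left_mono)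
 qed
 also have "... = e" using mollifier_integral[where 'a='a] by simp
 finally show ?thesis .
qed

lemma mollify_gradient:
 fixes u :: "'a::euclidean_space => real"
 assumes g: "C1g u g" shows "C1g (mollify d u) (mollify d g)"
 unfolding mollify_def[abs_def]
proof (rule C1g_integral_param)
 show "((%b. mollifier d a *R u (b - a)) has_derivative (%h. (mollifier d a *R g (b - a)) \<bullet> h)) (at b)" for a b
  by (rule has_derivative_eq_rhs[OF has_derivative_scaleR_right[OF has_derivative_shift(2)[OF g]]]) simp
 show "contU (%(a, b). mollifier d a *R u (b - a))"
  by (auto simp: case_prod_unfold intro!: continuous_intros continuous_on_compose2[OF mollifier_cont] continuous_on_compose2[OF C1g_cont_fun[OF g]])
 show "contU (%(a, b). mollifier d a *R g (b - a))"
  by (auto simp: case_prod_unfold intro!: continuous_intros continuous_on_compose2[OF mollifier_cont] continuous_on_compose2[OF C1g_cont[OF g]])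
 show "EX K. compact K & (ALL a b. norm b < R --> a \<notin> K --> mollifier d a *R u (b - a) = 0)" for R
  using mollifier_supp by (intro exI[of _ "cball 0 d"]) auto
qed

end

lemma uniformly_close_compact_support:
 fixes f :: "'a::euclidean_space => 'b::real_normed_vector"
 assumes "contU f" "compact K" "!!x. x \<notin> K ==> f x = 0" "e > 0"
 obtains d where "d > 0" "!!x y. norm (x - y) <= d ==> norm (f x - f y) <= e"
proof -
 obtain B where B: "!!x. x \<in> K ==> norm x <= B" using assms(2) compact_imp_bounded bounded_iff by metis
 have "uniformly_continuous_on (cball 0 (B + 1)) f"
  by (rule compact_uniformly_continuous) (use assms(1) continuous_on_subset in auto)
 then obtain d where d: "d > 0" "!!x y. x \<in> cball 0 (B+1) ==> y \<in> cball 0 (B+1) ==> dist y x < d ==> dist (f y) (f x) < e"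
  using assms(4) unfolding uniformly_continuous_on_def by metis
 show thesis
 proof (rule that[of "min (d/2) 1"])
  show "min (d / 2) 1 > 0" using d by simp
  fix x y :: 'a assume xy: "norm (x - y) <= min (d / 2) 1"
  show "norm (f x - f y) <= e"
  proof (cases "x \<in> K \<or> y \<in> K")
   case True
   have "norm x <= norm y + 1" "norm y <= norm x + 1"
    using xy norm_triangle_ineq2[of x y] norm_triangle_ineq2[of y x] by (auto simp: norm_minus_commute)
   hence "x \<in> cball 0 (B+1)" "y \<in> cball 0 (B+1)" using B True by fastforce+
   thus ?thesis using d(2)[of y x] xy d(1) by (auto simp: dist_norm)
  next
   case False
   thus ?thesis using assms by simp
  qed
 qed
qed

lemma sums_cball_subset:
 fixes K :: "'a::euclidean_space set"
 assumes "compact K" "open U" "K \<subseteq> U"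
 obtains r where "r > 0" "{x + y | x y. x \<in> K & y \<in> cball 0 r} \<subseteq> U"
proof -
 obtain e where e: "e > 0" "(\<Union>x\<in>K. ball x e) \<subseteq> U"
  using compact_subset_open_imp_ball_epsilon_subset[OF assms] by metis
 have "{x + y | x y. x \<in> K & y \<in> cball 0 (e/2)} \<subseteq> (\<Union>x\<in>K. ball x e)"
  using e(1) by (force simp: dist_norm)
 thus thesis using e that[of "e/2"] by auto
qed

lemma approx_by_test_function:
 assumes cu: "contU u" and cs: "compact (supp u)" and U: "supp u \<subseteq> U" "open U" and e: "e > 0"
 obtains \<phi> where "\<phi> \<in> test_functions" "supp \<phi> \<subseteq> U" "!!x. \<bar>\<phi> x - u x\<bar> <= e"
proof -
 have nz: "!!x. x \<notin> supp u ==> u x = 0" by (rule not_supp)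
 obtain r where r: "r > 0" "{x + y | x y. x \<in> supp u & y \<in> cball 0 r} \<subseteq> U"
  using sums_cball_subset[OF cs U(2,1)] by blast
 obtain d where d: "d > 0" "!!x y. norm (x - y) <= d ==> norm (u x - u y) <= e"
  using uniformly_close_compact_support[OF cu cs nz e] by blast
 define s where "s = min r d"
 have s: "s > 0" using r d by (simp add: s_def)
 show thesis
 proof (rule that)
  show "mollify s u \<in> test_functions" by (rule mollify_test[OF s cu cs])
  show "supp (mollify s u) \<subseteq> U" using mollify_test(2)[OF s cu cs] r(2) by (fastforce simp: s_def)
  show "\<bar>mollify s u x - u x\<bar> <= e" for x
   using mollify_close[OF s cu, of e x] d(2) by (auto simp: s_def)
 qed
qed

lemma approx_C1_by_test_function:
 assumes u: "C1c u g" and U: "supp u \<subseteq> U" "open U" and e: "e > 0"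
 obtains \<phi> k where "\<phi> \<in> test_functions" "C1c \<phi> k" "supp \<phi> \<subseteq> U" "!!x. \<bar>\<phi> x - u x\<bar> <= e" "!!x. norm (k x - g x) <= e"
proof -
 have g: "C1g u g" and cs: "compact (supp u)" using u by (auto simp: C1c_def)
 note cu = C1g_cont_fun[OF g] and cg = C1g_cont[OF g]
 have nz: "!!x. x \<notin> supp u ==> u x = 0" by (rule not_supp)
 obtain r where r: "r > 0" "{x + y | x y. x \<in> supp u & y \<in> cball 0 r} \<subseteq> U"
  using sums_cball_subset[OF cs U(2,1)] by blast
 obtain d where d: "d > 0" "!!x y. norm (x - y) <= d ==> norm (u x - u y) <= e"
  using uniformly_close_compact_support[OF cu cs nz e] by blast
 obtain d' where d': "d' > 0" "!!x y. norm (x - y) <= d' ==> norm (g x - g y) <= e"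
  using uniformly_close_compact_support[OF cg cs C1g_zero_outside_supp[OF g] e, simplified] by blast
 define s where "s = min r (min d d')"
 have s: "s > 0" using r d d' by (simp add: s_def)
 show thesis
 proof (rule that)
  show *: "mollify s u \<in> test_functions" by (rule mollify_test[OF s cu cs])
  show "supp (mollify s u) \<subseteq> U" using mollify_test(2)[OF s cu cs] r(2) by (fastforce simp: s_def)
  show "\<bar>mollify s u x - u x\<bar> <= e" for x
   using mollify_close[OF s cu, of e x] d(2) by (auto simp: s_def)
  show "norm (mollify s g x - g x) <= e" for x
   using mollify_close[OF s cg, of e x] d'(2) by (auto simp: s_def)
  show "C1c (mollify s u) (mollify s g)"
   using mollify_gradient[OF s g] * by (auto simp: C1c_def test_functions_def)
 qed
qed

section \<open>Square integrable functions\<close>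

definition L2 :: "'a measure => ('a => 'b::euclidean_space) => bool" where
 "L2 M f \<longleftrightarrow> f \<in> borel_measurable M & integrable M (%x. (norm (f x))^2)"

definition ip :: "'a measure => ('a => 'b::euclidean_space) => ('a => 'b) => real" where
 "ip M f g = (\<integral>x. f x \<bullet> g x \<partial>M)"

abbreviation sqn :: "'a measure => ('a => 'b::euclidean_space) => real" where "sqn M f == ip M f f"

lemma L2_on_eq: "L2_on Om = L2 (lebesgue_on Om)"
 by (simp add: fun_eq_iff L2_on_def L2_def)

lemma L2_measurable [measurable_dest]: "L2 M f ==> f \<in> borel_measurable M"
 by (simp add: L2_def)

lemma L2_norm2_integrable: "L2 M f ==> integrable M (%x. (norm (f x))^2)"
 by (simp add: L2_def)

lemma L2_bound:
 assumes "f \<in> borel_measurable M" "integrable M h" "AE x in M. (norm (f x))^2 <= h x"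
 shows "L2 M f"
 unfolding L2_def using assms
 by (auto intro!: Bochner_Integration.integrable_bound[OF assms(2)] elim!: eventually_mono)

lemma norm_add_square_le: "(norm (a + b :: 'b::real_normed_vector))^2 <= 2 * (norm a)^2 + 2 * (norm b)^2"
proof -
 have "(norm (a + b))^2 <= (norm a + norm b)^2" by (rule power_mono[OF norm_triangle_ineq]) simp
 also have "... <= 2 * (norm a)^2 + 2 * (norm b)^2" 
  using zero_le_power2[of "norm a - norm b"] by (simp add: power2_sum power2_diff)
 finally show ?thesis .
qed

lemma L2_add: assumes "L2 M f" "L2 M g" shows "L2 M (%x. f x + g x)"
 by (rule L2_bound[where h = "%x. 2 * (norm (f x))^2 + 2 * (norm (g x))^2"])
  (use assms norm_add_square_le in \<open>auto simp: L2_def\<close>)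

lemma L2_scaleR: assumes "L2 M f" shows "L2 M (%x. c *R f x)"
 using assms by (auto simp: L2_def power_mult_distrib)

lemma L2_diff: assumes "L2 M f" "L2 M g" shows "L2 M (%x. f x - g x)"
 using L2_add[OF assms(1) L2_scaleR[OF assms(2), of "-1"]] by simp

lemma L2_mult: assumes "L2 M (f :: 'a => real)" shows "L2 M (%x. c * f x)"
 using L2_scaleR[OF assms, of c] by simp

lemma L2_zero: "L2 M (%x. 0)" by (simp add: L2_def)

lemma L2_sum: "(!!i. i \<in> I ==> L2 M (f i)) ==> L2 M (%x. \<Sum>i\<in>I. f i x)"
 by (induction I rule: infinite_finite_induct) (auto intro: L2_add L2_zero)

lemma inner_le_squares: "\<bar>a \<bullet> b\<bar> <= (norm a)^2 + (norm (b::'b::real_inner))^2"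
proof -
 have "\<bar>a \<bullet> b\<bar> <= norm a * norm b" by (rule Cauchy_Schwarz_ineq2)
 also have "... <= (norm a)^2 + (norm b)^2"
  using zero_le_power2[of "norm a - norm b"] mult_nonneg_nonneg[OF norm_ge_zero[of a] norm_ge_zero[of b]]
  unfolding power2_diff by linarith
 finally show ?thesis .
qed

lemma L2_inner: assumes "L2 M f" "L2 M g" shows "integrable M (%x. f x \<bullet> g x)"
 by (rule Bochner_Integration.integrable_bound[of _ "%x. (norm (f x))^2 + (norm (g x))^2"])
  (use assms inner_le_squares in \<open>auto simp: L2_def intro: order_trans\<close>)

lemma L2_prod: assumes "L2 M f" "L2 M (g :: _ => real)" shows "integrable M (%x. f x * g x)"
 using L2_inner[OF assms] by (simp add: inner_real_def)

lemma ip_commute: "ip M f g = ip M g f" by (simp add: ip_def inner_commute)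

lemma ip_self: "sqn M f = (\<integral>x. (norm (f x))^2 \<partial>M)"
 by (simp add: ip_def power2_norm_eq_inner)

lemma ip_self_nonneg: "sqn M f >= 0"
 unfolding ip_self by (rule integral_nonneg_AE) auto

lemma ip_add_left: "L2 M f ==> L2 M g ==> L2 M h ==> ip M (%x. f x + g x) h = ip M f h + ip M g h"
 unfolding ip_def inner_add_left by (rule Bochner_Integration.integral_add) (auto intro: L2_inner)

lemma ip_diff_left: "L2 M f ==> L2 M g ==> L2 M h ==> ip M (%x. f x - g x) h = ip M f h - ip M g h"
 unfolding ip_def inner_diff_left by (rule Bochner_Integration.integral_diff) (auto intro: L2_inner)

lemma ip_scale_left: "ip M (%x. c *R f x) h = c * ip M f h"
 by (simp add: ip_def)

lemma ip_add_right: "L2 M f ==> L2 M g ==> L2 M h ==> ip M h (%x. f x + g x) = ip M h f + ip M h g"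
 by (simp add: ip_commute[of M h] ip_add_left)

lemma ip_diff_right: "L2 M f ==> L2 M g ==> L2 M h ==> ip M h (%x. f x - g x) = ip M h f - ip M h g"
 by (simp add: ip_commute[of M h] ip_diff_left)

lemma ip_scale_right: "ip M h (%x. c *R f x) = c * ip M h f"
 by (simp add: ip_def)

lemma ip_cong_AE:
 assumes "f \<in> borel_measurable M" "f' \<in> borel_measurable M" "g \<in> borel_measurable M" "g' \<in> borel_measurable M"
  "AE x in M. f x = f' x" "AE x in M. g x = g' x"
 shows "ip M f g = ip M f' g'"
 unfolding ip_def by (rule integral_cong_AE) (use assms in auto)

lemma quadratic_nonneg_discriminant:
 fixes a b c :: real
 assumes "!!t. 0 <= a + 2 * t * b + t^2 * c"
 shows "b^2 <= a * c"
proof (cases "c = 0")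
 case True
 have "b = 0"
 proof (rule ccontr)
  assume "b ~= 0"
  thus False using assms[of "- (a + 1) / (2 * b)"] True by (auto simp: field_simps)
 qed
 thus ?thesis using True by simp
next
 case False
 have "c > 0"
 proof (rule ccontr)
  assume "~c > 0"
  hence c: "c < 0" using False by simp
  define t where "t = (\<bar>a\<bar> + 2 * \<bar>b\<bar> + 1) / (-c) + 1"
  have t: "t >= 1" "t * (-c) >= \<bar>a\<bar> + 2 * \<bar>b\<bar> + 1" using c unfolding t_def by (auto simp: field_simps)
  have "t * (t * (-c)) >= t * (\<bar>a\<bar> + 2 * \<bar>b\<bar> + 1)" using t by (intro mult_left_mono) auto
  moreover have "t * (\<bar>a\<bar> + 2 * \<bar>b\<bar> + 1) > a + 2 * t * b"
  proof -
   have "t * \<bar>a\<bar> >= \<bar>a\<bar>" using t(1) mult_right_mono[of 1 t "\<bar>a\<bar>"] by simp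
   moreover have "t * \<bar>b\<bar> >= t * b" using t(1) by (intro mult_left_mono) auto
   moreover have "t * (\<bar>a\<bar> + 2 * \<bar>b\<bar> + 1) = t * \<bar>a\<bar> + 2 * (t * \<bar>b\<bar>) + t" by algebra
   moreover have "2 * t * b = 2 * (t * b)" by simp
   ultimately show ?thesis using t(1) by linarith
  qed
  ultimately show False using assms[of t] by (simp add: power2_eq_square algebra_simps)
 qed
 thus ?thesis using assms[of "- b / c"] by (simp add: field_simps power2_eq_square)
qed

lemma ip_Cauchy_Schwarz:
 assumes "L2 M f" "L2 M g" shows "(ip M f g)^2 <= sqn M f * sqn M g"
proof (rule quadratic_nonneg_discriminant)
 fix t
 have "0 <= sqn M (%x. f x + t *R g x)" by (rule ip_self_nonneg)
 also have "... = sqn M f + 2 * t * ip M f g + t^2 * sqn M g"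
  using assms by (simp add: ip_add_left ip_add_right ip_scale_left ip_scale_right L2_add L2_scaleR 
    ip_commute[of M g f] power2_eq_square algebra_simps)
 finally show "0 <= sqn M f + 2 * t * ip M f g + t^2 * sqn M g" .
qed

definition L2_tendsto :: "'a measure => (nat => 'a => 'b::euclidean_space) => ('a => 'b) => bool" where
 "L2_tendsto M F f \<longleftrightarrow> (ALL n. L2 M (F n)) & L2 M f &
   (%n. sqn M (%x. F n x - f x)) \<longlonglongrightarrow> 0"

lemma L2_tendsto_ip_right:
 assumes "L2_tendsto M F f" "L2 M h" shows "(%n. ip M (F n) h) \<longlonglongrightarrow> ip M f h"
proof -
 have l: "!!n. L2 M (F n)" "L2 M f" "(%n. sqn M (%x. F n x - f x)) \<longlonglongrightarrow> 0"
  using assms by (auto simp: L2_tendsto_def)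
 have "(%n. ip M (%x. F n x - f x) h) \<longlonglongrightarrow> 0"
 proof (rule Lim_null_comparison)
  show "\<forall>\<^sub>F n in sequentially. norm (ip M (%x. F n x - f x) h) <= sqrt (sqn M (%x. F n x - f x) * sqn M h)"
  proof (rule eventuallyI)
   fix n
   have "(ip M (%x. F n x - f x) h)^2 <= sqn M (%x. F n x - f x) * sqn M h"
    by (rule ip_Cauchy_Schwarz) (use l assms in \<open>auto intro: L2_diff\<close>)
   thus "norm (ip M (%x. F n x - f x) h) <= sqrt (sqn M (%x. F n x - f x) * sqn M h)"
    by (simp add: real_le_rsqrt)
  qed
  have "(%n. sqrt (sqn M (%x. F n x - f x) * sqn M h)) \<longlonglongrightarrow> sqrt (0 * sqn M h)"
   by (intro tendsto_intros l(3))
  thus "(%n. sqrt (sqn M (%x. F n x - f x) * sqn M h)) \<longlonglongrightarrow> 0" by simp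
 qed
 hence "(%n. ip M (F n) h - ip M f h) \<longlonglongrightarrow> 0"
  using l assms(2) by (simp add: ip_diff_left)
 thus ?thesis by (simp add: LIM_zero_iff)
qed

lemma L2_tendsto_ip:
 assumes F: "L2_tendsto M F f" and G: "L2_tendsto M G g"
 shows "(%n. ip M (F n) (G n)) \<longlonglongrightarrow> ip M f g"
proof -
 have l: "!!n. L2 M (F n)" "L2 M f" "(%n. sqn M (%x. F n x - f x)) \<longlonglongrightarrow> 0"
  using F by (auto simp: L2_tendsto_def)
 have k: "!!n. L2 M (G n)" "L2 M g" "(%n. sqn M (%x. G n x - g x)) \<longlonglongrightarrow> 0"
  using G by (auto simp: L2_tendsto_def)
 have "(%n. ip M (%x. F n x - f x) (%x. G n x - g x)) \<longlonglongrightarrow> 0"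
 proof (rule Lim_null_comparison)
  show "\<forall>\<^sub>F n in sequentially. norm (ip M (%x. F n x - f x) (%x. G n x - g x)) <= 
    sqrt (sqn M (%x. F n x - f x) * sqn M (%x. G n x - g x))"
  proof (rule eventuallyI)
   fix n
   show "norm (ip M (%x. F n x - f x) (%x. G n x - g x)) <= 
    sqrt (sqn M (%x. F n x - f x) * sqn M (%x. G n x - g x))"
    unfolding real_norm_def by (rule real_le_rsqrt, subst power2_abs, rule ip_Cauchy_Schwarz) (use l k in \<open>auto intro: L2_diff\<close>)
  qed
  have "(%n. sqrt (sqn M (%x. F n x - f x) * sqn M (%x. G n x - g x))) \<longlonglongrightarrow> sqrt (0 * 0)"
   by (intro tendsto_intros l(3) k(3))
  thus "(%n. sqrt (sqn M (%x. F n x - f x) * sqn M (%x. G n x - g x))) \<longlonglongrightarrow> 0" by simp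
 qed
 moreover have "(%n. ip M (F n) g) \<longlonglongrightarrow> ip M f g" by (rule L2_tendsto_ip_right[OF F k(2)])
 moreover have "(%n. ip M f (G n)) \<longlonglongrightarrow> ip M f g"
  using L2_tendsto_ip_right[OF G l(2)] by (simp add: ip_commute)
 ultimately have "(%n. ip M (%x. F n x - f x) (%x. G n x - g x) + ip M (F n) g + ip M f (G n) - ip M f g) 
   \<longlonglongrightarrow> 0 + ip M f g + ip M f g - ip M f g"
  by (intro tendsto_intros)
 moreover have "ip M (%x. F n x - f x) (%x. G n x - g x) + ip M (F n) g + ip M f (G n) - ip M f g = ip M (F n) (G n)" for n
  using l k by (simp add: ip_diff_left ip_diff_right L2_diff)
 ultimately show ?thesis by simp
qed

lemma L2_tendsto_lin:
 assumes F: "L2_tendsto M F f" and G: "L2_tendsto M G g"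
 shows "L2_tendsto M (%n x. a *R F n x + b *R G n x) (%x. a *R f x + b *R g x)"
proof -
 have l: "!!n. L2 M (F n)" "L2 M f" "(%n. sqn M (%x. F n x - f x)) \<longlonglongrightarrow> 0"
  using F by (auto simp: L2_tendsto_def)
 have k: "!!n. L2 M (G n)" "L2 M g" "(%n. sqn M (%x. G n x - g x)) \<longlonglongrightarrow> 0"
  using G by (auto simp: L2_tendsto_def)
 let ?D = "%n x. (a *R F n x + b *R G n x) - (a *R f x + b *R g x)"
 have LF: "L2 M (%x. F n x - f x)" and LG: "L2 M (%x. G n x - g x)" for n using l k by (auto intro: L2_diff)
 have bound: "sqn M (?D n) <= 2 * a^2 * sqn M (%x. F n x - f x) + 2 * b^2 * sqn M (%x. G n x - g x)" for n
 proof -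
  have eq: "?D n x = a *R (F n x - f x) + b *R (G n x - g x)" for x by (simp add: algebra_simps)
  have "sqn M (?D n) <= (\<integral>x. 2 * a^2 * (norm (F n x - f x))^2 + 2 * b^2 * (norm (G n x - g x))^2 \<partial>M)"
   unfolding ip_self
  proof (rule integral_mono)
   show "integrable M (%x. (norm (?D n x))^2)"
    by (rule L2_norm2_integrable) (intro L2_diff L2_add L2_scaleR l k)
   show "integrable M (%x. 2 * a^2 * (norm (F n x - f x))^2 + 2 * b^2 * (norm (G n x - g x))^2)"
    by (intro Bochner_Integration.integrable_add integrable_mult_right L2_norm2_integrable LF LG)
   show "(norm (?D n x))^2 <= 2 * a^2 * (norm (F n x - f x))^2 + 2 * b^2 * (norm (G n x - g x))^2" for x
    unfolding eq using norm_add_square_le[of "a *R (F n x - f x)" "b *R (G n x - g x)"] by (simp add: power_mult_distrib)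
  qed
  also have "... = 2 * a^2 * sqn M (%x. F n x - f x) + 2 * b^2 * sqn M (%x. G n x - g x)"
   unfolding ip_self
   by (subst Bochner_Integration.integral_add) (auto intro!: integrable_mult_right L2_norm2_integrable LF LG)
  finally show ?thesis .
 qed
 have "(%n. sqn M (?D n)) \<longlonglongrightarrow> 0"
 proof (rule tendsto_sandwich[OF _ _ tendsto_const])
  have "(%n. 2 * a^2 * sqn M (%x. F n x - f x) + 2 * b^2 * sqn M (%x. G n x - g x)) \<longlonglongrightarrow> 2 * a^2 * 0 + 2 * b^2 * 0"
   by (intro tendsto_intros l(3) k(3))
  thus "(%n. 2 * a^2 * sqn M (%x. F n x - f x) + 2 * b^2 * sqn M (%x. G n x - g x)) \<longlonglongrightarrow> 0" by simp
 qed (auto intro!: always_eventually bound ip_self_nonneg)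
 thus ?thesis unfolding L2_tendsto_def using l k by (auto intro!: L2_add L2_scaleR)
qed

lemma L2_complete:
 fixes F :: "nat => 'a => 'b::euclidean_space"
 assumes L: "!!n. L2 M (F n)"
  and C: "!!e. e > 0 ==> EX N. ALL m>=N. ALL n>=N. sqn M (%x. F m x - F n x) < e"
 obtains f where "L2_tendsto M F f"
proof -
 let ?d = "%m n. sqn M (%x. F m x - F n x)"
 have [measurable]: "F n \<in> borel_measurable M" for n using L by (simp add: L2_def)
 have nn: "(\<integral>\<^sup>+x. ennreal ((norm (F m x - F n x))^2) \<partial>M) = ennreal (?d m n)" for m n
  unfolding ip_self by (rule nn_integral_eq_integral) (auto intro!: L2_norm2_integrable L2_diff L)
 obtain N where N: "!!k m n. m >= N k ==> n >= N k ==> ?d m n < (1/4)^k"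
 proof -
  have "ALL k. EX N. ALL m>=N. ALL n>=N. ?d m n < (1/4)^k" using C by simp
  thus thesis using that by metis
 qed
 define s where "s k = (\<Sum>i\<le>k. N i) + k" for k
 have sN: "s k >= N k" for k unfolding s_def by (simp add: member_le_sum trans_le_add1)
 have s1: "s (Suc k) >= s k" for k unfolding s_def by simp
 have sk: "s k >= k" for k unfolding s_def by simp
 define D where "D k x = norm (F (s (Suc k)) x - F (s k) x)" for k x
 have "(\<integral>\<^sup>+x. (\<Sum>k. ennreal (2^k * (D k x)^2)) \<partial>M) = (\<Sum>k. \<integral>\<^sup>+x. ennreal (2^k * (D k x)^2) \<partial>M)"
  unfolding D_def by (rule nn_integral_suminf) measurable
 also have "... <= (\<Sum>k. ennreal ((1/2)^k))"
 proof (rule suminf_le)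
  fix k
  have "(\<integral>\<^sup>+x. ennreal (2^k * (D k x)^2) \<partial>M) = (\<integral>\<^sup>+x. ennreal (2^k) * ennreal ((D k x)^2) \<partial>M)"
   by (simp add: ennreal_mult)
  also have "... = ennreal (2^k) * (\<integral>\<^sup>+x. ennreal ((D k x)^2) \<partial>M)"
   unfolding D_def by (rule nn_integral_cmult) measurable
  also have "... = ennreal (2^k * ?d (s (Suc k)) (s k))"
   unfolding D_def nn by (simp add: ennreal_mult ip_self_nonneg)
  also have "... <= ennreal ((1/2)^k)"
  proof (rule ennreal_leI)
   have "?d (s (Suc k)) (s k) < (1/4)^k" using N[of k "s (Suc k)" "s k"] sN[of k] s1[of k] by linarith
   hence "2^k * ?d (s (Suc k)) (s k) <= 2^k * (1/4)^k" by (intro mult_left_mono) auto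
   also have "... = (1/2::real)^k" by (simp add: power_mult_distrib[symmetric])
   finally show "2^k * ?d (s (Suc k)) (s k) <= (1/2)^k" .
  qed
  finally show "(\<integral>\<^sup>+x. ennreal (2^k * (D k x)^2) \<partial>M) <= ennreal ((1/2)^k)" .
 qed auto
 also have "... < \<infinity>"
  by (subst suminf_ennreal2) (auto intro: summable_geometric)
 finally have fin: "(\<integral>\<^sup>+x. (\<Sum>k. ennreal (2^k * (D k x)^2)) \<partial>M) ~= \<infinity>" by simp
 have "AE x in M. (\<Sum>k. ennreal (2^k * (D k x)^2)) ~= \<infinity>"
  by (rule nn_integral_noteq_infinite[OF _ fin]) (auto simp: D_def)
 hence conv: "AE x in M. convergent (%k. F (s k) x)"
 proof eventually_elim
  fix x assume "(\<Sum>k. ennreal (2^k * (D k x)^2)) ~= \<infinity>"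
  hence sum1: "summable (%k. 2^k * (D k x)^2)"
   by (intro summable_suminf_not_top) auto
  have "summable (%k. (1/2::real)^k + 2^k * (D k x)^2)"
   by (intro summable_add sum1 summable_geometric) auto
  hence "summable (%k. norm (F (s (Suc k)) x - F (s k) x))"
  proof (rule summable_comparison_test'[where N = 0])
   fix k
   have "D k x <= (1/2)^k + 2^k * (D k x)^2"
   proof -
    have "0 <= (2^k * D k x - 1/2)^2" by simp
    hence "2^k * D k x <= 2^k * 2^k * (D k x)^2 + 1/4" by (simp add: power2_eq_square algebra_simps)
    also have "... <= 2^k * ((1/2)^k + 2^k * (D k x)^2)"
    proof -
     have h: "2^k * (1/2)^k = (1::real)" by (simp flip: power_mult_distrib)
     show ?thesis unfolding distrib_left h by (simp add: mult.assoc)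
    qed
    finally show ?thesis by simp
   qed
   thus "norm (norm (F (s (Suc k)) x - F (s k) x)) <= (1/2)^k + 2^k * (D k x)^2" by (simp add: D_def)
  qed
  hence "summable (%k. F (s (Suc k)) x - F (s k) x)" by (rule summable_norm_cancel)
  hence "convergent (%n. \<Sum>k<n. F (s (Suc k)) x - F (s k) x)" by (simp add: summable_iff_convergent)
  hence "convergent (%n. F (s n) x - F (s 0) x)" by (simp add: sum_lessThan_telescope[of "%k. F (s k) x"])
  from convergent_add[OF this convergent_const[of "F (s 0) x"]]
  show "convergent (%k. F (s k) x)" by simp
 qed
 define f where "f x = lim (%k. F (s k) x)" for x
 have fm[measurable]: "f \<in> borel_measurable M" unfolding f_def[abs_def] by measurable
 have lim: "AE x in M. (%k. F (s k) x) \<longlonglongrightarrow> f x"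
  using conv by eventually_elim (simp add: f_def convergent_LIMSEQ_iff)
 have fatou: "(\<integral>\<^sup>+x. ennreal ((norm (F n x - f x))^2) \<partial>M) <= ennreal e" 
  if e: "e > 0" and NN: "!!m. m >= N' ==> ?d n m < e" for n e N'
 proof -
  have "(\<integral>\<^sup>+x. ennreal ((norm (F n x - f x))^2) \<partial>M) = (\<integral>\<^sup>+x. liminf (%k. ennreal ((norm (F n x - F (s k) x))^2)) \<partial>M)"
  proof (rule nn_integral_cong_AE, use lim in eventually_elim)
   fix x assume "(%k. F (s k) x) \<longlonglongrightarrow> f x"
   hence "(%k. ennreal ((norm (F n x - F (s k) x))^2)) \<longlonglongrightarrow> ennreal ((norm (F n x - f x))^2)"
    by (intro tendsto_intros)
   thus "ennreal ((norm (F n x - f x))^2) = liminf (%k. ennreal ((norm (F n x - F (s k) x))^2))"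
    by (metis lim_imp_Liminf sequentially_bot)
  qed
  also have "... <= liminf (%k. \<integral>\<^sup>+x. ennreal ((norm (F n x - F (s k) x))^2) \<partial>M)"
   by (rule nn_integral_liminf) measurable
  also have "... = liminf (%k. ennreal (?d n (s k)))" by (simp add: nn)
  also have "... <= liminf (%k::nat. ennreal e)"
  proof (rule Liminf_mono)
   show "\<forall>\<^sub>F k in sequentially. ennreal (?d n (s k)) <= ennreal e"
    using eventually_ge_at_top[of N'] proof eventually_elim
     fix k assume "N' <= k"
     hence "N' <= s k" using sk[of k] by simp
     thus "ennreal (?d n (s k)) <= ennreal e" using NN by (intro ennreal_leI less_imp_le)
    qed
  qed
  also have "... = ennreal e" by (simp add: Liminf_const)
  finally show ?thesis .
 qed
 have Lf: "L2 M (%x. F n x - f x)" "sqn M (%x. F n x - f x) <= e"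
  if e: "e > 0" and NN: "!!m. m >= N' ==> ?d n m < e" for n e N'
 proof -
  note fa = fatou[of e N' n, OF e NN]
  have i: "integrable M (%x. (norm (F n x - f x))^2)"
   by (rule integrableI_bounded) (use fa in \<open>auto intro: le_less_trans\<close>)
  thus "L2 M (%x. F n x - f x)" by (simp add: L2_def)
  have "ennreal (sqn M (%x. F n x - f x)) <= ennreal e"
   using fa nn_integral_eq_integral[OF i] by (simp add: ip_self)
  thus "sqn M (%x. F n x - f x) <= e" using e by (simp add: ennreal_le_iff)
 qed
 obtain N1 where N1: "!!m n. m >= N1 ==> n >= N1 ==> ?d m n < 1" using C[of 1] by auto
 have "L2 M (%x. F N1 x - f x)" by (rule Lf(1)[of 1 N1]) (use N1 in auto)
 from L2_diff[OF L[of N1] this] have L2f: "L2 M f" by simp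
 have "(%n. sqn M (%x. F n x - f x)) \<longlonglongrightarrow> 0"
 proof (rule LIMSEQ_I)
  fix r :: real assume r: "r > 0"
  obtain N2 where N2: "!!m n. m >= N2 ==> n >= N2 ==> ?d m n < r/2" using C[of "r/2"] r by auto
  have "sqn M (%x. F n x - f x) <= r/2" if "n >= N2" for n
   by (rule Lf(2)[of _ N2]) (use N2 that r in auto)
  thus "EX no. ALL n>=no. norm (sqn M (%x. F n x - f x) - 0) < r"
  proof (intro exI[of _ N2] allI impI)
   fix n assume "n >= N2"
   hence "sqn M (%x. F n x - f x) <= r/2" 
    using \<open>!!n. n >= N2 ==> sqn M (%x. F n x - f x) <= r/2\<close> by blast
   thus "norm (sqn M (%x. F n x - f x) - 0) < r"
    using r ip_self_nonneg[of M "%x. F n x - f x"] by simp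
  qed
 qed
 hence "L2_tendsto M F f" unfolding L2_tendsto_def using L L2f by auto
 thus thesis by (rule that)
qed

section \<open>Weak gradients\<close>

lemma test_function_gradient:
 assumes "f \<in> test_functions"
 shows "EX g. C1c f g & (ALL x v. frechet_derivative f (at x) v = g x \<bullet> v)"
 by (rule test_function_C1c[OF assms]) blast

lemma lebesgue_on_integral_borel:
 fixes f :: "'a::euclidean_space => 'b::{banach, second_countable_topology}"
 assumes "f \<in> BM" "Om \<in> sets borel"
 shows "integral\<^sup>L (lebesgue_on Om) f = (LI x. indicator Om x *R f x)"
 using assms by (simp add: integral_restrict_space integral_completion)

lemma lebesgue_on_integrable_borel:
 fixes f :: "'a::euclidean_space => 'b::{banach, second_countable_topology}"
 assumes "integrable lborel f" "Om \<in> sets borel"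
 shows "integrable (lebesgue_on Om) f"
proof -
 have [measurable]: "f \<in> BM" using assms(1) by auto
 have "integrable lborel (%x. indicator Om x *R f x)"
  using integrable_mult_indicator[OF _ assms(1)] assms(2) by simp
 thus ?thesis using assms(2) by (simp add: integrable_restrict_space integrable_completion)
qed

lemma borel_measurable_lebesgue_on:
 assumes "f \<in> BM" shows "f \<in> borel_measurable (lebesgue_on Om)"
 by (intro measurable_restrict_space1 measurable_completion) (use assms in auto)

lemma L2_continuous_compact:
 fixes f :: "'a::euclidean_space => 'b::euclidean_space"
 assumes "contU f" "compact K" "!!x. x \<notin> K ==> f x = 0" "Om \<in> sets borel"
 shows "L2 (lebesgue_on Om) f"
 unfolding L2_def
proof
 show "f \<in> borel_measurable (lebesgue_on Om)"
  using bm_cont[OF assms(1)] borel_measurable_lebesgue_on by blast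
 show "integrable (lebesgue_on Om) (%x. (norm (f x))^2)"
  by (rule lebesgue_on_integrable_borel[OF integrable_continuous_compact[OF _ assms(2)] assms(4)])
   (use assms in \<open>auto intro!: continuous_intros\<close>)
qed

lemma C1c_L2:
 assumes "C1c u g" "Om \<in> sets borel"
 shows "L2 (lebesgue_on Om) u" "L2 (lebesgue_on Om) g"
 using assms C1g_zero_outside_supp[of u g]
 by (auto intro!: L2_continuous_compact[of _ "supp u"] C1g_cont_fun C1g_cont simp: C1c_def dest: not_supp)

lemma L2_inner_const: assumes "L2 M g" shows "L2 M (%x. g x \<bullet> v)"
proof (rule L2_bound[where h = "%x. (norm v)^2 * (norm (g x))^2"])
 show "AE x in M. (norm (g x \<bullet> v))^2 <= (norm v)^2 * (norm (g x))^2"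
 proof (rule AE_I2)
  fix x
  have "\<bar>g x \<bullet> v\<bar> <= norm v * norm (g x)" using Cauchy_Schwarz_ineq2[of "g x" v] by (simp add: mult.commute)
  hence "\<bar>g x \<bullet> v\<bar>\<^sup>2 <= (norm v * norm (g x))^2" by (rule power_mono) simp
  thus "(norm (g x \<bullet> v))^2 <= (norm v)^2 * (norm (g x))^2" by (simp add: power_mult_distrib)
 qed
qed (use assms in \<open>auto simp: L2_def\<close>)

lemma C1c_supp_in_open_integral:
 assumes "C1c f k" "supp f \<subseteq> Om" "Om \<in> sets borel" "contU h" "!!x. x \<notin> supp f ==> h x = 0"
 shows "(\<integral>x. h x \<partial>lebesgue_on Om) = (LI x. (h x :: real))"
proof -
 have "(%x. indicator Om x *R h x) = h" using assms(2,5) by (auto simp: indicator_def fun_eq_iff)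
 thus ?thesis using lebesgue_on_integral_borel[OF bm_cont[OF assms(4)] assms(3)] by metis
qed

lemma C1c_weak_gradient:
 assumes "C1c u g" "Om \<in> sets borel" shows "has_weak_gradient Om u g"
 unfolding has_weak_gradient_def L2_on_eq
proof (intro conjI ballI impI allI)
 show "L2 (lebesgue_on Om) u" "L2 (lebesgue_on Om) g" using C1c_L2[OF assms] by auto
 fix \<phi> v assume \<phi>: "\<phi> \<in> test_functions" "supp \<phi> \<subseteq> Om"
 obtain k where k: "C1c \<phi> k" "!!x v. frechet_derivative \<phi> (at x) v = k x \<bullet> v"
  using test_function_gradient[OF \<phi>(1)] by blast
 have ug: "C1g u g" "C1g \<phi> k" using assms(1) k(1) C1c_C1g by auto
 note cont = C1g_cont[OF ug(1)] C1g_cont[OF ug(2)] C1g_cont_fun[OF ug(1)] C1g_cont_fun[OF ug(2)]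
 have p: "C1c (%x. \<phi> x * u x) (%x. \<phi> x *R g x + u x *R k x)" by (rule C1c_mult[OF k(1) ug(1)])
 have i: "integrable lborel (%x. u x * (k x \<bullet> v))" "integrable lborel (%x. (g x \<bullet> v) * \<phi> x)"
  by (rule integrable_continuous_compact[of _ "supp \<phi>"];
    use cont k(1) C1g_zero_outside_supp[OF ug(2)] not_supp in \<open>auto simp: C1c_def intro!: continuous_intros\<close>)+
 have "(LI x. u x * (k x \<bullet> v)) + (LI x. (g x \<bullet> v) * \<phi> x) = (LI x. u x * (k x \<bullet> v) + (g x \<bullet> v) * \<phi> x)"
  using i by simp
 also have "... = (LI x. (\<phi> x *R g x + u x *R k x) \<bullet> v)"
  by (simp add: inner_add_left algebra_simps)
 also have "... = 0" using C1c_integrable(2)[OF p] integral_gradient_zero[OF p] by simp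
 finally have "(LI x. u x * (k x \<bullet> v)) = - (LI x. (g x \<bullet> v) * \<phi> x)" by simp
 moreover have "(\<integral>x. u x * (k x \<bullet> v) \<partial>lebesgue_on Om) = (LI x. u x * (k x \<bullet> v))"
  by (rule C1c_supp_in_open_integral[OF k(1) \<phi>(2) assms(2)]) 
    (use cont C1g_zero_outside_supp[OF ug(2)] in \<open>auto intro!: continuous_intros\<close>)
 moreover have "(\<integral>x. (g x \<bullet> v) * \<phi> x \<partial>lebesgue_on Om) = (LI x. (g x \<bullet> v) * \<phi> x)"
  by (rule C1c_supp_in_open_integral[OF k(1) \<phi>(2) assms(2)]) 
    (use cont not_supp in \<open>auto intro!: continuous_intros\<close>)
 ultimately show "(LINT x|lebesgue_on Om. u x * frechet_derivative \<phi> (at x) v) = - (LINT x|lebesgue_on Om. (g x \<bullet> v) * \<phi> x)"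
  by (simp add: k(2))
qed

lemma zero_if_orthogonal_continuous:
 fixes f :: "'a::euclidean_space => real"
 assumes Om: "open Om" and f: "L2 (lebesgue_on Om) f"
  and orth: "!!\<phi>. \<phi> \<in> test_functions ==> supp \<phi> \<subseteq> Om ==> (\<integral>x. f x * \<phi> x \<partial>lebesgue_on Om) = 0"
  and c: "contU c" "compact (supp c)" "supp c \<subseteq> Om"
 shows "(\<integral>x. f x * c x \<partial>lebesgue_on Om) = 0"
proof -
 let ?M = "lebesgue_on Om"
 have Omb: "Om \<in> sets borel" using Om by simp
 obtain B where B: "!!x. x \<in> supp c ==> norm x < B" "B > 0"
 proof -
  obtain b where b: "b > 0" "!!x. x \<in> supp c ==> norm x <= b"
   using bounded_pos compact_imp_bounded[OF c(2)] by metis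
  show thesis using b(1) by (intro that[of "b + 1"]) (auto dest!: b(2))
 qed
 define w :: "'a => real" where "w x = max 0 (min 1 (B + 1 - norm x))" for x
 have w: "contU w" unfolding w_def by (intro continuous_intros)
 have Lw: "L2 ?M w"
  by (rule L2_continuous_compact[OF w, of "cball 0 (B+1)"]) (use Omb in \<open>auto simp: w_def\<close>)
 have Lc: "L2 ?M c" by (rule L2_continuous_compact[OF c(1,2) _ Omb]) (rule not_supp)
 define K where "K = (\<integral>x. \<bar>f x\<bar> * w x \<partial>?M)"
 have iK: "integrable ?M (%x. \<bar>f x\<bar> * w x)"
  using f by (intro L2_prod Lw) (auto simp: L2_def)
 have wnn: "w x >= 0" for x by (simp add: w_def)
 have "\<bar>\<integral>x. f x * c x \<partial>?M\<bar> <= e * K" if e: "e > 0" for e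
 proof -
  have "supp c \<subseteq> ball 0 B" using B(1) by (simp add: subset_iff)
  with c(3) have cU: "supp c \<subseteq> Om \<inter> ball 0 B" "open (Om \<inter> ball 0 B)" using Om by (simp_all add: open_Int)
  obtain \<phi> where \<phi>: "\<phi> \<in> test_functions" "supp \<phi> \<subseteq> Om \<inter> ball 0 B" "!!x. \<bar>\<phi> x - c x\<bar> <= e"
   by (rule approx_by_test_function[OF c(1,2) cU e]) (rule that)
  obtain k where k: "C1c \<phi> k" using test_function_gradient[OF \<phi>(1)] by blast
  note L\<phi> = C1c_L2(1)[OF k Omb]
  have "(\<integral>x. f x * c x \<partial>?M) = (\<integral>x. f x * c x \<partial>?M) - (\<integral>x. f x * \<phi> x \<partial>?M)"
  proof -
   have "supp \<phi> \<subseteq> Om" using \<phi>(2) by blast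
   from orth[OF \<phi>(1) this] show ?thesis by simp
  qed
  also have "... = (\<integral>x. f x * (c x - \<phi> x) \<partial>?M)"
   using L2_prod[OF f Lc] L2_prod[OF f L\<phi>] by (simp add: right_diff_distrib)
  finally have "\<bar>\<integral>x. f x * c x \<partial>?M\<bar> = norm (\<integral>x. f x * (c x - \<phi> x) \<partial>?M)" by simp
  also have "... <= (\<integral>x. e * (\<bar>f x\<bar> * w x) \<partial>?M)"
  proof (rule Bochner_Integration.integral_norm_bound_integral)
   show "integrable ?M (%x. f x * (c x - \<phi> x))"
    by (rule L2_prod[OF f L2_diff[OF Lc L\<phi>]])
   show "integrable ?M (%x. e * (\<bar>f x\<bar> * w x))" using iK by simp
   fix x
   show "norm (f x * (c x - \<phi> x)) <= e * (\<bar>f x\<bar> * w x)"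
   proof (cases "norm x < B")
    case True
    hence "w x = 1" by (simp add: w_def)
    thus ?thesis using mult_left_mono[OF \<phi>(3)[of x], of "\<bar>f x\<bar>"]
      by (simp add: abs_mult mult.commute[of e] abs_minus_commute[of "c x"])
   next
    case False
    hence "x \<notin> supp c" "x \<notin> supp \<phi>" using B \<phi>(2) by auto
    thus ?thesis using wnn[of x] e by (simp add: not_supp)
   qed
  qed
  also have "... = e * K" by (simp add: K_def)
  finally show ?thesis .
 qed
 note bd = this
 have K0: "K >= 0" unfolding K_def using wnn by (intro integral_nonneg_AE) auto
 show ?thesis
 proof (rule ccontr)
  assume "(\<integral>x. f x * c x \<partial>?M) ~= 0"
  hence p: "\<bar>\<integral>x. f x * c x \<partial>?M\<bar> > 0" by simp
  hence "\<bar>\<integral>x. f x * c x \<partial>?M\<bar> <= (\<bar>\<integral>x. f x * c x \<partial>?M\<bar> / (2 * (K + 1))) * K"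
   using K0 by (intro bd) auto
  also have "... < \<bar>\<integral>x. f x * c x \<partial>?M\<bar>" using p K0 by (simp add: field_simps add_strict_increasing)
  finally show False by simp
 qed
qed

lemma zero_if_orthogonal_test_functions:
 fixes f :: "'a::euclidean_space => real"
 assumes Om: "open Om" and f: "L2 (lebesgue_on Om) f"
  and orth: "!!\<phi>. \<phi> \<in> test_functions ==> supp \<phi> \<subseteq> Om ==> (\<integral>x. f x * \<phi> x \<partial>lebesgue_on Om) = 0"
 shows "AE x in lebesgue_on Om. f x = 0"
proof -
 let ?M = "lebesgue_on Om"
 have Omb: "Om \<in> sets borel" "Om \<in> sets lebesgue" using Om by auto
 have fm[measurable]: "f \<in> borel_measurable ?M" using f by (simp add: L2_def)
 have ball: "AE x in ?M. x \<in> ball z r --> f x = 0" if zr: "cball z r \<subseteq> Om" for z r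
 proof (cases "r > 0")
  case True
  define c where "c x = max 0 (r - dist z x)" for x
  have c: "contU c" unfolding c_def by (intro continuous_intros)
  have cz: "x \<in> cball z r" if "c x ~= 0" for x using that by (auto simp: c_def max_def split: if_splits)
  have Lc: "L2 ?M c" by (rule L2_continuous_compact[OF c, of "cball z r"]) (use cz Omb in auto)
  let ?F = "%x. if x \<in> Om then sgn (f x) else 0"
  have "?F \<in> borel_measurable lebesgue" using Omb by (subst borel_measurable_if) auto
  hence "?F measurable_on UNIV" by (rule lebesgue_measurable_imp_measurable_on_real) auto
  then obtain N g where N: "negligible N" and g: "!!n. contU (g n)"
   "!!x. x \<notin> N ==> (%n. g n x) \<longlonglongrightarrow> ?F x"
   unfolding measurable_on_def by auto
  define h where "h n x = max (-1) (min 1 (g n x))" for n x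
  have h: "contU (h n)" for n unfolding h_def by (intro continuous_intros g)
  have hl: "(%n. h n x) \<longlonglongrightarrow> ?F x" if "x \<notin> N" for x
  proof -
   have "(%n. max (-1) (min 1 (g n x))) \<longlonglongrightarrow> max (-1) (min 1 (?F x))"
    by (intro tendsto_max tendsto_min tendsto_const g(2) that)
   moreover have "max (-1) (min 1 (?F x)) = ?F x" by (auto simp: sgn_if)
   ultimately show ?thesis unfolding h_def by (simp only:)
  qed
  have hb: "\<bar>h n x\<bar> <= 1" for n x by (auto simp: h_def)
  have hm[measurable]: "h n \<in> borel_measurable ?M" for n
   using borel_measurable_lebesgue_on[OF bm_cont[OF h]] .
  have cm[measurable]: "c \<in> borel_measurable ?M"
   using borel_measurable_lebesgue_on[OF bm_cont[OF c]] .
  have c0: "c x >= 0" for x by (simp add: c_def)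
  have int: "integrable ?M (%x. \<bar>f x\<bar> * c x)"
   using f by (intro L2_prod Lc) (auto simp: L2_def)
  have "(\<integral>x. f x * (c x * h n x) \<partial>?M) = 0" for n
  proof (rule zero_if_orthogonal_continuous[OF Om f orth])
   have sub: "supp (%x. c x * h n x) \<subseteq> cball z r" by (rule supp_leI) (use cz in auto)
   show "contU (%x. c x * h n x)" by (intro continuous_intros c h)
   show "compact (supp (%x. c x * h n x))" by (rule compact_suppI[of "cball z r"]) (use cz in auto)
   show "supp (%x. c x * h n x) \<subseteq> Om" using sub zr by blast
  qed auto
  moreover have "(%n. \<integral>x. f x * (c x * h n x) \<partial>?M) \<longlonglongrightarrow> (\<integral>x. \<bar>f x\<bar> * c x \<partial>?M)"
  proof (rule integral_dominated_convergence[where w = "%x. \<bar>f x\<bar> * c x"])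
   have "AE x in lebesgue. x \<notin> N" using N by (simp add: AE_not_in negligible_iff_null_sets)
   hence "AE x in ?M. x \<notin> N" using Omb by (subst AE_restrict_space_iff) (auto elim: eventually_mono)
   moreover have "AE x in ?M. x \<in> Om" by (rule AE_I2) simp
   ultimately show "AE x in ?M. (%n. f x * (c x * h n x)) \<longlonglongrightarrow> \<bar>f x\<bar> * c x"
   proof eventually_elim
    fix x assume "x \<notin> N" "x \<in> Om"
    hence "(%n. f x * (c x * h n x)) \<longlonglongrightarrow> f x * (c x * sgn (f x))"
     using hl[of x] by (intro tendsto_intros) auto
    moreover have "f x * (c x * sgn (f x)) = \<bar>f x\<bar> * c x" by (simp add: sgn_if)
    ultimately show "(%n. f x * (c x * h n x)) \<longlonglongrightarrow> \<bar>f x\<bar> * c x" by metis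
   qed
   show "AE x in ?M. norm (f x * (c x * h n x)) <= \<bar>f x\<bar> * c x" for n
   proof (rule AE_I2)
    fix x
    have "c x * \<bar>h n x\<bar> <= c x * 1" using hb c0 by (intro mult_left_mono) auto
    thus "norm (f x * (c x * h n x)) <= \<bar>f x\<bar> * c x"
     using c0[of x] by (simp add: abs_mult mult_left_mono)
   qed
  qed (use int in auto)
  ultimately have "(\<integral>x. \<bar>f x\<bar> * c x \<partial>?M) = 0" by (simp add: LIMSEQ_const_iff)
  hence "AE x in ?M. \<bar>f x\<bar> * c x = 0"
   using integral_nonneg_eq_0_iff_AE[OF int] c0 by auto
  thus ?thesis by eventually_elim (auto simp: c_def)
 next
  case False
  hence "x \<notin> ball z r" for x using zero_le_dist[of z x] by (simp del: zero_le_dist)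
  thus ?thesis by (simp only: simp_thms) simp
 qed
 let ?\<F> = "{ball z r | z r. cball z r \<subseteq> Om}"
 obtain \<F> where \<F>: "\<F> \<subseteq> ?\<F>" "countable \<F>" "\<Union>\<F> = \<Union>?\<F>"
  using Lindelof[of ?\<F>] by auto
 have "AE x in ?M. ALL S:\<F>. x \<in> S --> f x = 0"
  by (rule AE_ball_countable'[OF _ \<F>(2)]) (use \<F>(1) ball in auto)
 moreover have "AE x in ?M. x \<in> Om" by (rule AE_I2) simp
 ultimately show ?thesis
 proof eventually_elim
  fix x assume x: "ALL S:\<F>. x \<in> S --> f x = 0" "x \<in> Om"
  obtain r where "r > 0" "cball x r \<subseteq> Om" using Om x(2) open_contains_cball by blast
  hence "x \<in> \<Union>?\<F>" by (auto intro!: exI[of _ "ball x r"])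
  thus "f x = 0" using x(1) \<F>(3) by blast
 qed
qed

lemma has_weak_gradient_L2:
 assumes "has_weak_gradient Om u g" shows "L2 (lebesgue_on Om) u" "L2 (lebesgue_on Om) g"
 using assms by (auto simp: has_weak_gradient_def L2_on_eq)

lemma has_weak_gradientD:
 assumes "has_weak_gradient Om u g" "\<phi> \<in> test_functions" "C1c \<phi> k" "supp \<phi> \<subseteq> Om"
 shows "ip (lebesgue_on Om) u (%x. k x \<bullet> v) = - ip (lebesgue_on Om) g (%x. \<phi> x *R v)"
proof -
 have "frechet_derivative \<phi> (at x) v = k x \<bullet> v" for x
  using frechet_derivative_at[OF C1gD[OF C1c_C1g[OF assms(3)]]] by metis
 moreover have "(LINT x|lebesgue_on Om. u x * frechet_derivative \<phi> (at x) v) = - (LINT x|lebesgue_on Om. (g x \<bullet> v) * \<phi> x)"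
  using assms unfolding has_weak_gradient_def by blast
 ultimately show ?thesis by (simp add: ip_def mult.commute)
qed

lemma has_weak_gradientI:
 assumes "L2 (lebesgue_on Om) u" "L2 (lebesgue_on Om) g"
  "!!\<phi> k v. \<phi> \<in> test_functions ==> C1c \<phi> k ==> supp \<phi> \<subseteq> Om ==> 
   ip (lebesgue_on Om) u (%x. k x \<bullet> v) = - ip (lebesgue_on Om) g (%x. \<phi> x *R v)"
 shows "has_weak_gradient Om u g"
 unfolding has_weak_gradient_def L2_on_eq
proof (intro conjI ballI impI allI assms(1,2))
 fix \<phi> v assume \<phi>: "\<phi> \<in> test_functions" "supp \<phi> \<subseteq> Om"
 obtain k where k: "C1c \<phi> k" "!!x v. frechet_derivative \<phi> (at x) v = k x \<bullet> v"
  using test_function_gradient[OF \<phi>(1)] by blast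
 show "(LINT x|lebesgue_on Om. u x * frechet_derivative \<phi> (at x) v) = - (LINT x|lebesgue_on Om. (g x \<bullet> v) * \<phi> x)"
  using assms(3)[OF \<phi>(1) k(1) \<phi>(2), of v] by (simp add: k(2) ip_def mult.commute)
qed

lemma weak_gradient_unique:
 assumes Om: "open Om" and g: "has_weak_gradient Om u g" "has_weak_gradient Om u h"
 shows "AE x in lebesgue_on Om. g x = h x"
proof -
 let ?M = "lebesgue_on Om"
 note L = has_weak_gradient_L2[OF g(1)] has_weak_gradient_L2[OF g(2)]
 have "AE x in ?M. (g x - h x) \<bullet> v = 0" for v
 proof (rule zero_if_orthogonal_test_functions[OF Om])
  show "L2 ?M (%x. (g x - h x) \<bullet> v)" by (intro L2_inner_const L2_diff L)
  fix \<phi> assume \<phi>: "\<phi> \<in> test_functions" "supp \<phi> \<subseteq> Om"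
  obtain k where k: "C1c \<phi> k" using test_function_gradient[OF \<phi>(1)] by blast
  have L\<phi>: "L2 ?M (%x. \<phi> x *R v)"
   by (rule L2_continuous_compact[of _ "supp \<phi>"])
    (use k Om in \<open>auto simp: C1c_def not_supp intro!: continuous_intros C1g_cont_fun\<close>)
  have "ip ?M g (%x. \<phi> x *R v) = ip ?M h (%x. \<phi> x *R v)"
   using has_weak_gradientD[OF g(1) \<phi>(1) k \<phi>(2), of v] has_weak_gradientD[OF g(2) \<phi>(1) k \<phi>(2), of v] by simp
  hence "ip ?M (%x. g x - h x) (%x. \<phi> x *R v) = 0" using L L\<phi> by (simp add: ip_diff_left)
  thus "(\<integral>x. ((g x - h x) \<bullet> v) * \<phi> x \<partial>?M) = 0" by (simp add: ip_def mult.commute)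
 qed
 hence "AE x in ?M. ALL v:Basis. (g x - h x) \<bullet> v = 0"
  by (intro AE_finite_allI) auto
 thus ?thesis by eventually_elim (rule euclidean_eqI, simp add: inner_diff_left)
qed

lemma weak_gradient_lin:
 fixes Om :: "'a::euclidean_space set"
 assumes g: "has_weak_gradient Om u g" "has_weak_gradient Om v h" and Om: "open Om"
 shows "has_weak_gradient Om (%x. a * u x + b * v x) (%x. a *R g x + b *R h x)"
proof -
 let ?M = "lebesgue_on Om"
 note L = has_weak_gradient_L2[OF g(1)] has_weak_gradient_L2[OF g(2)]
 show ?thesis
 proof (rule has_weak_gradientI)
  show "L2 ?M (%x. a * u x + b * v x)" "L2 ?M (%x. a *R g x + b *R h x)"
   by (intro L2_add L2_mult L2_scaleR L)+
  fix \<phi> k and w :: 'a assume \<phi>: "\<phi> \<in> test_functions" "C1c \<phi> k" "supp \<phi> \<subseteq> Om"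
  have L\<phi>: "L2 ?M (%x. \<phi> x *R w)"
   by (rule L2_continuous_compact[of _ "supp \<phi>"])
    (use \<phi> Om in \<open>auto simp: C1c_def not_supp intro!: continuous_intros C1g_cont_fun\<close>)
  have Lk: "L2 ?M (%x. k x \<bullet> w)" using C1c_L2(2)[OF \<phi>(2)] Om by (intro L2_inner_const) auto
  have "ip ?M (%x. a *R u x + b *R v x) (%x. k x \<bullet> w) = a * ip ?M u (%x. k x \<bullet> w) + b * ip ?M v (%x. k x \<bullet> w)"
   by (subst ip_add_left) (simp_all only: ip_scale_left L2_scaleR L Lk)
  also have "... = - (a * ip ?M g (%x. \<phi> x *R w) + b * ip ?M h (%x. \<phi> x *R w))"
   using has_weak_gradientD[OF g(1) \<phi>, of w] has_weak_gradientD[OF g(2) \<phi>, of w] by simp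
  also have "... = - ip ?M (%x. a *R g x + b *R h x) (%x. \<phi> x *R w)"
   by (subst ip_add_left) (simp_all only: ip_scale_left L2_scaleR L L\<phi>)
  finally show "ip ?M (%x. a * u x + b * v x) (%x. k x \<bullet> w) = - ip ?M (%x. a *R g x + b *R h x) (%x. \<phi> x *R w)" by simp
 qed
qed

lemma weak_gradient_limit:
 fixes Om :: "'a::euclidean_space set"
 assumes g: "!!n. has_weak_gradient Om (U n) (G n)" and Om: "open Om"
  and U: "L2_tendsto (lebesgue_on Om) U u" and G: "L2_tendsto (lebesgue_on Om) G g"
 shows "has_weak_gradient Om u g"
proof (rule has_weak_gradientI)
 let ?M = "lebesgue_on Om"
 show "L2 ?M u" "L2 ?M g" using U G by (auto simp: L2_tendsto_def)
 fix \<phi> k and w :: 'a assume \<phi>: "\<phi> \<in> test_functions" "C1c \<phi> k" "supp \<phi> \<subseteq> Om"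
 have L\<phi>: "L2 ?M (%x. \<phi> x *R w)"
  by (rule L2_continuous_compact[of _ "supp \<phi>"])
   (use \<phi> Om in \<open>auto simp: C1c_def not_supp intro!: continuous_intros C1g_cont_fun\<close>)
 have Lk: "L2 ?M (%x. k x \<bullet> w)" using C1c_L2(2)[OF \<phi>(2)] Om by (intro L2_inner_const) auto
 have "(%n. ip ?M (U n) (%x. k x \<bullet> w)) \<longlonglongrightarrow> ip ?M u (%x. k x \<bullet> w)"
  by (rule L2_tendsto_ip_right[OF U Lk])
 moreover have "(%n. - ip ?M (G n) (%x. \<phi> x *R w)) \<longlonglongrightarrow> - ip ?M g (%x. \<phi> x *R w)"
  by (intro tendsto_minus L2_tendsto_ip_right[OF G L\<phi>])
 ultimately show "ip ?M u (%x. k x \<bullet> w) = - ip ?M g (%x. \<phi> x *R w)"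
  using has_weak_gradientD[where v = w, OF g \<phi>] LIMSEQ_unique by fastforce
qed

section \<open>The spaces of functions vanishing on a part of the boundary\<close>

lemma H1_weak_gradient: "u \<in> H1 Om ==> has_weak_gradient Om u (weak_gradient Om u)"
 unfolding H1_def weak_gradient_def by (simp add: some_eq_ex)

lemma weak_gradient_AE:
 assumes "open Om" "has_weak_gradient Om u g"
 shows "AE x in lebesgue_on Om. weak_gradient Om u x = g x"
 by (rule weak_gradient_unique[OF assms(1) H1_weak_gradient assms(2)]) (use assms(2) H1_def in blast)

lemma H1_norm_sq_eq:
 assumes "open Om" "has_weak_gradient Om u g"
 shows "H1_norm_sq Om u = sqn (lebesgue_on Om) u + sqn (lebesgue_on Om) g"
proof -
 have "has_weak_gradient Om u (weak_gradient Om u)" by (rule H1_weak_gradient) (use assms(2) H1_def in blast)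
 note m = has_weak_gradient_L2(2)[OF this] has_weak_gradient_L2(2)[OF assms(2)]
 have "sqn (lebesgue_on Om) (weak_gradient Om u) = sqn (lebesgue_on Om) g"
  by (rule ip_cong_AE) (use m weak_gradient_AE[OF assms] in \<open>auto simp: L2_def\<close>)
 thus ?thesis by (simp add: H1_norm_sq_def ip_self)
qed

definition adm :: "'a::euclidean_space set => 'a set => ('a => real) => ('a => 'a) => bool" where
 "adm Om ga u g \<longleftrightarrow> u \<in> H1_vanishing Om ga & has_weak_gradient Om u g"

lemma adm_iff:
 assumes Om: "open Om" 
 shows "adm Om ga u g \<longleftrightarrow> has_weak_gradient Om u g & (ALL e>0. EX \<phi> k. \<phi> \<in> test_functions & C1c \<phi> k & supp \<phi> \<inter> closure ga = {} &
   sqn (lebesgue_on Om) (%x. u x - \<phi> x) + sqn (lebesgue_on Om) (%x. g x - k x) < e)" (is "_ \<longleftrightarrow> ?R")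
proof -
 have eq: "H1_norm_sq Om (%x. u x - \<phi> x) = sqn (lebesgue_on Om) (%x. u x - \<phi> x) + sqn (lebesgue_on Om) (%x. g x - k x)"
  if "has_weak_gradient Om u g" "C1c \<phi> k" for \<phi> k
 proof (rule H1_norm_sq_eq[OF Om])
  show "has_weak_gradient Om (%x. u x - \<phi> x) (%x. g x - k x)"
   using weak_gradient_lin[OF that(1) C1c_weak_gradient[OF that(2)] Om, of 1 "-1"] Om by simp
 qed
 show ?thesis
 proof
  assume a: "adm Om ga u g"
  hence w: "has_weak_gradient Om u g" by (simp add: adm_def)
  show ?R
  proof (intro conjI w allI impI)
   fix e :: real assume "e > 0"
   then obtain \<phi> where \<phi>: "\<phi> \<in> test_functions" "supp \<phi> \<inter> closure ga = {}" "H1_norm_sq Om (%x. u x - \<phi> x) < e"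
    using a unfolding adm_def H1_vanishing_def by blast
   obtain k where k: "C1c \<phi> k" using test_function_gradient[OF \<phi>(1)] by blast
   show "EX \<phi> k. \<phi> \<in> test_functions & C1c \<phi> k & supp \<phi> \<inter> closure ga = {} &
    sqn (lebesgue_on Om) (%x. u x - \<phi> x) + sqn (lebesgue_on Om) (%x. g x - k x) < e"
    using \<phi> k eq[OF w k] by (intro exI[of _ \<phi>] exI[of _ k]) auto
  qed
 next
  assume r: ?R
  show "adm Om ga u g"
   unfolding adm_def H1_vanishing_def H1_def
  proof (intro conjI CollectI allI impI)
   show "EX g. has_weak_gradient Om u g" "has_weak_gradient Om u g" using r by auto
   fix e :: real assume "e > 0"
   from r[THEN conjunct2, rule_format, OF this] obtain \<phi> k where \<phi>: "\<phi> \<in> test_functions" "C1c \<phi> k"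
    "supp \<phi> \<inter> closure ga = {}" "sqn (lebesgue_on Om) (%x. u x - \<phi> x) + 
     sqn (lebesgue_on Om) (%x. g x - k x) < e" by (elim exE conjE)
   show "EX \<phi>:test_functions. supp \<phi> \<inter> closure ga = {} & H1_norm_sq Om (%x. u x - \<phi> x) < e"
    by (intro bexI[OF _ \<phi>(1)] conjI \<phi>(3)) (use eq[OF r[THEN conjunct1] \<phi>(2)] \<phi>(4) in simp)
  qed
 qed
qed

lemma adm_L2: "adm Om ga u g ==> L2 (lebesgue_on Om) u" "adm Om ga u g ==> L2 (lebesgue_on Om) g"
 by (auto simp: adm_def has_weak_gradient_L2)

lemma C1c_adm:
 assumes u: "C1c u g" and Om: "open Om" and s: "supp u \<inter> closure ga = {}"
 shows "adm Om ga u g"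
 unfolding adm_iff[OF Om]
proof (intro conjI allI impI)
 have Omb: "Om \<in> sets borel" using Om by simp
 show "has_weak_gradient Om u g" by (rule C1c_weak_gradient[OF u Omb])
 fix e :: real assume e: "e > 0"
 let ?M = "lebesgue_on Om"
 obtain B where B: "!!x. x \<in> supp u ==> norm x < B" "B > 0"
 proof -
  have "compact (supp u)" using u by (simp add: C1c_def)
  then obtain b where b: "b > 0" "!!x. x \<in> supp u ==> norm x <= b"
   using bounded_pos compact_imp_bounded by metis
  show thesis using b(1) by (intro that[of "b + 1"]) (auto dest!: b(2))
 qed
 define w :: "'a => real" where "w x = max 0 (min 1 (B + 1 - norm x))" for x
 have cw: "contU w" unfolding w_def by (intro continuous_intros)
 have Lw: "L2 ?M w"
  by (rule L2_continuous_compact[OF cw, of "cball 0 (B+1)"]) (use Omb in \<open>auto simp: w_def\<close>)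
 define K where "K = sqn ?M w"
 have K: "K >= 0" by (simp add: K_def ip_self_nonneg)
 define d where "d = sqrt (e / (2 * (K + 1)))"
 have d: "d > 0" "d^2 * K + d^2 * K < e"
  using e K by (auto simp: d_def field_simps add_strict_increasing)
 let ?U = "ball 0 B - closure ga"
 have U: "supp u \<subseteq> ?U" "open ?U" using B s by auto
 obtain \<phi> k where \<phi>: "\<phi> \<in> test_functions" "C1c \<phi> k" "supp \<phi> \<subseteq> ?U" "!!x. \<bar>\<phi> x - u x\<bar> <= d" "!!x. norm (k x - g x) <= d"
  by (rule approx_C1_by_test_function[OF u U d(1)]) (rule that)
 have z: "norm x < B" if "x \<in> supp \<phi> \<or> x \<in> supp u" for x using that B \<phi>(3) by auto
 have p1: "(norm (u x - \<phi> x))^2 <= d^2 * (norm (w x))^2" for x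
 proof (cases "norm x < B")
  case True
  have "(norm (u x - \<phi> x))^2 <= d^2" by (rule power_mono) (use \<phi>(4)[of x] in \<open>auto simp: abs_minus_commute\<close>)
  thus ?thesis using True by (simp add: w_def)
 next
  case False
  hence "u x = 0" "\<phi> x = 0" using z not_supp by blast+
  thus ?thesis by simp
 qed
 have p2: "(norm (g x - k x))^2 <= d^2 * (norm (w x))^2" for x
 proof (cases "norm x < B")
  case True
  have "(norm (g x - k x))^2 <= d^2" by (rule power_mono) (use \<phi>(5)[of x] in \<open>auto simp: norm_minus_commute\<close>)
  thus ?thesis using True by (simp add: w_def)
 next
  case False
  hence "g x = 0" "k x = 0" using z C1g_zero_outside_supp C1c_C1g u \<phi>(2) by blast+
  thus ?thesis by simp
 qed
 have i: "integrable ?M (%x. d^2 * (norm (w x))^2)" using L2_norm2_integrable[OF Lw] by simp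
 have "sqn ?M (%x. u x - \<phi> x) <= d^2 * K"
 proof -
  have "sqn ?M (%x. u x - \<phi> x) <= (\<integral>x. d^2 * (norm (w x))^2 \<partial>?M)"
   unfolding ip_self by (rule integral_mono[OF L2_norm2_integrable i p1])
    (intro L2_diff C1c_L2(1)[OF u Omb] C1c_L2(1)[OF \<phi>(2) Omb])
  thus ?thesis by (simp add: K_def ip_self)
 qed
 moreover have "sqn ?M (%x. g x - k x) <= d^2 * K"
 proof -
  have "sqn ?M (%x. g x - k x) <= (\<integral>x. d^2 * (norm (w x))^2 \<partial>?M)"
   unfolding ip_self by (rule integral_mono[OF L2_norm2_integrable i p2])
    (intro L2_diff C1c_L2(2)[OF u Omb] C1c_L2(2)[OF \<phi>(2) Omb])
  thus ?thesis by (simp add: K_def ip_self)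
 qed
 ultimately have "sqn ?M (%x. u x - \<phi> x) + sqn ?M (%x. g x - k x) < e"
  using d(2) by linarith
 thus "EX \<phi> k. \<phi> \<in> test_functions & C1c \<phi> k & supp \<phi> \<inter> closure ga = {} &
   sqn ?M (%x. u x - \<phi> x) + sqn ?M (%x. g x - k x) < e"
  using \<phi>(1-3) by (intro exI[of _ \<phi>] exI[of _ k]) auto
qed

lemma adm_C1c_sequence:
 assumes Om: "open Om" and u: "adm Om ga u g"
 obtains \<phi> k where "!!n. C1c (\<phi> n) (k n)" "!!n. supp (\<phi> n) \<inter> closure ga = {}"
  "L2_tendsto (lebesgue_on Om) \<phi> u" "L2_tendsto (lebesgue_on Om) k g"
proof -
 let ?M = "lebesgue_on Om"
 have Omb: "Om \<in> sets borel" using Om by simp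
 define Q where "Q n \<phi> k \<longleftrightarrow> C1c \<phi> k & supp \<phi> \<inter> closure ga = {} &
   sqn ?M (%x. u x - \<phi> x) + sqn ?M (%x. g x - k x) < 1 / real (Suc n)" for n \<phi> k
 have "EX \<phi> k. Q n \<phi> k" for n
 proof -
  have "1 / real (Suc n) > 0" by simp
  from u[unfolded adm_iff[OF Om], THEN conjunct2, rule_format, OF this]
  show ?thesis unfolding Q_def by (elim exE conjE) (intro exI conjI)
 qed
 then obtain \<phi> k where Q: "!!n. Q n (\<phi> n) (k n)" by metis
 hence \<phi>: "C1c (\<phi> n) (k n)" "supp (\<phi> n) \<inter> closure ga = {}"
  "sqn ?M (%x. u x - \<phi> n x) + sqn ?M (%x. g x - k n x) < 1 / real (Suc n)" for n
  unfolding Q_def by auto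
 have l: "(%n. 1 / real (Suc n)) \<longlonglongrightarrow> 0" using LIMSEQ_inverse_real_of_nat by (simp add: inverse_eq_divide)
 have nn: "sqn ?M f >= 0" for f :: "'a => real" by (rule ip_self_nonneg)
 have nn': "sqn ?M f >= 0" for f :: "'a => 'a" by (rule ip_self_nonneg)
 have "(%n. sqn ?M (%x. \<phi> n x - u x)) \<longlonglongrightarrow> 0"
 proof (rule tendsto_sandwich[OF _ _ tendsto_const l])
  have "sqn ?M (%x. \<phi> n x - u x) = sqn ?M (%x. u x - \<phi> n x)" for n
   by (simp add: ip_self norm_minus_commute abs_minus_commute power2_commute)
  thus "\<forall>\<^sub>F n in sequentially. sqn ?M (%x. \<phi> n x - u x) <= 1 / real (Suc n)"
   using \<phi>(3) nn' by (intro always_eventually allI) (smt (verit, best))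
 qed (auto intro!: always_eventually nn)
 moreover have "(%n. sqn ?M (%x. k n x - g x)) \<longlonglongrightarrow> 0"
 proof (rule tendsto_sandwich[OF _ _ tendsto_const l])
  have "sqn ?M (%x. k n x - g x) = sqn ?M (%x. g x - k n x)" for n
   by (simp add: ip_self norm_minus_commute)
  thus "\<forall>\<^sub>F n in sequentially. sqn ?M (%x. k n x - g x) <= 1 / real (Suc n)"
   using \<phi>(3) nn by (intro always_eventually allI) (smt (verit, best))
 qed (auto intro!: always_eventually nn')
 ultimately show thesis
  using adm_L2[OF u] C1c_L2[OF \<phi>(1) Omb] \<phi>(1,2) by (intro that[of \<phi> k]) (auto simp: L2_tendsto_def)
qed

lemma adm_limit:
 assumes Om: "open Om" and A: "!!n. adm Om ga (U n) (G n)"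
  and U: "L2_tendsto (lebesgue_on Om) U u" and G: "L2_tendsto (lebesgue_on Om) G g"
 shows "adm Om ga u g"
 unfolding adm_iff[OF Om]
proof (intro conjI allI impI)
 let ?M = "lebesgue_on Om"
 have Omb: "Om \<in> sets borel" using Om by simp
 show "has_weak_gradient Om u g"
  by (rule weak_gradient_limit[OF _ Om U G]) (use A in \<open>auto simp: adm_def\<close>)
 fix e :: real assume e: "e > 0"
 have t: "(%n. sqn ?M (%x. U n x - u x) + sqn ?M (%x. G n x - g x)) \<longlonglongrightarrow> 0 + 0"
  using U G by (intro tendsto_intros) (auto simp: L2_tendsto_def)
 hence "\<forall>\<^sub>F n in sequentially. sqn ?M (%x. U n x - u x) + sqn ?M (%x. G n x - g x) < e/4"
  by (rule order_tendstoD(2)) (use e in simp)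
 then obtain n where n: "sqn ?M (%x. U n x - u x) + sqn ?M (%x. G n x - g x) < e/4"
  using eventually_happens by force
 obtain \<phi> k where \<phi>: "\<phi> \<in> test_functions" "C1c \<phi> k" "supp \<phi> \<inter> closure ga = {}"
  "sqn ?M (%x. U n x - \<phi> x) + sqn ?M (%x. G n x - k x) < e/4"
 proof -
  have "e / 4 > 0" using e by simp
  from A[of n, unfolded adm_iff[OF Om], THEN conjunct2, rule_format, OF this] show thesis
   by (elim exE conjE) (rule that)
 qed
 have tri: "sqn ?M (%x. a x - c x) <= 2 * sqn ?M (%x. b x - a x) + 2 * sqn ?M (%x. b x - c x)"
  if "L2 ?M a" "L2 ?M b" "L2 ?M c" for a b c :: "'a => 'c::euclidean_space"
 proof -
  have L: "L2 ?M (%x. a x - c x)" "L2 ?M (%x. b x - a x)" "L2 ?M (%x. b x - c x)" using that by (auto intro: L2_diff)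
  have "sqn ?M (%x. a x - c x) <= (\<integral>x. 2 * (norm (b x - a x))^2 + 2 * (norm (b x - c x))^2 \<partial>?M)"
   unfolding ip_self
  proof (rule integral_mono)
   show "(norm (a x - c x))^2 <= 2 * (norm (b x - a x))^2 + 2 * (norm (b x - c x))^2" for x
    using norm_add_square_le[of "- (b x - a x)" "b x - c x"] by (simp add: norm_minus_commute)
  qed (auto intro!: Bochner_Integration.integrable_add integrable_mult_right L2_norm2_integrable L)
  also have "... = 2 * sqn ?M (%x. b x - a x) + 2 * sqn ?M (%x. b x - c x)"
   unfolding ip_self by (subst Bochner_Integration.integral_add) (auto intro!: integrable_mult_right L2_norm2_integrable L)
  finally show ?thesis .
 qed
 have "sqn ?M (%x. u x - \<phi> x) <= 2 * sqn ?M (%x. U n x - u x) + 2 * sqn ?M (%x. U n x - \<phi> x)"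
  by (rule tri) (use U C1c_L2[OF \<phi>(2) Omb] in \<open>auto simp: L2_tendsto_def\<close>)
 moreover have "sqn ?M (%x. g x - k x) <= 2 * sqn ?M (%x. G n x - g x) + 2 * sqn ?M (%x. G n x - k x)"
  by (rule tri) (use G C1c_L2[OF \<phi>(2) Omb] in \<open>auto simp: L2_tendsto_def\<close>)
 ultimately have "sqn ?M (%x. u x - \<phi> x) + sqn ?M (%x. g x - k x) < e"
  using n \<phi>(4) by argo
 thus "EX \<phi> k. \<phi> \<in> test_functions & C1c \<phi> k & supp \<phi> \<inter> closure ga = {} &
   sqn ?M (%x. u x - \<phi> x) + sqn ?M (%x. g x - k x) < e"
  using \<phi>(1-3) by (intro exI[of _ \<phi>] exI[of _ k]) auto
qed

lemma adm_lin:
 assumes Om: "open Om" and u: "adm Om ga u g" and v: "adm Om ga v h"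
 shows "adm Om ga (%x. a * u x + b * v x) (%x. a *R g x + b *R h x)"
proof -
 obtain \<phi> k where \<phi>: "!!n. C1c (\<phi> n) (k n)" "!!n. supp (\<phi> n) \<inter> closure ga = {}"
  "L2_tendsto (lebesgue_on Om) \<phi> u" "L2_tendsto (lebesgue_on Om) k g" by (rule adm_C1c_sequence[OF Om u]) (rule that)
 obtain \<psi> l where \<psi>: "!!n. C1c (\<psi> n) (l n)" "!!n. supp (\<psi> n) \<inter> closure ga = {}"
  "L2_tendsto (lebesgue_on Om) \<psi> v" "L2_tendsto (lebesgue_on Om) l h" by (rule adm_C1c_sequence[OF Om v]) (rule that)
 show ?thesis
 proof (rule adm_limit[OF Om])
  show "adm Om ga (%x. a * \<phi> n x + b * \<psi> n x) (%x. a *R k n x + b *R l n x)" for n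
  proof (rule C1c_adm[OF _ Om])
   show "C1c (%x. a * \<phi> n x + b * \<psi> n x) (%x. a *R k n x + b *R l n x)"
    by (intro C1c_add C1c_scale \<phi> \<psi>)
   have "supp (%x. a * \<phi> n x + b * \<psi> n x) \<subseteq> supp (\<phi> n) \<union> supp (\<psi> n)"
    by (rule supp_leI) (auto simp: closed_supp closed_Un dest: not_supp, metis add_0 mult_zero_right not_supp)
   thus "supp (%x. a * \<phi> n x + b * \<psi> n x) \<inter> closure ga = {}" using \<phi>(2)[of n] \<psi>(2)[of n] by blast
  qed
  show "L2_tendsto (lebesgue_on Om) (%n x. a * \<phi> n x + b * \<psi> n x) (%x. a * u x + b * v x)"
   using L2_tendsto_lin[OF \<phi>(3) \<psi>(3)] by simp
  show "L2_tendsto (lebesgue_on Om) (%n x. a *R k n x + b *R l n x) (%x. a *R g x + b *R h x)"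
   by (rule L2_tendsto_lin[OF \<phi>(4) \<psi>(4)])
 qed
qed

lemma adm_zero:
 assumes "open Om" shows "adm Om ga (%x. 0) (%x. 0)"
 by (rule C1c_adm[OF _ assms]) (auto simp: C1c_def C1g_const supp_def)

lemma adm_sum:
 assumes Om: "open Om" and u: "!!i. i \<in> I ==> adm Om ga (u i) (g i)"
 shows "adm Om ga (%x. \<Sum>i\<in>I. c i * u i x) (%x. \<Sum>i\<in>I. c i *R g i x)"
 using u
proof (induction I rule: infinite_finite_induct)
 case (insert i I)
 have "adm Om ga (%x. c i * u i x + 1 * (\<Sum>i\<in>I. c i * u i x)) (%x. c i *R g i x + 1 *R (\<Sum>i\<in>I. c i *R g i x))"
  by (rule adm_lin[OF Om]) (use insert in auto)
 thus ?case using insert by simp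
qed (simp_all add: adm_zero[OF Om])

lemma adm_weak_gradient: "u \<in> H1_vanishing Om ga ==> adm Om ga u (weak_gradient Om u)"
 unfolding adm_def by (auto simp: H1_vanishing_def H1_weak_gradient)

section \<open>Eigenfunctions by minimisation\<close>

lemma homogeneous_system_solution:
 fixes M :: "nat => 'j => real"
 assumes "finite J" "N < card J"
 shows "EX a. (EX j:J. a j ~= 0) & (ALL i<N. (\<Sum>j\<in>J. a j * M i j) = 0)"
 using assms
proof (induction N arbitrary: J M)
 case 0
 hence "J ~= {}" by auto
 thus ?case by (intro exI[of _ "%_. 1"]) auto
next
 case (Suc N)
 show ?case
 proof (cases "ALL j:J. M N j = 0")
  case True
  obtain a where a: "EX j:J. a j ~= 0" "ALL i<N. (\<Sum>j\<in>J. a j * M i j) = 0" 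
   using Suc.IH[of J M] Suc.prems by auto
  have "(\<Sum>j\<in>J. a j * M N j) = 0" using True by simp
  thus ?thesis using a by (intro exI[of _ a]) (auto simp: less_Suc_eq)
 next
  case False
  then obtain p where p: "p \<in> J" "M N p ~= 0" by blast
  let ?J = "J - {p}"
  have J: "finite ?J" "N < card ?J" using Suc.prems p by auto
  obtain a where a: "EX j:?J. a j ~= 0" "ALL i<N. (\<Sum>j\<in>?J. a j * (M i j - M i p * M N j / M N p)) = 0"
   using Suc.IH[OF J, of "%i j. M i j - M i p * M N j / M N p"] by auto
  define b where "b j = (if j = p then - (\<Sum>j\<in>?J. a j * M N j) / M N p else a j)" for j
  have sum: "(\<Sum>j\<in>J. b j * M i j) = (\<Sum>j\<in>?J. a j * M i j) - (\<Sum>j\<in>?J. a j * M N j) / M N p * M i p" for i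
  proof -
   have "(\<Sum>j\<in>J. b j * M i j) = b p * M i p + (\<Sum>j\<in>?J. b j * M i j)"
    by (rule sum.remove) (use Suc.prems p in auto)
   also have "(\<Sum>j\<in>?J. b j * M i j) = (\<Sum>j\<in>?J. a j * M i j)"
    by (rule sum.cong) (auto simp: b_def)
   finally show ?thesis by (simp add: b_def)
  qed
  have "(\<Sum>j\<in>J. b j * M i j) = 0" if "i < Suc N" for i
  proof (cases "i = N")
   case True
   thus ?thesis unfolding sum using p by simp
  next
   case False
   hence "0 = (\<Sum>j\<in>?J. a j * (M i j - M i p * M N j / M N p))" using a(2) that by auto
   also have "... = (\<Sum>j\<in>?J. a j * M i j) - (\<Sum>j\<in>?J. a j * M N j) / M N p * M i p"
   proof -
    have "a j * (M i j - M i p * M N j / M N p) = a j * M i j - (a j * M N j) * (M i p / M N p)" for j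
     by (simp add: right_diff_distrib)
    thus ?thesis by (simp only: sum_subtractf sum_distrib_right[symmetric]) simp
   qed
   finally show ?thesis unfolding sum by simp
  qed
  moreover have "EX j:J. b j ~= 0" using a(1) by (auto simp: b_def)
  ultimately show ?thesis by blast
 qed
qed

lemma bounded_sequences_common_subsequence:
 fixes X :: "nat => nat => real"
 assumes "!!i. i < n ==> bounded (range (X i))"
 shows "EX r. strict_mono (r::nat=>nat) & (ALL i<n. convergent (X i \<circ> r))"
 using assms
proof (induction n)
 case 0
 show ?case by (intro exI[of _ id]) (auto simp: strict_mono_def)
next
 case (Suc n)
 then obtain r where r: "strict_mono (r::nat=>nat)" "ALL i<n. convergent (X i \<circ> r)" using less_SucI by blast
 have "bounded (range (X n \<circ> r))" by (rule bounded_subset[OF Suc.prems[of n]]) auto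
 then obtain l r' where r': "strict_mono (r'::nat=>nat)" "(X n \<circ> r \<circ> r') \<longlonglongrightarrow> l"
  using bounded_imp_convergent_subsequence by blast
 show ?case
 proof (intro exI[of _ "r \<circ> r'"] conjI allI impI)
  show "strict_mono (r \<circ> r')" using r r' by (simp add: strict_mono_o)
  fix i assume "i < Suc n"
  then consider "i < n" | "i = n" by linarith
  thus "convergent (X i \<circ> (r \<circ> r'))"
  proof cases
   case 1
   thus ?thesis using r(2) convergent_subseq_convergent[OF _ r'(1), of "X i \<circ> r"] by (simp add: o_assoc)
  next
   case 2
   thus ?thesis using r'(2) by (auto simp: convergent_def o_assoc)
  qed
 qed
qed

lemma sum_mult_delta:
 fixes b :: "nat => real"
 assumes "i < N" shows "(\<Sum>j<N. b j * (if j = i then 1 else 0)) = b i"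
proof -
 have "(\<Sum>j<N. b j * (if j = i then 1 else 0)) = (\<Sum>j<N. if j = i then b j else 0)"
  by (rule sum.cong) auto
 thus ?thesis using assms by simp
qed

lemma ip_sum_left:
 assumes "!!i. i \<in> I ==> L2 M (f i)" "L2 M g"
 shows "ip M (%x. \<Sum>i\<in>I. c i *R f i x) g = (\<Sum>i\<in>I. c i * ip M (f i) g)"
 using assms(1)
proof (induction I rule: infinite_finite_induct)
 case (insert i I)
 have "ip M (%x. c i *R f i x + (\<Sum>i\<in>I. c i *R f i x)) g = ip M (%x. c i *R f i x) g + ip M (%x. \<Sum>i\<in>I. c i *R f i x) g"
  by (rule ip_add_left) (use insert assms(2) in \<open>auto intro!: L2_scaleR L2_sum\<close>)
 thus ?case using insert by (simp add: ip_scale_left)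
qed (auto simp: ip_def)

lemma ip_lin_left:
 assumes "L2 M u" "L2 M v" "L2 M h"
 shows "ip M (%x. a * u x + b * v x) h = a * ip M u h + b * ip M v h"
 using ip_add_left[of M "%x. a *R u x" "%x. b *R v x" h] ip_scale_left[of M a u h] ip_scale_left[of M b v h]
  assms(3) L2_mult[OF assms(1), of a] L2_mult[OF assms(2), of b] by simp

locale elliptic =
 fixes Om :: "'a::euclidean_space set" and A :: "'a => 'b::euclidean_space => 'b" and c C :: real
 assumes open_Om: "open Om"
  and lin: "!!x. x \<in> Om ==> linear (A x)"
  and meas: "!!g. g \<in> borel_measurable (lebesgue_on Om) ==> (%x. A x (g x)) \<in> borel_measurable (lebesgue_on Om)"
  and sym: "!!x y z. x \<in> Om ==> A x y \<bullet> z = y \<bullet> A x z"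
  and c_pos: "c > 0"
  and ell: "!!x y. x \<in> Om ==> c * (norm y)^2 <= A x y \<bullet> y"
  and bd: "!!x y. x \<in> Om ==> norm (A x y) <= C * norm y"
begin

abbreviation M where "M == lebesgue_on Om"

definition en :: "('a => 'b) => ('a => 'b) => real" where
 "en g h = ip M (%x. A x (g x)) h"

lemma borel_Om: "Om \<in> sets borel" using open_Om by simp

lemma L2_A:
 assumes "L2 M g" shows "L2 M (%x. A x (g x))"
proof (rule L2_bound[where h = "%x. C^2 * (norm (g x))^2"])
 show "AE x in M. (norm (A x (g x)))^2 <= C^2 * (norm (g x))^2"
  by (rule AE_I2) (use bd in \<open>auto intro!: power_mono simp: power_mult_distrib[symmetric]\<close>)
qed (use assms meas in \<open>auto simp: L2_def\<close>)

lemma en_sym: "en g h = en h g"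
 unfolding en_def ip_def 
proof (rule Bochner_Integration.integral_cong)
 fix x assume "x \<in> space M"
 hence "A x (g x) \<bullet> h x = g x \<bullet> A x (h x)" by (intro sym) simp
 thus "A x (g x) \<bullet> h x = A x (h x) \<bullet> g x" by (simp only: inner_commute)
qed simp

lemma en_cong_AE:
 assumes "L2 M g" "L2 M h" "L2 M g'" "L2 M h'" "AE x in M. g x = g' x" "AE x in M. h x = h' x"
 shows "en g h = en g' h'"
 unfolding en_def
proof (rule ip_cong_AE)
 show "AE x in M. A x (g x) = A x (g' x)" using assms(5) by eventually_elim simp
qed (intro L2_measurable L2_A assms)+

lemma en_sum_left:
 assumes "!!i. i \<in> I ==> L2 M (f i)" "L2 M g"
 shows "en (%x. \<Sum>i\<in>I. a i *R f i x) g = (\<Sum>i\<in>I. a i * en (f i) g)"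
proof -
 have "en (%x. \<Sum>i\<in>I. a i *R f i x) g = ip M (%x. \<Sum>i\<in>I. a i *R A x (f i x)) g"
  unfolding en_def ip_def
  by (rule Bochner_Integration.integral_cong) (auto simp: linear_sum[OF lin] linear_scale[OF lin])
 also have "... = (\<Sum>i\<in>I. a i * en (f i) g)"
  unfolding en_def by (rule ip_sum_left) (use assms L2_A in auto)
 finally show ?thesis .
qed

lemma en_lin_left:
 assumes "L2 M f" "L2 M f'" "L2 M g"
 shows "en (%x. a *R f x + b *R f' x) g = a * en f g + b * en f' g"
proof -
 have "en (%x. a *R f x + b *R f' x) g = ip M (%x. a *R A x (f x) + b *R A x (f' x)) g"
  unfolding en_def ip_def
  by (rule Bochner_Integration.integral_cong) (auto simp: linear_add[OF lin] linear_scale[OF lin])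
 thus ?thesis using assms L2_A by (simp add: en_def ip_add_left ip_scale_left L2_scaleR)
qed

lemma en_lin_right:
 assumes "L2 M f" "L2 M f'" "L2 M g"
 shows "en g (%x. a *R f x + b *R f' x) = a * en g f + b * en g f'"
 using en_lin_left[OF assms] by (simp add: en_sym[of g])

lemma en_quadratic:
 assumes "L2 M g" "L2 M h"
 shows "en (%x. a *R g x + b *R h x) (%x. a *R g x + b *R h x) = a^2 * en g g + 2 * a * b * en g h + b^2 * en h h"
proof -
 have L: "L2 M (%x. a *R g x + b *R h x)" by (intro L2_add L2_scaleR assms)
 show ?thesis
  using assms L by (simp add: en_lin_left en_lin_right en_sym[of h g] power2_eq_square algebra_simps)
qed

lemma ip_quadratic:
 assumes "L2 M' u" "L2 M' v"
 shows "sqn M' (%x. a *R u x + b *R v x) = a^2 * sqn M' u + 2 * a * b * ip M' u v + b^2 * sqn M' v"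
 using assms by (simp add: ip_add_left ip_add_right ip_scale_left ip_scale_right L2_add L2_scaleR 
   ip_commute[of M' v u] power2_eq_square algebra_simps)

lemma en_lower: 
 assumes "L2 M g" shows "c * sqn M g <= en g g"
proof -
 have "c * sqn M g = (\<integral>x. c * (norm (g x))^2 \<partial>M)" by (simp add: ip_self)
 also have "... <= en g g"
  unfolding en_def ip_def
  by (rule integral_mono) (use assms ell L2_inner[OF L2_A[OF assms] assms] L2_norm2_integrable[OF assms] in auto)
 finally show ?thesis .
qed

lemma en_nonneg: assumes "L2 M g" shows "0 <= en g g"
 using en_lower[OF assms] c_pos ip_self_nonneg[of M g] by (smt (verit) mult_nonneg_nonneg)

lemma L2_tendsto_A:
 assumes "L2_tendsto M G g" shows "L2_tendsto M (%n x. A x (G n x)) (%x. A x (g x))"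
 unfolding L2_tendsto_def
proof (intro conjI allI)
 have L: "L2 M (G n)" "L2 M g" for n using assms by (auto simp: L2_tendsto_def)
 thus "L2 M (%x. A x (G n x))" "L2 M (%x. A x (g x))" for n by (auto intro: L2_A)
 have le: "sqn M (%x. A x (G n x) - A x (g x)) <= C^2 * sqn M (%x. G n x - g x)" for n
 proof -
  have "sqn M (%x. A x (G n x) - A x (g x)) <= (\<integral>x. C^2 * (norm (G n x - g x))^2 \<partial>M)"
   unfolding ip_self
  proof (rule integral_mono)
   show "integrable M (%x. (norm (A x (G n x) - A x (g x)))^2)"
    by (intro L2_norm2_integrable L2_diff L2_A L)
   show "integrable M (%x. C^2 * (norm (G n x - g x))^2)"
    by (intro integrable_mult_right L2_norm2_integrable L2_diff L)
   fix x assume "x \<in> space M"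
   hence x: "x \<in> Om" by simp
   have "(norm (A x (G n x) - A x (g x)))^2 = (norm (A x (G n x - g x)))^2" 
    by (simp add: linear_diff[OF lin[OF x]])
   also have "... <= (C * norm (G n x - g x))^2" by (rule power_mono[OF bd[OF x]]) simp
   finally show "(norm (A x (G n x) - A x (g x)))^2 <= C^2 * (norm (G n x - g x))^2" by (simp add: power_mult_distrib)
  qed
  thus ?thesis by (simp add: ip_self)
 qed
 show "(%n. sqn M (%x. A x (G n x) - A x (g x))) \<longlonglongrightarrow> 0"
 proof (rule tendsto_sandwich[OF _ _ tendsto_const])
  have "(%n. C^2 * sqn M (%x. G n x - g x)) \<longlonglongrightarrow> C\<^sup>2 * 0"
   using assms by (intro tendsto_intros) (auto simp: L2_tendsto_def)
  thus "(%n. C^2 * sqn M (%x. G n x - g x)) \<longlonglongrightarrow> 0" by simp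
 qed (auto intro!: always_eventually ip_self_nonneg le)
qed

lemma en_tendsto:
 assumes "L2_tendsto M G g" shows "(%n. en (G n) (G n)) \<longlonglongrightarrow> en g g"
 unfolding en_def by (rule L2_tendsto_ip[OF L2_tendsto_A[OF assms] assms])

end

locale elliptic_problem = elliptic Om A c C for Om :: "'a::euclidean_space set" and ga :: "'a set" and A :: "'a => 'a => 'a" and c C
begin

lemma energy_eq:
 assumes "has_weak_gradient Om u g" "has_weak_gradient Om v h"
 shows "energy Om A u v = en g h"
proof -
 have wu: "has_weak_gradient Om u (weak_gradient Om u)" "has_weak_gradient Om v (weak_gradient Om v)"
  using assms by (auto intro!: H1_weak_gradient simp: H1_def)
 have "energy Om A u v = en (weak_gradient Om u) (weak_gradient Om v)"
  by (simp add: energy_def en_def ip_def)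
 also have "... = en g h"
  by (intro en_cong_AE weak_gradient_AE[OF open_Om] assms has_weak_gradient_L2(2)[OF wu(1)] has_weak_gradient_L2(2)[OF wu(2)]
    has_weak_gradient_L2(2)[OF assms(1)] has_weak_gradient_L2(2)[OF assms(2)])
 finally show ?thesis .
qed

text \<open>Compactness of the embedding into \<open>L\<^sup>2\<close>, in the form of a bound by finitely many functionals.\<close>

definition compactly_embedded :: bool where
 "compactly_embedded \<longleftrightarrow> (ALL \<eta>>0. EX (n::nat) f K. (ALL i<n. L2 M (f i)) &
   (ALL u g. adm Om ga u g --> sqn M u <= \<eta> * (sqn M u + sqn M g) + K * (\<Sum>i<n. (ip M u (f i))^2)))"

lemma Cauchy_subsequence:
 fixes U :: "nat => 'a => real"
 assumes K: compactly_embedded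
  and U: "!!n. adm Om ga (U n) (G n)" and B: "!!n. sqn M (U n) + sqn M (G n) <= B"
 shows "EX r::nat=>nat. strict_mono r & (ALL e>0. EX N. ALL m>=N. ALL n>=N. sqn M (%x. U (r m) x - U (r n) x) < e)"
proof -
 let ?d = "%m n. sqn M (%x. U m x - U n x)"
 note LU = adm_L2[OF U]
 define P where "P k s \<longleftrightarrow> (EX N. ALL m>=N. ALL n>=N. ?d (s m) (s n) < 1 / real (Suc k))" for k and s :: "nat => nat"
 have B0: "B >= 0" using B[of 0] ip_self_nonneg[of M "U 0"] ip_self_nonneg[of M "G 0"] by linarith
 have "EX r'. strict_mono r' & P k (s \<circ> r')" if s: "strict_mono s" for k and s :: "nat => nat"
 proof -
  define \<eta> where "\<eta> = 1 / (8 * (B + 1) * real (Suc k))"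
  have \<eta>: "\<eta> > 0" using B0 by (simp add: \<eta>_def)
  from K[unfolded compactly_embedded_def, rule_format, OF \<eta>]
  obtain n :: nat and f K where f': "ALL i<n. L2 M (f i)" and K': "ALL u g. adm Om ga u g --> sqn M u <= \<eta> * (sqn M u + sqn M g) + K * (\<Sum>i<n. (ip M u (f i))^2)"
   by (elim exE conjE)
  note f = f'[rule_format] and K = K'[rule_format]
  define X where "X i m = ip M (U (s m)) (f i)" for i m :: nat
  have "bounded (range (X i))" if "i < n" for i
  proof -
   have "\<bar>X i m\<bar> <= sqrt (B * sqn M (f i))" for m
   proof -
    have "(X i m)^2 <= sqn M (U (s m)) * sqn M (f i)"
     unfolding X_def by (rule ip_Cauchy_Schwarz[OF LU(1) f[OF that]])
    also have "... <= B * sqn M (f i)"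
     using B[of "s m"] ip_self_nonneg[of M "G (s m)"] ip_self_nonneg[of M "f i"] by (intro mult_right_mono) auto
    finally show ?thesis by (metis real_le_rsqrt power2_abs)
   qed
   thus ?thesis unfolding bounded_iff by auto
  qed
  from bounded_sequences_common_subsequence[of n X, OF this]
  obtain r where r: "strict_mono (r::nat=>nat)" "!!i. i < n ==> convergent (X i \<circ> r)" by auto
  have cau: "EX N. ALL m>=N. ALL m'>=N. K * (\<Sum>i<n. (X i (r m) - X i (r m'))^2) < 1 / (2 * real (Suc k))"
  proof -
   define e where "e = 1 / (2 * real (Suc k) * (\<bar>K\<bar> + 1) * real (Suc n))"
   have e: "e > 0" by (simp add: e_def add_nonneg_pos)
   have "ALL i. EX N. i < n --> (ALL m>=N. ALL m'>=N. \<bar>X i (r m) - X i (r m')\<bar> < sqrt e)"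
   proof
    fix i
    show "EX N. i < n --> (ALL m>=N. ALL m'>=N. \<bar>X i (r m) - X i (r m')\<bar> < sqrt e)"
    proof (cases "i < n")
     case True
     from r(2)[OF this] have "Cauchy (X i \<circ> r)" by (rule convergent_Cauchy)
     moreover have "sqrt e > 0" using e by simp
     ultimately show ?thesis unfolding Cauchy_def dist_real_def by auto
    qed simp
   qed
   then obtain N where N: "!!i m m'. i < n ==> m >= N i ==> m' >= N i ==> \<bar>X i (r m) - X i (r m')\<bar> < sqrt e"
    by metis
   define N0 where "N0 = (\<Sum>i<n. N i)"
   have N0: "N0 >= N i" if "i < n" for i unfolding N0_def using that by (intro member_le_sum) auto
   have "K * (\<Sum>i<n. (X i (r m) - X i (r m'))^2) < 1 / (2 * real (Suc k))" if "m >= N0" "m' >= N0" for m m'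
   proof -
    have sm: "(\<Sum>i<n. (X i (r m) - X i (r m'))^2) <= (\<Sum>i<n. e)"
    proof (rule sum_mono)
     fix i assume "i \<in> {..<n}"
     hence i: "i < n" by simp
     have "\<bar>X i (r m) - X i (r m')\<bar> <= sqrt e" using N[OF i, of m m'] N0[OF i] that by simp
     hence "\<bar>X i (r m) - X i (r m')\<bar>\<^sup>2 <= (sqrt e)^2" by (rule power_mono) simp
     thus "(X i (r m) - X i (r m'))^2 <= e" using e by simp
    qed
    have "K * (\<Sum>i<n. (X i (r m) - X i (r m'))^2) <= \<bar>K\<bar> * (\<Sum>i<n. (X i (r m) - X i (r m'))^2)"
     by (intro mult_right_mono sum_nonneg) auto
    also have "... <= \<bar>K\<bar> * (real n * e)" using sm by (intro mult_left_mono) auto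
    also have "... < (\<bar>K\<bar> + 1) * (real (Suc n) * e)" 
    proof (rule mult_strict_mono')
     show "real n * e < real (Suc n) * e" using e by (simp add: algebra_simps)
    qed (use e in auto)
    also have "... = 1 / (2 * real (Suc k))"
     unfolding e_def by (simp add: divide_simps add_nonneg_eq_0_iff)
    finally show ?thesis .
   qed
   thus ?thesis by blast
  qed
  have "P k (s \<circ> r)"
  proof -
   obtain N where N: "!!m m'. m >= N ==> m' >= N ==> K * (\<Sum>i<n. (X i (r m) - X i (r m'))^2) < 1 / (2 * real (Suc k))"
    using cau by blast
   have "?d (s (r m)) (s (r m')) < 1 / real (Suc k)" if "m >= N" "m' >= N" for m m'
   proof -
    let ?a = "s (r m)" and ?b = "s (r m')"
    have ad: "adm Om ga (%x. U ?a x - U ?b x) (%x. G ?a x - G ?b x)"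
     using adm_lin[OF open_Om U[of ?a] U[of ?b], of 1 "-1"] by simp
    have par: "sqn M (%x. f x - g x) <= 2 * sqn M f + 2 * sqn M g"
     if "L2 M f" "L2 M g" for f g :: "'a => 'd::euclidean_space"
     using ip_quadratic[OF that, of 1 1] ip_quadratic[OF that, of 1 "-1"] ip_self_nonneg[of M "%x. 1 *R f x + 1 *R g x"] 
     by simp
    have "?d ?a ?b + sqn M (%x. G ?a x - G ?b x) <= 4 * B"
     using par[OF LU(1) LU(1), of ?a ?b] par[OF LU(2) LU(2), of ?a ?b] B[of ?a] B[of ?b] by linarith
    hence "\<eta> * (?d ?a ?b + sqn M (%x. G ?a x - G ?b x)) <= \<eta> * (4 * B)"
     using \<eta> by (intro mult_left_mono) auto
    also have "\<eta> * (4 * B) = (B / (B + 1)) * (1 / (2 * real (Suc k)))"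
     using B0 unfolding \<eta>_def by (simp add: divide_simps, simp add: algebra_simps)
    also have "... <= 1 * (1 / (2 * real (Suc k)))"
     using B0 by (intro mult_right_mono) (auto simp: divide_le_eq_1)
    also have "... = 1 / (2 * real (Suc k))" by simp
    finally have 1: "\<eta> * (?d ?a ?b + sqn M (%x. G ?a x - G ?b x)) <= 1 / (2 * real (Suc k))" .
    have "(\<Sum>i<n. (ip M (%x. U ?a x - U ?b x) (f i))^2) = (\<Sum>i<n. (X i (r m) - X i (r m'))^2)"
     by (rule sum.cong) (use f LU in \<open>auto simp: X_def ip_diff_left\<close>)
    hence "?d ?a ?b <= \<eta> * (?d ?a ?b + sqn M (%x. G ?a x - G ?b x)) + K * (\<Sum>i<n. (X i (r m) - X i (r m'))^2)"
     using K[OF ad] by (simp only:)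
    also have "... < 1 / (2 * real (Suc k)) + 1 / (2 * real (Suc k))"
     by (rule add_le_less_mono[OF 1 N[OF that]])
    also have "... = 1 / real (Suc k)" by (simp add: field_simps)
    finally show ?thesis .
   qed
   thus ?thesis unfolding P_def o_def by blast
  qed
  thus ?thesis using r(1) by blast
 qed
 then interpret subseqs P by unfold_locales
 have stable: "P k (s \<circ> r)" if "strict_mono r" "P k s" for r s k
 proof -
  from that(2) obtain N where N: "!!m n. m >= N ==> n >= N ==> ?d (s m) (s n) < 1 / real (Suc k)" unfolding P_def by blast
  show ?thesis unfolding P_def
  proof (intro exI[of _ N] allI impI)
   fix m n assume mn: "m >= N" "n >= N"
   have "N <= r m" "N <= r n" using seq_suble[OF that(1), of m] seq_suble[OF that(1), of n] mn by auto
   thus "?d ((s \<circ> r) m) ((s \<circ> r) n) < 1 / real (Suc k)" using N by simp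
  qed
 qed
 show ?thesis
 proof (intro exI[of _ diagseq] conjI subseq_diagseq allI impI)
  fix e :: real assume "e > 0"
  then obtain k where k: "1 / real (Suc k) < e" using nat_approx_posE by blast
  have "P k (diagseq \<circ> ((+) (Suc k)))" by (rule diagseq_holds) (rule stable)
  then obtain N where N: "!!m n. m >= N ==> n >= N ==> ?d (diagseq (Suc k + m)) (diagseq (Suc k + n)) < 1 / real (Suc k)"
   unfolding P_def by auto
  show "EX N. ALL m>=N. ALL n>=N. ?d (diagseq m) (diagseq n) < e"
  proof (intro exI[of _ "Suc k + N"] allI impI)
   fix m n assume mn: "m >= Suc k + N" "n >= Suc k + N"
   hence "N <= m - Suc k" "N <= n - Suc k" by auto
   from N[OF this] mn have "?d (diagseq m) (diagseq n) < 1 / real (Suc k)" by simp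
   thus "?d (diagseq m) (diagseq n) < e" using k by (rule order.strict_trans)
  qed
 qed
qed

lemma minimiser_exists:
 fixes w :: "nat => 'a => real"
 assumes K: compactly_embedded
  and w: "!!i. i < N ==> adm Om ga (w i) (h i)"
  and trial: "adm Om ga u g" "!!i. i < N ==> ip M u (w i) = 0" "sqn M u > 0" "en g g <= s * sqn M u"
 shows "EX u g \<mu>. adm Om ga u g & (ALL i<N. ip M u (w i) = 0) & sqn M u = 1 & \<mu> <= s & en g g = \<mu> &
  (ALL v k. adm Om ga v k --> (ALL i<N. ip M v (w i) = 0) --> \<mu> * sqn M v <= en k k)"
proof -
 define X where "X = {(v, k). adm Om ga v k & (ALL i<N. ip M v (w i) = 0)}"
 define R where "R = {en k k / sqn M v | v k. (v, k) \<in> X & sqn M v > 0}"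
 define \<mu> where "\<mu> = Inf R"
 have inR: "en g g / sqn M u \<in> R" using trial by (auto simp: R_def X_def)
 have R0: "0 <= x" if "x \<in> R" for x
  using that unfolding R_def X_def by (auto intro!: divide_nonneg_pos en_nonneg adm_L2)
 have bdd: "bdd_below R" using R0 by (rule bdd_belowI)
 have \<mu>s: "\<mu> <= s"
 proof -
  have "\<mu> <= en g g / sqn M u" unfolding \<mu>_def by (rule cInf_lower[OF inR bdd])
  also have "... <= s" using trial by (simp add: divide_le_eq)
  finally show ?thesis .
 qed
 have \<mu>0: "0 <= \<mu>" unfolding \<mu>_def by (rule cInf_greatest) (use inR R0 in auto)
 have low: "\<mu> * sqn M v <= en k k" if "(v, k) \<in> X" for v k
 proof (cases "sqn M v > 0")
  case True
  hence "\<mu> <= en k k / sqn M v" unfolding \<mu>_def using that by (intro cInf_lower[OF _ bdd]) (auto simp: R_def)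
  thus ?thesis using True by (simp add: le_divide_eq)
 next
  case False
  hence "sqn M v = 0" using ip_self_nonneg[of M v] by linarith
  thus ?thesis using that by (auto simp: X_def intro!: en_nonneg intro: adm_L2)
 qed
 have X_lin: "(%x. a * v x + b * v' x, %x. a *R k x + b *R k' x) \<in> X" if "(v, k) \<in> X" "(v', k') \<in> X" for a b v k v' k'
 proof -
  have ad: "adm Om ga v k" "adm Om ga v' k'" using that by (auto simp: X_def)
  have "ip M (%x. a * v x + b * v' x) (w i) = 0" if "i < N" for i
   using ip_lin_left[OF adm_L2(1)[OF ad(1)] adm_L2(1)[OF ad(2)] adm_L2(1)[OF w[OF that]]]
    \<open>(v, k) \<in> X\<close> \<open>(v', k') \<in> X\<close> that by (simp add: X_def)
  thus ?thesis using adm_lin[OF open_Om ad, of a b] by (simp add: X_def)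
 qed
 define Q where "Q n p \<longleftrightarrow> p \<in> X & sqn M (fst p) = 1 & en (snd p) (snd p) < \<mu> + 1 / real (Suc n)"
  for n and p :: "('a => real) \<times> ('a => 'a)"
 have "EX p. Q n p" for n
 proof -
  have "EX x:R. x < \<mu> + 1 / real (Suc n)"
   unfolding \<mu>_def by (rule cInf_lessD) (use inR in auto)
  then obtain v k where vk: "(v, k) \<in> X" "sqn M v > 0" "en k k / sqn M v < \<mu> + 1 / real (Suc n)"
   unfolding R_def by blast
  define a where "a = 1 / sqrt (sqn M v)"
  have a2: "a^2 = 1 / sqn M v" using vk(2) by (simp add: a_def power_divide)
  have ad: "adm Om ga v k" using vk(1) by (auto simp: X_def)
  have 1: "(%x. a * v x + 0 * v x, %x. a *R k x + 0 *R k x) \<in> X" by (rule X_lin[OF vk(1) vk(1)])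
  have 2: "sqn M (%x. a *R v x + 0 *R v x) = 1"
   using adm_L2[OF ad] vk(2) a2 by (subst ip_quadratic) auto
  have 3: "en (%x. a *R k x + 0 *R k x) (%x. a *R k x + 0 *R k x) = en k k / sqn M v"
   using adm_L2[OF ad] a2 by (subst en_quadratic) auto
  have "Q n (%x. a * v x + 0 * v x, %x. a *R k x + 0 *R k x)"
   unfolding Q_def fst_conv snd_conv using 1 2 3 vk(3) by simp
  thus ?thesis by blast
 qed
 then obtain p where p: "!!n. Q n (p n)" by metis
 define U where "U n = fst (p n)" for n
 define G where "G n = snd (p n)" for n
 have UX: "(U n, G n) \<in> X" "sqn M (U n) = 1" "en (G n) (G n) < \<mu> + 1 / real (Suc n)" for n
  using p[of n] by (auto simp: U_def G_def Q_def)
 have ad: "adm Om ga (U n) (G n)" for n using UX(1)[of n] by (simp add: X_def)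
 note LU = adm_L2[OF ad]
 have bnd: "sqn M (U n) + sqn M (G n) <= 1 + (\<mu> + 1) / c" for n
 proof -
  have "c * sqn M (G n) <= en (G n) (G n)" by (rule en_lower[OF LU(2)])
  also have "... <= \<mu> + 1" 
  proof -
   have "1 / real (Suc n) <= 1" by simp
   thus ?thesis using UX(3)[of n] by linarith
  qed
  finally show ?thesis using UX(2)[of n] c_pos by (simp add: field_simps)
 qed
 have "EX r::nat=>nat. strict_mono r & (ALL e>0. EX N. ALL m>=N. ALL n>=N. sqn M (%x. U (r m) x - U (r n) x) < e)"
  by (rule Cauchy_subsequence[OF K, where U = U and G = G and B = "1 + (\<mu> + 1) / c"]) (rule ad bnd)+
 then obtain r where r1: "strict_mono (r::nat=>nat)" 
  and r2: "ALL e>0. EX N. ALL m>=N. ALL n>=N. sqn M (%x. U (r m) x - U (r n) x) < e"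
  by (elim exE conjE)
 note r = r1 r2[rule_format]
 obtain u0 where u0: "L2_tendsto M (%n. U (r n)) u0"
  by (rule L2_complete[OF LU(1) r(2)]) (assumption, rule that)
 have lim1: "(%n. en (G n) (G n)) \<longlonglongrightarrow> \<mu>"
 proof (rule tendsto_sandwich)
  show "\<forall>\<^sub>F n in sequentially. \<mu> <= en (G n) (G n)" using low[OF UX(1)] UX(2) by auto
  show "\<forall>\<^sub>F n in sequentially. en (G n) (G n) <= \<mu> + 1 / real (Suc n)"
   using UX(3) by (auto intro!: always_eventually less_imp_le)
  have "(%n. \<mu> + 1 / real (Suc n)) \<longlonglongrightarrow> \<mu> + 0"
   using LIMSEQ_inverse_real_of_nat by (intro tendsto_intros) (simp add: inverse_eq_divide)
  thus "(%n. \<mu> + 1 / real (Suc n)) \<longlonglongrightarrow> \<mu>" by simp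
 qed simp
 have CG: "EX N. ALL m>=N. ALL n>=N. sqn M (%x. G (r m) x - G (r n) x) < e" if e: "e > 0" for e
 proof -
  let ?d = "%m n. sqn M (%x. U (r m) x - U (r n) x)"
  have key: "c * sqn M (%x. G m x - G n x) <= 2 * (en (G m) (G m) - \<mu>) + 2 * (en (G n) (G n) - \<mu>)
    + \<mu> * sqn M (%x. U m x - U n x)" for m n
  proof -
   have "c * sqn M (%x. G m x - G n x) <= en (%x. G m x - G n x) (%x. G m x - G n x)"
    by (rule en_lower) (intro L2_diff LU)
   also have "... = en (G m) (G m) - 2 * en (G m) (G n) + en (G n) (G n)"
    using en_quadratic[OF LU(2)[of m] LU(2)[of n], of 1 "-1"] by simp
   also have "... = 2 * en (G m) (G m) + 2 * en (G n) (G n) - en (%x. 1 *R G m x + 1 *R G n x) (%x. 1 *R G m x + 1 *R G n x)"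
    using en_quadratic[OF LU(2)[of m] LU(2)[of n], of 1 1] by simp
   also have "... <= 2 * en (G m) (G m) + 2 * en (G n) (G n) - \<mu> * sqn M (%x. 1 * U m x + 1 * U n x)"
    using low[OF X_lin[OF UX(1)[of m] UX(1)[of n], of 1 1]] by simp
   also have "sqn M (%x. 1 * U m x + 1 * U n x) = 4 - sqn M (%x. U m x - U n x)"
    using ip_quadratic[OF LU(1)[of m] LU(1)[of n], of 1 1] ip_quadratic[OF LU(1)[of m] LU(1)[of n], of 1 "-1"] UX(2) by simp
   finally show ?thesis by (simp add: algebra_simps)
  qed
  have e2: "e * c / 4 > 0" using e c_pos by simp
  have "\<forall>\<^sub>F n in sequentially. en (G (r n)) (G (r n)) < \<mu> + e * c / 8"
   using LIMSEQ_subseq_LIMSEQ[OF lim1 r(1)] by (intro order_tendstoD(2)) (use e2 in \<open>auto simp: o_def\<close>)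
  then obtain N1 where N1: "!!n. n >= N1 ==> en (G (r n)) (G (r n)) < \<mu> + e * c / 8"
   unfolding eventually_sequentially by blast
  have "e * c / (4 * (\<mu> + 1)) > 0" using e c_pos \<mu>0 by simp
  then obtain N2 where N2: "!!m n. m >= N2 ==> n >= N2 ==> ?d m n < e * c / (4 * (\<mu> + 1))" using r(2) by blast
  have "sqn M (%x. G (r m) x - G (r n) x) < e" if "m >= max N1 N2" "n >= max N1 N2" for m n
  proof -
   have "\<mu> * ?d m n <= \<mu> * (e * c / (4 * (\<mu> + 1)))" using N2[of m n] that \<mu>0 by (intro mult_left_mono) auto
   also have "... <= e * c / 4" using \<mu>0 e c_pos by (simp add: divide_simps mult_left_mono)
   finally have "c * sqn M (%x. G (r m) x - G (r n) x) < c * e"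
    using key[of "r m" "r n"] N1[of m] N1[of n] that e2 by (auto simp: algebra_simps)
   thus ?thesis using c_pos by simp
  qed
  thus ?thesis by blast
 qed
 obtain g0 where g0: "L2_tendsto M (%n. G (r n)) g0"
  by (rule L2_complete[OF LU(2) CG]) (assumption, rule that)
 have a0: "adm Om ga u0 g0" by (rule adm_limit[OF open_Om ad u0 g0])
 have o0: "ip M u0 (w i) = 0" if "i < N" for i
 proof -
  have "(%n. ip M (U (r n)) (w i)) \<longlonglongrightarrow> ip M u0 (w i)"
   by (rule L2_tendsto_ip_right[OF u0 adm_L2(1)[OF w[OF that]]])
  moreover have "ip M (U n) (w i) = 0" for n using UX(1)[of n] that by (simp add: X_def)
  ultimately show ?thesis by (simp add: LIMSEQ_const_iff)
 qed
 have n0: "sqn M u0 = 1"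
  using L2_tendsto_ip[OF u0 u0] UX(2) by (simp add: LIMSEQ_const_iff)
 have e0: "en g0 g0 = \<mu>"
  using LIMSEQ_unique[OF en_tendsto[OF g0]] LIMSEQ_subseq_LIMSEQ[OF lim1 r(1)] by (simp add: o_def)
 show ?thesis
  using a0 o0 n0 e0 \<mu>s low by (intro exI[of _ u0] exI[of _ g0] exI[of _ \<mu>]) (auto simp: X_def)
qed

definition eigenpair :: "real => ('a => real) => ('a => 'a) => bool" where
 "eigenpair \<mu> u g \<longleftrightarrow> adm Om ga u g & (ALL v k. adm Om ga v k --> en g k = \<mu> * ip M u v)"

lemma eigenpairs_exist:
 fixes v :: "nat => 'a => real"
 assumes K: compactly_embedded
  and v: "!!j. j < k ==> adm Om ga (v j) (q j)" "!!j. j < k ==> sqn M (v j) > 0"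
   "!!i j. i < k ==> j < k ==> i ~= j ==> ip M (v i) (v j) = 0 & en (q i) (q j) = 0"
   "!!j. j < k ==> en (q j) (q j) <= s * sqn M (v j)"
 shows "N <= k ==> EX w h \<mu>. ALL i<N. eigenpair (\<mu> i) (w i) (h i) & \<mu> i <= s & (ALL j<N. ip M (w i) (w j) = (if i = j then 1 else 0))"
proof (induction N)
 case 0
 show ?case by simp
next
 case (Suc N)
 hence "EX w h \<mu>. ALL i<N. eigenpair (\<mu> i) (w i) (h i) & \<mu> i <= s & (ALL j<N. ip M (w i) (w j) = (if i = j then 1 else 0))"
  by simp
 then obtain w h \<mu> where w: "!!i. i < N ==> eigenpair (\<mu> i) (w i) (h i)" "!!i. i < N ==> \<mu> i <= s"
  "!!i j. i < N ==> j < N ==> ip M (w i) (w j) = (if i = j then 1 else 0)" by blast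
 have wa: "adm Om ga (w i) (h i)" if "i < N" for i using w(1)[OF that] by (simp add: eigenpair_def)
 have "N < card {..<k}" using Suc.prems by simp
 from homogeneous_system_solution[OF _ this, of "%i j. ip M (v j) (w i)"]
 obtain a where a: "EX j<k. a j ~= 0" "!!i. i < N ==> (\<Sum>j<k. a j * ip M (v j) (w i)) = 0" by auto
 define u where "u x = (\<Sum>j<k. a j * v j x)" for x
 define g where "g x = (\<Sum>j<k. a j *R q j x)" for x
 have ua: "adm Om ga u g" unfolding u_def[abs_def] g_def[abs_def] by (rule adm_sum[OF open_Om]) (use v in auto)
 have Lv: "L2 M (v j)" "L2 M (q j)" if "j < k" for j using adm_L2[OF v(1)[OF that]] by auto
 have u1: "ip M u f = (\<Sum>j<k. a j * ip M (v j) f)" if "L2 M f" for f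
  using ip_sum_left[of "{..<k}" M v f a] Lv that by (simp add: u_def[abs_def])
 have g1: "en g f = (\<Sum>j<k. a j * en (q j) f)" if "L2 M f" for f
  using en_sum_left[of "{..<k}" q f a] Lv that by (simp add: g_def[abs_def])
 have "sqn M u = (\<Sum>j<k. a j * ip M (v j) u)" by (rule u1[OF adm_L2(1)[OF ua]])
 also have "... = (\<Sum>j<k. (a j)^2 * sqn M (v j))"
 proof (rule sum.cong)
  fix j assume j: "j \<in> {..<k}"
  have "ip M (v j) u = (\<Sum>i<k. a i * ip M (v i) (v j))" using u1[OF Lv(1)] j by (simp add: ip_commute[of M _ u])
  also have "... = (\<Sum>i<k. if i = j then a i * ip M (v i) (v j) else 0)"
   by (rule sum.cong) (use v(3) j in auto)
  also have "... = a j * sqn M (v j)" using j by simp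
  finally show "a j * ip M (v j) u = (a j)^2 * sqn M (v j)" by (simp add: power2_eq_square)
 qed simp
 finally have uu: "sqn M u = (\<Sum>j<k. (a j)^2 * sqn M (v j))" .
 have "en g g = (\<Sum>j<k. a j * en (q j) g)" by (rule g1[OF adm_L2(2)[OF ua]])
 also have "... = (\<Sum>j<k. (a j)^2 * en (q j) (q j))"
 proof (rule sum.cong)
  fix j assume j: "j \<in> {..<k}"
  have "en (q j) g = (\<Sum>i<k. a i * en (q i) (q j))" using g1[OF Lv(2)] j by (simp add: en_sym[of _ g])
  also have "... = (\<Sum>i<k. if i = j then a i * en (q i) (q j) else 0)"
   by (rule sum.cong) (use v(3) j in auto)
  also have "... = a j * en (q j) (q j)" using j by simp
  finally show "a j * en (q j) g = (a j)^2 * en (q j) (q j)" by (simp add: power2_eq_square)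
 qed simp
 also have "... <= (\<Sum>j<k. (a j)^2 * (s * sqn M (v j)))"
  by (intro sum_mono mult_left_mono v(4)) auto
 also have "... = s * sqn M u" unfolding uu by (simp add: sum_distrib_left algebra_simps)
 finally have eg: "en g g <= s * sqn M u" .
 have upos: "sqn M u > 0"
 proof -
  obtain j where j: "j < k" "a j ~= 0" using a(1) by blast
  have "0 < (a j)^2 * sqn M (v j)" using j v(2)[OF j(1)] by simp
  also have "... <= (\<Sum>j<k. (a j)^2 * sqn M (v j))"
   by (rule member_le_sum) (use j in \<open>auto intro!: mult_nonneg_nonneg ip_self_nonneg\<close>)
  finally show ?thesis unfolding uu .
 qed
 have orth: "ip M u (w i) = 0" if "i < N" for i
  using u1[OF adm_L2(1)[OF wa[OF that]]] a(2)[OF that] by simp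
 have "EX u g \<mu>. adm Om ga u g & (ALL i<N. ip M u (w i) = 0) & sqn M u = 1 & \<mu> <= s & en g g = \<mu> &
  (ALL v k. adm Om ga v k --> (ALL i<N. ip M v (w i) = 0) --> \<mu> * sqn M v <= en k k)"
  by (rule minimiser_exists[OF K, where w = w and h = h and u = u and g = g]) (use wa ua orth upos eg in auto)
 then 
 obtain u' g' \<mu>' where u': "adm Om ga u' g'" "!!i. i < N ==> ip M u' (w i) = 0" "sqn M u' = 1" "\<mu>' <= s" "en g' g' = \<mu>'"
  and min: "!!v k. adm Om ga v k ==> (!!i. i < N ==> ip M v (w i) = 0) ==> \<mu>' * sqn M v <= en k k" by blast
 have el: "en g' l = \<mu>' * ip M u' f" if f: "adm Om ga f l" "!!i. i < N ==> ip M f (w i) = 0" for f l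
 proof -
  note L = adm_L2[OF u'(1)] adm_L2[OF f(1)]
  have "(en g' l - \<mu>' * ip M u' f)^2 <= 0 * (en l l - \<mu>' * sqn M f)"
  proof (rule quadratic_nonneg_discriminant)
   fix t
   have "\<mu>' * sqn M (%x. 1 * u' x + t * f x) <= en (%x. 1 *R g' x + t *R l x) (%x. 1 *R g' x + t *R l x)"
   proof (rule min[OF adm_lin[OF open_Om u'(1) f(1)]])
    fix i assume i: "i < N"
    show "ip M (%x. 1 * u' x + t * f x) (w i) = 0"
     using ip_lin_left[OF L(1) L(3) adm_L2(1)[OF wa[OF i]], of 1 t] u'(2)[OF i] f(2)[OF i] by simp
   qed
   thus "0 <= 0 + 2 * t * (en g' l - \<mu>' * ip M u' f) + t^2 * (en l l - \<mu>' * sqn M f)"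
    using ip_quadratic[OF L(1) L(3), of 1 t] en_quadratic[OF L(2) L(4), of 1 t] u'(3,5)
    by (simp add: algebra_simps)
  qed
  thus ?thesis by simp
 qed
 have new: "eigenpair \<mu>' u' g'"
  unfolding eigenpair_def
 proof (intro conjI u'(1) allI impI)
  fix f l assume f: "adm Om ga f l"
  define b where "b i = ip M f (w i)" for i
  define f' where "f' x = (\<Sum>i<N. b i * w i x)" for x
  define l' where "l' x = (\<Sum>i<N. b i *R h i x)" for x
  have fa: "adm Om ga f' l'" unfolding f'_def[abs_def] l'_def[abs_def] by (rule adm_sum[OF open_Om]) (use wa in auto)
  have Lw: "L2 M (w i)" "L2 M (h i)" if "i < N" for i using adm_L2[OF wa[OF that]] by auto
  have f1: "ip M f' e = (\<Sum>j<N. b j * ip M (w j) e)" if "L2 M e" for e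
   using ip_sum_left[of "{..<N}" M w e b] Lw that by (simp add: f'_def[abs_def])
  have l1: "en l' e = (\<Sum>j<N. b j * en (h j) e)" if "L2 M e" for e
   using en_sum_left[of "{..<N}" h e b] Lw that by (simp add: l'_def[abs_def])
  have d: "adm Om ga (%x. 1 * f x + (-1) * f' x) (%x. 1 *R l x + (-1) *R l' x)" by (rule adm_lin[OF open_Om f fa])
  note L = adm_L2[OF f] adm_L2[OF fa] adm_L2[OF u'(1)]
  have "ip M (%x. 1 * f x + (-1) * f' x) (w i) = 0" if i: "i < N" for i
  proof -
   have "ip M f' (w i) = (\<Sum>j<N. b j * (if j = i then 1 else 0))"
    unfolding f1[OF Lw(1)[OF i]] by (rule sum.cong) (use w(3) i in auto)
   also have "... = b i" by (rule sum_mult_delta[OF i])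
   finally show ?thesis using ip_diff_left[OF L(1) L(3) Lw(1)[OF i]] by (simp add: b_def)
  qed
  from el[OF d this] have "en g' (%x. 1 *R l x + (-1) *R l' x) = \<mu>' * ip M u' (%x. 1 * f x + (-1) * f' x)" .
  moreover have "en g' (%x. 1 *R l x + (-1) *R l' x) = en g' l - en g' l'"
   using en_lin_right[OF L(2) L(4) L(6), of 1 "-1"] by simp
  moreover have "en g' l' = 0"
  proof -
   have "en (h j) g' = 0" if "j < N" for j
    using w(1)[OF that] u'(1) u'(2)[OF that] by (simp add: eigenpair_def ip_commute[of M "w j"])
   thus ?thesis using l1[OF L(6)] by (simp add: en_sym[of g'])
  qed
  moreover have "ip M u' (%x. 1 * f x + (-1) * f' x) = ip M u' f - ip M u' f'"
   using ip_diff_right[OF L(1) L(3) L(5)] by simp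
  moreover have "ip M u' f' = 0"
   using f1[OF L(5)] u'(2) by (simp add: ip_commute[of M u'])
  ultimately show "en g' l = \<mu>' * ip M u' f" by simp
 qed
 show ?case
 proof (intro exI allI impI conjI)
  let ?w = "w(N := u')" and ?h = "h(N := g')" and ?\<mu> = "\<mu>(N := \<mu>')"
  fix i assume i: "i < Suc N"
  show "eigenpair (?\<mu> i) (?w i) (?h i)" using new w(1)[of i] i by auto
  show "?\<mu> i <= s" using u'(4) w(2)[of i] i by auto
  fix j assume j: "j < Suc N"
  consider "i = N" "j = N" | "i = N" "j < N" | "i < N" "j = N" | "i < N" "j < N" using i j by linarith
  thus "ip M (?w i) (?w j) = (if i = j then 1 else 0)"
  proof cases
   case 3
   thus ?thesis using u'(2)[of i] ip_commute[of M "w i" u'] by simp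
  qed (use u'(2,3) w(3)[of i j] in auto)
 qed
qed

lemma eigenpair_weak_eigenfunction:
 assumes "eigenpair \<mu> u g" "sqn M u ~= 0"
 shows "weak_eigenfunction Om ga A \<mu> u"
 unfolding weak_eigenfunction_def
proof (intro conjI ballI)
 have a: "adm Om ga u g" using assms(1) by (simp add: eigenpair_def)
 thus "u \<in> H1_vanishing Om ga" by (simp add: adm_def)
 show "~(AE x in M. u x = 0)"
 proof
  assume z: "AE x in M. u x = 0"
  have "sqn M u = ip M (%x. 0) (%x. 0::real)" by (intro ip_cong_AE z) (use adm_L2[OF a] in \<open>auto simp: L2_def\<close>)
  thus False using assms(2) by (simp add: ip_def)
 qed
 fix v assume "v \<in> H1_vanishing Om ga"
 hence v: "adm Om ga v (weak_gradient Om v)" by (rule adm_weak_gradient)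
 have "energy Om A u v = en g (weak_gradient Om v)" by (rule energy_eq) (use a v in \<open>auto simp: adm_def\<close>)
 also have "... = \<mu> * ip M u v" using assms(1) v by (simp add: eigenpair_def)
 finally show "energy Om A u v = \<mu> * (LINT x|M. u x * v x)" by (simp add: ip_def)
qed

lemma L2_zero_AE:
 assumes "L2 M u" "sqn M u = 0" shows "AE x in M. (u :: 'a => real) x = 0"
proof -
 have "AE x in M. (norm (u x))^2 = 0"
  using assms(2) integral_nonneg_eq_0_iff_AE[OF L2_norm2_integrable[OF assms(1)]] by (simp add: ip_self)
 thus ?thesis by eventually_elim simp
qed

theorem kth_eigenvalue_bounds:
 fixes v :: "nat => 'a => real"
 assumes K: compactly_embedded and k: "k >= 1"
  and v: "!!j. j < k ==> adm Om ga (v j) (q j)" "!!j. j < k ==> sqn M (v j) > 0"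
   "!!i j. i < k ==> j < k ==> i ~= j ==> ip M (v i) (v j) = 0 & en (q i) (q j) = 0"
   "!!j. j < k ==> en (q j) (q j) <= s * sqn M (v j)"
  and low: "!!u g. adm Om ga u g ==> z * sqn M u <= en g g"
 shows "z <= kth_eigenvalue Om ga A k" "kth_eigenvalue Om ga A k <= s"
proof -
 define S where "S = {\<sigma>. (EX w. weak_eigenfunction Om ga A \<sigma> w) &
   (EX (s::nat => real) u.
    (ALL i<k. s i <= \<sigma> & weak_eigenfunction Om ga A (s i) (u i)) &
    (ALL c::nat => real. (AE x in M. (\<Sum>i<k. c i * u i x) = 0) --> (ALL i<k. c i = 0)))}"
 have keq: "kth_eigenvalue Om ga A k = Inf S" by (simp add: kth_eigenvalue_def S_def)
 have lowS: "z <= \<sigma>" if \<sigma>: "\<sigma> \<in> S" for \<sigma>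
 proof -
  obtain w where w: "weak_eigenfunction Om ga A \<sigma> w" using \<sigma> unfolding S_def by blast
  hence wH: "w \<in> H1_vanishing Om ga" and wn: "~(AE x in M. w x = 0)"
   and we: "energy Om A w w = \<sigma> * (LINT x|M. w x * w x)" unfolding weak_eigenfunction_def by auto
  have a: "adm Om ga w (weak_gradient Om w)" by (rule adm_weak_gradient[OF wH])
  have "energy Om A w w = en (weak_gradient Om w) (weak_gradient Om w)" by (rule energy_eq) (use a in \<open>auto simp: adm_def\<close>)
  hence "z * sqn M w <= \<sigma> * sqn M w" using low[OF a] we by (simp add: ip_def)
  moreover have "sqn M w > 0" using wn L2_zero_AE[OF adm_L2(1)[OF a]] ip_self_nonneg[of M w] by fastforce
  ultimately show ?thesis by simp
 qed
 have "EX w h \<mu>. ALL i<k. eigenpair (\<mu> i) (w i) (h i) & \<mu> i <= s & (ALL j<k. ip M (w i) (w j) = (if i = j then 1 else 0))"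
  by (rule eigenpairs_exist[OF K, where v = v and q = q and k = k]) (use v in auto)
 then obtain w h \<mu> where w: "!!i. i < k ==> eigenpair (\<mu> i) (w i) (h i)" "!!i. i < k ==> \<mu> i <= s"
  "!!i j. i < k ==> j < k ==> ip M (w i) (w j) = (if i = j then 1 else 0)"
  by blast
 have Lw: "L2 M (w i)" if "i < k" for i using w(1)[OF that] adm_L2 by (auto simp: eigenpair_def)
 have we: "weak_eigenfunction Om ga A (\<mu> i) (w i)" if "i < k" for i
  by (rule eigenpair_weak_eigenfunction[OF w(1)[OF that]]) (use w(3)[OF that that] in simp)
 define \<sigma> where "\<sigma> = Max (\<mu> ` {..<k})"
 have fin: "finite (\<mu> ` {..<k})" "\<mu> ` {..<k} ~= {}" using k by (auto simp: lessThan_empty_iff)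
 have "\<sigma> \<in> \<mu> ` {..<k}" unfolding \<sigma>_def by (rule Max_in[OF fin])
 then obtain m where m: "m < k" "\<sigma> = \<mu> m" by auto
 have ind: "c j = 0" if AE0: "AE x in M. (\<Sum>i<k. c i * w i x) = 0" and j: "j < k" for c j
 proof -
  have "0 = ip M (%x. 0) (w j)" by (simp add: ip_def)
  also have "... = ip M (%x. \<Sum>i<k. c i *R w i x) (w j)"
  proof (rule ip_cong_AE)
   show "AE x in M. (0::real) = (\<Sum>i<k. c i *R w i x)" using AE0 by eventually_elim simp
   show "(%x. \<Sum>i<k. c i *R w i x) \<in> borel_measurable M"
    by (intro L2_measurable L2_sum L2_scaleR Lw) simp
  qed (use L2_measurable[OF Lw[OF j]] in auto)
  also have "... = (\<Sum>i<k. c i * (if i = j then 1 else 0))"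
   by (subst ip_sum_left) (use Lw w(3) j in auto)
  also have "... = c j" by (rule sum_mult_delta[OF j])
  finally show ?thesis by simp
 qed
 have le: "\<mu> i <= \<sigma>" if "i < k" for i unfolding \<sigma>_def using that by (intro Max_ge fin) auto
 have \<sigma>S: "\<sigma> \<in> S"
  unfolding S_def
 proof (intro CollectI conjI exI allI impI)
  show "weak_eigenfunction Om ga A \<sigma> (w m)" using we[OF m(1)] m(2) by simp
  show "\<mu> i <= \<sigma>" "weak_eigenfunction Om ga A (\<mu> i) (w i)" if "i < k" for i using le[OF that] we[OF that] by auto
  show "c j = 0" if "AE x in M. (\<Sum>i<k. c i * w i x) = 0" "j < k" for c j using ind that by blast
 qed
 show "z <= kth_eigenvalue Om ga A k" unfolding keq by (rule cInf_greatest) (use \<sigma>S lowS in auto)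
 have "Inf S <= \<sigma>" by (rule cInf_lower[OF \<sigma>S bdd_belowI[of S z]]) (rule lowS)
 also have "... <= s" using m w(2) by simp
 finally show "kth_eigenvalue Om ga A k <= s" unfolding keq .
qed

end

section \<open>Nonnegative integrals over Euclidean spaces\<close>

lemma nn_integral_pair:
 fixes f :: "'a::euclidean_space \<times> 'b::euclidean_space => ennreal"
 assumes "f \<in> BM"
 shows "(NI x. f x) = (NI x. NI y. f (x, y))"
proof -
 have "f \<in> borel_measurable (lborel \<Otimes>\<^sub>M lborel)" using assms by (simp add: lborel_prod)
 from lborel.nn_integral_fst[OF this] show ?thesis by (simp add: lborel_prod)
qed

lemma nn_integral_pair':
 fixes f :: "'a::euclidean_space \<times> 'b::euclidean_space => ennreal"
 assumes "f \<in> BM"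
 shows "(NI x. f x) = (NI y. NI x. f (x, y))"
proof -
 have "f \<in> borel_measurable (lborel \<Otimes>\<^sub>M lborel)" using assms by (simp add: lborel_prod)
 from lborel_pair.nn_integral_snd[OF this] show ?thesis by (simp add: lborel_prod)
qed

lemma nn_integral_swap:
 fixes f :: "'a::euclidean_space => 'b::euclidean_space => ennreal"
 assumes "(%(x, y). f x y) \<in> borel_measurable (borel \<Otimes>\<^sub>M borel)"
 shows "(NI x. NI y. f x y) = (NI y. NI x. f x y)"
 using nn_integral_pair[of "%(x, y). f x y"] nn_integral_pair'[of "%(x, y). f x y"] assms by (simp add: borel_prod)

lemma nn_integral_affine:
 fixes f :: "'a::euclidean_space => ennreal"
 assumes [measurable]: "f \<in> BM" and "c ~= 0"
 shows "(NI x. f x) = ennreal (\<bar>c\<bar> ^ DIM('a)) * (NI x. f (t + c *R x))"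
 by (subst lborel_affine[OF assms(2), of t])
  (simp add: nn_integral_density nn_integral_distr nn_integral_cmult)

lemma nn_integral_translate:
 fixes f :: "'a::euclidean_space => ennreal"
 assumes [measurable]: "f \<in> BM"
 shows "(NI x. f (x + t)) = (NI x. f x)"
 using nn_integral_affine[OF assms, of 1 t] by (simp add: add.commute)

lemma L2_nn_integral:
 assumes "f \<in> BM" "L2 (lebesgue_on Om) f" "Om \<in> sets borel"
 shows "(NI x. ennreal ((norm (f x))^2) * indicator Om x) = ennreal (sqn (lebesgue_on Om) f)"
proof -
 have "(NI x. ennreal ((norm (f x))^2) * indicator Om x) = (\<integral>\<^sup>+x. ennreal ((norm (f x))^2) \<partial>lebesgue_on Om)"
  using assms by (simp add: nn_integral_restrict_space nn_integral_completion)
 also have "... = ennreal (sqn (lebesgue_on Om) f)"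
  unfolding ip_self by (rule nn_integral_eq_integral[OF L2_norm2_integrable[OF assms(2)]]) simp
 finally show ?thesis .
qed

lemma C1c_nn_integral:
 assumes "C1c u g" "open Om"
 shows "(NI x. ennreal ((u x)^2) * indicator Om x) = ennreal (sqn (lebesgue_on Om) u)"
  "(NI x. ennreal ((norm (g x))^2) * indicator Om x) = ennreal (sqn (lebesgue_on Om) g)"
proof -
 have b: "Om \<in> sets borel" using assms by simp
 have m: "u \<in> BM" "g \<in> BM"
  using assms(1) by (auto simp: C1c_def intro!: bm_cont C1g_cont_fun C1g_cont)
 show "(NI x. ennreal ((u x)^2) * indicator Om x) = ennreal (sqn (lebesgue_on Om) u)"
  using L2_nn_integral[OF m(1) C1c_L2(1)[OF assms(1) b] b] by simp
 show "(NI x. ennreal ((norm (g x))^2) * indicator Om x) = ennreal (sqn (lebesgue_on Om) g)"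
  using L2_nn_integral[OF m(2) C1c_L2(2)[OF assms(1) b] b] .
qed

lemma increment_bound:
 fixes u :: "'a::euclidean_space => real"
 assumes d: "!!s. 0 <= s ==> s <= \<tau> ==> (u has_derivative (%h. g (x + s *R v) \<bullet> h)) (at (x + s *R v))"
  and c: "continuous_on {0..\<tau>} (%s. g (x + s *R v))" and \<tau>: "\<tau> >= 0"
 shows "ennreal ((u (x + \<tau> *R v) - u x)^2) <= ennreal (\<tau> * (norm v)^2) * (NI s. ennreal ((norm (g (x + s *R v)))^2) * indicator {0..\<tau>} s)"
proof -
 let ?F = "%s. u (x + s *R v)" and ?f = "%s. g (x + s *R v) \<bullet> v"
 have der: "(?F has_real_derivative ?f s) (at s)" if "0 <= s" "s <= \<tau>" for s
 proof -
  have "((%s. x + s *R v) has_derivative (%h. h *R v)) (at s)" by (auto intro!: derivative_eq_intros)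
  from has_derivative_compose[OF this d[OF that]] show ?thesis
   by (simp add: has_field_derivative_def mult.commute[of _ "g _ \<bullet> v"])
 qed
 have cf: "continuous_on {0..\<tau>} ?f" by (intro continuous_intros c)
 have ncf: "continuous_on {0..\<tau>} (%s. norm (g (x + s *R v)))" by (intro continuous_intros c)
 define G where "G s = norm (g (x + s *R v)) * indicator {0..\<tau>} s" for s
 have Gm[measurable]: "G \<in> BM"
  using borel_measurable_continuous_on_indicator[OF _ ncf] by (simp add: G_def[abs_def] mult.commute)
 have fi: "integrable lborel (%s. indicator {0..\<tau>} s *R ?f s)"
  by (rule borel_integrable_compact[OF compact_Icc cf])
 have Gi: "integrable lborel G"
  using borel_integrable_compact[OF compact_Icc ncf] by (simp add: G_def[abs_def] mult.commute)
 have ftc: "(LI s. indicator {0..\<tau>} s *R ?f s) = ?F \<tau> - ?F 0"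
  by (rule integral_FTC_Icc[OF \<tau> _ cf])
   (use der in \<open>auto simp: has_real_derivative_iff_has_vector_derivative[symmetric] intro: has_field_derivative_at_within\<close>)
 have "\<bar>?F \<tau> - ?F 0\<bar> <= (LI s. norm v * G s)"
  unfolding ftc[symmetric] real_norm_def[symmetric]
 proof (rule Bochner_Integration.integral_norm_bound_integral[OF fi])
  show "integrable lborel (%s. norm v * G s)" using Gi by simp
  show "norm (indicator {0..\<tau>} s *R ?f s) <= norm v * G s" for s
   using Cauchy_Schwarz_ineq2[of "g (x + s *R v)" v] by (auto simp: G_def indicator_def mult.commute)
 qed
 also have "... = norm v * (LI s. G s)" by simp
 finally have le: "\<bar>u (x + \<tau> *R v) - u x\<bar> <= norm v * (LI s. G s)" by simp
 have G0: "G s >= 0" for s by (simp add: G_def)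
 have I0: "(LI s. G s) >= 0" by (rule integral_nonneg_AE) (simp add: G0)
 have "(u (x + \<tau> *R v) - u x)^2 <= (norm v)^2 * (LI s. G s)^2"
  using power_mono[OF le, of 2] by (simp add: power_mult_distrib)
 hence "ennreal ((u (x + \<tau> *R v) - u x)^2) <= ennreal ((norm v)^2) * (ennreal (LI s. G s))^2"
  using I0 by (simp add: ennreal_mult[symmetric] ennreal_power ennreal_leI)
 also have "ennreal (LI s. G s) = (NI s. ennreal (G s))"
  by (rule nn_integral_eq_integral[symmetric, OF Gi]) (simp add: G0)
 also have "(NI s. ennreal (G s)) = (NI s. ennreal (G s) * indicator {0..\<tau>} s)"
  by (rule nn_integral_cong) (auto simp: G_def indicator_def)
 also have "ennreal ((norm v)^2) * (NI s. ennreal (G s) * indicator {0..\<tau>} s)^2 <= 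
   ennreal ((norm v)^2) * ((NI s. (ennreal (G s))^2) * (NI s. (indicator {0..\<tau>} s)^2))"
  by (intro mult_left_mono Cauchy_Schwarz_nn_integral) auto
 also have "(NI s. (indicator {0..\<tau>} s)^2) = (NI s. indicator {0..\<tau>} s)"
  by (rule nn_integral_cong) (auto simp: indicator_def)
 also have "... = ennreal \<tau>" using \<tau> by simp
 also have "(NI s. (ennreal (G s))^2) = (NI s. ennreal ((norm (g (x + s *R v)))^2) * indicator {0..\<tau>} s)"
  by (rule nn_integral_cong) (auto simp: G_def indicator_def ennreal_power)
 finally show ?thesis using \<tau> by (simp add: ennreal_mult mult_ac)
qed

lemma C1g_increment_bound:
 assumes "C1g u g" "\<tau> >= 0"
 shows "ennreal ((u (x + \<tau> *R v) - u x)^2) <= ennreal (\<tau> * (norm v)^2) * (NI s. ennreal ((norm (g (x + s *R v)))^2) * indicator {0..\<tau>} s)"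
 by (rule increment_bound[OF C1gD[OF assms(1)] _ assms(2)])
  (auto intro!: continuous_on_compose2[OF C1g_cont[OF assms(1)]] continuous_intros)

section \<open>Boundary charts\<close>

lemma Ck_1_C1g:
 assumes "Ck 1 f" obtains g where "C1g f g"
proof -
 have ck: "!!x. f differentiable (at x)" "!!v. contU (%x. frechet_derivative f (at x) v)"
  using assms by auto
 define g where "g x = (\<Sum>b\<in>Basis. frechet_derivative f (at x) b *R b)" for x
 have d: "(f has_derivative frechet_derivative f (at x)) (at x)" for x
  using ck(1) by (simp add: frechet_derivative_works)
 have lin: "linear (frechet_derivative f (at x))" for x using d has_derivative_linear by blast
 have eq: "frechet_derivative f (at x) v = g x \<bullet> v" for x v
 proof -
  have "frechet_derivative f (at x) v = frechet_derivative f (at x) (\<Sum>b\<in>Basis. (v \<bullet> b) *R b)"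
   by (simp add: euclidean_representation)
  also have "... = (\<Sum>b\<in>Basis. (v \<bullet> b) * frechet_derivative f (at x) b)"
   by (simp add: linear_sum[OF lin] linear_scale[OF lin])
  also have "... = g x \<bullet> v"
   unfolding g_def inner_sum_left by (rule sum.cong) (simp_all add: inner_commute mult.commute)
  finally show ?thesis .
 qed
 have "contU g" unfolding g_def by (intro continuous_intros ck(2))
 moreover have "(f has_derivative (%h. g x \<bullet> h)) (at x)" for x
  by (rule has_derivative_eq_rhs[OF d]) (simp add: eq fun_eq_iff)
 ultimately have "C1g f g" unfolding C1g_def by auto
 thus thesis by (rule that)
qed

lemma invariant_gradient:
 assumes "C1g h k" "!!y t. h (y + t *R e) = h y" shows "k y \<bullet> e = 0"
proof -
 have "((%t. y + t *R e) has_derivative (%s. s *R e)) (at 0)" by (auto intro!: derivative_eq_intros)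
 moreover have "(h has_derivative (%v. k y \<bullet> v)) (at (y + 0 *R e))" using C1gD[OF assms(1), of y] by simp
 ultimately have "((%t. h (y + t *R e)) has_derivative (%s. k y \<bullet> (s *R e))) (at 0)" by (rule has_derivative_compose)
 moreover have "((%t::real. h (y + t *R e)) has_derivative (%s. 0)) (at 0)" unfolding assms(2) by simp
 ultimately have "(%s::real. k y \<bullet> (s *R e)) = (%s. 0)" using has_derivative_unique by blast
 hence "k y \<bullet> (1 *R e) = 0" by metis
 thus ?thesis by simp
qed

definition graph_chart :: "'a::euclidean_space set => 'a => real => real => 'a => ('a => real) => ('a => 'a) => 'a => bool" where
 "graph_chart D b r de e h k p \<longleftrightarrow> norm e = 1 & C1g h k & (ALL y t. h (y + t *R e) = h y) &
   D \<inter> ball b r = {y \<in> ball b r. y \<bullet> e < h y} & p \<bullet> e = 0 & (ALL y:ball b r. norm (k y - p) <= de)"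

text \<open>By compactness of the boundary the charts have a uniform size. Balls that miss the boundary
  are covered as well, with a constant function \<open>h\<close>.\<close>

lemma uniform_charts:
 fixes \<omega> :: "'a::euclidean_space set"
 assumes \<omega>: "bounded_C1_domain \<omega>" and de: "de > 0"
 obtains r where "r > 0" "!!b. EX e h k p. graph_chart \<omega> b r de e h k p"
proof -
 have comp: "compact (frontier \<omega>)" using \<omega> by (simp add: bounded_C1_domain_def compact_frontier_bounded)
 define P where "P z r \<longleftrightarrow> r > 0 & (EX e h k p. graph_chart \<omega> z r de e h k p)" for z r
 have loc: "EX r. P z r" if z: "z \<in> frontier \<omega>" for z
 proof -
  have "EX r>0. EX e h. norm e = 1 & Ck 1 h & (ALL y t. h (y + t *R e) = h y) &
   \<omega> \<inter> ball z r = {y \<in> ball z r. y \<bullet> e < h y}"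
   using \<omega> z unfolding bounded_C1_domain_def C1_boundary_def by blast
  then obtain r e h where c: "r > 0" "norm e = 1" "Ck 1 h" "!!y t. h (y + t *R e) = h y"
   "\<omega> \<inter> ball z r = {y \<in> ball z r. y \<bullet> e < h y}" by blast
  obtain k where k: "C1g h k" by (rule Ck_1_C1g[OF c(3)])
  have "isCont k z" using C1g_cont[OF k] by (simp add: continuous_on_eq_continuous_at)
  then obtain d where d: "d > 0" "!!y. dist y z < d ==> dist (k y) (k z) < de"
   using de unfolding continuous_at_eps_delta by blast
  have "\<omega> \<inter> ball z (min r d) = \<omega> \<inter> ball z r \<inter> ball z (min r d)" by auto
  also have "... = {y \<in> ball z (min r d). y \<bullet> e < h y}" unfolding c(5) by auto
  finally have eq: "\<omega> \<inter> ball z (min r d) = {y \<in> ball z (min r d). y \<bullet> e < h y}" .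
  have "graph_chart \<omega> z (min r d) de e h k (k z)"
   unfolding graph_chart_def using c k eq invariant_gradient[OF k c(4)] d(2)
   by (auto simp: dist_norm norm_minus_commute less_imp_le)
  thus ?thesis unfolding P_def using c(1) d(1) by (intro exI[of _ "min r d"]) auto
 qed
 define \<G> where "\<G> = {ball z r | z r. z \<in> frontier \<omega> & P z r}"
 have cov: "frontier \<omega> \<subseteq> \<Union>\<G>"
 proof
  fix z assume z: "z \<in> frontier \<omega>"
  then obtain r where r: "P z r" using loc by blast
  hence "z \<in> ball z r" by (simp add: P_def)
  thus "z \<in> \<Union>\<G>" using z r unfolding \<G>_def by blast
 qed
 obtain ep where ep: "ep > 0" "!!x. x \<in> frontier \<omega> ==> EX G:\<G>. ball x ep \<subseteq> G"
  by (rule Heine_Borel_lemma[OF comp cov]) (auto simp: \<G>_def)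
 show thesis
 proof (rule that)
  show "ep / 2 > 0" using ep by simp
  fix b :: 'a
  show "EX e h k p. graph_chart \<omega> b (ep / 2) de e h k p"
  proof (cases "ball b (ep/2) \<inter> frontier \<omega> = {}")
   case True
   hence c: "ball b (ep/2) \<subseteq> \<omega> \<or> ball b (ep/2) \<inter> \<omega> = {}"
    using connected_Int_frontier[of "ball b (ep/2)" \<omega>] by auto
   obtain e :: 'a where e: "e \<in> Basis" using nonempty_Basis by blast
   have ne: "norm e = 1" using e by simp
   have inn: "\<bar>y \<bullet> e - b \<bullet> e\<bar> < ep" if "y \<in> ball b (ep/2)" for y
   proof -
    have "\<bar>(y - b) \<bullet> e\<bar> <= norm (y - b) * norm e" by (rule Cauchy_Schwarz_ineq2)
    thus ?thesis using that ep(1) ne by (simp add: inner_diff_left dist_norm norm_minus_commute)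
   qed
   define s where "s = (if ball b (ep/2) \<subseteq> \<omega> then b \<bullet> e + ep else b \<bullet> e - ep)"
   have "graph_chart \<omega> b (ep/2) de e (%_. s) (%_. 0) 0"
    unfolding graph_chart_def
   proof (intro conjI)
    show "\<omega> \<inter> ball b (ep/2) = {y \<in> ball b (ep/2). y \<bullet> e < s}"
    proof (cases "ball b (ep/2) \<subseteq> \<omega>")
     case True
     have "y \<bullet> e < s" if "y \<in> ball b (ep/2)" for y using inn[OF that] True by (simp add: s_def)
     thus ?thesis using True by blast
    next
     case False
     have "~y \<bullet> e < s" if "y \<in> ball b (ep/2)" for y using inn[OF that] False by (simp add: s_def)
     thus ?thesis using False c by blast
    qed
   qed (use ne de C1g_const in auto)
   thus ?thesis by blast
  next
   case False
   then obtain x where x: "x \<in> ball b (ep/2)" "x \<in> frontier \<omega>" by blast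
   obtain z r where zr: "P z r" "ball x ep \<subseteq> ball z r" using ep(2)[OF x(2)] unfolding \<G>_def by blast
   have sub: "ball b (ep/2) \<subseteq> ball z r"
   proof
    fix y assume "y \<in> ball b (ep/2)"
    hence "dist x y < ep" using x(1) dist_triangle_half_l[of x b ep y] by (simp add: dist_commute)
    thus "y \<in> ball z r" using zr(2) by auto
   qed
   obtain e h k p where gc: "graph_chart \<omega> z r de e h k p" using zr(1) unfolding P_def by blast
   have "\<omega> \<inter> ball b (ep/2) = \<omega> \<inter> ball z r \<inter> ball b (ep/2)" using sub by blast
   also have "... = {y \<in> ball b (ep/2). y \<bullet> e < h y}" using gc sub unfolding graph_chart_def by blast
   finally have "graph_chart \<omega> b (ep/2) de e h k p" using gc sub unfolding graph_chart_def by blast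
   thus ?thesis by blast
  qed
 qed
qed

lemma graph_chart_scale:
 assumes "graph_chart \<omega> b r de e h k p" and l: "l > 0"
 shows "graph_chart ((*\<^sub>R) l ` \<omega>) (l *R b) (l * r) de e (%y. l * h ((1/l) *R y)) (%y. k ((1/l) *R y)) p"
proof -
 have c: "norm e = 1" "C1g h k" "!!y t. h (y + t *R e) = h y" "\<omega> \<inter> ball b r = {y \<in> ball b r. y \<bullet> e < h y}" 
  "p \<bullet> e = 0" "!!y. y \<in> ball b r ==> norm (k y - p) <= de"
  using assms(1) unfolding graph_chart_def by auto
 have ball: "(1/l) *R y \<in> ball b r \<longleftrightarrow> y \<in> ball (l *R b) (l * r)" for y
 proof -
  have "norm (l *R b - y) = l * norm (b - (1/l) *R y)"
   using l norm_scaleR[of l "b - (1/l) *R y"] by (simp add: scaleR_diff_right)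
  thus ?thesis using l by (simp add: dist_norm)
 qed
 have im: "y \<in> (*\<^sub>R) l ` \<omega> \<longleftrightarrow> (1/l) *R y \<in> \<omega>" for y
  using l by (auto simp: image_iff intro: bexI[of _ "(1/l) *R y"])
 show ?thesis
  unfolding graph_chart_def
 proof (intro conjI allI ballI c(1) c(5))
  have "C1g (%y. h ((1/l) *R y)) (%y. (1/l) *R k ((1/l) *R y))"
   by (rule C1g_comp[OF c(2), where T' = "%_ v. (1/l) *R v"])
    (auto intro!: derivative_eq_intros continuous_intros continuous_on_compose2[OF C1g_cont[OF c(2)]])
  from C1g_scale[OF this, of l] show "C1g (%y. l * h ((1/l) *R y)) (%y. k ((1/l) *R y))"
   using l by simp
  show "l * h ((1/l) *R (y + t *R e)) = l * h ((1/l) *R y)" for y t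
   using c(3)[of "(1/l) *R y" "t / l"] by (simp add: scaleR_add_right)
  show "norm (k ((1/l) *R y) - p) <= de" if "y \<in> ball (l *R b) (l * r)" for y
   using c(6) ball that by blast
  have "y \<in> (*\<^sub>R) l ` \<omega> \<longleftrightarrow> y \<bullet> e < l * h ((1/l) *R y)" if "y \<in> ball (l *R b) (l * r)" for y
  proof -
   have "(1/l) *R y \<in> \<omega> \<longleftrightarrow> (1/l) *R y \<bullet> e < h ((1/l) *R y)" using c(4) ball that by blast
   thus ?thesis using im l by (simp add: field_simps)
  qed
  thus "(*\<^sub>R) l ` \<omega> \<inter> ball (l *R b) (l * r) = {y \<in> ball (l *R b) (l * r). y \<bullet> e < l * h ((1/l) *R y)}"
   by blast
 qed
qed

section \<open>Mass near the boundary\<close>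

text \<open>The layer is shifted into the domain against \<open>e\<close>; averaging over the shifts in \<open>[0, T]\<close> gives the
  factor \<open>d / T\<close>.\<close>

lemma boundary_layer:
 fixes u :: "'m::euclidean_space \<times> 'p::euclidean_space => real"
 assumes u: "C1g u g" and D: "open D" and \<omega>2: "open \<omega>2"
  and gc: "graph_chart D b r de e h k p" and T: "0 < T" "T <= r / 4" and d: "d > 0"
  and L: "L = {y \<in> D \<inter> ball b (r/2). h y - d <= y \<bullet> e}"
 shows "(NI x. ennreal ((u x)^2) * indicator (L \<times> \<omega>2) x) <= 
   ennreal (2 * d / T) * (NI x. ennreal ((u x)^2) * indicator (D \<times> \<omega>2) x) +
   ennreal (2 * T^2) * (NI x. ennreal ((norm (g x))^2) * indicator (D \<times> \<omega>2) x)"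
proof -
 have c: "norm e = 1" "C1g h k" "!!y t. h (y + t *R e) = h y" "D \<inter> ball b r = {y \<in> ball b r. y \<bullet> e < h y}"
  using gc unfolding graph_chart_def by auto
 define E where "E = (e, 0 :: 'p)"
 have nE: "norm E = 1" using c(1) by (simp add: E_def norm_Pair)
 have [measurable]: "u \<in> BM" "g \<in> BM" "h \<in> BM"
  using u c(2) by (auto intro!: bm_cont C1g_cont_fun C1g_cont)
 have [measurable]: "D \<in> sets borel" "\<omega>2 \<in> sets borel" using D \<omega>2 by auto
 have L'[measurable]: "L \<in> sets borel" unfolding L by measurable
 have DO[measurable]: "D \<times> \<omega>2 \<in> sets borel" "L \<times> \<omega>2 \<in> sets borel"
  unfolding borel_prod[symmetric] by (intro pair_measureI; measurable)+
 have e1: "e \<bullet> e = 1" using c(1) by (simp add: dot_square_norm)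
 have inD: "x - s *R E \<in> D \<times> \<omega>2" "h (fst (x - s *R E)) - d <= fst (x - s *R E) \<bullet> e + s" "fst (x - s *R E) \<bullet> e + s < h (fst (x - s *R E))"
  if xL: "x \<in> L \<times> \<omega>2" and sT: "s \<in> {0..T}" for x s
 proof -
  obtain y \<xi> where x: "x = (y, \<xi>)" "y \<in> L" "\<xi> \<in> \<omega>2" using xL by auto
  have hy: "h (y - s *R e) = h y" using c(3)[of y "-s"] by simp
  have yL: "y \<in> D" "dist b y < r/2" "h y - d <= y \<bullet> e" using x(2) unfolding L by simp_all
  hence "y \<in> ball b r" using T by simp
  with yL(1) c(4) have yb: "y \<in> ball b r" "y \<bullet> e < h y" by blast+
  have "dist b (y - s *R e) <= dist b y + dist y (y - s *R e)" by (rule dist_triangle)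
  also have "dist y (y - s *R e) = s" using sT c(1) by (simp add: dist_norm)
  also have "dist b y + s < r/2 + r/2" using yL(2) sT T by auto
  finally have "y - s *R e \<in> ball b r" by simp
  moreover have "(y - s *R e) \<bullet> e < h (y - s *R e)" using yb(2) sT by (simp add: hy inner_diff_left e1)
  ultimately have "y - s *R e \<in> D" using c(4) by blast
  thus "x - s *R E \<in> D \<times> \<omega>2" "h (fst (x - s *R E)) - d <= fst (x - s *R E) \<bullet> e + s" "fst (x - s *R E) \<bullet> e + s < h (fst (x - s *R E))"
   using x yb hy yL by (auto simp: E_def inner_diff_left e1)
 qed
 let ?U = "%x. ennreal ((u x)^2)" and ?G = "%x. ennreal ((norm (g x))^2)"
 let ?I = "%s::real. indicator {0..T} s :: ennreal"
 have pt: "ennreal T * ?U x <= 2 * (NI s. ?U (x - s *R E) * ?I s) + ennreal (2 * T^2) * (NI s. ?G (x - s *R E) * ?I s)" for x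
 proof -
  define J where "J = (NI s. ?G (x - s *R E) * ?I s)"
  have "?U x <= 2 * ?U (x - \<tau> *R E) + ennreal (2 * T) * J" if \<tau>: "\<tau> \<in> {0..T}" for \<tau>
  proof -
   have "ennreal ((u (x + \<tau> *R (-E)) - u x)^2) <= ennreal (\<tau> * (norm (-E))^2) * (NI s. ?G (x + s *R (-E)) * indicator {0..\<tau>} s)"
    by (rule C1g_increment_bound[OF u]) (use \<tau> in auto)
   also have "... <= ennreal T * J"
    unfolding J_def by (rule mult_mono) (use \<tau> nE in \<open>auto intro!: nn_integral_mono ennreal_leI simp: indicator_def\<close>)
   finally have 1: "ennreal ((u (x - \<tau> *R E) - u x)^2) <= ennreal T * J" by simp
   have "(u x)^2 <= 2 * (u (x - \<tau> *R E))^2 + 2 * (u (x - \<tau> *R E) - u x)^2"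
    using norm_add_square_le[of "u (x - \<tau> *R E)" "- (u (x - \<tau> *R E) - u x)"]
    by (simp add: power2_commute[of "u x"])
   hence "?U x <= ennreal (2 * (u (x - \<tau> *R E))^2 + 2 * (u (x - \<tau> *R E) - u x)^2)" by (rule ennreal_leI)
   also have "... = 2 * ?U (x - \<tau> *R E) + 2 * ennreal ((u (x - \<tau> *R E) - u x)^2)"
    by (simp add: ennreal_mult)
   also have "... <= 2 * ?U (x - \<tau> *R E) + 2 * (ennreal T * J)"
    by (intro add_left_mono mult_left_mono 1) auto
   also have "2 * (ennreal T * J) = ennreal (2 * T) * J" using T by (simp add: ennreal_mult mult.assoc)
   finally show ?thesis .
  qed
  hence "(NI \<tau>. ?U x * ?I \<tau>) <= (NI \<tau>. (2 * ?U (x - \<tau> *R E) + ennreal (2 * T) * J) * ?I \<tau>)"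
   by (intro nn_integral_mono) (auto simp: indicator_def)
  also have "... = (NI \<tau>. 2 * (?U (x - \<tau> *R E) * ?I \<tau>) + ennreal (2 * T) * J * ?I \<tau>)"
   by (intro nn_integral_cong) (simp add: distrib_right mult.assoc)
  also have "... = 2 * (NI \<tau>. ?U (x - \<tau> *R E) * ?I \<tau>) + ennreal (2 * T) * J * ennreal T"
   using T by (subst nn_integral_add) (auto simp: nn_integral_cmult)
  also have "ennreal (2 * T) * J * ennreal T = ennreal (2 * T^2) * J"
   using T by (simp add: mult.commute[of _ J] mult.assoc ennreal_mult[symmetric] power2_eq_square)
  also have "(NI \<tau>. ?U x * ?I \<tau>) = ennreal T * ?U x"
   using T by (subst nn_integral_cmult) (auto simp: mult.commute)
  finally show ?thesis by (simp add: J_def)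
 qed
 let ?L = "%x. indicator (L \<times> \<omega>2) x :: ennreal" and ?D = "%x. indicator (D \<times> \<omega>2) x :: ennreal"
 have shift: "(NI x. (NI s. F (x - s *R E) * ?I s) * ?L x) = 
   (NI x. F x * (NI s. ?I s * ?L (x + s *R E)))" if [measurable]: "F \<in> BM" for F
 proof -
  have "(NI x. (NI s. F (x - s *R E) * ?I s) * ?L x) = (NI x. (NI s. F (x - s *R E) * ?I s * ?L x))"
   by (intro nn_integral_cong nn_integral_multc[symmetric]) measurable
  also have "... = (NI s. (NI x. F (x - s *R E) * ?I s * ?L x))"
   by (rule nn_integral_swap) measurable
  also have "... = (NI s. (NI x. F x * ?I s * ?L (x + s *R E)))"
  proof (rule nn_integral_cong)
   fix s
   have [measurable]: "(%x. F (x - s *R E) * ?I s * ?L x) \<in> BM" by measurable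
   show "(NI x. F (x - s *R E) * ?I s * ?L x) = (NI x. F x * ?I s * ?L (x + s *R E))"
    using nn_integral_translate[of "%x. F (x - s *R E) * ?I s * ?L x" "s *R E"] by simp
  qed
  also have "... = (NI x. (NI s. F x * ?I s * ?L (x + s *R E)))"
   by (rule nn_integral_swap) measurable
  also have "... = (NI x. F x * (NI s. ?I s * ?L (x + s *R E)))"
   by (intro nn_integral_cong) (simp add: mult.assoc nn_integral_cmult)
  finally show ?thesis .
 qed
 have in1: "(NI s. ?I s * ?L (x + s *R E)) <= ennreal d * ?D x" for x
 proof -
  define a where "a = h (fst x) - d - fst x \<bullet> e"
  have "?I s * ?L (x + s *R E) <= indicator {a..a+d} s * ?D x" for s
   using inD[of "x + s *R E" s] by (auto simp: indicator_def a_def)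
  hence "(NI s. ?I s * ?L (x + s *R E)) <= (NI s. indicator {a..a+d} s * ?D x)"
   by (intro nn_integral_mono)
  also have "... = ennreal d * ?D x" using d by (simp add: nn_integral_multc)
  finally show ?thesis .
 qed
 have in2: "(NI s. ?I s * ?L (x + s *R E)) <= ennreal T * ?D x" for x
 proof -
  have "?I s * ?L (x + s *R E) <= ?I s * ?D x" for s
   using inD[of "x + s *R E" s] by (auto simp: indicator_def)
  hence "(NI s. ?I s * ?L (x + s *R E)) <= (NI s. ?I s * ?D x)"
   by (intro nn_integral_mono)
  also have "... = ennreal T * ?D x" using T by (simp add: nn_integral_multc)
  finally show ?thesis .
 qed
 have "ennreal T * (NI x. ?U x * ?L x) = (NI x. ennreal T * ?U x * ?L x)"
  by (subst nn_integral_cmult[symmetric]) (auto simp: mult.assoc)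
 also have "... <= (NI x. (2 * (NI s. ?U (x - s *R E) * ?I s) + ennreal (2 * T^2) * (NI s. ?G (x - s *R E) * ?I s)) * ?L x)"
  by (intro nn_integral_mono mult_right_mono pt) auto
 also have "... = (NI x. 2 * ((NI s. ?U (x - s *R E) * ?I s) * ?L x) + ennreal (2 * T^2) * ((NI s. ?G (x - s *R E) * ?I s) * ?L x))"
  by (intro nn_integral_cong) (simp add: distrib_right mult.assoc)
 also have "... = 2 * (NI x. (NI s. ?U (x - s *R E) * ?I s) * ?L x) + ennreal (2 * T^2) * (NI x. (NI s. ?G (x - s *R E) * ?I s) * ?L x)"
  by (subst nn_integral_add) (auto simp: nn_integral_cmult)
 also have "... = 2 * (NI x. ?U x * (NI s. ?I s * ?L (x + s *R E))) + ennreal (2 * T^2) * (NI x. ?G x * (NI s. ?I s * ?L (x + s *R E)))"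
  by (subst (1 2) shift) auto
 also have "... <= 2 * (NI x. ?U x * (ennreal d * ?D x)) + ennreal (2 * T^2) * (NI x. ?G x * (ennreal T * ?D x))"
  by (intro add_mono mult_left_mono nn_integral_mono in1 in2) auto
 also have "(NI x. ?U x * (ennreal d * ?D x)) = ennreal d * (NI x. ?U x * ?D x)"
  by (subst nn_integral_cmult[symmetric]) (auto simp: mult_ac)
 also have "(NI x. ?G x * (ennreal T * ?D x)) = ennreal T * (NI x. ?G x * ?D x)"
  by (subst nn_integral_cmult[symmetric]) (auto simp: mult_ac)
 finally have fin: "ennreal T * (NI x. ?U x * ?L x) <= 2 * (ennreal d * (NI x. ?U x * ?D x)) + ennreal (2 * T^2) * (ennreal T * (NI x. ?G x * ?D x))" .
 have "(NI x. ?U x * ?L x) = ennreal (1/T) * (ennreal T * (NI x. ?U x * ?L x))"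
  using T by (simp add: mult.assoc[symmetric] ennreal_mult[symmetric])
 also have "... <= ennreal (1/T) * (2 * (ennreal d * (NI x. ?U x * ?D x)) + ennreal (2 * T^2) * (ennreal T * (NI x. ?G x * ?D x)))"
  by (intro mult_left_mono fin) auto
 also have "... = ennreal (2 * d / T) * (NI x. ?U x * ?D x) + ennreal (2 * T^2) * (NI x. ?G x * ?D x)"
 proof -
  have "ennreal (1/T) * (2 * (ennreal d * A)) = ennreal (2 * d / T) * A" for A
   using T d by (simp add: mult.assoc[symmetric] ennreal_mult[symmetric] ennreal_numeral[symmetric] del: ennreal_numeral)
  moreover have "ennreal (1/T) * (ennreal (2 * T^2) * (ennreal T * A)) = ennreal (2 * T^2) * A" for A
   using T by (simp add: mult.assoc[symmetric] ennreal_mult[symmetric])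
  ultimately show ?thesis by (simp only: distrib_left)
 qed
 finally show ?thesis .
qed

section \<open>Poincare inequality on small convex sets\<close>

lemma convex_poincare:
 fixes u :: "'a::euclidean_space => real"
 assumes S: "convex S" "S \<in> sets borel" "bounded S"
  and diam: "!!x y. x \<in> S ==> y \<in> S ==> norm (x - y) <= de"
  and d: "!!x. x \<in> S ==> (u has_derivative (%h. g x \<bullet> h)) (at x)" and cg: "continuous_on S g"
  and m: "u \<in> BM" "g \<in> BM" and bd: "!!x. \<bar>u x\<bar> <= B"
 shows "ennreal (2 * (measure lborel S * (LI x. indicator S x * (u x)^2) - (LI x. indicator S x * u x)^2)) <= 
  ennreal (de^2 * 2 ^ DIM('a) * measure lborel S) * (NI x. ennreal ((norm (g x))^2) * indicator S x)"
proof -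
 note [measurable] = S(2) m
 define I :: "'a => ennreal" where "I x = indicator S x" for x
 have [measurable]: "I \<in> BM" unfolding I_def by measurable
 have fin: "emeasure lborel S < \<infinity>" using S(3) by (rule emeasure_bounded_finite)
 define mu where "mu = measure lborel S"
 have emu: "emeasure lborel S = ennreal mu" using fin by (simp add: mu_def emeasure_eq_ennreal_measure)
 have mu0: "mu >= 0" by (simp add: mu_def)
 have iS: "integrable lborel (%x. indicator S x * (B' :: real))" for B' using fin by simp
 have B0: "B >= 0" using bd[of 0] by linarith
 have i1: "integrable lborel (%x. indicator S x * u x)"
  by (rule Bochner_Integration.integrable_bound[OF iS[of B]]) (use bd B0 in \<open>auto simp: indicator_def\<close>)
 have sq: "(u x)^2 <= B^2" for x using power_mono[OF bd[of x], of 2] by simp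
 have i2: "integrable lborel (%x. indicator S x * (u x)^2)"
  by (rule Bochner_Integration.integrable_bound[OF iS[of "B^2"]]) (use sq in \<open>auto simp: indicator_def\<close>)
 have i0: "integrable lborel (indicator S :: 'a => real)" using fin by simp
 define U where "U = (LI x. indicator S x * u x)"
 define Q where "Q = (LI x. indicator S x * (u x)^2)"
 define G where "G x = ennreal ((norm (g x))^2) * I x" for x
 have [measurable]: "G \<in> BM" unfolding G_def by measurable
 have eq: "indicator S y * (u x - u y)^2 = (u x)^2 * indicator S y - 2 * u x * (indicator S y * u y) + indicator S y * (u y)^2" for x y
  by (simp add: power2_diff algebra_simps)
 define q where "q x = mu * (u x)^2 - 2 * u x * U + Q" for x
 have q: "(LI y. indicator S y * (u x - u y)^2) = q x" for x
  unfolding eq using i0 i1 i2 by (simp add: q_def U_def Q_def mu_def)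
 have q0: "0 <= q x" for x unfolding q[symmetric] by (rule integral_nonneg_AE) simp
 have J1: "(NI y. ennreal ((u x - u y)^2) * I y) = ennreal (q x)" for x
 proof -
  have "(NI y. ennreal ((u x - u y)^2) * I y) = (NI y. ennreal (indicator S y * (u x - u y)^2))"
   by (rule nn_integral_cong) (simp add: I_def indicator_def)
  also have "... = ennreal (LI y. indicator S y * (u x - u y)^2)"
   by (rule nn_integral_eq_integral) (unfold eq, use i0 i1 i2 in auto, simp add: eq[symmetric])
  finally show ?thesis unfolding q .
 qed
 have J2: "(NI x. (NI y. ennreal ((u x - u y)^2) * I y) * I x) = ennreal (2 * (mu * Q - U^2))"
 proof -
  have eq: "indicator S x * q x = mu * (indicator S x * (u x)^2) - 2 * U * (indicator S x * u x) + Q * indicator S x" for x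
   by (simp add: q_def algebra_simps)
  have i: "integrable lborel (%x. indicator S x * q x)" unfolding eq using i0 i1 i2 by auto
  have "(NI x. (NI y. ennreal ((u x - u y)^2) * I y) * I x) = (NI x. ennreal (indicator S x * q x))"
   unfolding J1 by (rule nn_integral_cong) (simp add: I_def indicator_def)
  also have "... = ennreal (LI x. indicator S x * q x)"
   by (rule nn_integral_eq_integral[OF i]) (use q0 in auto)
  also have "(LI x. indicator S x * q x) = 2 * (mu * Q - U^2)"
   unfolding eq using i0 i1 i2 by (simp add: U_def Q_def mu_def power2_eq_square)
  finally show ?thesis .
 qed
 define mid where "mid x y = y + 1 *R ((1/2) *R (x - y))" for x y :: 'a
 have midsym: "mid x y = mid y x" for x y unfolding mid_def by (simp add: algebra_simps flip: scaleR_add_left)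
 define H where "H x y = ennreal ((u (mid x y) - u y)^2) * I y * I x" for x y
 have [measurable]: "(%(x, y). H x y) \<in> borel_measurable (borel \<Otimes>\<^sub>M borel)" unfolding H_def mid_def by measurable
 have H1: "ennreal ((u x - u y)^2) * I y * I x <= 2 * H y x + 2 * H x y" for x y
 proof -
  have "(u x - u y)^2 <= 2 * (u (mid y x) - u x)^2 + 2 * (u (mid x y) - u y)^2"
   using norm_add_square_le[of "- (u (mid y x) - u x)" "u (mid x y) - u y"] by (simp add: midsym[of y x] power2_commute)
  hence "ennreal ((u x - u y)^2) <= ennreal (2 * (u (mid y x) - u x)^2 + 2 * (u (mid x y) - u y)^2)" by (rule ennreal_leI)
  also have "... = 2 * ennreal ((u (mid y x) - u x)^2) + 2 * ennreal ((u (mid x y) - u y)^2)" by (simp add: ennreal_mult)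
  finally have "ennreal ((u x - u y)^2) * (I y * I x) <= (2 * ennreal ((u (mid y x) - u x)^2) + 2 * ennreal ((u (mid x y) - u y)^2)) * (I y * I x)"
   by (rule mult_right_mono) simp
  thus ?thesis by (simp add: H_def distrib_left distrib_right mult_ac)
 qed
 let ?I1 = "%s::real. indicator {0..1} s :: ennreal"
 have H2: "H x y <= ennreal (de^2 / 4) * (NI s. G (y + s *R ((1/2) *R (x - y))) * ?I1 s) * I x" for x y
 proof (cases "x \<in> S & y \<in> S")
  case True
  let ?v = "(1/2) *R (x - y)"
  have inS: "y + s *R ?v \<in> S" if "0 <= s" "s <= 1" for s
  proof -
   have "y + s *R ?v = (1 - s/2) *R y + (s/2) *R x" by (simp add: algebra_simps)
   thus ?thesis using convexD[OF S(1), of y x "1 - s/2" "s/2"] True that by auto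
  qed
  have "ennreal ((u (y + 1 *R ?v) - u y)^2) <= ennreal (1 * (norm ?v)^2) * (NI s. ennreal ((norm (g (y + s *R ?v)))^2) * indicator {0..1} s)"
  proof (rule increment_bound)
   show "continuous_on {0..1} (%s. g (y + s *R ?v))"
    by (rule continuous_on_compose2[OF cg]) (use inS in \<open>auto intro!: continuous_intros\<close>)
  qed (use inS d in auto)
  also have "(NI s. ennreal ((norm (g (y + s *R ?v)))^2) * indicator {0..1} s) = (NI s. G (y + s *R ?v) * ?I1 s)"
   by (rule nn_integral_cong) (use inS in \<open>auto simp: G_def I_def indicator_def\<close>)
  also have "ennreal (1 * (norm ?v)^2) <= ennreal (de^2 / 4)"
  proof (rule ennreal_leI)
   have "(norm (x - y))^2 <= de^2" using diam True by (intro power_mono) auto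
   thus "1 * (norm ?v)^2 <= de^2 / 4" by (simp add: power_divide)
  qed
  finally have *: "ennreal ((u (y + 1 *R ?v) - u y)^2) <= ennreal (de^2 / 4) * (NI s. G (y + s *R ?v) * ?I1 s)"
   by (simp add: mult_right_mono)
  have "I x = 1" "I y = 1" using True by (auto simp: I_def)
  thus ?thesis using * by (simp add: H_def mid_def)
 next
  case False
  hence "H x y = 0" by (auto simp: H_def I_def)
  thus ?thesis by simp
 qed
 let ?G = "%x y s. G (y + s *R ((1/2) *R (x - y)))"
 define GG where "GG = (NI x. G x)"
 have Hint: "(NI x. NI y. H x y) <= ennreal (de^2 / 4) * (ennreal (2 ^ DIM('a)) * ennreal mu * GG)"
 proof -
  have inner: "(NI y. ?G x y s * ?I1 s) <= ennreal (2 ^ DIM('a)) * GG * ?I1 s" for s x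
  proof (cases "s \<in> {0..1}")
   case True
   define c where "c = 1 - s / 2"
   have c: "c >= 1/2" "c ~= 0" using True by (auto simp: c_def)
   have "y + s *R ((1/2) *R (x - y)) = (s/2) *R x + c *R y" for y by (simp add: c_def algebra_simps)
   hence "(NI y. ?G x y s * ?I1 s) = (NI y. G ((s/2) *R x + c *R y))"
    using True by simp
   also have "... = 1 * (NI y. G ((s/2) *R x + c *R y))" by simp
   also have "... <= (ennreal (2 ^ DIM('a)) * ennreal (\<bar>c\<bar> ^ DIM('a))) * (NI y. G ((s/2) *R x + c *R y))"
   proof (rule mult_right_mono)
    have "1 <= (2 * c) ^ DIM('a)" using c by (intro one_le_power) auto
    also have "... = 2 ^ DIM('a) * \<bar>c\<bar> ^ DIM('a)" using c by (simp add: power_mult_distrib)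
    finally have "ennreal 1 <= ennreal (2 ^ DIM('a) * \<bar>c\<bar> ^ DIM('a))" by (rule ennreal_leI)
    also have "... = ennreal (2 ^ DIM('a)) * ennreal (\<bar>c\<bar> ^ DIM('a))" by (rule ennreal_mult) auto
    finally show "1 <= ennreal (2 ^ DIM('a)) * ennreal (\<bar>c\<bar> ^ DIM('a))" by simp
   qed simp
   also have "... = ennreal (2 ^ DIM('a)) * GG"
    unfolding GG_def by (subst nn_integral_affine[OF _ c(2), of G "(s/2) *R x"]) (auto simp: mult.assoc)
   finally show ?thesis using True by simp
  qed simp
  have "(NI x. NI y. H x y) <= 
    (NI x. NI y. ennreal (de^2 / 4) * (NI s. ?G x y s * ?I1 s) * I x)"
   by (intro nn_integral_mono H2)
  also have "... = (NI x. ennreal (de^2 / 4) * ((NI y. NI s. ?G x y s * ?I1 s) * I x))"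
  proof (rule nn_integral_cong)
   fix x :: 'a
   have "(%(y, s). ?G x y s * ?I1 s) \<in> borel_measurable (borel \<Otimes>\<^sub>M lborel)" by measurable
   from lborel.borel_measurable_nn_integral[OF this]
   have [measurable]: "(%y. NI s. ?G x y s * ?I1 s) \<in> BM" .
   show "(NI y. ennreal (de^2 / 4) * (NI s. ?G x y s * ?I1 s) * I x) =
    ennreal (de^2 / 4) * ((NI y. NI s. ?G x y s * ?I1 s) * I x)"
    by (subst nn_integral_multc, measurable, subst nn_integral_cmult, measurable) (rule mult.assoc)
  qed
  also have "... = (NI x. ennreal (de^2 / 4) * ((NI s. NI y. ?G x y s * ?I1 s) * I x))"
   by (intro nn_integral_cong, subst nn_integral_swap) auto
  also have "... <= (NI x. ennreal (de^2 / 4) * ((NI s. ennreal (2 ^ DIM('a)) * GG * ?I1 s) * I x))"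
   by (intro nn_integral_mono mult_left_mono mult_right_mono inner) auto
  also have "... = (NI x. ennreal (de^2 / 4) * (ennreal (2 ^ DIM('a)) * GG) * I x)"
   by (subst nn_integral_cmult) (auto simp: mult.assoc)
  also have "... = ennreal (de^2 / 4) * (ennreal (2 ^ DIM('a)) * GG) * ennreal mu"
  proof -
   have "(NI x. I x) = ennreal mu" unfolding I_def by (simp add: emu)
   thus ?thesis by (subst nn_integral_cmult) auto
  qed
  finally show ?thesis by (simp add: mult_ac)
 qed
 have "ennreal (2 * (mu * Q - U^2)) = (NI x. (NI y. ennreal ((u x - u y)^2) * I y * I x))"
  unfolding J2[symmetric] by (intro nn_integral_cong nn_integral_multc[symmetric]) measurable
 also have "... <= (NI x. (NI y. 2 * H y x + 2 * H x y))"
  by (intro nn_integral_mono H1)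
 also have "... = 2 * (NI x. NI y. H y x) + 2 * (NI x. NI y. H x y)"
 proof -
  have [measurable]: "(%(x, y). H y x) \<in> borel_measurable (borel \<Otimes>\<^sub>M borel)" unfolding H_def mid_def by measurable
  have [measurable]: "(%y. H x y) \<in> BM" "(%y. H y x) \<in> BM" for x unfolding H_def mid_def by measurable
  have "(NI y. 2 * H y x + 2 * H x y) = 2 * (NI y. H y x) + 2 * (NI y. H x y)" for x
   by (subst nn_integral_add) (auto simp: nn_integral_cmult)
  thus ?thesis by (simp, subst nn_integral_add) (auto simp: nn_integral_cmult)
 qed
 also have "(NI x. NI y. H y x) = (NI x. NI y. H x y)"
  by (rule nn_integral_swap) (unfold H_def mid_def, measurable)
 also have "2 * (NI x. NI y. H x y) + 2 * (NI x. NI y. H x y) <= 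
   4 * (ennreal (de^2 / 4) * (ennreal (2 ^ DIM('a)) * ennreal mu * GG))"
  using mult_left_mono[OF Hint, of 4] by (simp add: distrib_right[symmetric])
 also have "... = ennreal (de^2 * 2 ^ DIM('a) * mu) * GG"
 proof -
  have "4 * (ennreal (de^2 / 4) * (ennreal (2 ^ DIM('a)) * ennreal mu * GG)) = (ennreal 4 * ennreal (de^2 / 4) * ennreal (2 ^ DIM('a)) * ennreal mu) * GG"
   by (simp add: mult.assoc)
  also have "ennreal 4 * ennreal (de^2 / 4) * ennreal (2 ^ DIM('a)) * ennreal mu = ennreal (4 * (de^2 / 4) * 2 ^ DIM('a) * mu)"
   using mu0 by (simp only: ennreal_mult[symmetric] zero_le_power2 zero_le_numeral divide_nonneg_nonneg zero_le_power mult_nonneg_nonneg)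
  finally show ?thesis by simp
 qed
 finally show ?thesis unfolding GG_def G_def I_def mu_def Q_def U_def .
qed

section \<open>Grids\<close>

definition grid_index :: "real => 'a::euclidean_space => 'a" where
 "grid_index s x = (\<Sum>i\<in>Basis. real_of_int \<lfloor>(x \<bullet> i) / s\<rfloor> *R i)"

definition grid_cell :: "real => 'a::euclidean_space => 'a set" where
 "grid_cell s z = {x. ALL i:Basis. s * (z \<bullet> i) <= x \<bullet> i & x \<bullet> i < s * (z \<bullet> i + 1)}"

lemma grid_index_inner: "i \<in> Basis ==> grid_index s x \<bullet> i = real_of_int \<lfloor>(x \<bullet> i) / s\<rfloor>"
 unfolding grid_index_def by (simp add: inner_sum_left inner_Basis if_distrib sum.delta cong: if_cong)

lemma grid_cell_mem:
 assumes "s > 0" shows "x \<in> grid_cell s (grid_index s x)"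
 using assms by (auto simp: grid_cell_def grid_index_inner) 
  (metis floor_divide_lower mult.commute, metis floor_divide_upper mult.commute)

lemma grid_cell_unique:
 assumes "s > 0" "x \<in> grid_cell s (grid_index s y)" shows "grid_index s x = grid_index s y"
proof (rule euclidean_eqI)
 fix i :: 'a assume i: "i \<in> Basis"
 have "s * real_of_int \<lfloor>y \<bullet> i / s\<rfloor> <= x \<bullet> i" "x \<bullet> i < s * (real_of_int \<lfloor>y \<bullet> i / s\<rfloor> + 1)"
  using assms(2) i by (auto simp: grid_cell_def grid_index_inner)
 hence "\<lfloor>x \<bullet> i / s\<rfloor> = \<lfloor>y \<bullet> i / s\<rfloor>"
  using assms(1) by (intro floor_unique) (auto simp: field_simps)
 thus "grid_index s x \<bullet> i = grid_index s y \<bullet> i" using i by (simp add: grid_index_inner)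
qed

lemma grid_cell_convex: "convex (grid_cell s z)"
proof -
 have "grid_cell s z = (\<Inter>i\<in>Basis. {x. s * (z \<bullet> i) <= i \<bullet> x} \<inter> {x. i \<bullet> x < s * (z \<bullet> i + 1)})"
  by (auto simp: grid_cell_def inner_commute)
 thus ?thesis by (auto intro!: convex_INT convex_Int convex_halfspace_lt convex_halfspace_ge)
qed

lemma grid_cell_diam:
 fixes x y :: "'a::euclidean_space"
 assumes "x \<in> grid_cell s z" "y \<in> grid_cell s z"
 shows "norm (x - y) <= s * DIM('a)"
proof -
 have "norm (x - y) <= (\<Sum>i\<in>Basis. \<bar>(x - y) \<bullet> i\<bar>)" by (rule norm_le_l1)
 also have "... <= (\<Sum>i\<in>(Basis::'a set). s)"
 proof (rule sum_mono)
  fix i :: 'a assume "i \<in> Basis"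
  hence "s * (z \<bullet> i) <= x \<bullet> i" "x \<bullet> i < s * (z \<bullet> i + 1)" "s * (z \<bullet> i) <= y \<bullet> i" "y \<bullet> i < s * (z \<bullet> i + 1)"
   using assms by (auto simp: grid_cell_def)
  thus "\<bar>(x - y) \<bullet> i\<bar> <= s" by (simp add: inner_diff_left algebra_simps abs_if)
 qed
 finally show ?thesis by (simp add: mult.commute)
qed

lemma grid_cell_borel [measurable]: "grid_cell s (z::'a::euclidean_space) \<in> sets borel"
proof -
 have "grid_cell s z = (\<Inter>i\<in>Basis. {x. s * (z \<bullet> i) <= x \<bullet> i & x \<bullet> i < s * (z \<bullet> i + 1)})"
  by (auto simp: grid_cell_def)
 also have "... \<in> sets borel"
  by (rule sets.finite_INT) auto
 finally show ?thesis .
qed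

lemma grid_cell_bounded: "bounded (grid_cell s (z::'a::euclidean_space))"
proof (rule bounded_subset[OF bounded_cbox])
 show "grid_cell s z \<subseteq> cbox (s *R z) (s *R (z + One))"
  by (auto simp: grid_cell_def mem_box inner_add_left less_imp_le)
qed

lemma grid_cell_measure_pos:
 assumes "s > 0" shows "measure lborel (grid_cell s (z::'a::euclidean_space)) > 0"
proof -
 have "box (s *R z) (s *R (z + One)) \<subseteq> grid_cell s z"
  by (auto simp: grid_cell_def mem_box inner_add_left less_imp_le)
 moreover have "emeasure lborel (grid_cell s z) < \<infinity>" by (rule emeasure_bounded_finite[OF grid_cell_bounded])
 ultimately have "measure lborel (box (s *R z) (s *R (z + One))) <= measure lborel (grid_cell s z)"
  by (intro measure_mono_fmeasurable) (auto simp: fmeasurable_def)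
 moreover have "measure lborel (box (s *R z) (s *R (z + One))) = (\<Prod>b\<in>Basis. (s *R (z + One) - s *R z) \<bullet> b)"
  using assms by (intro measure_lborel_box) (auto simp: inner_add_left)
 moreover have "... > 0" using assms by (intro prod_pos) (auto simp: scaleR_add_right)
 ultimately show ?thesis by linarith
qed

lemma finite_grid_index:
 assumes "bounded (B :: 'a::euclidean_space set)" shows "finite (grid_index s ` B)"
proof -
 obtain c where c: "!!x. x \<in> B ==> norm x <= c" using assms bounded_iff by metis
 define N where "N = \<lceil>\<bar>c\<bar> / \<bar>s\<bar>\<rceil> + 1"
 let ?\<Phi> = "%\<phi>. (\<Sum>i\<in>Basis. real_of_int (\<phi> i) *R i) :: 'a"
 have "grid_index s ` B \<subseteq> ?\<Phi> ` (PiE Basis (%_. {-N..N}))"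
 proof
  fix z assume "z \<in> grid_index s ` B"
  then obtain x where x: "x \<in> B" "z = grid_index s x" by blast
  define \<phi> where "\<phi> = restrict (%i. \<lfloor>(x \<bullet> i) / s\<rfloor>) Basis"
  have "z = ?\<Phi> \<phi>" unfolding x(2) grid_index_def \<phi>_def by (rule sum.cong) auto
  moreover have "\<lfloor>(x \<bullet> i) / s\<rfloor> \<in> {-N..N}" if "i \<in> Basis" for i
  proof -
   define a b where "a = x \<bullet> i / s" and "b = \<bar>c\<bar> / \<bar>s\<bar>"
   have "\<bar>x \<bullet> i\<bar> <= \<bar>c\<bar>" using Basis_le_norm[OF that, of x] c[OF x(1)] by linarith
   hence "\<bar>x \<bullet> i / s\<bar> <= \<bar>c\<bar> / \<bar>s\<bar>" by (simp add: abs_divide divide_right_mono)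
   hence "\<bar>a\<bar> <= b" unfolding a_def b_def .
   hence "a <= b" "- b <= a" by linarith+
   hence "- (\<lceil>b\<rceil> + 1) <= \<lfloor>a\<rfloor>" "\<lfloor>a\<rfloor> <= \<lceil>b\<rceil> + 1" by linarith+
   thus ?thesis unfolding N_def a_def b_def by simp
  qed
  ultimately show "z \<in> ?\<Phi> ` (PiE Basis (%_. {-N..N}))" 
   by (intro image_eqI[of _ _ \<phi>]) (auto simp: \<phi>_def)
 qed
 thus ?thesis by (rule finite_subset) (auto intro!: finite_imageI finite_PiE)
qed

section \<open>Compact embedding\<close>

lemma closure_lateral: "closure (D \<times> frontier W) = closure D \<times> frontier W"
 by (simp add: closure_Times)

lemma zero_extension:
 fixes u :: "'m::euclidean_space \<times> 'p::euclidean_space => real"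
 assumes u: "C1g u g" and W: "open W" and s: "supp u \<inter> closure (D \<times> frontier W) = {}" and x: "fst x \<in> D"
 shows "((%x. if snd x \<in> W then u x else 0) has_derivative (%h. (if snd x \<in> W then g x else 0) \<bullet> h)) (at x)"
  and "isCont (%x. if snd x \<in> W then g x else 0) x"
proof -
 let ?u = "%x. if snd x \<in> W then u x else 0" and ?g = "%x. if snd x \<in> W then g x else 0"
 have *: "(?u has_derivative (%h. ?g x \<bullet> h)) (at x) & isCont ?g x"
 proof (cases "snd x \<in> W")
  case True
  have o: "open (UNIV \<times> W)" "x \<in> UNIV \<times> W" using W True by (auto simp: open_Times mem_Times_iff)
  have "(?u has_derivative (%h. g x \<bullet> h)) (at x)"
   by (rule has_derivative_transform_within_open[OF C1gD[OF u] o]) auto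
  moreover have "isCont ?g x"
  proof -
   have "isCont g x" using C1g_cont[OF u] unfolding continuous_on_eq_continuous_at[OF open_UNIV] by blast
   hence "(g \<longlongrightarrow> ?g x) (at x)" using True by (simp add: isCont_def)
   hence "(?g \<longlongrightarrow> ?g x) (at x)" by (rule Lim_transform_within_open[OF _ o]) auto
   thus ?thesis by (simp add: isCont_def)
  qed
  ultimately show ?thesis using True by simp
 next
  case False
  have "EX U. open U & x \<in> U & (ALL y:U. ?u y = 0 & ?g y = 0)"
  proof (cases "snd x \<in> closure W")
   case True
   hence "snd x \<in> frontier W" using False W by (simp add: frontier_def interior_open)
   hence "x \<in> closure (D \<times> frontier W)" using x closure_subset[of D] by (auto simp: closure_lateral mem_Times_iff)
   hence "x \<in> - supp u" using s by blast
   thus ?thesis using closed_supp[of u] not_supp[of _ u] C1g_zero_outside_supp[OF u]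
    by (intro exI[of _ "- supp u"]) auto
  next
   case False
   have "open (UNIV \<times> (- closure W) :: ('m \<times> 'p) set)" by (auto intro!: open_Times)
   moreover have "y \<notin> W" if "y \<notin> closure W" for y using that closure_subset by blast
   ultimately show ?thesis using False by (intro exI[of _ "UNIV \<times> (- closure W)"]) (auto simp: mem_Times_iff)
  qed
  then obtain U where U: "open U" "x \<in> U" "!!y. y \<in> U ==> ?u y = 0" "!!y. y \<in> U ==> ?g y = 0" by blast
  have "((%x. 0) has_derivative (%h. 0)) (at x)" by simp
  hence "(?u has_derivative (%h. 0)) (at x)"
   by (rule has_derivative_transform_within_open[OF _ U(1,2)]) (use U(3) in auto)
  moreover have "((%x. 0) \<longlongrightarrow> 0) (at x)" by simp
  hence "(?g \<longlongrightarrow> 0) (at x)" by (rule Lim_transform_within_open[OF _ U(1,2)]) (use U(4) in auto)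
  ultimately show ?thesis using False by (simp add: isCont_def)
 qed
 thus "(?u has_derivative (%h. ?g x \<bullet> h)) (at x)" "isCont ?g x" by auto
qed

lemma ennreal_lincomb:
 fixes a b p q :: real
 assumes "p >= 0" "q >= 0" "a >= 0" "b >= 0"
 shows "ennreal p * ennreal a + ennreal q * ennreal b = ennreal (p * a + q * b)"
 using assms by (simp add: ennreal_mult)

lemma halve_le: "2 * (a - b) <= x ==> a <= b + x / (2::real)"
 by (simp add: field_simps)

lemma C1c_compactness:
 fixes D :: "'m::euclidean_space set" and W :: "'p::euclidean_space set"
 assumes D: "open D" "bounded D" and W: "open W" "bounded W" and r: "r > 0"
  and charts: "!!b. EX e h k p. graph_chart D b r 1 e h k p" and \<eta>: "\<eta> > 0"
 shows "EX (n::nat) f K. (ALL i<n. L2 (lebesgue_on (D \<times> W)) (f i)) &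
   (ALL u g. C1c u g --> supp u \<inter> closure (D \<times> frontier W) = {} --> 
   sqn (lebesgue_on (D \<times> W)) u <= \<eta> * (sqn (lebesgue_on (D \<times> W)) u + sqn (lebesgue_on (D \<times> W)) g) + 
    K * (\<Sum>i<n. (ip (lebesgue_on (D \<times> W)) u (f i))^2))"
proof -
 let ?Om = "D \<times> W"
 let ?M = "lebesgue_on ?Om"
 have oOm: "open ?Om" using D W by (simp add: open_Times)
 hence bOm[measurable]: "?Om \<in> sets borel" by simp
 have [measurable]: "W \<in> sets borel" "D \<in> sets borel" using D W by auto
 obtain e h k p where gc: "!!b. graph_chart D b r 1 (e b) (h b) (k b) (p b)" using charts by metis
 have ch: "C1g (h b) (k b)" "D \<inter> ball b r = {y \<in> ball b r. y \<bullet> e b < h b y}" for b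
  using gc[of b] unfolding graph_chart_def by auto
 have ch': "continuous_on S (h b)" for b S using C1g_cont_fun[OF ch(1)] continuous_on_subset by blast
 have comp: "compact (closure D)" using D(2) by (simp add: compact_closure)
 obtain B where B: "finite B" "closure D \<subseteq> (\<Union>b\<in>B. ball b (r/2))"
 proof -
  have "closure D \<subseteq> (\<Union>b\<in>closure D. ball b (r/2))" using r by auto
  thus thesis by (rule compactE_image[OF comp open_ball]) (rule that)
 qed
 define N where "N = real (card B)"
 have N: "N >= 0" by (simp add: N_def)
 define T where "T = min (r / 4) (sqrt (\<eta> / (8 * (N + 1))))"
 have T: "T > 0" "T <= r / 4" using r \<eta> N by (auto simp: T_def)
 have T2: "2 * T^2 <= \<eta> / (4 * (N + 1))"
 proof -
  have "T^2 <= (sqrt (\<eta> / (8 * (N + 1))))^2" by (rule power_mono) (use T(1) in \<open>auto simp: T_def\<close>)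
  also have "... = \<eta> / (8 * (N + 1))" using \<eta> N by simp
  finally show ?thesis using N by (simp add: field_simps)
 qed
 define d where "d = \<eta> * T / (8 * (N + 1))"
 have d: "d > 0" using \<eta> T N by (simp add: d_def)
 have d2: "2 * d / T = \<eta> / (4 * (N + 1))"
 proof -
  have "2 * d / T = 2 * (\<eta> / (8 * (N + 1)))" using T(1) by (simp add: d_def)
  also have "... = \<eta> / (4 * (N + 1))" using N by (simp add: divide_simps)
  finally show ?thesis .
 qed
 define L where "L b = {y \<in> D \<inter> ball b (r/2). h b y - d <= y \<bullet> e b}" for b
 define K where "K = (\<Union>b\<in>B. {y \<in> cball b (r/2). y \<bullet> e b <= h b y - d})"
 have Lm[measurable]: "L b \<in> sets borel" for b
 proof -
  have [measurable]: "h b \<in> BM" using ch' by (intro bm_cont)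
  show ?thesis unfolding L_def by measurable
 qed
 have Kc: "compact K"
  unfolding K_def
 proof (rule compact_UN[OF B(1)])
  fix b
  have "closed {y. y \<bullet> e b <= h b y - d}" by (intro closed_Collect_le continuous_intros ch')
  hence "compact (cball b (r/2) \<inter> {y. y \<bullet> e b <= h b y - d})" by (simp add: compact_Int_closed)
  thus "compact {y \<in> cball b (r/2). y \<bullet> e b <= h b y - d}" by (simp add: Int_def)
 qed
 have KD: "K \<subseteq> D"
 proof
  fix y assume "y \<in> K"
  then obtain b where b: "dist b y <= r/2" "y \<bullet> e b <= h b y - d" unfolding K_def by auto
  hence "y \<in> {y \<in> ball b r. y \<bullet> e b < h b y}" using r d by simp
  thus "y \<in> D" using ch(2) by blast
 qed
 have DKL: "D \<subseteq> K \<union> (\<Union>b\<in>B. L b)"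
 proof
  fix y assume y: "y \<in> D"
  then obtain b where b: "b \<in> B" "y \<in> ball b (r/2)" using B(2) closure_subset by blast
  show "y \<in> K \<union> (\<Union>b\<in>B. L b)"
  proof (cases "h b y - d <= y \<bullet> e b")
   case True
   hence "y \<in> L b" using y b by (simp add: L_def)
   thus ?thesis using b(1) by blast
  next
   case False
   hence "y \<in> {y \<in> cball b (r/2). y \<bullet> e b <= h b y - d}" using b(2) by simp
   thus ?thesis using b(1) unfolding K_def by blast
  qed
 qed
 let ?n = "DIM('m \<times> 'p)"
 let ?C = "K \<times> closure W"
 have cC: "compact ?C" using Kc W(2) by (intro compact_Times) (auto simp: compact_closure)
 obtain ep where ep: "ep > 0" "(\<Union>x\<in>?C. ball x ep) \<subseteq> D \<times> (UNIV :: 'p set)"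
 proof -
  have "open (D \<times> (UNIV :: 'p set))" "?C \<subseteq> D \<times> (UNIV :: 'p set)" using D KD by (auto intro!: open_Times)
  thus thesis by (rule compact_subset_open_imp_ball_epsilon_subset[OF cC]) (rule that)
 qed
 define de where "de = min (ep / 2) (sqrt (\<eta> / (2 * 2 ^ ?n)))"
 have de: "de > 0" "de < ep" using ep \<eta> by (auto simp: de_def)
 have de2: "de^2 * 2 ^ ?n / 2 <= \<eta> / 4"
 proof -
  have "de^2 <= (sqrt (\<eta> / (2 * 2 ^ ?n)))^2" by (rule power_mono) (use de(1) in \<open>auto simp: de_def\<close>)
  also have "... = \<eta> / (2 * 2 ^ ?n)" using \<eta> by (intro real_sqrt_pow2) auto
  finally have "de^2 * (2 * 2 ^ ?n) <= \<eta>" by (subst (asm) le_divide_eq) auto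
  thus ?thesis by simp
 qed
 define s where "s = de / real ?n"
 have nn: "real ?n > 0" using DIM_positive[where 'a = "'m \<times> 'p"] by linarith
 have s: "s > 0" "s * real ?n = de" using de nn by (simp_all add: s_def)
 define Z where "Z = grid_index s ` ?C"
 have Zf: "finite Z" unfolding Z_def by (rule finite_grid_index[OF compact_imp_bounded[OF cC]])
 let ?S = "grid_cell s :: ('m \<times> 'p) => _"
 have cellD: "fst x \<in> D" if zx: "z \<in> Z" "x \<in> ?S z" for z x
 proof -
  obtain y where y: "y \<in> ?C" "z = grid_index s y" using zx(1) unfolding Z_def by blast
  have "norm (y - x) <= s * ?n" by (rule grid_cell_diam[OF _ that(2)]) (use y grid_cell_mem[OF s(1)] in auto)
  hence "x \<in> ball y ep" using de(2) s(2) by (simp add: dist_norm)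
  hence "x \<in> D \<times> (UNIV :: 'p set)" using ep(2) y(1) by blast
  thus ?thesis by (simp add: mem_Times_iff)
 qed
 have cell1: "z = grid_index s x" if "z \<in> Z" "x \<in> ?S z" for z x
 proof -
  from that(1) obtain y where "z = grid_index s y" unfolding Z_def by blast
  thus ?thesis using grid_cell_unique[OF s(1), of x y] that(2) by simp
 qed
 define m where "m z = measure lborel (?S z)" for z
 have m: "m z > 0" for z unfolding m_def by (rule grid_cell_measure_pos[OF s(1)])
 define KK where "KK = (\<Sum>z\<in>Z. 1 / m z)"
 have KKm: "1 / m z <= KK" if "z \<in> Z" for z
  unfolding KK_def by (rule member_le_sum[OF that]) (use m Zf in \<open>auto intro: less_imp_le\<close>)
 have LS: "L2 ?M (%x. indicator (?S z) x :: real)" for z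
 proof -
  have "integrable lborel (%x. indicator (?S z) x :: real)"
   using emeasure_bounded_finite[OF grid_cell_bounded] by (intro integrable_real_indicator) auto
  hence "integrable ?M (%x. indicator (?S z) x :: real)" by (rule lebesgue_on_integrable_borel[OF _ bOm])
  moreover have "(norm (indicator (?S z) x :: real))^2 = indicator (?S z) x" for x by (simp add: indicator_def)
  ultimately show ?thesis unfolding L2_def using borel_measurable_lebesgue_on[of "%x. indicator (?S z) x :: real" ?Om] by simp
 qed
 have main: "sqn ?M u <= \<eta> * (sqn ?M u + sqn ?M g) + KK * (\<Sum>z\<in>Z. (ip ?M u (%x. indicator (?S z) x))^2)"
  if u: "C1c u g" and su: "supp u \<inter> closure (D \<times> frontier W) = {}" for u g
 proof -
  have ug: "C1g u g" using u C1c_C1g by blast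
  have [measurable]: "u \<in> BM" "g \<in> BM"
   using ug by (auto intro!: bm_cont C1g_cont_fun C1g_cont)
  define u' where "u' x = (if snd x \<in> W then u x else 0)" for x
  define g' where "g' x = (if snd x \<in> W then g x else 0)" for x
  have W'[measurable]: "UNIV \<times> W \<in> sets (borel :: ('m \<times> 'p) measure)" using W(1) by (auto intro!: borel_open open_Times)
  have u'm[measurable]: "u' \<in> BM"
  proof -
   have "u' = (%x. indicator (UNIV \<times> W) x *R u x)" by (auto simp: u'_def indicator_def fun_eq_iff mem_Times_iff)
   thus ?thesis by simp
  qed
  have g'm[measurable]: "g' \<in> BM"
  proof -
   have "g' = (%x. indicator (UNIV \<times> W) x *R g x)" by (auto simp: g'_def indicator_def fun_eq_iff mem_Times_iff)
   thus ?thesis by simp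
  qed
  obtain Bd where Bd: "Bd > 0" "!!x. \<bar>u x\<bar> <= Bd" using C1c_bounded[OF u] by metis
  have Bd': "\<bar>u' x\<bar> <= Bd" for x using Bd by (auto simp: u'_def)
  let ?gg = "sqn ?M g" and ?uu = "sqn ?M u"
  note nnu = C1c_nn_integral(1)[OF u oOm] and nng = C1c_nn_integral(2)[OF u oOm]
  have nn1: "?uu >= 0" "?gg >= 0" by (rule ip_self_nonneg)+
  let ?g = "%z x. ennreal ((norm (g' x))^2) * indicator (?S z) x" and ?e = "\<eta> / (4 * (N + 1)) * ?uu + \<eta> / (4 * (N + 1)) * ?gg"
  define Q where "Q z = (LI x. indicator (?S z) x * (u' x)^2)" for z
  define V where "V z = (LI x. indicator (?S z) x * u' x)" for z
  define G where "G z = enn2real (NI x. ?g z x)" for z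
  have sumG: "(\<Sum>z\<in>Z. NI x. ?g z x) <= ennreal ?gg"
  proof -
   have "(\<Sum>z\<in>Z. ?g z x) <= ennreal ((norm (g x))^2) * indicator ?Om x" for x
   proof (cases "EX z:Z. x \<in> ?S z")
    case True
    then obtain z where z: "z \<in> Z" "x \<in> ?S z" by blast
    have "(\<Sum>z'\<in>Z. ?g z' x) = (\<Sum>z'\<in>Z. if z' = z then ennreal ((norm (g' x))^2) else 0)"
    proof (rule sum.cong[OF refl])
     fix z' assume z': "z' \<in> Z"
     have "x \<in> ?S z' \<longleftrightarrow> z' = z" using cell1[OF z] cell1[OF z'] z(2) by metis
     thus "?g z' x = (if z' = z then ennreal ((norm (g' x))^2) else 0)"
      by (simp add: indicator_def)
    qed
    also have "... = ennreal ((norm (g' x))^2)" using z Zf by simp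
    also have "... <= ennreal ((norm (g x))^2) * indicator ?Om x"
     using cellD[OF z] by (auto simp: g'_def indicator_def mem_Times_iff)
    finally show ?thesis .
   next
    case False
    hence "(\<Sum>z'\<in>Z. ?g z' x) = 0" by (intro sum.neutral) auto
    thus ?thesis by simp
   qed
   hence "(NI x. (\<Sum>z\<in>Z. ?g z x)) <= (NI x. ennreal ((norm (g x))^2) * indicator ?Om x)"
    by (intro nn_integral_mono)
   thus ?thesis unfolding nng by (subst (asm) nn_integral_sum) auto
  qed
  have Gfin: "(NI x. ?g z x) = ennreal (G z)" if "z \<in> Z" for z
  proof -
   have "(NI x. ?g z x) <= (\<Sum>z\<in>Z. NI x. ?g z x)"
    by (rule member_le_sum[OF that]) (use Zf in auto)
   hence "(NI x. ?g z x) < top"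
    using sumG by (meson ennreal_less_top le_less_trans order_trans)
   thus ?thesis unfolding G_def by simp
  qed
  have G0: "G z >= 0" for z by (simp add: G_def)
  have sumG': "(\<Sum>z\<in>Z. G z) <= ?gg"
  proof -
   have "ennreal (\<Sum>z\<in>Z. G z) = (\<Sum>z\<in>Z. ennreal (G z))" using G0 by (simp add: sum_ennreal)
   also have "... <= ennreal ?gg" using sumG Gfin by simp
   finally show ?thesis using nn1 by (simp add: ennreal_le_iff)
  qed
  have V: "V z = ip ?M u (%x. indicator (?S z) x)" if "z \<in> Z" for z
  proof -
   have "ip ?M u (%x. indicator (?S z) x) = (LI x. indicator ?Om x *R (u x * indicator (?S z) x))"
    unfolding ip_def inner_real_def by (rule lebesgue_on_integral_borel) (use bOm in auto)
   also have "... = V z"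
    unfolding V_def by (rule Bochner_Integration.integral_cong) 
     (use cellD[OF that] in \<open>auto simp: indicator_def u'_def mem_Times_iff\<close>)
   finally show ?thesis by simp
  qed
  have poin: "Q z <= KK * (V z)^2 + \<eta> / 4 * G z" if z: "z \<in> Z" for z
  proof -
   have "ennreal (2 * (m z * Q z - (V z)^2)) <= ennreal (de^2 * 2 ^ ?n * m z) * (NI x. ?g z x)"
    unfolding m_def Q_def V_def
   proof (rule convex_poincare[OF grid_cell_convex _ grid_cell_bounded _ _ _ u'm g'm Bd'])
    show "norm (x - y) <= de" if "x \<in> ?S z" "y \<in> ?S z" for x y using grid_cell_diam[OF that] s(2) by simp
    show "(u' has_derivative (%h. g' x \<bullet> h)) (at x)" if "x \<in> ?S z" for x
     unfolding u'_def[abs_def] g'_def by (rule zero_extension(1)[OF ug W(1) su cellD[OF z that]])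
    show "continuous_on (?S z) g'"
    proof (rule continuous_at_imp_continuous_on, rule ballI)
     fix x assume "x \<in> ?S z"
     show "isCont g' x" unfolding g'_def[abs_def] by (rule zero_extension(2)[OF ug W(1) su cellD[OF z \<open>x \<in> ?S z\<close>]])
    qed
   qed auto
   also have "... = ennreal (de^2 * 2 ^ ?n * m z * G z)"
    unfolding Gfin[OF z] using m[of z] G0[of z] by (intro ennreal_mult[symmetric]) auto
   finally have "2 * (m z * Q z - (V z)^2) <= de^2 * 2 ^ ?n * m z * G z"
    using m[of z] G0[of z] by (subst (asm) ennreal_le_iff) auto
   hence "m z * Q z <= (V z)^2 + (de^2 * 2 ^ ?n * m z * G z) / 2" by (rule halve_le)
   also have "... = m z * (1 / m z * (V z)^2 + de^2 * 2 ^ ?n / 2 * G z)"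
    using m[of z] by (simp add: distrib_left)
   finally have "m z * Q z <= m z * (1 / m z * (V z)^2 + de^2 * 2 ^ ?n / 2 * G z)" .
   hence "Q z <= 1 / m z * (V z)^2 + de^2 * 2 ^ ?n / 2 * G z" using m[of z] by simp
   also have "... <= KK * (V z)^2 + \<eta> / 4 * G z"
    by (intro add_mono mult_right_mono KKm z de2 G0) auto
   finally show ?thesis .
  qed
  have QE: "(NI x. ennreal ((u' x)^2) * indicator (?S z) x) = ennreal (Q z)" for z
  proof -
   have i: "integrable lborel (%x. indicator (?S z) x * (u' x)^2)"
   proof (rule Bochner_Integration.integrable_bound)
    show "integrable lborel (%x. Bd^2 * indicator (?S z) x)"
     using emeasure_bounded_finite[OF grid_cell_bounded] by (intro integrable_mult_right integrable_real_indicator) auto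
    show "AE x in lborel. norm (indicator (?S z) x * (u' x)^2) <= norm (Bd^2 * indicator (?S z) x)"
     using power_mono[where n = 2, OF Bd'] by (auto simp: indicator_def)
   qed auto
   have "(NI x. ennreal ((u' x)^2) * indicator (?S z) x) = (NI x. ennreal (indicator (?S z) x * (u' x)^2))"
    by (rule nn_integral_cong) (simp add: indicator_def)
   also have "... = ennreal (Q z)" unfolding Q_def by (rule nn_integral_eq_integral[OF i]) simp
   finally show ?thesis .
  qed
  have Q0: "Q z >= 0" for z unfolding Q_def by (rule integral_nonneg_AE) simp
  let ?U = "%x. ennreal ((u x)^2)"
  have Kb[measurable]: "K \<in> sets borel" using Kc compact_imp_closed by (auto intro: borel_closed)
  have [measurable]: "L b \<times> W \<in> sets borel" "K \<times> W \<in> sets borel" for b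
   unfolding borel_prod[symmetric] by (intro pair_measureI; measurable)+
  have pt: "?U x * indicator ?Om x <= ?U x * indicator (K \<times> W) x + (\<Sum>b\<in>B. ?U x * indicator (L b \<times> W) x)" for x
  proof (cases "x \<in> ?Om")
   case True
   show ?thesis
   proof (cases "fst x \<in> K")
    case True
    thus ?thesis using \<open>x \<in> ?Om\<close> by (auto simp: indicator_def mem_Times_iff)
   next
    case False
    then obtain b where b: "b \<in> B" "fst x \<in> L b" using DKL True by (auto simp: mem_Times_iff)
    have "?U x * indicator ?Om x = ?U x * indicator (L b \<times> W) x" using True b(2) by (auto simp: indicator_def mem_Times_iff)
    also have "... <= (\<Sum>b\<in>B. ?U x * indicator (L b \<times> W) x)" by (rule member_le_sum[OF b(1)]) (use B in auto)
    finally show ?thesis by (simp add: add_increasing)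
   qed
  qed simp
  have "ennreal ?uu <= (NI x. ?U x * indicator (K \<times> W) x + (\<Sum>b\<in>B. ?U x * indicator (L b \<times> W) x))"
   unfolding nnu[symmetric] by (intro nn_integral_mono pt)
  also have "... = (NI x. ?U x * indicator (K \<times> W) x) + (\<Sum>b\<in>B. NI x. ?U x * indicator (L b \<times> W) x)"
   by (subst nn_integral_add) (auto simp: nn_integral_sum)
  also have "... <= (\<Sum>z\<in>Z. ennreal (Q z)) + (\<Sum>b\<in>B. ennreal (?e))"
  proof (rule add_mono)
   have "?U x * indicator (K \<times> W) x <= (\<Sum>z\<in>Z. ennreal ((u' x)^2) * indicator (?S z) x)" for x
   proof (cases "x \<in> K \<times> W")
    case True
    hence "x \<in> ?C" using closure_subset by (auto simp: mem_Times_iff)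
    hence z: "grid_index s x \<in> Z" unfolding Z_def by blast
    have "?U x * indicator (K \<times> W) x = ennreal ((u' x)^2) * indicator (?S (grid_index s x)) x"
     using True grid_cell_mem[OF s(1), of x] by (auto simp: u'_def mem_Times_iff)
    also have "... <= (\<Sum>z\<in>Z. ennreal ((u' x)^2) * indicator (?S z) x)" by (rule member_le_sum[OF z]) (use Zf in auto)
    finally show ?thesis .
   qed simp
   hence "(NI x. ?U x * indicator (K \<times> W) x) <= (NI x. (\<Sum>z\<in>Z. ennreal ((u' x)^2) * indicator (?S z) x))"
    by (intro nn_integral_mono)
   also have "... = (\<Sum>z\<in>Z. ennreal (Q z))" by (subst nn_integral_sum) (auto simp: QE)
   finally show "(NI x. ?U x * indicator (K \<times> W) x) <= (\<Sum>z\<in>Z. ennreal (Q z))" .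
   show "(\<Sum>b\<in>B. NI x. ?U x * indicator (L b \<times> W) x) <= (\<Sum>b\<in>B. ennreal (?e))"
   proof (rule sum_mono)
    fix b assume "b \<in> B"
    have "(NI x. ?U x * indicator (L b \<times> W) x) <= ennreal (2 * d / T) * ennreal ?uu + ennreal (2 * T^2) * ennreal ?gg"
     unfolding nnu[symmetric] nng[symmetric] by (rule boundary_layer[OF ug D(1) W(1) gc T d L_def])
    also have "... <= ennreal (\<eta> / (4 * (N + 1))) * ennreal ?uu + ennreal (\<eta> / (4 * (N + 1))) * ennreal ?gg"
     unfolding d2 by (intro add_mono mult_right_mono ennreal_leI T2) auto
    also have "... = ennreal (?e)"
     by (rule ennreal_lincomb) (use \<eta> N nn1 in auto)
    finally show "(NI x. ?U x * indicator (L b \<times> W) x) <= ennreal (?e)" .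
   qed
  qed
  also have "... = ennreal ((\<Sum>z\<in>Z. Q z) + N * (\<eta> / (4 * (N + 1)) * (?uu + ?gg)))"
  proof -
   have "(\<Sum>b\<in>B. ennreal (?e)) = ennreal (\<Sum>b\<in>B. ?e)"
    using \<eta> N nn1 by (intro sum_ennreal) auto
   moreover have "(\<Sum>b\<in>B. ?e) = N * (\<eta> / (4 * (N + 1)) * (?uu + ?gg))"
    by (simp add: N_def distrib_left)
   moreover have "(\<Sum>z\<in>Z. ennreal (Q z)) = ennreal (\<Sum>z\<in>Z. Q z)" using Q0 by (intro sum_ennreal) auto
   ultimately show ?thesis using Q0 \<eta> N nn1 by (simp add: sum_nonneg)
  qed
  finally have "?uu <= (\<Sum>z\<in>Z. Q z) + N * (\<eta> / (4 * (N + 1)) * (?uu + ?gg))"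
   using Q0 \<eta> N nn1 by (subst (asm) ennreal_le_iff) (auto intro!: add_nonneg_nonneg mult_nonneg_nonneg sum_nonneg)
  also have "N * (\<eta> / (4 * (N + 1)) * (?uu + ?gg)) <= \<eta> / 4 * (?uu + ?gg)"
  proof -
   have "N * (\<eta> / (4 * (N + 1)) * (?uu + ?gg)) = N / (N + 1) * (\<eta> / 4 * (?uu + ?gg))" using N by (simp add: divide_simps)
   also have "... <= 1 * (\<eta> / 4 * (?uu + ?gg))" by (rule mult_right_mono) (use N \<eta> nn1 in auto)
   finally show ?thesis by simp
  qed
  also have "(\<Sum>z\<in>Z. Q z) <= (\<Sum>z\<in>Z. KK * (V z)^2 + \<eta> / 4 * G z)" by (intro sum_mono poin)
  also have "... = KK * (\<Sum>z\<in>Z. (V z)^2) + \<eta> / 4 * (\<Sum>z\<in>Z. G z)" by (simp add: sum.distrib sum_distrib_left)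
  also have "\<eta> / 4 * (\<Sum>z\<in>Z. G z) <= \<eta> / 4 * ?gg" by (rule mult_left_mono[OF sumG']) (use \<eta> in auto)
  finally have "?uu <= KK * (\<Sum>z\<in>Z. (V z)^2) + \<eta> / 4 * ?gg + \<eta> / 4 * (?uu + ?gg)" by simp
  also have "... <= \<eta> * (?uu + ?gg) + KK * (\<Sum>z\<in>Z. (V z)^2)"
  proof -
   have "\<eta> * ?gg >= 0" "\<eta> * ?uu >= 0" using \<eta> nn1 by auto
   thus ?thesis by (simp add: algebra_simps)
  qed
  finally show ?thesis using V by simp
 qed
 obtain z where z: "bij_betw z {0..<card Z} Z" using ex_bij_betw_nat_finite[OF Zf] by blast
 have sumz: "(\<Sum>i<card Z. F (z i)) = (\<Sum>z\<in>Z. F z)" for F :: "_ => real"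
  using sum.reindex_bij_betw[OF z, of F] by (simp add: atLeast0LessThan)
 show ?thesis
 proof (intro exI conjI allI impI)
  show "L2 ?M (%x. indicator (?S (z i)) x :: real)" if "i < card Z" for i by (rule LS)
  show "sqn ?M u <= \<eta> * (sqn ?M u + sqn ?M g) + KK * (\<Sum>i<card Z. (ip ?M u (%x. indicator (?S (z i)) x))^2)"
   if "C1c u g" "supp u \<inter> closure (D \<times> frontier W) = {}" for u g
   using main[OF that] sumz[of "%z. (ip ?M u (%x. indicator (?S z) x))^2"] by simp
 qed
qed

lemma compactly_embedded_cylinder:
 fixes D :: "'m::euclidean_space set" and W :: "'p::euclidean_space set" and A :: "'m \<times> 'p => 'm \<times> 'p => 'm \<times> 'p"
 assumes el: "elliptic_problem (D \<times> W) A c C"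
  and D: "open D" "bounded D" and W: "open W" "bounded W" and r: "r > 0"
  and charts: "!!b. EX e h k p. graph_chart D b r 1 e h k p"
 shows "elliptic_problem.compactly_embedded (D \<times> W) (D \<times> frontier W)"
proof -
 interpret elliptic_problem "D \<times> W" "D \<times> frontier W" A c C using el .
 show ?thesis
  unfolding compactly_embedded_def
 proof (intro allI impI)
  fix \<eta> :: real assume "\<eta> > 0"
  from C1c_compactness[OF D W r charts this]
  obtain n :: nat and f K where f': "ALL i<n. L2 M (f i)" and K': "ALL u g. C1c u g --> supp u \<inter> closure (D \<times> frontier W) = {} --> 
    sqn M u <= \<eta> * (sqn M u + sqn M g) + K * (\<Sum>i<n. (ip M u (f i))^2)"
   by (elim exE conjE)
  show "EX (n::nat) f K. (ALL i<n. L2 M (f i)) &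
    (ALL u g. adm (D \<times> W) (D \<times> frontier W) u g --> sqn M u <= \<eta> * (sqn M u + sqn M g) + K * (\<Sum>i<n. (ip M u (f i))^2))"
  proof (intro exI conjI allI impI)
   show "L2 M (f i)" if "i < n" for i using f' that by blast
   fix u g assume u: "adm (D \<times> W) (D \<times> frontier W) u g"
   obtain \<phi> k where \<phi>: "!!n. C1c (\<phi> n) (k n)" "!!n. supp (\<phi> n) \<inter> closure (D \<times> frontier W) = {}"
    "L2_tendsto M \<phi> u" "L2_tendsto M k g" by (rule adm_C1c_sequence[OF open_Om u]) (rule that)
   show "sqn M u <= \<eta> * (sqn M u + sqn M g) + K * (\<Sum>i<n. (ip M u (f i))^2)"
   proof (rule LIMSEQ_le)
    show "(%j. sqn M (\<phi> j)) \<longlonglongrightarrow> sqn M u" by (rule L2_tendsto_ip[OF \<phi>(3) \<phi>(3)])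
    show "(%j. \<eta> * (sqn M (\<phi> j) + sqn M (k j)) + K * (\<Sum>i<n. (ip M (\<phi> j) (f i))^2)) \<longlonglongrightarrow> 
      \<eta> * (sqn M u + sqn M g) + K * (\<Sum>i<n. (ip M u (f i))^2)"
     using f' by (intro tendsto_intros L2_tendsto_ip[OF \<phi>(3) \<phi>(3)] L2_tendsto_ip[OF \<phi>(4) \<phi>(4)] L2_tendsto_ip_right[OF \<phi>(3)]) auto
    show "EX N. ALL j>=N. sqn M (\<phi> j) <= \<eta> * (sqn M (\<phi> j) + sqn M (k j)) + K * (\<Sum>i<n. (ip M (\<phi> j) (f i))^2)"
     using K' \<phi>(1,2) by blast
   qed
  qed
 qed
qed

section \<open>Disintegration along a unit vector\<close>

lemma disintegration:
 fixes f :: "'m::euclidean_space => ennreal" and H :: "'m => real" and ka :: "real => ennreal"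
 assumes [measurable]: "f \<in> BM" "H \<in> BM" "ka \<in> BM"
  and e: "norm e = 1" and a: "a > 0" and ka: "(NI s. ka s) = 1"
 shows "(NI x. f x) = ennreal a * (NI t. NI y. f (y - (y \<bullet> e) *R e + (a * t + H y) *R e) * ka (y \<bullet> e))"
proof -
 have ee: "e \<bullet> e = 1" using e by (simp add: dot_square_norm)
 have 1: "ennreal a * (NI t. f (y - (y \<bullet> e) *R e + (a * t + H y) *R e)) = (NI s. f (y + s *R e))" for y
 proof -
  have "(NI s. f (y + s *R e)) = ennreal \<bar>a\<bar> * (NI t. f (y + ((H y - y \<bullet> e) + a * t) *R e))"
   by (rule nn_integral_real_affine) (use a in auto)
  also have "(%t. f (y + ((H y - y \<bullet> e) + a * t) *R e)) = (%t. f (y - (y \<bullet> e) *R e + (a * t + H y) *R e))"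
   by (rule ext) (simp add: algebra_simps)
  finally show ?thesis using a by simp
 qed
 have "ennreal a * (NI t. NI y. f (y - (y \<bullet> e) *R e + (a * t + H y) *R e) * ka (y \<bullet> e)) = 
   ennreal a * (NI y. NI t. f (y - (y \<bullet> e) *R e + (a * t + H y) *R e) * ka (y \<bullet> e))"
  by (subst nn_integral_swap) auto
 also have "... = ennreal a * (NI y. (NI t. f (y - (y \<bullet> e) *R e + (a * t + H y) *R e)) * ka (y \<bullet> e))"
  by (simp add: nn_integral_multc)
 also have "... = (NI y. ennreal a * ((NI t. f (y - (y \<bullet> e) *R e + (a * t + H y) *R e)) * ka (y \<bullet> e)))"
  by (rule nn_integral_cmult[symmetric]) measurable
 also have "... = (NI y. (NI s. f (y + s *R e)) * ka (y \<bullet> e))"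
  by (simp add: mult.assoc[symmetric] 1)
 also have "... = (NI y. NI s. f (y + s *R e) * ka (y \<bullet> e))"
  by (simp add: nn_integral_multc)
 also have "... = (NI s. NI y. f (y + s *R e) * ka (y \<bullet> e))"
  by (rule nn_integral_swap) measurable
 also have "... = (NI s. NI y. f y * ka (y \<bullet> e - s))"
 proof (rule nn_integral_cong)
  fix s
  have "(NI y. f y * ka (y \<bullet> e - s)) = (NI y. f (y + s *R e) * ka ((y + s *R e) \<bullet> e - s))"
   by (rule nn_integral_translate[symmetric]) measurable
  thus "(NI y. f (y + s *R e) * ka (y \<bullet> e)) = (NI y. f y * ka (y \<bullet> e - s))"
   by (simp add: inner_add_left ee)
 qed
 also have "... = (NI y. NI s. f y * ka (y \<bullet> e - s))"
  by (rule nn_integral_swap) measurable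
 also have "... = (NI y. f y)"
 proof (rule nn_integral_cong)
  fix y
  have "(NI s. ka s) = ennreal \<bar>- 1\<bar> * (NI s. ka (y \<bullet> e + (-1) * s))"
   by (rule nn_integral_real_affine) auto
  hence "(NI s. ka (y \<bullet> e - s)) = 1" using ka by simp
  thus "(NI s. f y * ka (y \<bullet> e - s)) = f y" by (simp add: nn_integral_cmult)
 qed
 finally show ?thesis by simp
qed

definition kernel_mass :: real where "kernel_mass = (LI s. pos2 (1 - s^2))"
definition kernel :: "real => real" where "kernel s = pos2 (1 - s^2) / kernel_mass"
definition kernel' :: "real => real" where "kernel' s = (2 * max 0 (1 - s^2)) * (- 2 * s) / kernel_mass"

lemma pos2_cont: "continuous_on S pos2"
 unfolding pos2_def[abs_def] by (intro continuous_intros)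

lemma kernel_supp: "kernel s ~= 0 ==> \<bar>s\<bar> <= 1"
 by (auto simp: kernel_def pos2_def max_def abs_square_le_1 split: if_splits)

lemma kernel_base_integrable: "integrable lborel (%s::real. pos2 (1 - s^2))"
proof (rule integrable_continuous_compact[of _ "cbox (-1) 1"])
 show "contU (%s::real. pos2 (1 - s^2))"
  by (intro continuous_on_compose2[OF pos2_cont] continuous_intros) auto
 show "pos2 (1 - x^2) = 0" if "x \<notin> cbox (-1) 1" for x :: real
  using that abs_square_le_1[of x] by (auto simp: pos2_def max_def abs_le_iff)
qed auto

lemma kernel_mass_pos: "kernel_mass > 0"
proof -
 have "(LI s. indicator {-1/2..1/2::real} s * (1/4)) <= kernel_mass"
  unfolding kernel_mass_def
 proof (rule integral_mono[OF _ kernel_base_integrable])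
  fix s :: real
  show "indicator {-1/2..1/2} s * (1/4) <= pos2 (1 - s^2)"
  proof (cases "s \<in> {-1/2..1/2}")
   case True
   hence "\<bar>s\<bar> <= 1/2" by auto
   from power_mono[OF this, of 2] have "s^2 <= 1/4" by (simp add: power_divide)
   hence "1 - s^2 >= 1/2" by simp
   hence "(1 - s^2)^2 >= (1/2)^2" by (intro power_mono) auto
   thus ?thesis using True \<open>1 - s^2 >= 1/2\<close> by (simp add: pos2_def power_divide)
  qed (simp add: pos2_nonneg)
 qed simp
 thus ?thesis by simp
qed

lemma kernel_nonneg: "kernel s >= 0"
 using kernel_mass_pos by (simp add: kernel_def pos2_nonneg)

lemma kernel_deriv: "(kernel has_real_derivative kernel' s) (at s)"
proof -
 have "((%s. 1 - s^2) has_real_derivative (- 2 * s)) (at s)" by (auto intro!: derivative_eq_intros)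
 from DERIV_cdivide[OF DERIV_chain2[OF pos2_deriv this], of kernel_mass]
 show ?thesis unfolding kernel_def[abs_def] kernel'_def .
qed

lemma kernel'_cont: "continuous_on S kernel'"
 unfolding kernel'_def[abs_def] using kernel_mass_pos by (intro continuous_intros) auto

lemma kernel_cont: "continuous_on S kernel"
 using kernel_deriv by (meson DERIV_isCont continuous_at_imp_continuous_on)

lemma kernel_nn_integral: "(NI s. ennreal (kernel s)) = 1"
proof -
 have i: "integrable lborel kernel" unfolding kernel_def[abs_def] using kernel_base_integrable by simp
 have "(NI s. ennreal (kernel s)) = ennreal (LI s. kernel s)"
  by (rule nn_integral_eq_integral[OF i]) (simp add: kernel_nonneg)
 also have "(LI s. kernel s) = 1"
  unfolding kernel_def using kernel_mass_pos by (simp add: kernel_mass_def[symmetric])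
 finally show ?thesis by simp
qed

lemma kernel_borel [measurable]: "kernel \<in> BM"
 by (rule bm_cont[OF kernel_cont])

section \<open>The coefficients\<close>

definition dir_embed :: "'m::real_vector => real \<times> 'p => 'm \<times> 'p" where
 "dir_embed \<nu> y = (fst y *R \<nu>, snd y)"

text \<open>The coefficients are taken Borel measurable, symmetric and elliptic at every point; at the end the
  given matrix is replaced by such a \<open>B\<close> off a null set. The operators \<open>cylB\<close>, \<open>dirB \<nu>\<close> and \<open>baseB\<close>
  belong to \<open>\<lambda>\<^sub>\<ell>\<^sup>k\<close>, \<open>Z\<^sup>\<nu>\<close> and \<open>\<mu>\<^sub>1\<close>.\<close>

locale coef =
 fixes B :: "'p::euclidean_space => 'm::euclidean_space \<times> 'p => 'm \<times> 'p" and c C :: real and W :: "'p set"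
 assumes B_lin: "!!\<xi>. linear (B \<xi>)"
  and B_sym: "!!\<xi> x y. B \<xi> x \<bullet> y = x \<bullet> B \<xi> y"
  and B_ell: "!!\<xi> y. c * (norm y)^2 <= B \<xi> y \<bullet> y"
  and B_bd: "!!\<xi> y. norm (B \<xi> y) <= C * norm y"
  and B_meas: "(%p. B (fst p) (snd p)) \<in> borel_measurable (borel \<Otimes>\<^sub>M borel)"
  and c_pos: "c > 0"
  and W: "open W" "bounded W" "W ~= {}"
begin

definition Q :: "'p => 'm \<times> 'p => real" where "Q \<xi> y = B \<xi> y \<bullet> y"

definition dirB :: "'m => real \<times> 'p => real \<times> 'p => real \<times> 'p" where
 "dirB \<nu> x y = (fst (B (snd x) (dir_embed \<nu> y)) \<bullet> \<nu>, snd (B (snd x) (dir_embed \<nu> y)))"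

definition cylB :: "'m \<times> 'p => 'm \<times> 'p => 'm \<times> 'p" where "cylB x = B (snd x)"

lemma strip_borel: "{..<0::real} \<times> W \<in> sets borel"
 using open_Times[OF open_lessThan[of "0::real"] W(1)] by simp

lemma Q_nonneg: "Q \<xi> y >= 0"
 unfolding Q_def using B_ell[of y \<xi>] c_pos by (smt (verit) mult_nonneg_nonneg zero_le_power2)

lemma Q_upper: "Q \<xi> y <= C * (norm y)^2"
proof -
 have "Q \<xi> y <= norm (B \<xi> y) * norm y" unfolding Q_def by (rule norm_cauchy_schwarz)
 also have "... <= C * norm y * norm y" by (intro mult_right_mono B_bd) auto
 finally show ?thesis by (simp add: power2_eq_square mult.assoc)
qed

lemma c_le_C: "c <= C"
proof -
 obtain b :: "'m \<times> 'p" where "b \<in> Basis" using nonempty_Basis by blast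
 hence "norm b = 1" by simp
 thus ?thesis using B_ell[of b undefined] Q_upper[of undefined b] by (simp add: Q_def)
qed

lemma C_pos: "C > 0" using c_le_C c_pos by linarith

lemma B_compose [measurable (raw)]:
 assumes [measurable]: "f \<in> borel_measurable M" "g \<in> borel_measurable M"
 shows "(%x. B (f x) (g x)) \<in> borel_measurable M"
proof -
 have "(%x. (f x, g x)) \<in> M \<rightarrow>\<^sub>M borel \<Otimes>\<^sub>M borel" by measurable
 from measurable_compose[OF this B_meas] show ?thesis by simp
qed

lemma Q_compose [measurable (raw)]:
 assumes [measurable]: "f \<in> borel_measurable M" "g \<in> borel_measurable M"
 shows "(%x. Q (f x) (g x)) \<in> borel_measurable M"
 unfolding Q_def by measurable

lemma Q_expand: "Q \<xi> (x + y) = Q \<xi> x + 2 * (B \<xi> x \<bullet> y) + Q \<xi> y"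
 unfolding Q_def linear_add[OF B_lin] using B_sym[of \<xi> x y]
 by (simp add: inner_add_left inner_add_right inner_commute[of "B \<xi> y" x])

lemma Q_scale: "Q \<xi> (a *R x) = a^2 * Q \<xi> x"
 unfolding Q_def linear_scale[OF B_lin] by (simp add: power2_eq_square)

lemma Q_diff_expand: "Q \<xi> (x - a *R y) = Q \<xi> x - 2 * a * (B \<xi> y \<bullet> x) + a^2 * Q \<xi> y"
proof -
 have "Q \<xi> (x + (-a) *R y) = Q \<xi> x + 2 * (B \<xi> x \<bullet> ((-a) *R y)) + Q \<xi> ((-a) *R y)" by (rule Q_expand)
 also have "... = Q \<xi> x - 2 * a * (B \<xi> y \<bullet> x) + a^2 * Q \<xi> y"
  unfolding Q_scale using B_sym[of \<xi> x y] by (simp add: inner_commute[of x])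
 finally show ?thesis by simp
qed

lemma dirB_inner: "dirB \<nu> x y \<bullet> z = B (snd x) (dir_embed \<nu> y) \<bullet> dir_embed \<nu> z"
 by (cases z) (simp add: dirB_def dir_embed_def inner_prod_def mult.commute)

lemma norm_dir_embed: "norm \<nu> = 1 ==> norm (dir_embed \<nu> y) = norm y"
 by (simp add: dir_embed_def norm_Pair norm_prod_def)

lemma dir_embed_measurable [measurable]: "(%y::real \<times> 'p. dir_embed (\<nu>::'m) y) \<in> BM"
 unfolding dir_embed_def by (intro bm_cont continuous_intros)

lemma linear_dir_embed: "linear (dir_embed \<nu>)"
 by (rule linearI) (auto simp: dir_embed_def scaleR_add_left)

lemma elliptic_cyl:
 assumes "open D" shows "elliptic_problem (D \<times> W) cylB c C"
proof (intro elliptic_problem.intro elliptic.intro)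
 show "open (D \<times> W)" using assms W by (simp add: open_Times)
 show "linear (cylB x)" for x unfolding cylB_def by (rule B_lin)
 show "cylB x y \<bullet> z = y \<bullet> cylB x z" for x y z unfolding cylB_def by (rule B_sym)
 show "c * (norm y)^2 <= cylB x y \<bullet> y" for x y unfolding cylB_def by (rule B_ell)
 show "norm (cylB x y) <= C * norm y" for x y unfolding cylB_def by (rule B_bd)
 show "c > 0" by (rule c_pos)
 fix g :: "'m \<times> 'p => 'm \<times> 'p" assume [measurable]: "g \<in> borel_measurable (lebesgue_on (D \<times> W))"
 have [measurable]: "snd \<in> borel_measurable (lebesgue_on (D \<times> W))"
  by (rule borel_measurable_lebesgue_on) (intro bm_cont continuous_intros)
 show "(%x. cylB x (g x)) \<in> borel_measurable (lebesgue_on (D \<times> W))" unfolding cylB_def by measurable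
qed

lemma elliptic_dir:
 assumes "norm \<nu> = 1" shows "elliptic_problem ({..<0} \<times> W) (dirB \<nu>) c C"
proof (intro elliptic_problem.intro elliptic.intro)
 show "open ({..<0::real} \<times> W)" using W by (simp add: open_Times)
 show "linear (dirB \<nu> x)" for x
 proof (rule linearI)
  show "dirB \<nu> x (y + z) = dirB \<nu> x y + dirB \<nu> x z" for y z
   by (simp add: dirB_def linear_add[OF linear_dir_embed] linear_add[OF B_lin] inner_add_left)
  show "dirB \<nu> x (r *R y) = r *R dirB \<nu> x y" for r y
   by (simp add: dirB_def linear_scale[OF linear_dir_embed] linear_scale[OF B_lin])
 qed
 show "dirB \<nu> x y \<bullet> z = y \<bullet> dirB \<nu> x z" for x y z
  unfolding inner_commute[of y] dirB_inner B_sym[of _ "dir_embed \<nu> y"] by (rule inner_commute)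
 show "c * (norm y)^2 <= dirB \<nu> x y \<bullet> y" for x y
  unfolding dirB_inner using B_ell[of "dir_embed \<nu> y" "snd x"] by (simp add: norm_dir_embed[OF assms])
 show "norm (dirB \<nu> x y) <= C * norm y" for x y
 proof -
  have "\<bar>fst (B (snd x) (dir_embed \<nu> y)) \<bullet> \<nu>\<bar> <= norm (fst (B (snd x) (dir_embed \<nu> y))) * norm \<nu>" by (rule Cauchy_Schwarz_ineq2)
  hence "\<bar>fst (B (snd x) (dir_embed \<nu> y)) \<bullet> \<nu>\<bar> <= norm (fst (B (snd x) (dir_embed \<nu> y)))" by (simp add: assms)
  hence "(fst (B (snd x) (dir_embed \<nu> y)) \<bullet> \<nu>)^2 <= (norm (fst (B (snd x) (dir_embed \<nu> y))))^2"
   by (metis abs_ge_zero power2_abs power_mono)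
  hence "norm (dirB \<nu> x y) <= norm (B (snd x) (dir_embed \<nu> y))"
   unfolding dirB_def norm_prod_def by (simp add: norm_prod_def)
  also have "... <= C * norm y" using B_bd[of "snd x" "dir_embed \<nu> y"] by (simp add: norm_dir_embed[OF assms])
  finally show ?thesis .
 qed
 show "c > 0" by (rule c_pos)
 fix g :: "real \<times> 'p => real \<times> 'p" assume [measurable]: "g \<in> borel_measurable (lebesgue_on ({..<0} \<times> W))"
 have [measurable]: "snd \<in> borel_measurable (lebesgue_on ({..<0::real} \<times> W))"
  by (rule borel_measurable_lebesgue_on) (intro bm_cont continuous_intros)
 have f: "(%x. B (snd x) (dir_embed \<nu> (g x))) \<in> borel_measurable (lebesgue_on ({..<0} \<times> W))" by measurable
 have m1: "(%y::'m \<times> 'p. (fst y \<bullet> \<nu>, snd y)) \<in> BM"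
  by (intro bm_cont continuous_intros)
 show "(%x. dirB \<nu> x (g x)) \<in> borel_measurable (lebesgue_on ({..<0} \<times> W))"
  unfolding dirB_def using measurable_compose[OF f m1] .
qed

definition Zd :: "'m => real" where
 "Zd \<nu> = rayleigh_inf ({..<0} \<times> W) ({..<0} \<times> frontier W) (dirB \<nu>)"

end

context elliptic_problem
begin

lemma rayleigh_inf_nonneg: 
 assumes "adm Om ga u g" "sqn M u > 0"
 shows "0 <= rayleigh_inf Om ga A"
 unfolding rayleigh_inf_def
proof (rule cInf_greatest)
 have "~(AE x in M. u x = 0)"
 proof
  assume z: "AE x in M. u x = 0"
  have "sqn M u = ip M (%x. 0) (%x. 0::real)" by (intro ip_cong_AE z) (use adm_L2[OF assms(1)] in \<open>auto simp: L2_def\<close>)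
  thus False using assms(2) by (simp add: ip_def)
 qed
 thus "{energy Om A u u / (LINT x|lebesgue_on Om. (u x)^2) |u. u \<in> H1_vanishing Om ga & ~(AE x in lebesgue_on Om. u x = 0)} ~= {}"
  using assms(1) unfolding adm_def by blast
 fix x assume "x \<in> {energy Om A u u / (LINT x|lebesgue_on Om. (u x)^2) |u. u \<in> H1_vanishing Om ga & ~(AE x in lebesgue_on Om. u x = 0)}"
 then obtain v where v: "x = energy Om A v v / (LINT x|lebesgue_on Om. (v x)^2)" "v \<in> H1_vanishing Om ga" by blast
 have a: "adm Om ga v (weak_gradient Om v)" by (rule adm_weak_gradient[OF v(2)])
 have "energy Om A v v >= 0" using energy_eq[of v "weak_gradient Om v" v "weak_gradient Om v"] a en_nonneg adm_L2(2)[OF a] by (simp add: adm_def)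
 thus "0 <= x" unfolding v(1) by (intro divide_nonneg_nonneg) auto
qed

lemma rayleigh_inf_le:
 assumes a: "adm Om ga u g"
 shows "rayleigh_inf Om ga A * sqn M u <= en g g"
proof (cases "sqn M u > 0")
 case True
 let ?S = "{energy Om A u u / (LINT x|lebesgue_on Om. (u x)^2) |u. u \<in> H1_vanishing Om ga & ~(AE x in lebesgue_on Om. u x = 0)}"
 have nz: "~(AE x in M. u x = 0)"
 proof
  assume z: "AE x in M. u x = 0"
  have "sqn M u = ip M (%x. 0) (%x. 0::real)" by (intro ip_cong_AE z) (use adm_L2[OF a] in \<open>auto simp: L2_def\<close>)
  thus False using True by (simp add: ip_def)
 qed
 have e: "energy Om A u u = en g g" using energy_eq[of u g u g] a by (simp add: adm_def)
 have "rayleigh_inf Om ga A <= energy Om A u u / (LINT x|lebesgue_on Om. (u x)^2)"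
  unfolding rayleigh_inf_def
 proof (rule cInf_lower)
  show "energy Om A u u / (LINT x|lebesgue_on Om. (u x)^2) \<in> ?S" using a nz unfolding adm_def by blast
  show "bdd_below ?S"
  proof (rule bdd_belowI[of _ 0])
   fix x assume "x \<in> ?S"
   then obtain v where v: "x = energy Om A v v / (LINT x|lebesgue_on Om. (v x)^2)" "v \<in> H1_vanishing Om ga" by blast
   have av: "adm Om ga v (weak_gradient Om v)" by (rule adm_weak_gradient[OF v(2)])
   have "energy Om A v v >= 0" using energy_eq[of v "weak_gradient Om v" v "weak_gradient Om v"] av en_nonneg adm_L2(2)[OF av] by (simp add: adm_def)
   thus "0 <= x" unfolding v(1) by (intro divide_nonneg_nonneg) auto
  qed
 qed
 moreover have "(LINT x|lebesgue_on Om. (u x)^2) = sqn M u" by (simp add: ip_self)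
 ultimately show ?thesis using True e by (simp add: le_divide_eq)
next
 case False
 hence "sqn M u = 0" using ip_self_nonneg[of M u] by linarith
 thus ?thesis using en_nonneg[OF adm_L2(2)[OF a]] by simp
qed

lemma rayleigh_inf_approx:
 assumes a: "adm Om ga u g" "sqn M u > 0" and z: "rayleigh_inf Om ga A < z"
 shows "EX v k. C1c v k & supp v \<inter> closure ga = {} & sqn M v > 0 & en k k < z * sqn M v"
proof -
 let ?S = "{energy Om A u u / (LINT x|lebesgue_on Om. (u x)^2) |u. u \<in> H1_vanishing Om ga & ~(AE x in lebesgue_on Om. u x = 0)}"
 have nz: "~(AE x in M. u x = 0)"
 proof
  assume z: "AE x in M. u x = 0"
  have "sqn M u = ip M (%x. 0) (%x. 0::real)" by (intro ip_cong_AE z) (use adm_L2[OF a(1)] in \<open>auto simp: L2_def\<close>)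
  thus False using a(2) by (simp add: ip_def)
 qed
 hence "?S ~= {}" using a(1) unfolding adm_def by blast
 hence "EX x:?S. x < z" using z unfolding rayleigh_inf_def by (rule cInf_lessD)
 then obtain v where v: "energy Om A v v / (LINT x|lebesgue_on Om. (v x)^2) < z" "v \<in> H1_vanishing Om ga"
  "~(AE x in M. v x = 0)" by blast
 let ?g = "weak_gradient Om v"
 have av: "adm Om ga v ?g" by (rule adm_weak_gradient[OF v(2)])
 have p: "sqn M v > 0" using L2_zero_AE[OF adm_L2(1)[OF av]] v(3) ip_self_nonneg[of M v] by fastforce
 have e: "energy Om A v v = en ?g ?g" using energy_eq[of v ?g v ?g] av by (simp add: adm_def)
 have lt: "en ?g ?g < z * sqn M v" using v(1) p unfolding e by (simp add: ip_self divide_less_eq)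
 obtain \<phi> k where \<phi>: "!!n. C1c (\<phi> n) (k n)" "!!n. supp (\<phi> n) \<inter> closure ga = {}"
  "L2_tendsto M \<phi> v" "L2_tendsto M k ?g" by (rule adm_C1c_sequence[OF open_Om av]) (rule that)
 have t1: "(%n. sqn M (\<phi> n)) \<longlonglongrightarrow> sqn M v" by (rule L2_tendsto_ip[OF \<phi>(3) \<phi>(3)])
 have "(%n. z * sqn M (\<phi> n) - en (k n) (k n)) \<longlonglongrightarrow> z * sqn M v - en ?g ?g"
  by (intro tendsto_intros t1 en_tendsto[OF \<phi>(4)])
 from order_tendstoD(1)[OF this, of 0] have e1: "\<forall>\<^sub>F n in sequentially. 0 < z * sqn M (\<phi> n) - en (k n) (k n)" using lt by simp
 have "\<forall>\<^sub>F n in sequentially. 0 < sqn M (\<phi> n)" by (rule order_tendstoD(1)[OF t1 p])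
 with e1 have "\<forall>\<^sub>F n in sequentially. en (k n) (k n) < z * sqn M (\<phi> n) & 0 < sqn M (\<phi> n)" by eventually_elim simp
 then obtain n where "en (k n) (k n) < z * sqn M (\<phi> n)" "0 < sqn M (\<phi> n)"
  using eventually_happens by force
 thus ?thesis using \<phi>(1,2) by blast
qed

lemma en_nn_integral:
 assumes "L2 M g" "(%x. A x (g x) \<bullet> g x) \<in> BM"
 shows "(NI x. ennreal (A x (g x) \<bullet> g x) * indicator Om x) = ennreal (en g g)"
proof -
 have "(NI x. ennreal (A x (g x) \<bullet> g x) * indicator Om x) = (\<integral>\<^sup>+x. ennreal (A x (g x) \<bullet> g x) \<partial>M)"
  using borel_Om by (simp add: nn_integral_restrict_space nn_integral_completion)
 also have "... = ennreal (en g g)"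
  unfolding en_def ip_def
 proof (rule nn_integral_eq_integral[OF L2_inner[OF L2_A[OF assms(1)] assms(1)]])
  show "AE x in M. 0 <= A x (g x) \<bullet> g x"
  proof (rule AE_I2)
   fix x assume "x \<in> space M"
   hence "c * (norm (g x))^2 <= A x (g x) \<bullet> g x" by (intro ell) simp
   moreover have "0 <= c * (norm (g x))^2" using c_pos by simp
   ultimately show "0 <= A x (g x) \<bullet> g x" by linarith
  qed
 qed
 finally show ?thesis .
qed

end

lemma C1c_borel: "C1c v g ==> v \<in> BM" "C1c v g ==> g \<in> BM"
 by (auto simp: C1c_def intro!: bm_cont C1g_cont_fun C1g_cont)

context coef
begin

definition N2 :: "'a::euclidean_space set => ('a \<times> 'p => real) => ennreal" where
 "N2 D v = (NI x. ennreal ((v x)^2) * indicator (D \<times> W) x)"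

definition E :: "'m set => ('m \<times> 'p => 'm \<times> 'p) => ennreal" where
 "E D g = (NI x. ennreal (Q (snd x) (g x)) * indicator (D \<times> W) x)"

definition Ed :: "'m => (real \<times> 'p => real \<times> 'p) => ennreal" where
 "Ed \<nu> k = (NI x. ennreal (Q (snd x) (dir_embed \<nu> (k x))) * indicator ({..<0} \<times> W) x)"

lemma snd_borel [measurable]: "(snd :: 'a::euclidean_space \<times> 'p => 'p) \<in> BM"
 by (intro bm_cont continuous_intros)

lemma E_eq:
 assumes "C1c v g" "open D" shows "E D g = ennreal (elliptic.en (D \<times> W) cylB g g)"
proof -
 interpret elliptic_problem "D \<times> W" "D \<times> frontier W" cylB c C by (rule elliptic_cyl[OF assms(2)])
 have [measurable]: "g \<in> BM" using C1c_borel[OF assms(1)] by simp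
 have "E D g = (NI x. ennreal (cylB x (g x) \<bullet> g x) * indicator (D \<times> W) x)"
  by (simp add: E_def Q_def cylB_def)
 also have "... = ennreal (en g g)"
  by (rule en_nn_integral[OF C1c_L2(2)[OF assms(1) borel_Om]]) (unfold cylB_def, measurable)
 finally show ?thesis .
qed

lemma Ed_eq:
 assumes "C1c w k" "norm \<nu> = 1" shows "Ed \<nu> k = ennreal (elliptic.en ({..<0} \<times> W) (dirB \<nu>) k k)"
proof -
 interpret elliptic_problem "{..<0} \<times> W" "{..<0} \<times> frontier W" "dirB \<nu>" c C by (rule elliptic_dir[OF assms(2)])
 have [measurable]: "k \<in> BM" using C1c_borel[OF assms(1)] by simp
 have "Ed \<nu> k = (NI x. ennreal (dirB \<nu> x (k x) \<bullet> k x) * indicator ({..<0} \<times> W) x)"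
  by (simp add: Ed_def Q_def dirB_inner)
 also have "... = ennreal (en k k)"
  by (rule en_nn_integral[OF C1c_L2(2)[OF assms(1) borel_Om]]) (unfold dirB_inner, measurable)
 finally show ?thesis .
qed

lemma N2_eq:
 assumes "C1c v g" "open D" shows "N2 D v = ennreal (sqn (lebesgue_on (D \<times> W)) v)"
 unfolding N2_def by (rule C1c_nn_integral(1)[OF assms(1)]) (use assms(2) W in \<open>auto intro: open_Times\<close>)

end

lemma C1c_ip_pos:
 assumes u: "C1c u g" and Om: "open Om" and x: "x \<in> Om" "u x ~= 0"
 shows "sqn (lebesgue_on Om) u > 0"
proof -
 let ?S = "Om \<inter> u -` (- {0})"
 have "open ?S" by (intro open_Int Om open_vimage) (use u in \<open>auto simp: C1c_def C1g_cont_fun\<close>)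
 hence "~negligible ?S" using x by (intro open_not_negligible) auto
 moreover have "negligible ?S" if "sqn (lebesgue_on Om) u = 0"
 proof -
  have m: "(%x. ennreal ((u x)^2) * indicator Om x) \<in> borel_measurable lborel"
   using C1c_borel(1)[OF u] borel_open[OF Om] by simp
  have "(NI x. ennreal ((u x)^2) * indicator Om x) = 0" using C1c_nn_integral(1)[OF u Om] that by simp
  hence "AE x in lborel. ennreal ((u x)^2) * indicator Om x = 0" using nn_integral_0_iff_AE[OF m] by simp
  hence "AE x in lborel. x \<notin> ?S" by eventually_elim (auto simp: indicator_def split: if_splits)
  hence "?S \<in> null_sets lborel" using \<open>open ?S\<close> by (simp add: AE_iff_null_sets)
  thus ?thesis by (simp add: negligible_iff_null_sets null_sets_completionI)
 qed
 ultimately show ?thesis using ip_self_nonneg[of "lebesgue_on Om" u] by fastforce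
qed

definition unit_bump :: "'a::euclidean_space => real" where "unit_bump x = pos2 (1 - x \<bullet> x)"
definition unit_bump' :: "'a::euclidean_space => 'a" where "unit_bump' x = (2 * max 0 (1 - x \<bullet> x)) *R (0 - 2 *R x)"

lemma unit_bump_supp: "unit_bump x ~= 0 ==> norm x < 1"
 using abs_square_less_1[of "norm x"] by (auto simp: unit_bump_def pos2_def dot_square_norm max_def split: if_splits)

lemma unit_bump_C1c: "C1c unit_bump unit_bump'"
proof -
 have "C1g unit_bump (unit_bump' :: 'a => 'a)"
  using C1g_pos2[OF C1g_diff[OF C1g_const[of 1] C1g_norm2]] unfolding unit_bump_def[abs_def] unit_bump'_def[abs_def] .
 moreover have "compact (supp (unit_bump :: 'a => real))"
  by (rule compact_suppI[of "cball 0 1"]) (auto dest: unit_bump_supp)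
 ultimately show ?thesis by (simp add: C1c_def)
qed

lemma C1g_affine:
 assumes "C1g u g" shows "C1g (%x. u (r *R (x - a))) (%x. r *R g (r *R (x - a)))"
 by (rule C1g_comp[OF assms, where T' = "%_ h. r *R h"])
  (auto intro!: derivative_eq_intros continuous_intros continuous_on_compose2[OF C1g_cont[OF assms]])

context coef
begin

lemma strip_function:
 obtains u g where "C1c u g" "supp u \<inter> closure ({..<0::real} \<times> frontier W) = {}"
   "sqn (lebesgue_on ({..<0::real} \<times> W)) u > 0"
proof -
 obtain \<xi> where \<xi>: "\<xi> \<in> W" using W by blast
 have oS: "open ({..<0::real} \<times> W)" using W by (auto intro: open_Times)
 then obtain r where r: "r > 0" "cball (-1, \<xi>) r \<subseteq> {..<0::real} \<times> W"
  using \<xi> open_contains_cball by (metis SigmaI lessThan_iff less_minus_one_simps(1))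
 let ?z = "(-1::real, \<xi>)"
 define u where "u = (%x. unit_bump ((1 / r) *R (x - ?z)))"
 have g: "C1g u (%x. (1 / r) *R unit_bump' ((1 / r) *R (x - ?z)))"
  unfolding u_def by (rule C1g_affine[OF C1c_C1g[OF unit_bump_C1c]])
 have us: "x \<in> cball ?z r" if "u x ~= 0" for x
  using unit_bump_supp[OF that[unfolded u_def]] r(1) by (simp add: dist_norm norm_minus_commute)
 have c: "C1c u (%x. (1 / r) *R unit_bump' ((1 / r) *R (x - ?z)))"
  unfolding C1c_def by (intro conjI g compact_suppI[OF compact_cball us])
 have "supp u \<subseteq> {..<0} \<times> W" using supp_leI[OF closed_cball us] r(2) by blast
 moreover have "W \<inter> frontier W = {}" using W(1) by (simp add: frontier_def interior_open)
 ultimately have 1: "supp u \<inter> closure ({..<0::real} \<times> frontier W) = {}"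
  by (auto simp: closure_lateral)
 have 2: "sqn (lebesgue_on ({..<0::real} \<times> W)) u > 0"
  by (rule C1c_ip_pos[OF c oS, of ?z]) (use \<xi> in \<open>auto simp: u_def unit_bump_def pos2_def\<close>)
 show thesis by (rule that[OF c 1 2])
qed

lemma Zd_nonneg:
 assumes "norm \<nu> = 1" shows "Zd \<nu> >= 0"
proof -
 interpret elliptic_problem "{..<0} \<times> W" "{..<0} \<times> frontier W" "dirB \<nu>" c C by (rule elliptic_dir[OF assms])
 obtain u g where u: "C1c u g" "supp u \<inter> closure ({..<0::real} \<times> frontier W) = {}"
   "sqn (lebesgue_on ({..<0::real} \<times> W)) u > 0" by (rule strip_function) (rule that)
 show ?thesis unfolding Zd_def by (rule rayleigh_inf_nonneg[OF C1c_adm[OF u(1) open_Om u(2)] u(3)])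
qed

lemma Zd_le:
 assumes \<nu>: "norm \<nu> = 1" and w: "C1c w k" "supp w \<inter> closure ({..<0::real} \<times> frontier W) = {}"
 shows "ennreal (Zd \<nu>) * N2 {..<0} w <= Ed \<nu> k"
proof -
 interpret elliptic_problem "{..<0} \<times> W" "{..<0} \<times> frontier W" "dirB \<nu>" c C by (rule elliptic_dir[OF \<nu>])
 have "Zd \<nu> * sqn M w <= en k k" unfolding Zd_def by (rule rayleigh_inf_le[OF C1c_adm[OF w(1) open_Om w(2)]])
 hence "ennreal (Zd \<nu> * sqn M w) <= ennreal (en k k)" by (rule ennreal_leI)
 thus ?thesis unfolding Ed_eq[OF w(1) \<nu>] N2_eq[OF w(1) open_lessThan]
  using Zd_nonneg[OF \<nu>] ip_self_nonneg[of M w] by (simp add: ennreal_mult)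
qed

lemma Zd_approx:
 assumes \<nu>: "norm \<nu> = 1" and z: "Zd \<nu> < z"
 shows "EX w k. C1c w k & supp w \<inter> closure ({..<0::real} \<times> frontier W) = {} & 
  sqn (lebesgue_on ({..<0} \<times> W)) w > 0 & elliptic.en ({..<0} \<times> W) (dirB \<nu>) k k < z * sqn (lebesgue_on ({..<0} \<times> W)) w"
proof -
 interpret elliptic_problem "{..<0} \<times> W" "{..<0} \<times> frontier W" "dirB \<nu>" c C by (rule elliptic_dir[OF \<nu>])
 obtain u g where u: "C1c u g" "supp u \<inter> closure ({..<0::real} \<times> frontier W) = {}"
   "sqn (lebesgue_on ({..<0::real} \<times> W)) u > 0" by (rule strip_function) (rule that)
 show ?thesis by (rule rayleigh_inf_approx[OF C1c_adm[OF u(1) open_Om u(2)] u(3)]) (use z in \<open>simp add: Zd_def\<close>)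
qed

end

lemma C1g_sqrt:
 assumes u: "C1g u g" "!!x. u x > 0"
 shows "C1g (%x. sqrt (u x)) (%x. (1 / (2 * sqrt (u x))) *R g x)"
 unfolding C1g_def
proof
 show "ALL x. ((%x. sqrt (u x)) has_derivative (%h. ((1 / (2 * sqrt (u x))) *R g x) \<bullet> h)) (at x)"
 proof
  fix x
  have "(sqrt has_real_derivative (inverse (sqrt (u x)) / 2)) (at (u x))" by (rule DERIV_real_sqrt[OF u(2)])
  from diff_chain_at[OF C1gD[OF u(1), of x] this[unfolded has_field_derivative_def]]
  show "((%x. sqrt (u x)) has_derivative (%h. ((1 / (2 * sqrt (u x))) *R g x) \<bullet> h)) (at x)"
   by (simp add: o_def field_simps)
 qed
 show "contU (%x. (1 / (2 * sqrt (u x))) *R g x)"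
  by (intro continuous_intros C1g_cont[OF u(1)] C1g_cont_fun[OF u(1)]) (use u(2) in \<open>auto simp: less_imp_neq[symmetric]\<close>)
qed

lemma integral_lincomb5:
 fixes f1 f2 f5 :: "'a => real" and f3 :: "'a => 'b::euclidean_space" and f4 :: "'a => 'c::euclidean_space"
 assumes "integrable M f1" "integrable M f2" "integrable M f3" "integrable M f4" "integrable M f5"
 shows "(\<integral>y. c1 * f1 y - c2 * f2 y - 2 * (u3 \<bullet> f3 y) - 2 * (u4 \<bullet> f4 y) + c5 * f5 y \<partial>M) = 
  c1 * (\<integral>y. f1 y \<partial>M) - c2 * (\<integral>y. f2 y \<partial>M) - 2 * (u3 \<bullet> (\<integral>y. f3 y \<partial>M)) - 2 * (u4 \<bullet> (\<integral>y. f4 y \<partial>M)) + c5 * (\<integral>y. f5 y \<partial>M)"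
 using assms by simp

lemma measurable_borel_pair_lborel:
 fixes f :: "'a::euclidean_space \<times> 'b::euclidean_space => 'c::topological_space"
 assumes "f \<in> BM" shows "f \<in> borel_measurable (borel \<Otimes>\<^sub>M lborel)"
 using assms by (simp add: borel_prod[symmetric] measurable_cong_sets[OF sets_pair_measure_cong[OF refl sets_lborel] refl])

locale slice = coef B c C W for B :: "'p::euclidean_space => 'm::euclidean_space \<times> 'p => 'm \<times> 'p" and c C W +
 fixes v :: "'m \<times> 'p => real" and g :: "'m \<times> 'p => 'm \<times> 'p"
  and D :: "'m set" and b :: 'm and R de :: real and e :: 'm and H :: "'m => real" and k :: "'m => 'm" and p :: 'm
 assumes v: "C1c v g" and gc: "graph_chart D b R de e H k p"
  and v_ball: "!!x. x \<in> supp v ==> fst x \<in> ball b R"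
  and v_lateral: "supp v \<inter> closure (D \<times> frontier W) = {}"
  and D: "open D" and small: "C / c * de < 1"
begin

lemma e1: "norm e = 1" and ee: "e \<bullet> e = 1" and H: "C1g H k" and H_inv: "H (y + t *R e) = H y"
 and D_ball: "y \<in> ball b R ==> y \<in> D \<longleftrightarrow> y \<bullet> e < H y" and pe: "p \<bullet> e = 0" 
 and k_close: "y \<in> ball b R ==> norm (k y - p) <= de"
 using gc by (auto simp: graph_chart_def dot_square_norm)

lemma k_inv: "k (y + t *R e) = k y"
proof -
 have "C1g (%y. H (y + t *R e)) (%y. k (y + t *R e))"
  by (rule C1g_comp[OF H, where T' = "%_ h. h"]) (auto intro!: derivative_eq_intros continuous_on_compose2[OF C1g_cont[OF H]] continuous_intros)
 hence "C1g H (%y. k (y + t *R e))" by (simp add: H_inv)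
 from fun_cong[OF C1g_unique[OF this H]] show ?thesis .
qed

lemma ke: "k y \<bullet> e = 0" by (rule invariant_gradient[OF H H_inv])

definition a :: real where "a = norm (e - p)"
definition \<nu> :: 'm where "\<nu> = (1 / a) *R (e - p)"

lemma a_pos: "a > 0"
proof -
 have "(e - p) \<bullet> e = 1" by (simp add: inner_diff_left ee pe)
 hence "e - p ~= 0" by auto
 thus ?thesis by (simp add: a_def)
qed

lemma \<nu>1: "norm \<nu> = 1" using a_pos by (simp add: \<nu>_def a_def)

text \<open>The surface \<open>{T y (t, \<xi>)}\<close> is the boundary graph translated by \<open>a t\<close> along \<open>e\<close>. The component of
  \<open>y\<close> along \<open>e\<close> is a dummy variable, integrated out against \<open>kernel\<close>; this replaces integration over
  the hyperplane orthogonal to \<open>e\<close>.\<close>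

definition T :: "'m => real \<times> 'p => 'm \<times> 'p" where
 "T y x = (y - (y \<bullet> e) *R e + (a * fst x + H y) *R e, snd x)"

lemma fst_T: "fst (T y x) = y + (a * fst x + H y - y \<bullet> e) *R e" by (simp add: T_def algebra_simps)

lemma T_in_D: "fst (T y x) \<in> ball b R ==> fst (T y x) \<in> D \<longleftrightarrow> fst x < 0"
 using a_pos by (simp add: D_ball) (simp add: fst_T H_inv inner_add_left ee mult_less_0_iff)

lemma cont_H [continuous_intros]: "continuous_on S f ==> continuous_on S (%x. H (f x))"
 by (rule continuous_on_compose2[OF C1g_cont_fun[OF H]]) auto

lemma cont_k [continuous_intros]: "continuous_on S f ==> continuous_on S (%x. k (f x))"
 by (rule continuous_on_compose2[OF C1g_cont[OF H]]) auto

lemma cont_v [continuous_intros]: "continuous_on S f ==> continuous_on S (%x. v (f x))"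
 by (rule continuous_on_compose2[OF C1g_cont_fun[OF C1c_C1g[OF v]]]) auto

lemma cont_g [continuous_intros]: "continuous_on S f ==> continuous_on S (%x. g (f x))"
 by (rule continuous_on_compose2[OF C1g_cont[OF C1c_C1g[OF v]]]) auto

lemma cont_kernel [continuous_intros]: "continuous_on S f ==> continuous_on S (%x. kernel (f x))"
 by (rule continuous_on_compose2[OF kernel_cont]) auto

lemma cont_T [continuous_intros]: "continuous_on S f ==> continuous_on S h ==> continuous_on S (%x. T (f x) (h x))"
 unfolding T_def by (intro continuous_intros) auto

lemma measurable_H [measurable]: "H \<in> BM" by (intro bm_cont continuous_intros)
lemma measurable_v [measurable]: "v \<in> BM" by (intro bm_cont continuous_intros)
lemma measurable_g [measurable]: "g \<in> BM" by (intro bm_cont continuous_intros)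

definition R0 :: real where "R0 = (SOME r. r > 0 & supp v \<subseteq> cball 0 r)"

lemma R0: "R0 > 0" "x \<in> supp v ==> norm x <= R0"
proof -
 have "bounded (supp v)" using v by (simp add: C1c_def compact_imp_bounded)
 hence "EX r. r > 0 & supp v \<subseteq> cball 0 r" by (meson bounded_subset_ballD ball_subset_cball order_trans)
 from someI_ex[OF this] show "R0 > 0" "x \<in> supp v ==> norm x <= R0" by (auto simp: R0_def)
qed

definition K :: "'m set" where "K = cball 0 (R0 + 1)"

lemma in_K:
 assumes "T y x \<in> supp v" "kernel (y \<bullet> e) ~= 0" shows "y \<in> K"
proof -
 let ?y = "y - (y \<bullet> e) *R e"
 have o: "?y \<bullet> e = 0" by (simp add: inner_diff_left ee)
 have "(norm (fst (T y x)))^2 = (norm ?y)^2 + (norm ((a * fst x + H y) *R e))^2"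
  unfolding T_def fst_conv by (subst norm_add_Pythagorean) (auto simp: orthogonal_def o)
 hence "(norm ?y)^2 <= (norm (fst (T y x)))^2" by simp
 hence "norm ?y <= norm (fst (T y x))" by (rule power2_le_imp_le) simp
 also have "... <= R0" using R0(2)[OF assms(1)] norm_fst_le[of "T y x"] by (metis norm_fst_le order_trans prod.collapse)
 finally have 1: "norm ?y <= R0" .
 have "norm y <= norm ?y + norm ((y \<bullet> e) *R e)" using norm_triangle_ineq[of ?y "(y \<bullet> e) *R e"] by simp
 also have "... <= R0 + 1" using 1 kernel_supp[OF assms(2)] by (simp add: e1)
 finally show ?thesis by (simp add: K_def)
qed

lemma compact_K: "compact K" by (simp add: K_def)

lemma slice_integrable:
 fixes f :: "'m => 'z::euclidean_space"
 assumes "contU f" "!!y. T y x \<notin> supp v ==> f y = 0"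
 shows "integrable lborel (%y. kernel (y \<bullet> e) *R f y)"
proof (rule integrable_continuous_compact[OF _ compact_K])
 show "contU (%y. kernel (y \<bullet> e) *R f y)" by (intro continuous_intros assms)
 show "kernel (y \<bullet> e) *R f y = 0" if "y \<notin> K" for y using in_K[of y x] assms(2)[of y] that by auto
qed

lemma v0: "x \<notin> supp v ==> v x = 0" by (rule not_supp)
lemma g0: "x \<notin> supp v ==> g x = 0" by (rule C1g_zero_outside_supp[OF C1c_C1g[OF v]])

definition S :: "real \<times> 'p => real" where "S x = (LI y. kernel (y \<bullet> e) * (v (T y x))^2)"
definition \<beta> :: "real \<times> 'p => real" where "\<beta> x = (LI y. kernel (y \<bullet> e) * (v (T y x) * (fst (g (T y x)) \<bullet> e)))"
definition \<zeta> :: "real \<times> 'p => 'p" where "\<zeta> x = (LI y. kernel (y \<bullet> e) *R (v (T y x) *R snd (g (T y x))))"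
definition G :: "real \<times> 'p => real" where "G x = (LI y. kernel (y \<bullet> e) * Q (snd x) (g (T y x)))"

lemma S_nonneg: "S x >= 0"
 unfolding S_def by (intro integral_nonneg_AE AE_I2) (simp add: kernel_nonneg)

lemma cont_Q [continuous_intros]: "continuous_on s f ==> continuous_on s (%y. Q \<xi> (f y))"
 unfolding Q_def
 by (intro continuous_intros continuous_on_compose2[OF linear_continuous_on[OF B_lin[unfolded linear_conv_bounded_linear], of UNIV]]) auto

lemma Q0: "Q \<xi> 0 = 0" by (simp add: Q_def)

lemma slice_int:
 "integrable lborel (%y. kernel (y \<bullet> e) * (v (T y x))^2)"
 "integrable lborel (%y. kernel (y \<bullet> e) * (v (T y x) * (fst (g (T y x)) \<bullet> e)))"
 "integrable lborel (%y. kernel (y \<bullet> e) *R (v (T y x) *R snd (g (T y x))))"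
 "integrable lborel (%y. kernel (y \<bullet> e) * Q (snd x) (g (T y x)))"
proof -
 show "integrable lborel (%y. kernel (y \<bullet> e) * (v (T y x))^2)"
  using slice_integrable[of "%y. (v (T y x))^2" x] by (simp add: continuous_intros v0)
 show "integrable lborel (%y. kernel (y \<bullet> e) * (v (T y x) * (fst (g (T y x)) \<bullet> e)))"
  using slice_integrable[of "%y. v (T y x) * (fst (g (T y x)) \<bullet> e)" x] by (simp add: continuous_intros v0)
 show "integrable lborel (%y. kernel (y \<bullet> e) *R (v (T y x) *R snd (g (T y x))))"
  by (rule slice_integrable[where x = x]) (auto simp: v0 zero_prod_def intro!: continuous_intros)
 show "integrable lborel (%y. kernel (y \<bullet> e) * Q (snd x) (g (T y x)))"
  using slice_integrable[of "%y. Q (snd x) (g (T y x))" x] by (simp add: continuous_intros g0 Q0)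
qed

lemma S_C1g: "C1g S (%x. 2 *R (a * \<beta> x, \<zeta> x))"
proof -
 define G' where "G' y x = kernel (y \<bullet> e) *R (2 * v (T y x)) *R (a * (fst (g (T y x)) \<bullet> e), snd (g (T y x)))" for y x
 have "C1g (%x. LI y. kernel (y \<bullet> e) * (v (T y x))^2) (%x. LI y. G' y x)"
 proof (rule C1g_integral_param)
  fix y x
  have T': "((%x. T y x) has_derivative (%h. ((a * fst h) *R e, snd h))) (at x)"
   unfolding T_def by (auto intro!: derivative_eq_intros)
  have 1: "((%x. v (T y x)) has_derivative (%h. g (T y x) \<bullet> ((a * fst h) *R e, snd h))) (at x)"
   using diff_chain_at[OF T' C1gD[OF C1c_C1g[OF v], of "T y x"]] by (simp add: o_def)
  show "((%x. kernel (y \<bullet> e) * (v (T y x))^2) has_derivative (%h. G' y x \<bullet> h)) (at x)"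
   by (rule derivative_eq_intros 1 refl ext)+ (simp add: G'_def inner_prod_def algebra_simps)
 next
  show "contU (%(y, x). kernel (y \<bullet> e) * (v (T y x))^2)"
   unfolding split_beta by (intro continuous_intros)
  show "contU (%(y, x). G' y x)"
   unfolding split_beta G'_def by (intro continuous_intros)
  have "kernel (y \<bullet> e) * (v (T y x))^2 = 0" if "y \<notin> K" for y x using that in_K[of y x] v0[of "T y x"] by auto
  thus "EX K. compact K & (ALL y x. norm x < R --> y \<notin> K --> kernel (y \<bullet> e) * (v (T y x))^2 = 0)" for R
   using compact_K by blast
 qed
 moreover have "(LI y. G' y x) = 2 *R (a * \<beta> x, \<zeta> x)" for x
 proof -
  have "integrable lborel (%y. G' y x)"
   unfolding G'_def by (rule slice_integrable[where x = x]) (auto simp: v0 zero_prod_def intro!: continuous_intros)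
  hence "fst (LI y. G' y x) = (LI y. fst (G' y x))" "snd (LI y. G' y x) = (LI y. snd (G' y x))"
   using integral_bounded_linear[OF bounded_linear_fst] integral_bounded_linear[OF bounded_linear_snd] by metis+
  moreover have "(LI y. fst (G' y x)) = (LI y. (2 * a) * (kernel (y \<bullet> e) * (v (T y x) * (fst (g (T y x)) \<bullet> e))))"
   by (intro Bochner_Integration.integral_cong) (auto simp: G'_def)
  moreover have "(LI y. snd (G' y x)) = 2 *R \<zeta> x"
   unfolding \<zeta>_def integral_scaleR_right[symmetric] by (intro Bochner_Integration.integral_cong) (auto simp: G'_def)
  ultimately show ?thesis by (simp add: prod_eq_iff \<beta>_def)
 qed
 ultimately show ?thesis unfolding S_def[abs_def] by simp
qed

lemma by_parts:
 "(LI y. kernel (y \<bullet> e) *R (v (T y x) *R (fst (g (T y x)) - (fst (g (T y x)) \<bullet> e) *R (e - k y)))) = 0"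
proof -
 let ?n = "%y. fst (g (T y x)) - (fst (g (T y x)) \<bullet> e) *R (e - k y)"
 define u where "u y = (v (T y x))^2 * kernel (y \<bullet> e)" for y
 define u' where "u' y = ((v (T y x))^2 * kernel' (y \<bullet> e)) *R e + (2 * v (T y x) * kernel (y \<bullet> e)) *R ?n y" for y
 have "C1g u u'"
  unfolding C1g_def
 proof (intro conjI allI)
  fix y
  have T': "((%y. T y x) has_derivative (%h. (h - (h \<bullet> e) *R e + (k y \<bullet> h) *R e, 0))) (at y)"
   unfolding T_def by (auto intro!: derivative_eq_intros C1gD[OF H])
  have 1: "((%y. v (T y x)) has_derivative (%h. g (T y x) \<bullet> (h - (h \<bullet> e) *R e + (k y \<bullet> h) *R e, 0))) (at y)"
   using diff_chain_at[OF T' C1gD[OF C1c_C1g[OF v], of "T y x"]] by (simp add: o_def)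
  have "((%y. kernel (y \<bullet> e)) has_derivative (%h. kernel' (y \<bullet> e) * (h \<bullet> e))) (at y)"
   using diff_chain_at[OF bounded_linear_imp_has_derivative[OF bounded_linear_inner_left, of e "at y"] kernel_deriv[unfolded has_field_derivative_def]] by (simp add: o_def)
  note 2 = this
  show "(u has_derivative (%h. u' y \<bullet> h)) (at y)"
   unfolding u_def[abs_def]
   by (rule derivative_eq_intros 1 2 refl ext)+ (simp add: u'_def inner_prod_def inner_commute[of e] algebra_simps)
 next
  have "contU (%y. kernel' (y \<bullet> e))" by (rule continuous_on_compose2[OF kernel'_cont]) (auto intro: continuous_intros)
  thus "contU u'" unfolding u'_def[abs_def] by (intro continuous_intros)
 qed
 moreover have "y \<in> K" if "u y ~= 0" for y using that in_K[of y x] v0[of "T y x"] by (auto simp: u_def)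
 ultimately have c: "C1c u u'" unfolding C1c_def using compact_suppI[OF compact_K] by blast
 have z: "(LI y. u' y) = 0" by (rule integral_gradient_zero[OF c])
 have i: "integrable lborel u'" by (rule C1c_integrable(2)[OF c])
 have "(LI y. (1/2) *R (u' y - (u' y \<bullet> e) *R e)) = (1/2) *R ((LI y. u' y) - ((LI y. u' y) \<bullet> e) *R e)"
  using i by simp
 hence "(LI y. (1/2) *R (u' y - (u' y \<bullet> e) *R e)) = 0" by (simp add: z)
 moreover have "(1/2) *R (u' y - (u' y \<bullet> e) *R e) = kernel (y \<bullet> e) *R (v (T y x) *R ?n y)" for y
 proof -
  have n: "?n y \<bullet> e = 0" by (simp add: inner_diff_left ee ke)
  have "u' y - (u' y \<bullet> e) *R e = (2 * v (T y x) * kernel (y \<bullet> e)) *R ?n y"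
   unfolding u'_def by (simp only: inner_add_left inner_scaleR_left ee n) simp
  thus ?thesis by simp
 qed
 ultimately show ?thesis by simp
qed

text \<open>Integrating \<open>Q (g - v q) \<ge> 0\<close> over a slice, where \<open>q\<close> does not depend on \<open>y\<close>, gives a Jensen
  inequality; by \<open>by_parts\<close> the tangential derivatives drop out up to the oscillation \<open>de\<close> of \<open>k\<close>.\<close>

lemma slice_energy:
 assumes ep: "ep > 0"
 shows "(1 - C / c * de) * Q (snd x) (dir_embed \<nu> ((1 / sqrt (S x + ep^2)) *R (a * \<beta> x, \<zeta> x))) <= (1 + C / c * de) * G x"
proof -
 let ?s = "S x + ep^2"
 have s: "?s > 0" using ep S_nonneg[of x] by (simp add: add_nonneg_pos)
 define q where "q = (1 / ?s) *R (\<beta> x *R (e - p), \<zeta> x)"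
 let ?B = "B (snd x) q" and ?V = "%y. v (T y x)" and ?g = "%y. g (T y x)" and ?ka = "%y. kernel (y \<bullet> e)"
 have sq: "1 / sqrt ?s = sqrt ?s / ?s" using s by (metis inverse_eq_divide less_imp_le sqrt_divide_self_eq)
 have "dir_embed \<nu> ((1 / sqrt ?s) *R (a * \<beta> x, \<zeta> x)) = sqrt ?s *R q"
  unfolding sq using a_pos by (simp add: dir_embed_def q_def \<nu>_def)
 hence goal: "Q (snd x) (dir_embed \<nu> ((1 / sqrt ?s) *R (a * \<beta> x, \<zeta> x))) = ?s * Q (snd x) q"
  using s by (simp add: Q_scale)
 have de: "de >= 0" if "T y x \<in> supp v" for y using k_close[OF v_ball[OF that]] norm_ge_zero order_trans by blast
 have pw: "0 <= Q (snd x) (?g y) - 2 * (?B \<bullet> (?V y * (fst (?g y) \<bullet> e)) *R (e - p, 0)) - 2 * (snd ?B \<bullet> (?V y *R snd (?g y)))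
   - 2 * (fst ?B \<bullet> (?V y *R (fst (?g y) - (fst (?g y) \<bullet> e) *R (e - k y))))
   + (?V y)^2 * Q (snd x) q + C / c * de * ((?V y)^2 * Q (snd x) q + Q (snd x) (?g y))" for y
 proof (cases "T y x \<in> supp v")
  case True
  let ?X = "fst (?g y)"
  have "0 <= Q (snd x) (?g y - ?V y *R q)" by (rule Q_nonneg)
  also have "... = Q (snd x) (?g y) - 2 * ?V y * (?B \<bullet> ?g y) + (?V y)^2 * Q (snd x) q" by (rule Q_diff_expand)
  also have "?B \<bullet> ?g y = fst ?B \<bullet> ?X + snd ?B \<bullet> snd (?g y)" by (simp add: inner_prod_def)
  finally have 1: "0 <= Q (snd x) (?g y) - 2 * ?V y * (fst ?B \<bullet> ?X + snd ?B \<bullet> snd (?g y)) + (?V y)^2 * Q (snd x) q" .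
  have kk: "norm (k y - p) <= de" using k_close[OF v_ball[OF True]] by (simp add: fst_T k_inv)
  have f: "norm (fst ?B) <= C * norm q" using norm_fst_le[of "fst ?B" "snd ?B"] B_bd[of "snd x" q] by simp
  have "\<bar>?X \<bullet> e\<bar> <= norm ?X * norm e" by (rule Cauchy_Schwarz_ineq2)
  also have "... <= norm (?g y)" using norm_fst_le[of "fst (?g y)" "snd (?g y)"] by (simp add: e1)
  finally have Xe: "\<bar>?X \<bullet> e\<bar> <= norm (?g y)" .
  have "\<bar>fst ?B \<bullet> (k y - p)\<bar> <= norm (fst ?B) * norm (k y - p)" by (rule Cauchy_Schwarz_ineq2)
  also have "... <= (C * norm q) * de" by (intro mult_mono f kk) (use C_pos in auto)
  finally have Bk: "\<bar>fst ?B \<bullet> (k y - p)\<bar> <= (C * norm q) * de" .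
  have "\<bar>2 * (?V y * (?X \<bullet> e) * (fst ?B \<bullet> (k y - p)))\<bar> = 2 * (\<bar>?V y\<bar> * \<bar>?X \<bullet> e\<bar> * \<bar>fst ?B \<bullet> (k y - p)\<bar>)" by (simp add: abs_mult)
  also have "... <= 2 * (\<bar>?V y\<bar> * norm (?g y) * ((C * norm q) * de))"
   by (intro mult_left_mono mult_mono Xe Bk) auto
  also have "... = C * de * (2 * ((\<bar>?V y\<bar> * norm q) * norm (?g y)))" by (simp add: mult_ac)
  also have "... <= C * de * ((\<bar>?V y\<bar> * norm q)^2 + (norm (?g y))^2)"
   using C_pos de[OF True] sum_squares_bound[of "\<bar>?V y\<bar> * norm q" "norm (?g y)"] by (intro mult_left_mono) (auto simp: mult.assoc)
  also have "... = C / c * de * ((?V y)^2 * (c * (norm q)^2) + c * (norm (?g y))^2)"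
   using c_pos by (simp add: power_mult_distrib field_simps)
  also have "... <= C / c * de * ((?V y)^2 * Q (snd x) q + Q (snd x) (?g y))"
   unfolding Q_def by (intro mult_left_mono add_mono B_ell) (use C_pos c_pos de[OF True] in auto)
  finally have 2: "\<bar>2 * (?V y * (?X \<bullet> e) * (fst ?B \<bullet> (k y - p)))\<bar> <= C / c * de * ((?V y)^2 * Q (snd x) q + Q (snd x) (?g y))" .
  have 3: "(?B \<bullet> (?V y * (?X \<bullet> e)) *R (e - p, 0)) + (snd ?B \<bullet> (?V y *R snd (?g y))) + (fst ?B \<bullet> (?V y *R (?X - (?X \<bullet> e) *R (e - k y))))
    = ?V y * (fst ?B \<bullet> ?X + snd ?B \<bullet> snd (?g y)) + ?V y * (?X \<bullet> e) * (fst ?B \<bullet> (k y - p))"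
   by (simp add: inner_prod_def inner_diff_right algebra_simps)
  show ?thesis using 1 2 3 by (simp only: abs_le_iff) (simp add: algebra_simps)
 qed (simp add: v0 g0 Q0 zero_prod_def[symmetric])
 have i1: "integrable lborel (%y. ?ka y *R (?V y *R (fst (?g y) - (fst (?g y) \<bullet> e) *R (e - k y))))"
  by (rule slice_integrable[where x = x]) (auto simp: v0 zero_prod_def intro!: continuous_intros)
 note int = slice_int[of x] i1
 have "0 <= (LI y. (1 + C / c * de) * (?ka y * Q (snd x) (?g y)) - 2 * (?B \<bullet> (e - p, 0)) * (?ka y * (?V y * (fst (?g y) \<bullet> e)))
   - 2 * (snd ?B \<bullet> (?ka y *R (?V y *R snd (?g y)))) - 2 * (fst ?B \<bullet> (?ka y *R (?V y *R (fst (?g y) - (fst (?g y) \<bullet> e) *R (e - k y)))))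
   + ((1 + C / c * de) * Q (snd x) q) * (?ka y * (?V y)^2))"
 proof (rule integral_nonneg_AE, rule AE_I2)
  fix y
  have "0 <= ?ka y * (Q (snd x) (?g y) - 2 * (?B \<bullet> (?V y * (fst (?g y) \<bullet> e)) *R (e - p, 0)) - 2 * (snd ?B \<bullet> (?V y *R snd (?g y)))
   - 2 * (fst ?B \<bullet> (?V y *R (fst (?g y) - (fst (?g y) \<bullet> e) *R (e - k y))))
   + (?V y)^2 * Q (snd x) q + C / c * de * ((?V y)^2 * Q (snd x) q + Q (snd x) (?g y)))" (is "_ <= ?r")
   by (intro mult_nonneg_nonneg pw kernel_nonneg)
  also have "?r = (1 + C / c * de) * (?ka y * Q (snd x) (?g y)) - 2 * (?B \<bullet> (e - p, 0)) * (?ka y * (?V y * (fst (?g y) \<bullet> e)))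
   - 2 * (snd ?B \<bullet> (?ka y *R (?V y *R snd (?g y)))) - 2 * (fst ?B \<bullet> (?ka y *R (?V y *R (fst (?g y) - (fst (?g y) \<bullet> e) *R (e - k y)))))
   + ((1 + C / c * de) * Q (snd x) q) * (?ka y * (?V y)^2)"
   unfolding inner_scaleR_right by algebra
  finally show "0 <= ..." .
 qed
 also have "... = (1 + C / c * de) * G x - 2 * (?B \<bullet> (e - p, 0)) * \<beta> x - 2 * (snd ?B \<bullet> \<zeta> x) + ((1 + C / c * de) * Q (snd x) q) * S x"
  unfolding integral_lincomb5[OF int(4) int(2) int(3) int(5) int(1)] by_parts G_def \<beta>_def \<zeta>_def S_def by simp
 also have "(?B \<bullet> (e - p, 0)) * \<beta> x + snd ?B \<bullet> \<zeta> x = ?B \<bullet> (?s *R q)"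
  using s by (simp add: q_def inner_prod_def)
 hence "2 * (?B \<bullet> (e - p, 0)) * \<beta> x = 2 * (?s * Q (snd x) q) - 2 * (snd ?B \<bullet> \<zeta> x)" by (simp add: Q_def)
 finally have 4: "0 <= (1 + C / c * de) * G x - 2 * (?s * Q (snd x) q) + (1 + C / c * de) * (S x * Q (snd x) q)" by (simp add: mult_ac)
 have "(1 + C / c * de) * (S x * Q (snd x) q) <= (1 + C / c * de) * (?s * Q (snd x) q)" if ne: "supp v ~= {}"
 proof -
  obtain z where "z \<in> supp v" using ne by blast
  from k_close[OF v_ball[OF this]] have "de >= 0" using norm_ge_zero order_trans by blast
  thus ?thesis using C_pos c_pos Q_nonneg by (intro mult_left_mono mult_right_mono) auto
 qed
 moreover have "Q (snd x) q = 0 & G x = 0" if "supp v = {}"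
  using that by (simp add: q_def \<beta>_def \<zeta>_def G_def v0 g0 Q0 zero_prod_def[symmetric])
 ultimately show ?thesis unfolding goal using 4 by (cases "supp v = {}") (auto simp: algebra_simps)
qed

text \<open>The regularised square root of \<open>S\<close> is the competitor for \<open>Z\<^sup>\<nu>\<close>.\<close>

definition w :: "real => real \<times> 'p => real" where "w ep x = sqrt (S x + ep^2) - ep"
definition w' :: "real => real \<times> 'p => real \<times> 'p" where "w' ep x = (1 / sqrt (S x + ep^2)) *R (a * \<beta> x, \<zeta> x)"

lemma w_C1g: assumes "ep > 0" shows "C1g (w ep) (w' ep)"
proof -
 have "C1g (%x. S x + ep^2) (%x. 2 *R (a * \<beta> x, \<zeta> x) + 0)" by (rule C1g_add[OF S_C1g C1g_const])
 from C1g_diff[OF C1g_sqrt[OF this] C1g_const[of ep]]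
 show ?thesis using assms S_nonneg by (simp add: w_def[abs_def] w'_def[abs_def] add_nonneg_pos)
qed

lemma w_support:
 assumes "ep > 0"
 shows "compact (supp (w ep))" "supp (w ep) \<inter> closure ({..<0::real} \<times> frontier W) = {}"
proof -
 obtain B where B: "!!y. y \<in> K ==> \<bar>H y\<bar> <= B"
 proof -
  have "bounded (H ` K)" by (intro compact_imp_bounded compact_continuous_image compact_K continuous_intros)
  thus thesis using that by (auto simp: bounded_real)
 qed
 define L where "L = {z :: 'm \<times> real \<times> 'p. z \<in> K \<times> cball 0 ((R0 + B) / a + R0) & T (fst z) (snd z) \<in> supp v}"
 have "compact L"
 proof -
  have "L = (K \<times> cball 0 ((R0 + B) / a + R0)) \<inter> (%z. T (fst z) (snd z)) -` supp v" by (auto simp: L_def)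
  moreover have "closed ((%z::'m \<times> real \<times> 'p. T (fst z) (snd z)) -` supp v)"
   by (intro closed_vimage closed_supp continuous_intros)
  ultimately show ?thesis using compact_K by (simp add: compact_Times compact_Int_closed)
 qed
 hence c: "compact (snd ` L)" by (intro compact_continuous_image continuous_intros)
 have sub: "x \<in> snd ` L" if "w ep x ~= 0" for x
 proof -
  have "EX y. kernel (y \<bullet> e) * (v (T y x))^2 ~= 0"
  proof (rule ccontr)
   assume "~?thesis" hence "!!y. kernel (y \<bullet> e) * (v (T y x))^2 = 0" by blast
   from Bochner_Integration.integral_cong[OF refl this] have "S x = 0" unfolding S_def by simp
   thus False using that assms by (simp add: w_def)
  qed
  then obtain y where y: "kernel (y \<bullet> e) ~= 0" "v (T y x) ~= 0" by auto
  hence s: "T y x \<in> supp v" using v0 by blast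
  have yK: "y \<in> K" by (rule in_K[OF s y(1)])
  have n: "norm (T y x) <= R0" by (rule R0(2)[OF s])
  have "fst (T y x) \<bullet> e = a * fst x + H y" by (simp add: fst_T inner_add_left ee)
  moreover have "\<bar>fst (T y x) \<bullet> e\<bar> <= norm (fst (T y x)) * norm e" by (rule Cauchy_Schwarz_ineq2)
  moreover have "norm (fst (T y x)) <= R0" using n norm_fst_le[of "fst (T y x)" "snd (T y x)"] by simp
  ultimately have "\<bar>a * fst x\<bar> <= R0 + B" using B[OF yK] e1 by auto
  hence 1: "\<bar>fst x\<bar> <= (R0 + B) / a" using a_pos by (simp add: abs_mult field_simps)
  have 2: "norm (snd x) <= R0" using n norm_snd_le[of "snd (T y x)" "fst (T y x)"] by (simp add: T_def)
  have "norm x <= (R0 + B) / a + R0" using norm_Pair_le[of "fst x" "snd x"] 1 2 by simp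
  hence "(y, x) \<in> L" using yK s by (simp add: L_def)
  thus ?thesis by force
 qed
 show "compact (supp (w ep))" by (rule compact_suppI[OF c sub])
 have "supp (w ep) \<subseteq> snd ` L" by (rule supp_leI[OF compact_imp_closed[OF c] sub])
 moreover have False if "z \<in> L" "snd z \<in> closure ({..<0::real} \<times> frontier W)" for z
 proof -
  let ?X = "fst (T (fst z) (snd z))"
  have s: "T (fst z) (snd z) \<in> supp v" using that by (simp add: L_def)
  have t: "fst (snd z) <= 0" "snd (snd z) \<in> frontier W" using that(2) by (auto simp: closure_lateral)
  have bX: "?X \<in> ball b R" by (rule v_ball[OF s])
  have "?X \<in> closure D" unfolding closure_approachable
  proof (intro allI impI)
   fix r :: real assume r: "r > 0"
   obtain r' where r': "r' > 0" "ball ?X r' \<subseteq> ball b R" using openE[OF open_ball bX] by blast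
   define d where "d = min r r' / 2"
   have d: "d > 0" "d < r" "d < r'" using r r' by (auto simp: d_def)
   have di: "dist (?X - d *R e) ?X = d" using d by (simp add: dist_norm e1)
   hence "?X - d *R e \<in> ball b R" using r'(2) d(3) by (metis dist_commute mem_ball subsetD)
   moreover have "(?X - d *R e) \<bullet> e < H (?X - d *R e)"
   proof -
    have "H (?X - d *R e) = H (fst z)" using H_inv[of ?X "-d"] by (simp add: fst_T H_inv)
    moreover have "(?X - d *R e) \<bullet> e = a * fst (snd z) + H (fst z) - d" by (simp add: fst_T inner_add_left inner_diff_left ee)
    moreover have "a * fst (snd z) <= 0" using a_pos t(1) by (simp add: mult_nonneg_nonpos)
    ultimately show ?thesis using d by linarith
   qed
   ultimately have "?X - d *R e \<in> D" by (simp add: D_ball)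
   thus "EX y:D. dist y ?X < r" using di d(2) by (metis (no_types))
  qed
  moreover have "snd (T (fst z) (snd z)) \<in> frontier W" using t(2) by (simp add: T_def)
  ultimately have "T (fst z) (snd z) \<in> closure (D \<times> frontier W)"
   unfolding closure_lateral by (metis SigmaI prod.collapse)
  thus False using s v_lateral by blast
 qed
 ultimately show "supp (w ep) \<inter> closure ({..<0::real} \<times> frontier W) = {}" by blast
qed

lemma slice_disintegration:
 fixes F :: "'p => 'm \<times> 'p => real"
 assumes F: "(%x. F (snd x) x) \<in> BM" "!!\<xi> x. F \<xi> x >= 0" "!!\<xi> x. x \<notin> supp v ==> F \<xi> x = 0"
  and i: "!!x. integrable lborel (%y. kernel (y \<bullet> e) * F (snd x) (T y x))"
 shows "(NI x. ennreal (F (snd x) x) * indicator (D \<times> W) x) = 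
   ennreal a * (NI x. ennreal (LI y. kernel (y \<bullet> e) * F (snd x) (T y x)) * indicator ({..<0} \<times> W) x)"
proof -
 have [measurable]: "D \<in> sets borel" "W \<in> sets borel" using D W by auto
 note F(1)[measurable]
 have Fm [measurable]: "(%x. F \<xi> (x, \<xi>)) \<in> BM" for \<xi>
 proof -
  have "(%x::'m. (x, \<xi>)) \<in> BM" by (intro bm_cont continuous_intros)
  from measurable_compose[OF this F(1)] show ?thesis by simp
 qed
 have DW: "D \<times> W \<in> sets borel" using open_Times[OF D W(1)] by simp
 have m0: "(%x. ennreal (F (snd x) x) * indicator (D \<times> W) x) \<in> BM"
  using DW by measurable
 have "(NI x. ennreal (F (snd x) x) * indicator (D \<times> W) x) = 
   (NI \<xi>. NI X. (ennreal (F \<xi> (X, \<xi>)) * indicator D X) * indicator W \<xi>)"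
  by (subst nn_integral_pair'[OF m0]) (simp add: indicator_times mult.assoc)
 also have "... = (NI \<xi>. (NI X. ennreal (F \<xi> (X, \<xi>)) * indicator D X) * indicator W \<xi>)"
  by (simp add: nn_integral_multc)
 also have "... = (NI \<xi>. (ennreal a * (NI t. ennreal (LI y. kernel (y \<bullet> e) * F \<xi> (T y (t, \<xi>))) * indicator {..<0} t)) * indicator W \<xi>)"
 proof (rule nn_integral_cong)
  fix \<xi>
  let ?Y = "%t y. y - (y \<bullet> e) *R e + (a * t + H y) *R e"
  let ?i = "%t y. (ennreal (F \<xi> (?Y t y, \<xi>)) * indicator D (?Y t y)) * ennreal (kernel (y \<bullet> e))"
  have "(NI X. ennreal (F \<xi> (X, \<xi>)) * indicator D X) = 
    ennreal a * (NI t. NI y. ?i t y)"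
   by (rule disintegration[OF _ _ _ e1 a_pos kernel_nn_integral]) measurable
  also have "(NI t. NI y. ?i t y)
    = (NI t. ennreal (LI y. kernel (y \<bullet> e) * F \<xi> (T y (t, \<xi>))) * indicator {..<0} t)"
  proof (rule nn_integral_cong)
   fix t :: real
   have "(NI y. ?i t y)
    = (NI y. ennreal (kernel (y \<bullet> e) * F \<xi> (T y (t, \<xi>))) * indicator {..<0} t)"
   proof (rule nn_integral_cong)
    fix y
    have "F \<xi> (T y (t, \<xi>)) = 0 \<or> (fst (T y (t, \<xi>)) \<in> D \<longleftrightarrow> t < 0)"
    proof (cases "T y (t, \<xi>) \<in> supp v")
     case True
     show ?thesis using T_in_D[OF v_ball[OF True]] by simp
    qed (simp add: F(3))
    moreover have "T y (t, \<xi>) = (?Y t y, \<xi>)" by (simp add: T_def)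
    ultimately show "?i t y
     = ennreal (kernel (y \<bullet> e) * F \<xi> (T y (t, \<xi>))) * indicator {..<0} t"
     using F(2) kernel_nonneg by (auto simp: indicator_def ennreal_mult mult.commute)
   qed
   also have "... = (NI y. ennreal (kernel (y \<bullet> e) * F \<xi> (T y (t, \<xi>)))) * indicator {..<0} t"
    by (rule nn_integral_multc) (use i[of "(t, \<xi>)"] in auto)
   also have "(NI y. ennreal (kernel (y \<bullet> e) * F \<xi> (T y (t, \<xi>)))) = ennreal (LI y. kernel (y \<bullet> e) * F \<xi> (T y (t, \<xi>)))"
    by (rule nn_integral_eq_integral) (use i[of "(t, \<xi>)"] F(2) kernel_nonneg in auto)
   finally show "(NI y. ?i t y)
     = ennreal (LI y. kernel (y \<bullet> e) * F \<xi> (T y (t, \<xi>))) * indicator {..<0} t" .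
  qed
  finally show "(NI X. ennreal (F \<xi> (X, \<xi>)) * indicator D X) * indicator W \<xi> = (ennreal a * (NI t. ennreal (LI y. kernel (y \<bullet> e) * F \<xi> (T y (t, \<xi>))) * indicator {..<0} t)) * indicator W \<xi>" by simp
 qed
 also have "... = ennreal a * (NI x. ennreal (LI y. kernel (y \<bullet> e) * F (snd x) (T y x)) * indicator ({..<0} \<times> W) x)"
 proof -
  have m [measurable]: "(%x. LI y. kernel (y \<bullet> e) * F (snd x) (T y x)) \<in> BM"
  proof -
   have "(%z::(real \<times> 'p) \<times> 'm. T (snd z) (fst z)) \<in> BM" 
    by (intro bm_cont continuous_intros)
   from measurable_compose[OF this F(1)] have "(%z::(real \<times> 'p) \<times> 'm. F (snd (fst z)) (T (snd z) (fst z))) \<in> BM"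
    by (simp add: T_def)
   hence [measurable]: "(%z::(real \<times> 'p) \<times> 'm. F (snd (fst z)) (T (snd z) (fst z))) \<in> borel_measurable (borel \<Otimes>\<^sub>M lborel)"
    by (rule measurable_borel_pair_lborel)
   show ?thesis by (rule lborel.borel_measurable_lebesgue_integral) (unfold split_beta, measurable)
  qed
  have m2 [measurable]: "(%t. LI y. kernel (y \<bullet> e) * F \<xi> (T y (t, \<xi>))) \<in> BM" for \<xi>
  proof -
   have "(%t::real. (t, \<xi>)) \<in> BM" by (intro bm_cont continuous_intros)
   from measurable_compose[OF this m] show ?thesis by simp
  qed
  have m3: "(%x. ennreal (LI y. kernel (y \<bullet> e) * F (snd x) (T y x)) * indicator ({..<0} \<times> W) x) \<in> BM"
   using strip_borel by measurable
  have "(%z::'p \<times> real. (snd z, fst z)) \<in> BM" by (intro bm_cont continuous_intros)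
  from measurable_borel_pair_lborel[OF measurable_compose[OF this m]]
  have m4: "(%\<xi>. NI t. ennreal (LI y. kernel (y \<bullet> e) * F \<xi> (T y (t, \<xi>))) * indicator {..<0} t) \<in> BM"
   by (intro lborel.borel_measurable_nn_integral) (simp add: split_beta)
  show ?thesis
   by (subst nn_integral_pair'[OF m3]) 
    (use m4 in \<open>simp add: indicator_times mult.assoc[symmetric] nn_integral_multc, simp add: mult.assoc nn_integral_cmult\<close>)
 qed
 finally show ?thesis .
qed

lemma slice_bound: "ennreal (Zd \<nu> * (1 - C / c * de)) * N2 D v <= ennreal (1 + C / c * de) * E D g"
proof -
 let ?I = "%f. NI x. ennreal (f x) * indicator ({..<0::real} \<times> W) x"
 have NE: "N2 D v = ennreal a * ?I S" "E D g = ennreal a * ?I G"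
  unfolding N2_def E_def S_def[abs_def] G_def[abs_def] 
  by (rule slice_disintegration; simp add: v0 g0 Q0 Q_nonneg slice_int)+
 have wc: "C1c (w ep) (w' ep)" if "ep > 0" for ep using w_C1g[OF that] w_support(1)[OF that] by (simp add: C1c_def)
 define ep where "ep n = 1 / real (Suc n)" for n
 have ep: "ep n > 0" for n by (simp add: ep_def)
 have lim: "ep \<longlonglongrightarrow> 0" unfolding ep_def using LIMSEQ_inverse_real_of_nat by (simp add: inverse_eq_divide)
 have n: "ennreal (Zd \<nu> * (1 - C / c * de)) * ?I (%x. (w (ep n) x)^2) <= ennreal (1 + C / c * de) * ?I G" for n
 proof -
  have [measurable]: "w' (ep n) \<in> BM" using C1c_borel(2)[OF wc[OF ep]] .
  have "ennreal (Zd \<nu> * (1 - C / c * de)) * ?I (%x. (w (ep n) x)^2) = ennreal (1 - C / c * de) * (ennreal (Zd \<nu>) * N2 {..<0} (w (ep n)))"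
   using Zd_nonneg[OF \<nu>1] small by (simp add: N2_def ennreal_mult mult_ac)
  also have "... <= ennreal (1 - C / c * de) * Ed \<nu> (w' (ep n))"
   by (intro mult_left_mono Zd_le[OF \<nu>1 wc[OF ep] w_support(2)[OF ep]]) auto
  also have "... = (NI x. ennreal (1 - C / c * de) * (ennreal (Q (snd x) (dir_embed \<nu> (w' (ep n) x))) * indicator ({..<0} \<times> W) x))"
  proof -
   have "(%x. ennreal (Q (snd x) (dir_embed \<nu> (w' (ep n) x))) * indicator ({..<0} \<times> W) x) \<in> BM" 
    using strip_borel by measurable
   thus ?thesis unfolding Ed_def by (intro nn_integral_cmult[symmetric]) simp
  qed
  also have "... <= (NI x. ennreal (1 + C / c * de) * (ennreal (G x) * indicator ({..<0} \<times> W) x))"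
  proof (rule nn_integral_mono)
   fix x
   have "ennreal (1 - C / c * de) * ennreal (Q (snd x) (dir_embed \<nu> (w' (ep n) x))) <= ennreal (1 + C / c * de) * ennreal (G x)"
   proof -
    have "G x >= 0" unfolding G_def by (intro integral_nonneg_AE AE_I2) (simp add: kernel_nonneg Q_nonneg)
    thus ?thesis
     using ennreal_leI[OF slice_energy[OF ep[of n], of x]] small Q_nonneg
     by (simp add: w'_def ennreal_mult' ennreal_mult'')
   qed
   thus "ennreal (1 - C / c * de) * (ennreal (Q (snd x) (dir_embed \<nu> (w' (ep n) x))) * indicator ({..<0} \<times> W) x) <= ennreal (1 + C / c * de) * (ennreal (G x) * indicator ({..<0} \<times> W) x)"
    by (simp add: mult.assoc[symmetric] mult_right_mono)
  qed
  also have "... = ennreal (1 + C / c * de) * ?I G"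
  proof (rule nn_integral_cmult)
   have "(%z::(real \<times> 'p) \<times> 'm. kernel (snd z \<bullet> e) * Q (snd (fst z)) (g (T (snd z) (fst z)))) \<in> BM"
   proof -
    have [measurable]: "(%z::(real \<times> 'p) \<times> 'm. T (snd z) (fst z)) \<in> BM" "(%z::(real \<times> 'p) \<times> 'm. snd (fst z)) \<in> BM"
     "(%z::(real \<times> 'p) \<times> 'm. kernel (snd z \<bullet> e)) \<in> BM"
     by (intro bm_cont continuous_intros)+
    show ?thesis by measurable
   qed
   hence [measurable]: "(%(x, y). kernel (y \<bullet> e) * Q (snd x) (g (T y x))) \<in> borel_measurable ((borel :: (real \<times> 'p) measure) \<Otimes>\<^sub>M (lborel :: 'm measure))"
    unfolding split_beta by (rule measurable_borel_pair_lborel)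
   have "G \<in> BM" unfolding G_def[abs_def]
    by (rule lborel.borel_measurable_lebesgue_integral) measurable
   thus "(%x. ennreal (G x) * indicator ({..<0} \<times> W) x) \<in> borel_measurable lborel" using strip_borel by simp
  qed
  finally show ?thesis .
 qed
 have [measurable]: "(%x. w (ep n) x) \<in> BM" for n using C1c_borel(1)[OF wc[OF ep]] .
 have "?I S <= (NI x. liminf (%n. ennreal ((w (ep n) x)^2) * indicator ({..<0::real} \<times> W) x))"
 proof (rule nn_integral_mono)
  fix x
  have "(%n. (w (ep n) x)^2) \<longlonglongrightarrow> (sqrt (S x + 0^2) - 0)\<^sup>2"
   unfolding w_def by (intro tendsto_intros lim)
  hence "(%n. ennreal ((w (ep n) x)^2) * indicator ({..<0::real} \<times> W) x) \<longlonglongrightarrow> ennreal (S x) * indicator ({..<0::real} \<times> W) x"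
   using S_nonneg by (intro tendsto_mult_ennreal tendsto_ennrealI tendsto_const) (auto simp: indicator_def)
  from lim_imp_Liminf[OF _ this] show "ennreal (S x) * indicator ({..<0::real} \<times> W) x <= liminf (%n. ennreal ((w (ep n) x)^2) * indicator ({..<0::real} \<times> W) x)" by simp
 qed
 also have "... <= liminf (%n. ?I (%x. (w (ep n) x)^2))"
  by (rule nn_integral_liminf) (use strip_borel in measurable)
 finally have fatou: "?I S <= liminf (%n. ?I (%x. (w (ep n) x)^2))" .
 have le: "ennreal (Zd \<nu> * (1 - C / c * de)) * ?I S <= ennreal (1 + C / c * de) * ?I G"
 proof (cases "Zd \<nu> * (1 - C / c * de) > 0")
  case True
  let ?z = "ennreal (Zd \<nu> * (1 - C / c * de))" and ?y = "ennreal (1 / (Zd \<nu> * (1 - C / c * de)))"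
  have yz: "?y * (?z * r) = r" "?z * (?y * r) = r" for r
   using True by (auto simp: mult.assoc[symmetric] ennreal_mult[symmetric])
  have "?I (%x. (w (ep n) x)^2) <= ?y * (ennreal (1 + C / c * de) * ?I G)" for n
   using mult_left_mono[OF n[of n], of ?y] by (simp only: yz) simp
  hence "liminf (%n. ?I (%x. (w (ep n) x)^2)) <= ?y * (ennreal (1 + C / c * de) * ?I G)"
   by (intro Liminf_le) auto
  with fatou have "?I S <= ?y * (ennreal (1 + C / c * de) * ?I G)" by (rule order_trans)
  hence "?z * ?I S <= ?z * (?y * (ennreal (1 + C / c * de) * ?I G))" by (rule mult_left_mono) simp
  also have "... = ennreal (1 + C / c * de) * ?I G" by (rule yz)
  finally show ?thesis .
 next
  case False
  thus ?thesis by (simp add: ennreal_neg)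
 qed
 show ?thesis unfolding NE using mult_left_mono[OF le, of "ennreal a"] by (simp add: mult_ac)
qed

end

section \<open>Localisation\<close>

lemma convolution_average:
 fixes f :: "'m::euclidean_space => ennreal" and F :: "'m \<times> 'p::euclidean_space => ennreal"
 assumes [measurable]: "f \<in> BM" "F \<in> BM" and R: "R > 0"
 shows "ennreal ((1 / R) ^ DIM('m)) * (NI a. NI x. F x * f ((1 / R) *R (fst x - a))) = (NI x. f x) * (NI x. F x)"
proof -
 have [measurable]: "(fst :: 'm \<times> 'p => 'm) \<in> BM" by (intro bm_cont continuous_intros)
 have 1: "ennreal ((1 / R) ^ DIM('m)) * (NI a. f ((1 / R) *R (X - a))) = (NI x. f x)" for X
  using nn_integral_affine[OF assms(1), of "- (1 / R)" "(1 / R) *R X"] R by (simp add: scaleR_diff_right)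
 have "ennreal ((1 / R) ^ DIM('m)) * (NI a. NI x. F x * f ((1 / R) *R (fst x - a))) = 
   ennreal ((1 / R) ^ DIM('m)) * (NI x. NI a. F x * f ((1 / R) *R (fst x - a)))"
  by (subst nn_integral_swap) auto
 also have "... = (NI x. ennreal ((1 / R) ^ DIM('m)) * (NI a. F x * f ((1 / R) *R (fst x - a))))"
  by (rule nn_integral_cmult[symmetric]) measurable
 also have "... = (NI x. F x * (NI x. f x))"
  by (rule nn_integral_cong) (simp add: nn_integral_cmult mult.left_commute[of "ennreal _" "F _"] 1)
 finally show ?thesis by (simp add: nn_integral_multc mult.commute)
qed

lemma ennreal_bilincomb:
 fixes p s t q u w :: real
 assumes "p >= 0" "s >= 0" "t >= 0" "q >= 0" "u >= 0" "w >= 0"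
 shows "ennreal p * (ennreal s * ennreal t) + ennreal q * (ennreal u * ennreal w) = ennreal (p * (s * t) + q * (u * w))"
 using assms by (simp add: ennreal_lincomb ennreal_mult[symmetric])

context coef
begin

lemma Q_add_le:
 assumes "\<eta> > 0" shows "Q \<xi> (x + y) <= (1 + \<eta>) * Q \<xi> x + (1 + 1 / \<eta>) * Q \<xi> y"
proof -
 have "0 <= Q \<xi> (y - \<eta> *R x)" by (rule Q_nonneg)
 also have "... = Q \<xi> y - 2 * \<eta> * (B \<xi> x \<bullet> y) + \<eta>^2 * Q \<xi> x" by (rule Q_diff_expand)
 finally have "0 <= (1 / \<eta>) * (Q \<xi> y - 2 * \<eta> * (B \<xi> x \<bullet> y) + \<eta>^2 * Q \<xi> x)" using assms by simp
 also have "... = (1 / \<eta>) * Q \<xi> y - 2 * (B \<xi> x \<bullet> y) + \<eta> * Q \<xi> x"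
  using assms by (simp add: field_simps power2_eq_square)
 finally show ?thesis unfolding Q_expand by (simp add: algebra_simps)
qed

text \<open>The cut-offs are averaged over all centres \<open>a\<close>, so that no partition of unity is needed and the
  localisation error is of order \<open>1 / R\<^sup>2\<close>.\<close>

lemma localised_bound:
 assumes \<phi>: "C1c \<phi> g" "supp \<phi> \<inter> closure (D \<times> frontier W) = {}" and D: "open D" and R: "R > 0"
  and ch: "!!a. EX e h k p. graph_chart D a (2 * R) de e h k p" and de: "C / c * de < 1"
  and z: "!!\<nu>. norm \<nu> = 1 ==> z <= Zd \<nu>" and \<eta>: "\<eta> > 0"
 defines "J0 == (NI x. ennreal ((unit_bump (x::'m))^2))" and "J1 == (NI x. ennreal ((norm (unit_bump' (x::'m)))^2))"
 shows "ennreal (z * (1 - C / c * de)) * (J0 * N2 D \<phi>) <= 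
  ennreal (1 + C / c * de) * (ennreal (1 + \<eta>) * (J0 * E D g) + ennreal ((1 + 1 / \<eta>) * (C / R^2)) * (J1 * N2 D \<phi>))"
proof -
 let ?\<chi> = "%a x. unit_bump ((1 / R) *R (fst x - a))" and ?\<chi>' = "%a x. unit_bump' ((1 / R) *R (fst x - a))"
 let ?q = "ennreal ((1 / R) ^ DIM('m))" and ?ind = "indicator (D \<times> W) :: 'm \<times> 'p => ennreal"
 have DW: "D \<times> W \<in> sets borel" using open_Times[OF D W(1)] by simp
 have [measurable]: "\<phi> \<in> BM" "g \<in> BM" using C1c_borel[OF \<phi>(1)] .
 have [measurable]: "(unit_bump :: 'm => real) \<in> BM" "(unit_bump' :: 'm => 'm) \<in> BM"
  using C1c_borel[OF unit_bump_C1c] .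
 have [measurable]: "(fst :: 'm \<times> 'p => 'm) \<in> BM" by (intro bm_cont continuous_intros)
 define v where "v a x = \<phi> x * ?\<chi> a x" for a x
 define v' where "v' a x = \<phi> x *R ((1 / R) *R ?\<chi>' a x, 0) + ?\<chi> a x *R g x" for a x
 have vc: "C1c (v a) (v' a)" for a
 proof -
  have cg: "C1g (%x. unit_bump ((1 / R) *R (x - a))) (%x. (1 / R) *R unit_bump' ((1 / R) *R (x - a)))" 
   by (rule C1g_affine[OF C1c_C1g[OF unit_bump_C1c]])
  have "C1g (%x::'m \<times> 'p. ?\<chi> a x) (%x. ((1 / R) *R ?\<chi>' a x, 0))"
   by (rule C1g_comp[OF cg, where T = fst and T' = "%_ h. fst h"])
    (auto intro!: derivative_eq_intros continuous_intros continuous_on_compose2[OF C1g_cont[OF C1c_C1g[OF unit_bump_C1c]]] simp: inner_prod_def)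
  from C1c_mult[OF \<phi>(1) this] show ?thesis unfolding v_def[abs_def] v'_def[abs_def] .
 qed
 have pt: "ennreal (z * (1 - C / c * de)) * N2 D (v a) <= ennreal (1 + C / c * de) * E D (v' a)" for a
 proof -
  from ch[of a] obtain e h k p where gc: "graph_chart D a (2 * R) de e h k p" by (elim exE)
  have "supp (v a) \<subseteq> supp \<phi>" by (rule supp_mono) (auto simp: v_def)
  hence s1: "supp (v a) \<inter> closure (D \<times> frontier W) = {}" using \<phi>(2) by blast
  have cl: "closed {x :: 'm \<times> 'p. dist a (fst x) <= R}" by (intro closed_Collect_le continuous_intros)
  have "supp (v a) \<subseteq> {x. dist a (fst x) <= R}"
  proof (rule supp_leI[OF cl])
   fix x assume "v a x ~= 0"
   hence "?\<chi> a x ~= 0" by (auto simp: v_def)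
   from unit_bump_supp[OF this] show "x \<in> {x. dist a (fst x) <= R}" using R by (simp add: dist_norm norm_minus_commute)
  qed
  hence s2: "fst x \<in> ball a (2 * R)" if "x \<in> supp (v a)" for x using that R by auto
  have sl: "slice B c C W (v a) (v' a) D a (2 * R) de e h k p"
   by (intro slice.intro coef_axioms slice_axioms.intro vc gc s2 s1 D de)
  have "ennreal (z * (1 - C / c * de)) <= ennreal (Zd (slice.\<nu> e p) * (1 - C / c * de))"
   using z[OF slice.\<nu>1[OF sl]] de by (intro ennreal_leI mult_right_mono) auto
  thus ?thesis using slice.slice_bound[OF sl] mult_right_mono order_trans by (metis zero_le)
 qed
 have N: "?q * (NI a. N2 D (v a)) = J0 * N2 D \<phi>"
 proof -
  have "N2 D (v a) = (NI x. (ennreal ((\<phi> x)^2) * ?ind x) * ennreal ((?\<chi> a x)^2))" for a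
   unfolding N2_def v_def by (simp add: power_mult_distrib ennreal_mult mult_ac)
  thus ?thesis unfolding N2_def J0_def using convolution_average[OF _ _ R, of "%y. ennreal ((unit_bump y)^2)" "%x. ennreal ((\<phi> x)^2) * ?ind x"] DW
   by simp
 qed
 define I0 I1 where "I0 a = (NI x. (ennreal (Q (snd x) (g x)) * ?ind x) * ennreal ((?\<chi> a x)^2))"
  and "I1 a = (NI x. (ennreal ((\<phi> x)^2) * ?ind x) * ennreal ((norm (?\<chi>' a x))^2))" for a
 have I0: "?q * (NI a. I0 a) = J0 * E D g" and I1: "?q * (NI a. I1 a) = J1 * N2 D \<phi>"
  unfolding I0_def I1_def J0_def J1_def E_def N2_def
  by (rule convolution_average[OF _ _ R]; use DW in simp)+
 have m: "I0 \<in> BM" "I1 \<in> BM"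
  unfolding I0_def[abs_def] I1_def[abs_def] using DW by measurable
 have e: "E D (v' a) <= ennreal (1 + \<eta>) * I0 a + ennreal ((1 + 1 / \<eta>) * (C / R^2)) * I1 a" for a
 proof -
  have "E D (v' a) <= (NI x. ennreal (1 + \<eta>) * ((ennreal (Q (snd x) (g x)) * ?ind x) * ennreal ((?\<chi> a x)^2)) + 
    ennreal ((1 + 1 / \<eta>) * (C / R^2)) * ((ennreal ((\<phi> x)^2) * ?ind x) * ennreal ((norm (?\<chi>' a x))^2)))"
   unfolding E_def
  proof (rule nn_integral_mono)
   fix x
   have "Q (snd x) (v' a x) <= (1 + \<eta>) * Q (snd x) (?\<chi> a x *R g x) + (1 + 1 / \<eta>) * Q (snd x) (\<phi> x *R ((1 / R) *R ?\<chi>' a x, 0))"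
    unfolding v'_def using Q_add_le[OF \<eta>, of "snd x" "?\<chi> a x *R g x" "\<phi> x *R ((1 / R) *R ?\<chi>' a x, 0)"] by (simp only: add.commute)
   also have "... <= (1 + \<eta>) * Q (snd x) (?\<chi> a x *R g x) + (1 + 1 / \<eta>) * (C * (norm (\<phi> x *R ((1 / R) *R ?\<chi>' a x, 0 :: 'p)))^2)"
    using \<eta> by (intro add_left_mono mult_left_mono Q_upper) auto
   also have "... = (1 + \<eta>) * (Q (snd x) (g x) * (?\<chi> a x)^2) + ((1 + 1 / \<eta>) * (C / R^2)) * ((\<phi> x)^2 * (norm (?\<chi>' a x))^2)"
    by (simp add: Q_scale norm_Pair power_mult_distrib power_divide)
   finally have "ennreal (Q (snd x) (v' a x)) <= ennreal ((1 + \<eta>) * (Q (snd x) (g x) * (?\<chi> a x)^2) + ((1 + 1 / \<eta>) * (C / R^2)) * ((\<phi> x)^2 * (norm (?\<chi>' a x))^2))"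
    by (rule ennreal_leI)
   also have "... = ennreal (1 + \<eta>) * (ennreal (Q (snd x) (g x)) * ennreal ((?\<chi> a x)^2)) + ennreal ((1 + 1 / \<eta>) * (C / R^2)) * (ennreal ((\<phi> x)^2) * ennreal ((norm (?\<chi>' a x))^2))"
    by (rule ennreal_bilincomb[symmetric]) (use \<eta> C_pos Q_nonneg in auto)
   finally show "ennreal (Q (snd x) (v' a x)) * ?ind x <= ennreal (1 + \<eta>) * ((ennreal (Q (snd x) (g x)) * ?ind x) * ennreal ((?\<chi> a x)^2)) + 
    ennreal ((1 + 1 / \<eta>) * (C / R^2)) * ((ennreal ((\<phi> x)^2) * ?ind x) * ennreal ((norm (?\<chi>' a x))^2))"
    by (auto simp: indicator_def)
  qed
  also have "... = ennreal (1 + \<eta>) * I0 a + ennreal ((1 + 1 / \<eta>) * (C / R^2)) * I1 a"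
   unfolding I0_def I1_def using DW by (subst nn_integral_add) (simp_all add: nn_integral_cmult)
  finally show ?thesis .
 qed
 have "ennreal (z * (1 - C / c * de)) * (J0 * N2 D \<phi>) = ?q * (NI a. ennreal (z * (1 - C / c * de)) * N2 D (v a))"
 proof -
  have "(%a. N2 D (v a)) \<in> borel_measurable lborel" unfolding N2_def v_def using DW by simp
  thus ?thesis unfolding N[symmetric] by (simp add: nn_integral_cmult mult.left_commute)
 qed
 also have "... <= ?q * (NI a. ennreal (1 + C / c * de) * (ennreal (1 + \<eta>) * I0 a + ennreal ((1 + 1 / \<eta>) * (C / R^2)) * I1 a))"
  by (intro mult_left_mono nn_integral_mono order_trans[OF pt] e) auto
 also have "... = ennreal (1 + C / c * de) * (ennreal (1 + \<eta>) * (?q * (NI a. I0 a)) + ennreal ((1 + 1 / \<eta>) * (C / R^2)) * (?q * (NI a. I1 a)))"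
  using m by (simp add: nn_integral_cmult nn_integral_add distrib_left mult.left_commute[of ?q])
 finally show ?thesis unfolding I0 I1 .
qed

lemma lower_bound:
 assumes \<omega>: "bounded_C1_domain \<omega>" and z: "!!\<nu>. norm \<nu> = 1 ==> z <= Zd \<nu>" "z >= 0" and ep: "ep > 0"
 shows "EX L>0. ALL l>=L. ALL u g. adm ((*\<^sub>R) l ` \<omega> \<times> W) ((*\<^sub>R) l ` \<omega> \<times> frontier W) u g -->
   (z - ep) * sqn (lebesgue_on ((*\<^sub>R) l ` \<omega> \<times> W)) u <= elliptic.en ((*\<^sub>R) l ` \<omega> \<times> W) cylB g g"
proof -
 define ka where "ka = min (1/2) (ep / (6 * (z + 1)))"
 have ka: "ka > 0" "ka < 1" "z * (3 * ka) <= ep / 2"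
 proof -
  show "ka > 0" "ka < 1" using ep z(2) by (auto simp: ka_def)
  have "z * (3 * ka) <= (z + 1) * (3 * (ep / (6 * (z + 1))))" using z(2) ep by (intro mult_mono) (auto simp: ka_def)
  also have "... = ep / 2" using z(2) by (simp add: field_simps)
  finally show "z * (3 * ka) <= ep / 2" .
 qed
 define de where "de = ka * c / C"
 have de: "de > 0" "C / c * de = ka" using c_pos C_pos ka by (auto simp: de_def)
 obtain r where r: "r > 0" "!!b. EX e h k p. graph_chart \<omega> b r de e h k p" by (rule uniform_charts[OF \<omega> de(1)]) (rule that)
 define j0 j1 where "j0 = ip (lebesgue_on UNIV) (unit_bump :: 'm => real) unit_bump" and "j1 = ip (lebesgue_on UNIV) (unit_bump' :: 'm => 'm) unit_bump'"
 have J: "(NI x. ennreal ((unit_bump (x::'m))^2)) = ennreal j0" "(NI x. ennreal ((norm (unit_bump' (x::'m)))^2)) = ennreal j1"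
  using C1c_nn_integral[OF unit_bump_C1c open_UNIV] by (simp_all add: j0_def j1_def)
 have j0: "j0 > 0" unfolding j0_def by (rule C1c_ip_pos[OF unit_bump_C1c open_UNIV, of 0]) (auto simp: unit_bump_def pos2_def)
 have j1: "j1 >= 0" unfolding j1_def by (rule ip_self_nonneg)
 define X where "X = 2 * C * j1 / (ka * j0 * ep)"
 have X0: "X >= 0" using C_pos j0 j1 ka ep by (simp add: X_def)
 define L where "L = 2 * (1 + X) / r"
 have "L > 0" using X0 r by (simp add: L_def)
 moreover have "(z - ep) * sqn (lebesgue_on ((*\<^sub>R) l ` \<omega> \<times> W)) u <= elliptic.en ((*\<^sub>R) l ` \<omega> \<times> W) cylB g g"
  if l: "l >= L" and a: "adm ((*\<^sub>R) l ` \<omega> \<times> W) ((*\<^sub>R) l ` \<omega> \<times> frontier W) u g" for l u g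
 proof -
  define D where "D = (*\<^sub>R) l ` \<omega>"
  define R where "R = l * r / 2"
  have l0: "l > 0" using l \<open>L > 0\<close> by linarith
  have R1: "R >= 1 + X" using l r(1) by (simp add: R_def L_def field_simps)
  hence R0: "R > 0" using X0 by linarith
  have oD: "open D" unfolding D_def using \<omega> l0 by (intro open_scaling) (auto simp: bounded_C1_domain_def)
  have ch: "EX e h k p. graph_chart D a (2 * R) de e h k p" for a
  proof -
   from r(2)[of "(1 / l) *R a"] obtain e h k p where "graph_chart \<omega> ((1 / l) *R a) r de e h k p" by (elim exE)
   from graph_chart_scale[OF this l0] l0 show ?thesis unfolding D_def R_def by auto
  qed
  interpret el: elliptic_problem "D \<times> W" "D \<times> frontier W" cylB c C by (rule elliptic_cyl[OF oD])
  let ?N = "%u. sqn (lebesgue_on (D \<times> W)) u"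
  have main: "(z - ep) * ?N \<phi> <= el.en k k" if \<phi>: "C1c \<phi> k" "supp \<phi> \<inter> closure (D \<times> frontier W) = {}" for \<phi> k
  proof -
   let ?E = "el.en k k"
   have E0: "?E >= 0" by (rule el.en_nonneg[OF C1c_L2(2)[OF \<phi>(1) el.borel_Om]])
   have N0: "?N \<phi> >= 0" by (rule ip_self_nonneg)
   have ka1: "C / c * de < 1" using de ka by simp
   define Bq where "Bq = (1 + 1 / ka) * (C / R^2)"
   have B0: "Bq >= 0" using ka C_pos by (simp add: Bq_def)
   have "ennreal (z * (1 - ka)) * (ennreal j0 * ennreal (?N \<phi>)) <= 
     ennreal (1 + ka) * (ennreal (1 + ka) * (ennreal j0 * ennreal ?E) + ennreal Bq * (ennreal j1 * ennreal (?N \<phi>)))"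
    using localised_bound[OF \<phi> oD R0 ch ka1 z(1) ka(1)] unfolding J E_eq[OF \<phi>(1) oD] N2_eq[OF \<phi>(1) oD] de(2) Bq_def .
   also have "ennreal (1 + ka) * (ennreal j0 * ennreal ?E) + ennreal Bq * (ennreal j1 * ennreal (?N \<phi>)) = ennreal ((1 + ka) * (j0 * ?E) + Bq * (j1 * ?N \<phi>))"
    by (rule ennreal_bilincomb) (use ka j0 j1 E0 N0 B0 in auto)
   also have "ennreal (1 + ka) * ... = ennreal ((1 + ka) * ((1 + ka) * (j0 * ?E) + Bq * (j1 * ?N \<phi>)))"
    by (rule ennreal_mult[symmetric]) (use ka j0 j1 E0 N0 B0 in \<open>auto intro!: add_nonneg_nonneg mult_nonneg_nonneg\<close>)
   also have "ennreal (z * (1 - ka)) * (ennreal j0 * ennreal (?N \<phi>)) = ennreal (z * (1 - ka) * (j0 * ?N \<phi>))"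
    using z(2) ka j0 N0 by (simp only: ennreal_mult[symmetric] mult_nonneg_nonneg less_imp_le diff_ge_0_iff_ge)
   finally have "ennreal (z * (1 - ka) * (j0 * ?N \<phi>)) <= ennreal ((1 + ka) * ((1 + ka) * (j0 * ?E) + Bq * (j1 * ?N \<phi>)))" .
   hence "z * (1 - ka) * (j0 * ?N \<phi>) <= (1 + ka) * ((1 + ka) * (j0 * ?E) + Bq * (j1 * ?N \<phi>))"
    using ka j0 j1 E0 N0 B0 by (subst (asm) ennreal_le_iff) (auto intro!: mult_nonneg_nonneg add_nonneg_nonneg)
   also have "... = (1 + ka)^2 * j0 * (?E + (C * j1 / (ka * j0 * R^2)) * ?N \<phi>)"
    using ka j0 R0 by (simp add: Bq_def field_simps power2_eq_square)
   finally have 1: "z * (1 - ka) * (j0 * ?N \<phi>) <= (1 + ka)^2 * j0 * (?E + (C * j1 / (ka * j0 * R^2)) * ?N \<phi>)" .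
   have "(1 + ka)^2 * (1 - 3 * ka) <= 1 - ka" 
   proof -
    have "(1 - ka) - (1 + ka)^2 * (1 - 3 * ka) = 5 * ka^2 + 3 * (ka^2 * ka)" by (simp add: power2_eq_square algebra_simps)
    moreover have "... >= 0" using ka by (intro add_nonneg_nonneg mult_nonneg_nonneg) auto
    ultimately show ?thesis by linarith
   qed
   hence "((1 + ka)^2 * (1 - 3 * ka)) * (z * (j0 * ?N \<phi>)) <= (1 - ka) * (z * (j0 * ?N \<phi>))"
    using z(2) j0 N0 by (intro mult_right_mono mult_nonneg_nonneg) auto
   with 1 have "((1 + ka)^2 * j0) * ((1 - 3 * ka) * z * ?N \<phi>) <= ((1 + ka)^2 * j0) * (?E + (C * j1 / (ka * j0 * R^2)) * ?N \<phi>)"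
    by (simp add: mult_ac)
   hence 2: "(1 - 3 * ka) * z * ?N \<phi> <= ?E + (C * j1 / (ka * j0 * R^2)) * ?N \<phi>"
    using ka j0 by (subst (asm) mult_le_cancel_left_pos) auto
   have "X <= R^2"
   proof -
    have "R * 1 <= R * R" using R1 X0 by (intro mult_left_mono) auto
    thus ?thesis using R1 by (simp add: power2_eq_square)
   qed
   have 3: "C * j1 / (ka * j0 * R^2) <= ep / 2"
   proof -
    have "C * j1 / (ka * j0 * R^2) = X * (ep / 2) / R^2" using ka ep j0 R0 by (simp add: X_def field_simps)
    also have "... <= R^2 * (ep / 2) / R^2" using \<open>X <= R^2\<close> ep by (intro divide_right_mono mult_right_mono) auto
    finally show ?thesis using R0 by simp
   qed
   have "(z - ep) * ?N \<phi> <= ((1 - 3 * ka) * z - C * j1 / (ka * j0 * R^2)) * ?N \<phi>"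
   proof (rule mult_right_mono[OF _ N0])
    have "(1 - 3 * ka) * z = z - z * (3 * ka)" by (simp add: algebra_simps)
    thus "z - ep <= (1 - 3 * ka) * z - C * j1 / (ka * j0 * R^2)" using 3 ka(3) by linarith
   qed
   with 2 show ?thesis by (simp add: left_diff_distrib)
  qed
  obtain \<phi> k where \<phi>: "!!n. C1c (\<phi> n) (k n)" "!!n. supp (\<phi> n) \<inter> closure (D \<times> frontier W) = {}"
   "L2_tendsto (lebesgue_on (D \<times> W)) \<phi> u" "L2_tendsto (lebesgue_on (D \<times> W)) k g"
   by (rule adm_C1c_sequence[OF el.open_Om a[folded D_def]]) (rule that)
  have "(z - ep) * ?N u <= el.en g g"
  proof (rule LIMSEQ_le)
   show "(%n. (z - ep) * ?N (\<phi> n)) \<longlonglongrightarrow> (z - ep) * ?N u" by (intro tendsto_intros L2_tendsto_ip[OF \<phi>(3) \<phi>(3)])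
   show "(%n. el.en (k n) (k n)) \<longlonglongrightarrow> el.en g g" by (rule el.en_tendsto[OF \<phi>(4)])
   show "EX N. ALL n>=N. (z - ep) * ?N (\<phi> n) <= el.en (k n) (k n)" using main[OF \<phi>(1,2)] by blast
  qed
  thus ?thesis unfolding D_def .
 qed
 ultimately show ?thesis by blast
qed

end

section \<open>Trial functions\<close>

definition tang :: "'m::euclidean_space => 'm => 'm" where "tang \<nu> y = y - (y \<bullet> \<nu>) *R \<nu>"

lemma tang_cont [continuous_intros]: "continuous_on S f ==> continuous_on S (%x. tang \<nu> (f x))"
 unfolding tang_def by (intro continuous_intros)

lemma tang_measurable [measurable]: "tang \<nu> \<in> BM"
 by (intro bm_cont continuous_intros)

definition section_integral :: "'m::euclidean_space => ('m => ennreal) => ennreal" where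
 "section_integral \<nu> g = (NI y. g (tang \<nu> y) * ennreal (kernel (y \<bullet> \<nu>)))"

lemma nn_integral_product_form:
 fixes f :: "real \<times> 'p::euclidean_space => ennreal" and g :: "'m::euclidean_space => ennreal"
 assumes [measurable]: "f \<in> BM" "g \<in> BM" and R: "R > 0" and \<nu>: "norm \<nu> = 1" and b: "b \<bullet> \<nu> = 0"
 shows "(NI x. f (fst x \<bullet> \<nu>, snd x) * g ((1 / R) *R tang \<nu> (fst x) - b)) = 
  ennreal (R ^ DIM('m) / R) * section_integral \<nu> g * (NI x. f x)"
proof -
 have \<nu>\<nu>: "\<nu> \<bullet> \<nu> = 1" using \<nu> by (simp add: dot_square_norm)
 define ka where "ka s = ennreal (kernel (s / R) / R)" for s
 have [measurable]: "ka \<in> BM" unfolding ka_def by measurable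
 have ka1: "(NI s. ka s) = 1"
 proof -
  have "(NI s. ka s) = ennreal \<bar>R\<bar> * (NI s. ka (0 + R * s))"
   by (rule nn_integral_real_affine) (use R in auto)
  also have "... = (NI s. ennreal (kernel s))"
   using R kernel_nonneg by (simp add: nn_integral_cmult[symmetric] ka_def ennreal_mult[symmetric])
  finally show ?thesis by (simp add: kernel_nn_integral)
 qed
 have J: "(NI y. g ((1 / R) *R tang \<nu> y - b) * ka (y \<bullet> \<nu>)) = ennreal (R ^ DIM('m) / R) * section_integral \<nu> g"
 proof -
  have eq: "(1 / R) *R tang \<nu> (R *R b + R *R y) - b = tang \<nu> y" "(R *R b + R *R y) \<bullet> \<nu> / R = y \<bullet> \<nu>" for y
   using R by (auto simp: tang_def inner_add_left b algebra_simps)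
  have "(NI y. g ((1 / R) *R tang \<nu> y - b) * ka (y \<bullet> \<nu>)) = ennreal (\<bar>R\<bar> ^ DIM('m)) * (NI y. g ((1 / R) *R tang \<nu> (R *R b + R *R y) - b) * ka ((R *R b + R *R y) \<bullet> \<nu>))"
   by (rule nn_integral_affine) (use R in auto)
  also have "... = ennreal (R ^ DIM('m)) * (NI y. ennreal (1 / R) * (g (tang \<nu> y) * ennreal (kernel (y \<bullet> \<nu>))))"
   unfolding eq ka_def using R kernel_nonneg by (simp add: ennreal_mult'[symmetric] mult.left_commute[of "ennreal (1 / R)"])
  also have "... = ennreal (R ^ DIM('m)) * (ennreal (1 / R) * section_integral \<nu> g)"
   unfolding section_integral_def by (subst nn_integral_cmult) auto
  also have "... = ennreal (R ^ DIM('m) / R) * section_integral \<nu> g"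
   using R by (simp add: mult.assoc[symmetric] ennreal_mult'[symmetric])
  finally show ?thesis .
 qed
 have fm [measurable]: "(%t. f (t, \<xi>)) \<in> BM" for \<xi>
 proof -
  have "(%t::real. (t, \<xi>)) \<in> BM" by (intro bm_cont continuous_intros)
  from measurable_compose[OF this assms(1)] show ?thesis .
 qed
 have m: "(%x::'m \<times> 'p. f (fst x \<bullet> \<nu>, snd x) * g ((1 / R) *R tang \<nu> (fst x) - b)) \<in> BM"
 proof -
  have [measurable]: "(%x::'m \<times> 'p. (fst x \<bullet> \<nu>, snd x)) \<in> BM" "(%x::'m \<times> 'p. (1 / R) *R tang \<nu> (fst x) - b) \<in> BM" 
   by (intro bm_cont continuous_intros)+
  show ?thesis by measurable
 qed
 have "(NI x. f (fst x \<bullet> \<nu>, snd x) * g ((1 / R) *R tang \<nu> (fst x) - b)) = 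
   (NI \<xi>. NI X. f (X \<bullet> \<nu>, \<xi>) * g ((1 / R) *R tang \<nu> X - b))"
  by (subst nn_integral_pair'[OF m]) simp
 also have "... = (NI \<xi>. (ennreal (R ^ DIM('m) / R) * section_integral \<nu> g) * (NI t. f (t, \<xi>)))"
 proof (rule nn_integral_cong)
  fix \<xi> :: 'p
  have eq: "(y - (y \<bullet> \<nu>) *R \<nu> + (1 * t + 0) *R \<nu>) \<bullet> \<nu> = t" "tang \<nu> (y - (y \<bullet> \<nu>) *R \<nu> + (1 * t + 0) *R \<nu>) = tang \<nu> y" for y t
   by (auto simp: tang_def inner_add_left inner_diff_left \<nu>\<nu>)
  have "(NI X. f (X \<bullet> \<nu>, \<xi>) * g ((1 / R) *R tang \<nu> X - b)) = 
    ennreal 1 * (NI t. NI y. (f ((y - (y \<bullet> \<nu>) *R \<nu> + (1 * t + 0) *R \<nu>) \<bullet> \<nu>, \<xi>) * 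
     g ((1 / R) *R tang \<nu> (y - (y \<bullet> \<nu>) *R \<nu> + (1 * t + 0) *R \<nu>) - b)) * ka (y \<bullet> \<nu>))"
   by (rule disintegration[where H = "%_. 0", OF _ _ _ \<nu> zero_less_one ka1]) measurable
  also have "... = (NI t. f (t, \<xi>) * (NI y. g ((1 / R) *R tang \<nu> y - b) * ka (y \<bullet> \<nu>)))"
   unfolding eq by (simp add: mult.assoc nn_integral_cmult)
  also have "... = (ennreal (R ^ DIM('m) / R) * section_integral \<nu> g) * (NI t. f (t, \<xi>))"
   unfolding J by (simp add: nn_integral_multc mult.commute)
  finally show "(NI X. f (X \<bullet> \<nu>, \<xi>) * g ((1 / R) *R tang \<nu> X - b)) = (ennreal (R ^ DIM('m) / R) * section_integral \<nu> g) * (NI t. f (t, \<xi>))" .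
 qed
 also have "... = (ennreal (R ^ DIM('m) / R) * section_integral \<nu> g) * (NI x. f x)"
 proof -
  have "(%z::'p \<times> real. (snd z, fst z)) \<in> BM" by (intro bm_cont continuous_intros)
  from measurable_borel_pair_lborel[OF measurable_compose[OF this assms(1)]]
  have "(%\<xi>. NI t. f (t, \<xi>)) \<in> BM"
   by (intro lborel.borel_measurable_nn_integral) (simp add: split_beta)
  thus ?thesis by (subst nn_integral_pair'[OF assms(1)]) (simp add: nn_integral_cmult)
 qed
 finally show ?thesis by (simp add: mult.assoc)
qed

lemma norm_tang_le: "norm \<nu> = 1 ==> norm y <= norm (tang \<nu> y) + \<bar>y \<bullet> \<nu>\<bar>"
 using norm_triangle_ineq[of "tang \<nu> y" "(y \<bullet> \<nu>) *R \<nu>"] by (simp add: tang_def)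

lemma norm_tang: 
 assumes "norm \<nu> = 1" shows "norm (tang \<nu> y) <= norm y"
proof -
 have "(y - tang \<nu> y) \<bullet> tang \<nu> y = 0"
  using assms by (simp add: tang_def inner_diff_right inner_commute norm_eq_1)
 hence "tang \<nu> y \<bullet> tang \<nu> y = y \<bullet> tang \<nu> y" by (simp add: inner_diff_left)
 also have "... <= norm y * norm (tang \<nu> y)" by (rule norm_cauchy_schwarz)
 finally have "norm (tang \<nu> y) * norm (tang \<nu> y) <= norm y * norm (tang \<nu> y)" by (simp add: dot_square_norm power2_eq_square)
 thus ?thesis by (cases "tang \<nu> y = 0") auto
qed

lemma section_integral_finite:
 fixes g :: "'m::euclidean_space => 'b::euclidean_space"
 assumes "contU g" "!!x. g x ~= 0 ==> norm x < 1" "norm \<nu> = 1"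
 shows "section_integral \<nu> (%x. ennreal ((norm (g x))^2)) < \<infinity>"
proof -
 have "integrable lborel (%y. (norm (g (tang \<nu> y)))^2 * kernel (y \<bullet> \<nu>))"
 proof (rule integrable_continuous_compact[of _ "cball 0 2"])
  show "contU (%y. (norm (g (tang \<nu> y)))^2 * kernel (y \<bullet> \<nu>))"
   by (intro continuous_intros continuous_on_compose2[OF kernel_cont] continuous_on_compose2[OF assms(1)]) auto
  show "(norm (g (tang \<nu> y)))^2 * kernel (y \<bullet> \<nu>) = 0" if "y \<notin> cball 0 2" for y
   using that norm_tang_le[OF assms(3), of y] assms(2)[of "tang \<nu> y"] kernel_supp[of "y \<bullet> \<nu>"]
   by (cases "g (tang \<nu> y) = 0") auto
 qed simp
 from nn_integral_eq_integral[OF this] show ?thesis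
  unfolding section_integral_def using kernel_nonneg by (simp add: ennreal_mult)
qed

lemma ennreal_mult3: "0 <= a ==> 0 <= b ==> 0 <= c ==> ennreal a * ennreal b * ennreal c = ennreal (a * b * c)"
 by (simp add: ennreal_mult)

context coef
begin

lemma half_space_trial:
 fixes \<nu> :: 'm
 assumes dim: "DIM('m) >= 2" and \<nu>: "norm \<nu> = 1" and z: "Zd \<nu> < z"
 shows "EX (\<Psi> :: nat => 'm \<times> 'p => real) \<Psi>'. (ALL j. C1c (\<Psi> j) (\<Psi>' j) & 
   (ALL x:supp (\<Psi> j). fst x \<bullet> \<nu> <= 0 --> snd x \<notin> frontier W) &
   E {y. y \<bullet> \<nu> < 0} (\<Psi>' j) < ennreal z * N2 {y. y \<bullet> \<nu> < 0} (\<Psi> j)) & (ALL i j. i ~= j --> supp (\<Psi> i) \<inter> supp (\<Psi> j) = {})"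
proof -
 obtain w k where w: "C1c w k" "supp w \<inter> closure ({..<0::real} \<times> frontier W) = {}"
  "sqn (lebesgue_on ({..<0} \<times> W)) w > 0" "elliptic.en ({..<0} \<times> W) (dirB \<nu>) k k < z * sqn (lebesgue_on ({..<0} \<times> W)) w"
  using Zd_approx[OF \<nu> z] by (elim exE conjE)
 define n where "n = sqn (lebesgue_on ({..<0::real} \<times> W)) w"
 define e where "e = elliptic.en ({..<0} \<times> W) (dirB \<nu>) k k"
 have n: "N2 {..<0} w = ennreal n" "n > 0" using N2_eq[OF w(1) open_lessThan] w(3) by (auto simp: n_def)
 have e: "Ed \<nu> k = ennreal e" "e >= 0" "e < z * n"
 proof -
  interpret elliptic_problem "{..<0} \<times> W" "{..<0} \<times> frontier W" "dirB \<nu>" c C by (rule elliptic_dir[OF \<nu>])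
  show "e >= 0" unfolding e_def by (rule en_nonneg[OF C1c_L2(2)[OF w(1) borel_Om]])
  show "Ed \<nu> k = ennreal e" "e < z * n" using Ed_eq[OF w(1) \<nu>] w(4) by (auto simp: e_def n_def)
 qed
 have z0: "z > 0" using e n(2) by (smt (verit) mult_nonpos_nonneg)
 define j0 where "j0 = enn2real (section_integral \<nu> (%x. ennreal ((unit_bump x)^2)))"
 define j1 where "j1 = enn2real (section_integral \<nu> (%x. ennreal ((norm (unit_bump' x))^2)))"
 have bc: "contU (unit_bump :: 'm => real)" "contU (unit_bump' :: 'm => 'm)"
  using C1g_cont_fun[OF C1c_C1g[OF unit_bump_C1c]] C1g_cont[OF C1c_C1g[OF unit_bump_C1c]] .
 have b': "norm x < 1" if "unit_bump' x ~= 0" for x :: 'm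
  using that abs_square_less_1[of "norm x"] by (auto simp: unit_bump'_def dot_square_norm max_def split: if_splits)
 have j: "section_integral \<nu> (%x. ennreal ((unit_bump x)^2)) = ennreal j0" "section_integral \<nu> (%x. ennreal ((norm (unit_bump' x))^2)) = ennreal j1"
  using section_integral_finite[OF bc(1) unit_bump_supp \<nu>] section_integral_finite[OF bc(2) b' \<nu>] by (auto simp: j0_def j1_def)
 have j00: "j0 >= 0" "j1 >= 0" by (auto simp: j0_def j1_def)
 obtain \<tau> where \<tau>: "norm \<tau> = 1" "\<tau> \<bullet> \<nu> = 0"
 proof -
  obtain x where "x ~= 0" "orthogonal \<nu> x" by (rule orthogonal_to_vector_exists[OF dim])
  thus thesis by (intro that[of "(1 / norm x) *R x"]) (auto simp: orthogonal_def inner_commute)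
 qed
 let ?H = "{y. y \<bullet> \<nu> < 0} :: 'm set"
 have oH: "open ?H" by (rule open_halfspace_lt[of \<nu> 0, unfolded inner_commute[of \<nu>]])
 let ?t = "%x :: 'm \<times> 'p. (fst x \<bullet> \<nu>, snd x)"
 define T where "T R j x = (1 / R) *R tang \<nu> (fst x) - (3 * real j) *R \<tau>" for R j and x :: "'m \<times> 'p"
 define \<Psi> where "\<Psi> R j x = w (?t x) * unit_bump (T R j x)" for R j and x :: "'m \<times> 'p"
 define \<Psi>' where "\<Psi>' R j x = w (?t x) *R ((1 / R) *R tang \<nu> (unit_bump' (T R j x)), 0) + unit_bump (T R j x) *R dir_embed \<nu> (k (?t x))" for R j and x :: "'m \<times> 'p"
 have ind: "indicator (?H \<times> W) x = (indicator ({..<0} \<times> W) (?t x) :: ennreal)" for x by (cases x) (auto simp: indicator_def)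
 have [measurable]: "w \<in> BM" "k \<in> BM" "(unit_bump :: 'm => real) \<in> BM"
   "(unit_bump' :: 'm => 'm) \<in> BM"
  using C1c_borel[OF w(1)] C1c_borel[OF unit_bump_C1c] .
 have N: "N2 ?H (\<Psi> R j) = ennreal (R ^ DIM('m) / R * j0 * n)" if R: "R > 0" for R j
 proof -
  have "N2 ?H (\<Psi> R j) = (NI x. (%x. ennreal ((w x)^2) * indicator ({..<0} \<times> W) x) (fst x \<bullet> \<nu>, snd x) * 
    (%x. ennreal ((unit_bump x)^2)) ((1 / R) *R tang \<nu> (fst x) - (3 * real j) *R \<tau>))"
   unfolding N2_def ind \<Psi>_def T_def by (simp add: power_mult_distrib ennreal_mult mult_ac)
  also have "... = ennreal (R ^ DIM('m) / R) * ennreal j0 * ennreal n"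
   unfolding j(1)[symmetric] n(1)[symmetric] N2_def
   by (rule nn_integral_product_form[OF _ _ R \<nu>]) (use strip_borel \<tau>(2) in auto)
  also have "... = ennreal (R ^ DIM('m) / R * j0 * n)" by (rule ennreal_mult3) (use R j00 n(2) in auto)
  finally show ?thesis .
 qed
 have cg: "C1c (\<Psi> R j) (\<Psi>' R j)" if R: "R > 0" for R j
 proof -
  have kc: "contU k" by (rule C1g_cont[OF C1c_C1g[OF w(1)]])
  have 1: "C1g (%x. w (?t x)) (%x. dir_embed \<nu> (k (?t x)))"
   by (rule C1g_comp[OF C1c_C1g[OF w(1)], where T' = "%_ h. (fst h \<bullet> \<nu>, snd h)"])
    (auto intro!: derivative_eq_intros continuous_intros continuous_on_compose2[OF kc] simp: inner_prod_def dir_embed_def inner_commute)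
  have 2: "C1g (%x. unit_bump (T R j x)) (%x. ((1 / R) *R tang \<nu> (unit_bump' (T R j x)), 0))"
   unfolding T_def
   by (rule C1g_comp[OF C1c_C1g[OF unit_bump_C1c], where T' = "%_ h. (1 / R) *R tang \<nu> (fst h)"])
    (auto intro!: derivative_eq_intros continuous_intros continuous_on_compose2[OF bc(2)] 
     simp: inner_prod_def tang_def inner_diff_left inner_diff_right inner_commute[of \<nu>])
  let ?K = "{x :: 'm \<times> 'p. ?t x \<in> supp w & norm (T R j x) <= 1}"
  have "closed ?K" unfolding Collect_conj_eq T_def
   by (intro closed_Int closed_Collect_le continuous_intros closed_vimage[of "supp w" ?t, unfolded vimage_def] closed_supp)
  moreover have "bounded ?K"
  proof -
   obtain b where b: "!!x. x \<in> supp w ==> norm x <= b" using compact_imp_bounded[of "supp w"] w(1) unfolding C1c_def bounded_iff by blast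
   have "norm x <= (R * (1 + 3 * real j) + b) + b" if "x \<in> ?K" for x
   proof -
    have x: "norm (?t x) <= b" "norm (T R j x) <= 1" using that b by auto
    have "\<bar>fst x \<bullet> \<nu>\<bar> <= b" "norm (snd x) <= b"
     using x(1) norm_fst_le[of "fst x \<bullet> \<nu>" "snd x"] norm_snd_le[of "snd x" "fst x \<bullet> \<nu>"] by auto
    moreover have "norm ((1 / R) *R tang \<nu> (fst x)) <= 1 + 3 * real j"
     using norm_triangle_ineq[of "T R j x" "(3 * real j) *R \<tau>"] x(2) \<tau>(1) by (simp add: T_def)
    hence "norm (tang \<nu> (fst x)) <= R * (1 + 3 * real j)" using R by (simp add: field_simps)
    ultimately show ?thesis using norm_tang_le[OF \<nu>, of "fst x"] norm_Pair_le[of "fst x" "snd x"] by simp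
   qed
   thus ?thesis unfolding bounded_iff by blast
  qed
  ultimately have "compact ?K" by (simp add: compact_eq_bounded_closed)
  moreover have "x \<in> ?K" if "\<Psi> R j x ~= 0" for x
  proof -
   have "w (?t x) ~= 0" "unit_bump (T R j x) ~= 0" using that by (auto simp: \<Psi>_def)
   thus ?thesis using not_supp[of "?t x" w] unit_bump_supp[of "T R j x"] by fastforce
  qed
  ultimately have "compact (supp (\<Psi> R j))" by (rule compact_suppI)
  moreover have "C1g (\<Psi> R j) (\<Psi>' R j)" using C1g_mult[OF 1 2] unfolding \<Psi>_def[abs_def] \<Psi>'_def[abs_def] .
  ultimately show ?thesis by (simp add: C1c_def)
 qed
 have s1: "supp (\<Psi> R j) \<subseteq> ?t -` supp w \<inter> T R j -` cball 0 1" for R j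
 proof (rule supp_leI)
  show "closed (?t -` supp w \<inter> T R j -` cball 0 1)" unfolding T_def by (intro closed_Int closed_vimage closed_supp closed_cball continuous_intros)
  fix x assume "\<Psi> R j x ~= 0"
  hence "w (?t x) ~= 0" "unit_bump (T R j x) ~= 0" by (auto simp: \<Psi>_def)
  thus "x \<in> ?t -` supp w \<inter> T R j -` cball 0 1" using not_supp[of "?t x" w] unit_bump_supp[of "T R j x"] by fastforce
 qed
 have disj: "supp (\<Psi> R i) \<inter> supp (\<Psi> R j) = {}" if "i ~= j" for R i j
 proof -
  have False if "x \<in> supp (\<Psi> R i)" "x \<in> supp (\<Psi> R j)" for x
  proof -
   have "norm (T R i x) <= 1" "norm (T R j x) <= 1" using that s1 by fastforce+
   hence "norm (T R i x - T R j x) <= 2" using norm_triangle_ineq4[of "T R i x" "T R j x"] by linarith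
   moreover have "T R i x - T R j x = (3 * (real j - real i)) *R \<tau>" by (simp add: T_def algebra_simps)
   ultimately have "3 * \<bar>real j - real i\<bar> <= 2" by (simp add: \<tau>(1) abs_mult)
   moreover have "3 * 1 <= 3 * \<bar>real j - real i\<bar>" using \<open>i ~= j\<close> by (intro mult_left_mono) (cases "i < j", auto)
   ultimately have "3 * 1 <= (2::real)" by (rule order_trans[rotated])
   thus False by simp
  qed
  thus ?thesis by blast
 qed
 have lat: "snd x \<notin> frontier W" if "x \<in> supp (\<Psi> R j)" "fst x \<bullet> \<nu> <= 0" for x R j
 proof
  assume "snd x \<in> frontier W"
  hence "?t x \<in> closure ({..<0::real} \<times> frontier W)" using that(2) by (simp add: closure_lateral)
  moreover have "?t x \<in> supp w" using that(1) s1 by fastforce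
  ultimately show False using w(2) by blast
 qed
 have j0: "j0 > 0"
 proof (rule ccontr)
  assume "~j0 > 0"
  hence "j0 = 0" using j00 by linarith
  hence "N2 ?H (\<Psi> 1 0) = 0" using N[of 1 0] by simp
  hence ip0: "sqn (lebesgue_on (?H \<times> W)) (\<Psi> 1 0) <= 0" using N2_eq[OF cg[of 1 0] oH] by (simp add: ennreal_eq_0_iff)
  have "EX y:{..<0} \<times> W. w y ~= 0"
  proof (rule ccontr)
   assume "~?thesis"
   hence "N2 {..<0} w = (\<integral>\<^sup>+x. 0 \<partial>(lborel :: (real \<times> 'p) measure))" unfolding N2_def by (intro nn_integral_cong) (auto simp: indicator_def)
   thus False using n by simp
  qed
  then obtain t \<xi> where t: "t < 0" "\<xi> \<in> W" "w (t, \<xi>) ~= 0" by auto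
  have \<nu>\<nu>: "\<nu> \<bullet> \<nu> = 1" using \<nu> by (simp add: dot_square_norm)
  have "sqn (lebesgue_on (?H \<times> W)) (\<Psi> 1 0) > 0"
   by (rule C1c_ip_pos[OF cg open_Times[OF oH W(1)], of _ "(t *R \<nu>, \<xi>)"])
    (use t \<nu>\<nu> in \<open>auto simp: \<Psi>_def T_def tang_def unit_bump_def pos2_def\<close>)
  with ip0 show False by linarith
 qed
 have E: "E ?H (\<Psi>' R j) <= ennreal (R ^ DIM('m) / R * ((1 + \<eta>) * j0 * e + (1 + 1 / \<eta>) * (C / R^2) * j1 * n))" if R: "R > 0" and \<eta>: "\<eta> > 0" for R j \<eta>
 proof -
  let ?f = "%x. ennreal (Q (snd x) (dir_embed \<nu> (k x))) * indicator ({..<0} \<times> W) x" and ?f' = "%x. ennreal ((w x)^2) * indicator ({..<0} \<times> W) x"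
  let ?c = "(1 + 1 / \<eta>) * (C / R^2)"
  have c0: "?c >= 0" using \<eta> C_pos by simp
  have "E ?H (\<Psi>' R j) <= (NI x. ennreal (1 + \<eta>) * (?f (?t x) * ennreal ((unit_bump (T R j x))^2)) + ennreal ?c * (?f' (?t x) * ennreal ((norm (unit_bump' (T R j x)))^2)))"
   unfolding E_def
  proof (rule nn_integral_mono)
   fix x :: "'m \<times> 'p"
   let ?q = "Q (snd x) (dir_embed \<nu> (k (?t x)))" and ?u = "unit_bump (T R j x)" and ?u' = "unit_bump' (T R j x)"
   have "Q (snd x) (\<Psi>' R j x) <= (1 + \<eta>) * Q (snd x) (?u *R dir_embed \<nu> (k (?t x))) + (1 + 1 / \<eta>) * Q (snd x) (w (?t x) *R ((1 / R) *R tang \<nu> ?u', 0))"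
    unfolding \<Psi>'_def by (subst add.commute) (rule Q_add_le[OF \<eta>])
   also have "... <= (1 + \<eta>) * Q (snd x) (?u *R dir_embed \<nu> (k (?t x))) + (1 + 1 / \<eta>) * (C * (norm (w (?t x) *R ((1 / R) *R tang \<nu> ?u', 0 :: 'p)))^2)"
    using \<eta> by (intro add_left_mono mult_left_mono Q_upper) auto
   also have "... = (1 + \<eta>) * (?q * ?u^2) + ?c * ((w (?t x))^2 * (norm (tang \<nu> ?u'))^2)"
    by (simp add: Q_scale norm_Pair power_mult_distrib power_divide)
   also have "... <= (1 + \<eta>) * (?q * ?u^2) + ?c * ((w (?t x))^2 * (norm ?u')^2)"
    using c0 by (intro add_left_mono mult_left_mono power_mono norm_tang[OF \<nu>]) auto
   finally have "ennreal (Q (snd x) (\<Psi>' R j x)) <= ennreal ((1 + \<eta>) * (?q * ?u^2) + ?c * ((w (?t x))^2 * (norm ?u')^2))"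
    by (rule ennreal_leI)
   also have "... = ennreal (1 + \<eta>) * (ennreal ?q * ennreal (?u^2)) + ennreal ?c * (ennreal ((w (?t x))^2) * ennreal ((norm ?u')^2))"
    by (rule ennreal_bilincomb[symmetric]) (use \<eta> c0 Q_nonneg in auto)
   finally show "ennreal (Q (snd x) (\<Psi>' R j x)) * indicator (?H \<times> W) x <= ennreal (1 + \<eta>) * (?f (?t x) * ennreal (?u^2)) + ennreal ?c * (?f' (?t x) * ennreal ((norm ?u')^2))"
    unfolding ind by (auto simp: indicator_def)
  qed
  also have "... = ennreal (1 + \<eta>) * (NI x. ?f (?t x) * ennreal ((unit_bump (T R j x))^2)) + ennreal ?c * (NI x. ?f' (?t x) * ennreal ((norm (unit_bump' (T R j x)))^2))"
  proof -
   have [measurable]: "?f \<in> BM" "?f' \<in> BM" using strip_borel by measurable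
   have [measurable]: "?t \<in> BM" "T R j \<in> BM" unfolding T_def by (intro bm_cont continuous_intros)+
   have 1: "(%x. ?f (?t x) * ennreal ((unit_bump (T R j x))^2)) \<in> borel_measurable lborel" "(%x. ?f' (?t x) * ennreal ((norm (unit_bump' (T R j x)))^2)) \<in> borel_measurable lborel"
    using measurable_compose[of ?t borel borel ?f borel] measurable_compose[of ?t borel borel ?f' borel] by measurable
   show ?thesis by (subst nn_integral_add) (use 1 in \<open>auto simp: nn_integral_cmult\<close>)
  qed
  also have "(NI x. ?f (?t x) * ennreal ((unit_bump (T R j x))^2)) = ennreal (R ^ DIM('m) / R) * ennreal j0 * ennreal e"
   unfolding j(1)[symmetric] e(1)[symmetric] Ed_def T_def
   by (rule nn_integral_product_form[OF _ _ R \<nu>]) (use strip_borel \<tau>(2) in \<open>measurable, auto\<close>)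
  also have "(NI x. ?f' (?t x) * ennreal ((norm (unit_bump' (T R j x)))^2)) = ennreal (R ^ DIM('m) / R) * ennreal j1 * ennreal n"
   unfolding j(2)[symmetric] n(1)[symmetric] N2_def T_def
   by (rule nn_integral_product_form[OF _ _ R \<nu>]) (use strip_borel \<tau>(2) in \<open>measurable, auto\<close>)
  also have "ennreal (1 + \<eta>) * (ennreal (R ^ DIM('m) / R) * ennreal j0 * ennreal e) + ennreal ?c * (ennreal (R ^ DIM('m) / R) * ennreal j1 * ennreal n) =
    ennreal ((1 + \<eta>) * (R ^ DIM('m) / R * (j0 * e)) + ?c * (R ^ DIM('m) / R * (j1 * n)))"
   using R j00 e(2) n(2) \<eta> c0 ennreal_bilincomb[of "1 + \<eta>" "R ^ DIM('m) / R" "j0 * e" ?c "R ^ DIM('m) / R" "j1 * n"]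
   by (simp only: mult.assoc ennreal_mult less_imp_le zero_le_power divide_nonneg_nonneg mult_nonneg_nonneg add_nonneg_nonneg zero_le_one)
  also have "(1 + \<eta>) * (R ^ DIM('m) / R * (j0 * e)) + ?c * (R ^ DIM('m) / R * (j1 * n)) = R ^ DIM('m) / R * ((1 + \<eta>) * j0 * e + (1 + 1 / \<eta>) * (C / R^2) * j1 * n)"
  proof -
   have "!!a p b c q d f :: real. a * (p * (b * c)) + q * (p * (d * f)) = p * (a * b * c + q * d * f)" by (simp add: algebra_simps)
   thus ?thesis .
  qed
  finally show ?thesis .
 qed
 define d where "d = z * n - e"
 have d: "d > 0" using e(3) by (simp add: d_def)
 define \<eta> where "\<eta> = (d / 3) / (e + 1)"
 have \<eta>: "\<eta> > 0" "\<eta> * e <= d / 3"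
 proof -
  show "\<eta> > 0" using d e(2) by (simp add: \<eta>_def)
  have "\<eta> * e <= \<eta> * (e + 1)" using \<open>\<eta> > 0\<close> by simp
  also have "... = d / 3" using nonzero_eq_divide_eq[of "e + 1" \<eta> "d / 3"] e(2) \<eta>_def by linarith
  finally show "\<eta> * e <= d / 3" .
 qed
 define X where "X = (1 + 1 / \<eta>) * C * j1 * n / (j0 * d / 3)"
 define R where "R = 1 + X"
 have X: "X >= 0" using \<eta>(1) C_pos j00 j0 d n(2) by (simp add: X_def)
 have R: "R > 0" "X <= R^2"
 proof -
  show "R > 0" using X by (simp add: R_def)
  have "R * 1 <= R * R" using X by (intro mult_left_mono) (auto simp: R_def)
  thus "X <= R^2" by (simp add: R_def power2_eq_square)
 qed
 have "(1 + 1 / \<eta>) * (C / R^2) * j1 * n = X * (j0 * d / 3) / R^2" using j0 d by (simp add: X_def)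
 also have "... <= R^2 * (j0 * d / 3) / R^2" using R j0 d by (intro divide_right_mono mult_right_mono) auto
 finally have 1: "(1 + 1 / \<eta>) * (C / R^2) * j1 * n <= j0 * (d / 3)" using R by simp
 have "(1 + \<eta>) * j0 * e = j0 * e + j0 * (\<eta> * e)" by (simp add: algebra_simps)
 also have "... <= j0 * e + j0 * (d / 3)" using j0 \<eta>(2) by (intro add_left_mono mult_left_mono) auto
 finally have 2: "(1 + \<eta>) * j0 * e + (1 + 1 / \<eta>) * (C / R^2) * j1 * n <= j0 * e + j0 * (d / 3) + j0 * (d / 3)" using 1 by linarith
 have "j0 * (z * n) = j0 * e + j0 * (d / 3) + j0 * (d / 3) + j0 * (d / 3)"
 proof -
  have "j0 * (z * n) = j0 * (e + d)" by (simp add: d_def)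
  thus ?thesis by (simp add: distrib_left)
 qed
 moreover have "j0 * (d / 3) > 0" using j0 d by simp
 ultimately have 3: "(1 + \<eta>) * j0 * e + (1 + 1 / \<eta>) * (C / R^2) * j1 * n < j0 * (z * n)" using 2 by linarith
 have "E ?H (\<Psi>' R j) < ennreal z * N2 ?H (\<Psi> R j)" for j
 proof -
  have Rp: "R ^ DIM('m) / R > 0" using R by simp
  have "E ?H (\<Psi>' R j) <= ennreal (R ^ DIM('m) / R * ((1 + \<eta>) * j0 * e + (1 + 1 / \<eta>) * (C / R^2) * j1 * n))" by (rule E[OF R(1) \<eta>(1)])
  also have "... < ennreal (R ^ DIM('m) / R * (j0 * (z * n)))"
   by (intro ennreal_lessI mult_strict_left_mono[OF 3 Rp] mult_pos_pos Rp j0 z0 n(2))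
  also have "R ^ DIM('m) / R * (j0 * (z * n)) = z * (R ^ DIM('m) / R * j0 * n)" by (simp only: mult_ac)
  also have "ennreal ... = ennreal z * N2 ?H (\<Psi> R j)" unfolding N[OF R(1)] using z0 by (intro ennreal_mult') auto
  finally show ?thesis .
 qed
 thus ?thesis using cg[OF R(1)] lat disj by (intro exI[of _ "\<Psi> R"] exI[of _ "\<Psi>' R"]) blast
qed

end

lemma extreme_point_blowup:
 fixes \<omega> :: "'m::euclidean_space set"
 assumes \<omega>: "bounded_C1_domain \<omega>" and \<nu>: "norm \<nu> = 1"
 shows "EX x. (ALL y:closure \<omega>. y \<bullet> \<nu> <= x \<bullet> \<nu>) & (ALL y:\<omega>. y \<bullet> \<nu> < x \<bullet> \<nu>) & 
   (ALL X. X \<bullet> \<nu> < 0 --> (\<forall>\<^sub>F l in at_top. x + (1 / l) *R X \<in> \<omega>))"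
proof -
 have o: "open \<omega>" "\<omega> ~= {}" "bounded \<omega>" using \<omega> by (auto simp: bounded_C1_domain_def)
 have "compact (closure \<omega>)" "closure \<omega> ~= {}" using o by auto
 moreover have "continuous_on (closure \<omega>) (%y. y \<bullet> \<nu>)" by (intro continuous_intros)
 ultimately have "EX x:closure \<omega>. ALL y:closure \<omega>. y \<bullet> \<nu> <= x \<bullet> \<nu>" by (rule continuous_attains_sup)
 then obtain x where x: "x \<in> closure \<omega>" "y \<in> closure \<omega> ==> y \<bullet> \<nu> <= x \<bullet> \<nu>" for y by (elim bexE) (erule that, erule (1) bspec)
 have \<nu>\<nu>: "\<nu> \<bullet> \<nu> = 1" using \<nu> by (simp add: dot_square_norm)
 have strict: "y \<bullet> \<nu> < x \<bullet> \<nu>" if "y \<in> \<omega>" for y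
 proof -
  have "EX e>0. cball y e \<subseteq> \<omega>" using o(1)[unfolded open_contains_cball] that by blast
  then obtain e where e: "e > 0" "cball y e \<subseteq> \<omega>" by (elim exE conjE)
  have "y + e *R \<nu> \<in> cball y e" using e(1) \<nu> by (simp add: dist_norm)
  hence "(y + e *R \<nu>) \<bullet> \<nu> <= x \<bullet> \<nu>" using e(2) by (intro x(2) subsetD[OF closure_subset] subsetD[OF e(2)])
  thus ?thesis using e(1) by (simp add: inner_add_left \<nu>\<nu>)
 qed
 have "x \<in> frontier \<omega>" using x(1) strict[of x] o(1) by (auto simp: frontier_def interior_open)
 then obtain r e h where r: "r > 0" "norm e = 1" "Ck 1 h" "!!y t. h (y + t *R e) = h y" "\<omega> \<inter> ball x r = {y \<in> ball x r. y \<bullet> e < h y}"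
  using \<omega> unfolding bounded_C1_domain_def C1_boundary_def by blast
 obtain k where k: "C1g h k" by (rule Ck_1_C1g[OF r(3)])
 have in_\<omega>: "y \<in> \<omega>" if "y \<in> ball x r" "y \<bullet> e < h y" for y using r(5) that by blast
 have hx: "x \<bullet> e = h x"
 proof (rule antisym)
  show "h x <= x \<bullet> e" using r(1) strict[of x] in_\<omega>[of x] by (meson centre_in_ball less_irrefl not_less)
  have "x \<in> closure (\<omega> \<inter> ball x r)"
   using x(1) r(1) open_Int_closure_subset[OF open_ball, of x r \<omega>] by (auto simp: Int_commute)
  moreover have "\<omega> \<inter> ball x r \<subseteq> {y. y \<bullet> e <= h y}" unfolding r(5) by auto
  moreover have "closed {y. y \<bullet> e <= h y}" by (intro closed_Collect_le continuous_intros C1g_cont_fun[OF k])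
  ultimately show "x \<bullet> e <= h x" using closure_minimal by blast
 qed
 define n where "n = e - k x"
 have near: "\<forall>\<^sub>F t in at_right 0. x + t *R X \<in> \<omega>" if X: "X \<bullet> n < 0" for X
 proof -
  have "((%t. (x + t *R X) \<bullet> e - h (x + t *R X)) has_real_derivative (X \<bullet> n)) (at 0)"
  proof -
   have T: "((%t. x + t *R X) has_derivative (%t. t *R X)) (at 0)" by (auto intro!: derivative_eq_intros)
   have "((%t. h (x + t *R X)) has_derivative (%t. k x \<bullet> (t *R X))) (at 0)"
    using diff_chain_at[OF T, of h "%v. k x \<bullet> v"] C1gD[OF k, of x] by (simp add: o_def)
   moreover have "((%t. (x + t *R X) \<bullet> e) has_derivative (%t. (t *R X) \<bullet> e)) (at 0)" by (auto intro!: derivative_eq_intros)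
   ultimately have "((%t. (x + t *R X) \<bullet> e - h (x + t *R X)) has_derivative (%t. (t *R X) \<bullet> e - k x \<bullet> (t *R X))) (at 0)"
    by (rule has_derivative_diff[rotated])
   moreover have "(%t. (t *R X) \<bullet> e - k x \<bullet> (t *R X)) = (%t. (X \<bullet> n) * t)" by (auto simp: n_def inner_diff_right inner_commute[of "k x"] algebra_simps)
   ultimately show ?thesis by (simp add: has_field_derivative_def)
  qed
  from DERIV_neg_dec_right[OF this X] obtain d where d: "d > 0" "!!t. 0 < t ==> t < d ==> (x + t *R X) \<bullet> e - h (x + t *R X) < 0"
   using hx by (auto simp: add_0)
  have "((%t. x + t *R X) \<longlongrightarrow> x + 0 *R X) (at_right 0)" by (intro tendsto_intros)
  from topological_tendstoD[OF this open_ball, of x r] r(1) have "\<forall>\<^sub>F t in at_right 0. x + t *R X \<in> ball x r" by simp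
  moreover have "\<forall>\<^sub>F t in at_right 0. t \<in> {0<..<d}" by (rule eventually_at_right_real[OF d(1)])
  ultimately show ?thesis by eventually_elim (use d(2) in \<open>auto intro!: in_\<omega>\<close>)
 qed
 have imp: "X \<bullet> \<nu> < 0" if X: "X \<bullet> n < 0" for X
 proof -
  have "\<forall>\<^sub>F t in at_right (0::real). t > 0" by (simp add: eventually_at_right_less)
  with near[OF X] have "\<forall>\<^sub>F t in at_right 0. x + t *R X \<in> \<omega> & t > 0" by (rule eventually_conj)
  then obtain t :: real where t: "x + t *R X \<in> \<omega>" "t > 0"
   using eventually_happens'[OF trivial_limit_at_right_real] by blast
  from strict[OF t(1)] show ?thesis using t(2) by (simp add: inner_add_left mult_less_0_iff)
 qed
 have "k x \<bullet> e = 0" by (rule invariant_gradient[OF k r(4)])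
 hence "n \<bullet> e = 1" using r(2) by (simp add: n_def inner_diff_left dot_square_norm)
 hence n0: "n \<bullet> n > 0" by (metis inner_gt_zero_iff inner_zero_left zero_neq_one)
 define P where "P = \<nu> - ((\<nu> \<bullet> n) / (n \<bullet> n)) *R n"
 have Pn: "P \<bullet> n = 0" using n0 by (simp add: P_def inner_diff_left)
 have "P = 0"
 proof (rule ccontr)
  assume "P ~= 0"
  hence PP: "P \<bullet> P > 0" by simp
  define s where "s = (n \<bullet> \<nu>) / (P \<bullet> P)"
  have "(- n + s *R P) \<bullet> n < 0" using n0 by (simp only: inner_add_left inner_minus_left inner_scaleR_left Pn)
  from imp[OF this] have "- (n \<bullet> \<nu>) + s * (P \<bullet> \<nu>) < 0" by (simp only: inner_add_left inner_minus_left inner_scaleR_left)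
  moreover have "P \<bullet> \<nu> = P \<bullet> P" using Pn by (simp add: P_def inner_diff_right)
  ultimately show False using PP by (simp add: s_def)
 qed
 hence \<nu>n: "\<nu> = ((\<nu> \<bullet> n) / (n \<bullet> n)) *R n" by (simp add: P_def)
 have "(- n) \<bullet> \<nu> < 0" using n0 by (intro imp) simp
 hence "(\<nu> \<bullet> n) / (n \<bullet> n) > 0" using n0 by (simp add: inner_commute)
 hence conv: "X \<bullet> n < 0" if "X \<bullet> \<nu> < 0" for X
  using that arg_cong[OF \<nu>n, of "inner X"] unfolding inner_scaleR_right by (metis mult_less_0_iff not_less_iff_gr_or_eq)
 have "\<forall>\<^sub>F l in at_top. x + (1 / l) *R X \<in> \<omega>" if "X \<bullet> \<nu> < 0" for X
 proof -
  have "filterlim (%l::real. 1 / l) (at_right 0) at_top" using filterlim_inverse_at_right_top by (simp add: inverse_eq_divide)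
  from eventually_compose_filterlim[OF near[OF conv[OF that]] this] show ?thesis .
 qed
 thus ?thesis using x strict by blast
qed

context coef
begin

lemma kth_eigenvalue_asymptotic_bounds:
 fixes \<omega> :: "'m set" and \<nu> :: 'm
 assumes \<omega>: "bounded_C1_domain \<omega>" and dim: "DIM('m) >= 2" and \<nu>: "norm \<nu> = 1" and s: "Zd \<nu> < s" and k: "k >= 1"
 defines "Om == %l. (*\<^sub>R) l ` \<omega> \<times> W" and "ga == %l. (*\<^sub>R) l ` \<omega> \<times> frontier W"
 shows "\<forall>\<^sub>F l in at_top. kth_eigenvalue (Om l) (ga l) cylB k <= s & 
  (ALL z. (ALL u g. adm (Om l) (ga l) u g --> z * sqn (lebesgue_on (Om l)) u <= elliptic.en (Om l) cylB g g) --> z <= kth_eigenvalue (Om l) (ga l) cylB k)"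
proof -
 have o: "open \<omega>" "bounded \<omega>" using \<omega> by (auto simp: bounded_C1_domain_def)
 from extreme_point_blowup[OF \<omega> \<nu>] obtain x where x: "!!y. y \<in> closure \<omega> ==> y \<bullet> \<nu> <= x \<bullet> \<nu>" "!!y. y \<in> \<omega> ==> y \<bullet> \<nu> < x \<bullet> \<nu>"
  "!!X. X \<bullet> \<nu> < 0 ==> \<forall>\<^sub>F l in at_top. x + (1 / l) *R X \<in> \<omega>" by blast
 from half_space_trial[OF dim \<nu> s] obtain \<Psi> :: "nat => 'm \<times> 'p => real" and \<Psi>' where
  \<Psi>: "!!j. C1c (\<Psi> j) (\<Psi>' j)" "!!j x. x \<in> supp (\<Psi> j) ==> fst x \<bullet> \<nu> <= 0 ==> snd x \<notin> frontier W"
  "!!j. E {y. y \<bullet> \<nu> < 0} (\<Psi>' j) < ennreal s * N2 {y. y \<bullet> \<nu> < 0} (\<Psi> j)" "!!i j. i ~= j ==> supp (\<Psi> i) \<inter> supp (\<Psi> j) = {}"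
  by blast
 let ?H = "{y. y \<bullet> \<nu> < 0} :: 'm set"
 define v where "v l j y = \<Psi> j (y - (l *R x, 0))" for l j y
 define q where "q l j y = \<Psi>' j (y - (l *R x, 0))" for l j y
 have mem: "X + l *R x \<in> (*\<^sub>R) l ` \<omega> \<longleftrightarrow> x + (1 / l) *R X \<in> \<omega>" if "l > 0" for X l
 proof -
  have "X + l *R x = l *R (x + (1 / l) *R X)" using that by (simp add: algebra_simps)
  thus ?thesis using that by (auto simp: image_iff)
 qed
 have ind: "((%l. indicator (Om l) (y + (l *R x, 0)) :: ennreal) \<longlongrightarrow> indicator (?H \<times> W) y) at_top" for y
 proof (rule tendsto_eventually)
  obtain X \<xi> where y: "y = (X, \<xi>)" by (cases y)
  have "\<forall>\<^sub>F l in at_top. X + l *R x \<in> (*\<^sub>R) l ` \<omega> \<longleftrightarrow> X \<bullet> \<nu> < 0"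
  proof (cases "X \<bullet> \<nu> < 0")
   case True
   from x(3)[OF this] eventually_gt_at_top[of 0] show ?thesis by eventually_elim (use True mem in blast)
  next
   case False
   show ?thesis using eventually_gt_at_top[of 0]
   proof eventually_elim
    fix l :: real assume l: "l > 0"
    have "(x + (1 / l) *R X) \<bullet> \<nu> >= x \<bullet> \<nu>" using False l by (simp add: inner_add_left)
    thus "X + l *R x \<in> (*\<^sub>R) l ` \<omega> \<longleftrightarrow> X \<bullet> \<nu> < 0" unfolding mem[OF l] using x(2) False by fastforce
   qed
  qed
  thus "\<forall>\<^sub>F l in at_top. (indicator (Om l) (y + (l *R x, 0)) :: ennreal) = indicator (?H \<times> W) y"
   by eventually_elim (auto simp: y Om_def indicator_def)
 qed
 have oD: "open ((*\<^sub>R) l ` \<omega>)" if "l > 0" for l using o that by (intro open_scaling) auto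
 have oOm: "open (Om l)" if "l > 0" for l unfolding Om_def by (intro open_Times oD that W)
 have conv: "((%l. NI y. f (y - (l *R x, 0)) * indicator (Om l) y) \<longlongrightarrow> (NI y. f y * indicator (?H \<times> W) y)) at_top"
  if f: "f \<in> BM" "(NI y. f y) < \<infinity>" "!!y. f y < \<infinity>" for f :: "'m \<times> 'p => ennreal"
 proof (rule tendsto_at_topI_sequentially)
  fix X :: "nat => real" assume X: "filterlim X at_top sequentially"
  have m: "(%y. f y * indicator (Om l) (y + (l *R x, 0))) \<in> BM" if "l > 0" for l
  proof -
   have "(%y::'m \<times> 'p. y + (l *R x, 0)) \<in> BM" by measurable
   from measurable_compose[OF this, of "indicator (Om l)" "borel :: ennreal measure"] oOm[OF that] f(1) show ?thesis by simp
  qed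
  have "\<forall>\<^sub>F n in sequentially. X n > 0" using X by (simp add: filterlim_at_top_dense)
  then obtain n0 where n0: "!!n. n >= n0 ==> X n > 0" by (auto simp: eventually_sequentially)
  have "(%n. NI y. f y * indicator (Om (X (n + n0))) (y + (X (n + n0) *R x, 0))) \<longlonglongrightarrow> (NI y. f y * indicator (?H \<times> W) y)"
  proof (rule nn_integral_dominated_convergence[where w = f])
   show "(%y. f y * indicator (Om (X (n + n0))) (y + (X (n + n0) *R x, 0))) \<in> borel_measurable lborel" for n
    using m[OF n0[of "n + n0"]] by simp
   have "open (?H \<times> W)" by (intro open_Times W open_halfspace_lt[of \<nu> 0, unfolded inner_commute[of \<nu>]])
   thus "(%y. f y * indicator (?H \<times> W) y) \<in> borel_measurable lborel" using f(1) by simp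
   show "AE y in lborel. (%n. f y * indicator (Om (X (n + n0))) (y + (X (n + n0) *R x, 0))) \<longlonglongrightarrow> f y * indicator (?H \<times> W) y"
   proof (rule AE_I2)
    fix y
    have "filterlim (%n. X (n + n0)) at_top sequentially" by (rule filterlim_compose[OF X filterlim_add_const_nat_at_top])
    from filterlim_compose[OF ind this]
    show "(%n. f y * indicator (Om (X (n + n0))) (y + (X (n + n0) *R x, 0))) \<longlonglongrightarrow> f y * indicator (?H \<times> W) y"
     by (intro ennreal_tendsto_cmult) (use f(3) in auto)
   qed
  qed (use f in \<open>auto simp: indicator_def intro!: AE_I2\<close>)
  moreover have "(NI y. f y * indicator (Om l) (y + (l *R x, 0))) = (NI y. f (y - (l *R x, 0)) * indicator (Om l) y)" if "l > 0" for l
  proof -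
   have "(%y::'m \<times> 'p. y - (l *R x, 0)) \<in> BM" by measurable
   from measurable_compose[OF this f(1)] oOm[OF that]
   have "(%y. f (y - (l *R x, 0)) * indicator (Om l) y) \<in> BM" by simp
   from nn_integral_translate[OF this, of "(l *R x, 0)"] show ?thesis by simp
  qed
  ultimately have "(%n. NI y. f (y - (X (n + n0) *R x, 0)) * indicator (Om (X (n + n0))) y) \<longlonglongrightarrow> (NI y. f y * indicator (?H \<times> W) y)"
   using n0 by simp
  thus "(%n. NI y. f (y - (X n *R x, 0)) * indicator (Om (X n)) y) \<longlonglongrightarrow> (NI y. f y * indicator (?H \<times> W) y)"
   by (rule LIMSEQ_offset)
 qed
 have ev: "\<forall>\<^sub>F l in at_top. E ((*\<^sub>R) l ` \<omega>) (q l j) < ennreal s * N2 ((*\<^sub>R) l ` \<omega>) (v l j)" for j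
 proof -
  have [measurable]: "\<Psi> j \<in> BM" "\<Psi>' j \<in> BM" using C1c_borel[OF \<Psi>(1)] .
  note fin = C1c_nn_integral[OF \<Psi>(1)[of j] open_UNIV, simplified]
  have "(NI y. ennreal (Q (snd y) (\<Psi>' j y))) <= (NI y. ennreal C * ennreal ((norm (\<Psi>' j y))^2))"
   using C_pos Q_upper by (intro nn_integral_mono) (simp add: ennreal_mult[symmetric] ennreal_leI)
  also have "... < \<infinity>" using fin(2) by (simp add: nn_integral_cmult ennreal_mult_less_top)
  finally have fE: "(NI y. ennreal (Q (snd y) (\<Psi>' j y))) < \<infinity>" .
  have 1: "((%l. E ((*\<^sub>R) l ` \<omega>) (q l j)) \<longlongrightarrow> E ?H (\<Psi>' j)) at_top"
   using conv[of "%y. ennreal (Q (snd y) (\<Psi>' j y))", OF _ fE] unfolding E_def Om_def q_def by simp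
  have 2: "((%l. N2 ((*\<^sub>R) l ` \<omega>) (v l j)) \<longlongrightarrow> N2 ?H (\<Psi> j)) at_top"
   using conv[of "%y. ennreal ((\<Psi> j y)^2)"] fin(1) unfolding N2_def Om_def v_def by simp
  obtain m where m: "E ?H (\<Psi>' j) < m" "m < ennreal s * N2 ?H (\<Psi> j)" using \<Psi>(3)[of j] dense by blast
  have "\<forall>\<^sub>F l in at_top. E ((*\<^sub>R) l ` \<omega>) (q l j) < m" by (rule order_tendstoD(2)[OF 1 m(1)])
  moreover have "\<forall>\<^sub>F l in at_top. m < ennreal s * N2 ((*\<^sub>R) l ` \<omega>) (v l j)"
   by (rule order_tendstoD(1)[OF ennreal_tendsto_cmult[OF _ 2] m(2)]) simp
  ultimately show ?thesis by eventually_elim (rule less_trans)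
 qed
 hence "\<forall>\<^sub>F l in at_top. ALL j:{..<k}. E ((*\<^sub>R) l ` \<omega>) (q l j) < ennreal s * N2 ((*\<^sub>R) l ` \<omega>) (v l j)"
  by (intro eventually_ball_finite) auto
 thus ?thesis using eventually_gt_at_top[of 0]
 proof eventually_elim
  fix l :: real assume lt: "ALL j:{..<k}. E ((*\<^sub>R) l ` \<omega>) (q l j) < ennreal s * N2 ((*\<^sub>R) l ` \<omega>) (v l j)" and l: "l > 0"
  let ?D = "(*\<^sub>R) l ` \<omega>"
  interpret elliptic_problem "?D \<times> W" "?D \<times> frontier W" cylB c C by (rule elliptic_cyl[OF oD[OF l]])
  have vc: "C1c (v l j) (q l j)" for j
  proof -
   have "C1g (v l j) (q l j)" using C1g_affine[OF C1c_C1g[OF \<Psi>(1)[of j]], of 1 "(l *R x, 0)"] unfolding v_def[abs_def] q_def[abs_def] by simp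
   moreover have "compact (supp (v l j))"
   proof (rule compact_suppI)
    show "compact ((+) (l *R x, 0) ` supp (\<Psi> j))" using \<Psi>(1)[of j] by (intro compact_translation) (simp add: C1c_def)
    fix y assume "v l j y ~= 0"
    hence "y - (l *R x, 0) \<in> supp (\<Psi> j)" using not_supp by (fastforce simp: v_def)
    thus "y \<in> (+) (l *R x, 0) ` supp (\<Psi> j)" by (intro image_eqI[of _ _ "y - (l *R x, 0)"]) auto
   qed
   ultimately show ?thesis by (simp add: C1c_def)
  qed
  have vsupp: "y - (l *R x, 0) \<in> supp (\<Psi> j)" if "y \<in> supp (v l j)" for y j
  proof -
   have "supp (v l j) \<subseteq> (%y. y - (l *R x, 0)) -` supp (\<Psi> j)"
   proof (rule supp_leI)
    show "closed ((%y. y - (l *R x, 0)) -` supp (\<Psi> j))" by (intro closed_vimage closed_supp continuous_intros)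
   qed (use not_supp in \<open>fastforce simp: v_def\<close>)
   thus ?thesis using that by blast
  qed
  have lat: "supp (v l j) \<inter> closure (?D \<times> frontier W) = {}" for j
  proof -
   have False if y: "y \<in> supp (v l j)" "y \<in> closure (?D \<times> frontier W)" for y
   proof -
    have "fst y \<in> closure ?D" "snd y \<in> frontier W" using y(2) by (auto simp: closure_lateral)
    then obtain z where z: "z \<in> closure \<omega>" "fst y = l *R z" using closure_scaleR[of l \<omega>] by auto
    have "fst (y - (l *R x, 0)) \<bullet> \<nu> <= 0" using x(1)[OF z(1)] l by (simp add: z(2) inner_diff_left)
    from \<Psi>(2)[OF vsupp[OF y(1)] this] show False using \<open>snd y \<in> frontier W\<close> by simp
   qed
   thus ?thesis by blast
  qed
  have ad: "adm (?D \<times> W) (?D \<times> frontier W) (v l j) (q l j)" for j by (rule C1c_adm[OF vc open_Om lat])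
  obtain r where r: "r > 0" "!!b. EX e h k p. graph_chart \<omega> b r 1 e h k p" by (rule uniform_charts[OF \<omega> zero_less_one]) (rule that)
  have ce: compactly_embedded
  proof (rule compactly_embedded_cylinder[OF elliptic_cyl[OF oD[OF l]] oD[OF l] bounded_scaling[OF o(2)] W(1,2)])
   show "l * r > 0" using l r by simp
   fix b
   from r(2)[of "(1 / l) *R b"] obtain e h k p where "graph_chart \<omega> ((1 / l) *R b) r 1 e h k p" by (elim exE)
   from graph_chart_scale[OF this l] l show "EX e h k p. graph_chart ?D b (l * r) 1 e h k p" by auto
  qed
  have lt': "en (q l j) (q l j) < s * sqn M (v l j)" if "j < k" for j
  proof (rule ccontr)
   assume "~?thesis"
   hence "ennreal (s * sqn M (v l j)) <= ennreal (en (q l j) (q l j))" by (intro ennreal_leI) simp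
   moreover have "ennreal (s * sqn M (v l j)) = ennreal s * ennreal (sqn M (v l j))" by (rule ennreal_mult'') (rule ip_self_nonneg)
   ultimately show False using lt that unfolding E_eq[OF vc oD[OF l]] N2_eq[OF vc oD[OF l]] by (auto simp: not_less[symmetric])
  qed
  have dj: "v l i y = 0 & q l i y = 0 \<or> v l j y = 0 & q l j y = 0" if "i ~= j" for i j y
   using \<Psi>(4)[OF that] not_supp C1g_zero_outside_supp[OF C1c_C1g[OF \<Psi>(1)]] unfolding v_def q_def by (metis IntI empty_iff)
  have orth: "ip M (v l i) (v l j) = 0 & en (q l i) (q l j) = 0" if "i ~= j" for i j
  proof -
   have 1: "v l i y \<bullet> v l j y = 0" "cylB y (q l i y) \<bullet> q l j y = 0" for y
    using dj[OF that, of y] linear_0[OF B_lin] by (auto simp: cylB_def)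
   show ?thesis unfolding en_def ip_def 1 by simp
  qed
  have pos: "sqn M (v l j) > 0" if "j < k" for j
   using lt'[OF that] en_nonneg[OF adm_L2(2)[OF ad[of j]]] ip_self_nonneg[of M "v l j"] by (cases "sqn M (v l j) = 0") auto
  have bnd: "z <= kth_eigenvalue (?D \<times> W) (?D \<times> frontier W) cylB k & kth_eigenvalue (?D \<times> W) (?D \<times> frontier W) cylB k <= s"
   if low: "!!u g. adm (?D \<times> W) (?D \<times> frontier W) u g ==> z * sqn M u <= en g g" for z
   using kth_eigenvalue_bounds[where v = "v l" and q = "q l" and z = z and s = s, OF ce k ad pos orth less_imp_le[OF lt'] low] by blast
  have "kth_eigenvalue (?D \<times> W) (?D \<times> frontier W) cylB k <= s"
   using bnd[of 0] en_nonneg[OF adm_L2(2)] by simp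
  thus "kth_eigenvalue (Om l) (ga l) cylB k <= s & 
   (ALL z. (ALL u g. adm (Om l) (ga l) u g --> z * sqn (lebesgue_on (Om l)) u <= elliptic.en (Om l) cylB g g) --> z <= kth_eigenvalue (Om l) (ga l) cylB k)"
   unfolding Om_def ga_def using bnd by blast
 qed
qed

theorem kth_eigenvalue_limit:
 fixes \<omega> :: "'m set"
 assumes \<omega>: "bounded_C1_domain \<omega>" and dim: "DIM('m) >= 2" and k: "k >= 1"
 shows "((%l. kth_eigenvalue ((*\<^sub>R) l ` \<omega> \<times> W) ((*\<^sub>R) l ` \<omega> \<times> frontier W) cylB k) \<longlongrightarrow> (INF \<nu>\<in>sphere 0 1. Zd \<nu>)) at_top"
proof -
 let ?z = "INF \<nu>\<in>sphere 0 1. Zd \<nu>"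
 let ?ev = "%l. kth_eigenvalue ((*\<^sub>R) l ` \<omega> \<times> W) ((*\<^sub>R) l ` \<omega> \<times> frontier W) cylB k"
 have bb: "bdd_below (Zd ` sphere 0 1)" using Zd_nonneg by (auto intro!: bdd_belowI[of _ 0])
 have ne: "Zd ` sphere (0::'m) 1 ~= {}"
 proof -
  obtain b :: 'm where "b \<in> Basis" using nonempty_Basis by blast
  thus ?thesis by auto
 qed
 have z: "?z <= Zd \<nu>" if "norm \<nu> = 1" for \<nu> by (rule cINF_lower[OF bb]) (use that in auto)
 have z0: "?z >= 0" using ne Zd_nonneg by (intro cINF_greatest) auto
 show ?thesis
 proof (rule order_tendstoI)
  fix a assume "?z < a"
  then obtain s where s: "?z < s" "s < a" using dense by blast
  from cInf_lessD[OF ne s(1)] obtain \<nu> :: 'm where \<nu>: "norm \<nu> = 1" "Zd \<nu> < s" by auto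
  show "\<forall>\<^sub>F l in at_top. ?ev l < a"
   using kth_eigenvalue_asymptotic_bounds[OF \<omega> dim \<nu> k] by eventually_elim (use s(2) in auto)
 next
  fix a assume a: "a < ?z"
  from cInf_lessD[OF ne, of "?z + 1"] obtain \<nu> :: 'm where \<nu>: "norm \<nu> = 1" "Zd \<nu> < ?z + 1" by auto
  from lower_bound[OF \<omega> z z0, of "(?z - a) / 2"] a obtain L where L: "L > 0"
   "ALL l>=L. ALL u g. adm ((*\<^sub>R) l ` \<omega> \<times> W) ((*\<^sub>R) l ` \<omega> \<times> frontier W) u g -->
   (?z - (?z - a) / 2) * sqn (lebesgue_on ((*\<^sub>R) l ` \<omega> \<times> W)) u <= elliptic.en ((*\<^sub>R) l ` \<omega> \<times> W) cylB g g"
   by auto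
  have "a < ?z - (?z - a) / 2" using a by (simp add: field_simps)
  show "\<forall>\<^sub>F l in at_top. a < ?ev l"
   using kth_eigenvalue_asymptotic_bounds[OF \<omega> dim \<nu> k] eventually_ge_at_top[of L]
  proof eventually_elim
   fix l assume "?ev l <= ?z + 1 & (ALL z. (ALL u g. adm ((*\<^sub>R) l ` \<omega> \<times> W) ((*\<^sub>R) l ` \<omega> \<times> frontier W) u g --> z * sqn (lebesgue_on ((*\<^sub>R) l ` \<omega> \<times> W)) u <= elliptic.en ((*\<^sub>R) l ` \<omega> \<times> W) cylB g g) --> z <= ?ev l)"
    and "L <= l"
   hence "?z - (?z - a) / 2 <= ?ev l" using L(2) by blast
   with \<open>a < ?z - (?z - a) / 2\<close> show "a < ?ev l" by linarith
  qed
 qed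
qed

end

section \<open>The gap below the first eigenvalue of the cross section\<close>

definition half_int :: "(real => real) => real" where "half_int f = (LI t. indicator {..<0} t * f t)"

lemma half_int_integrable:
 fixes f :: "real => real"
 assumes "contU f" "compact K" "!!t. t \<notin> K ==> f t = 0"
 shows "integrable lborel (%t. indicator {..<0} t * (f t :: real))"
proof -
 have "{..<0::real} \<in> sets lborel" by measurable
 moreover have "integrable lborel f" by (rule integrable_continuous_compact[OF assms(1,2)]) (rule assms(3))
 ultimately have "integrable lborel (%t. indicator {..<0} t *R f t)" by (rule integrable_mult_indicator)
 thus ?thesis by simp
qed

lemma half_int_derivative:
 fixes F :: "real => real"
 assumes F: "C1c F F'" shows "half_int F' = F 0"
proof -
 obtain a where a: "a < 0" "!!t. t <= a ==> t \<notin> supp F"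
 proof -
  have "bounded (supp F)" using F by (simp add: C1c_def compact_imp_bounded)
  then obtain b where b: "!!t. t \<in> supp F ==> \<bar>t\<bar> <= b" by (auto simp: bounded_real)
  show thesis by (rule that[of "- \<bar>b\<bar> - 1"]) (use b in fastforce)+
 qed
 have z: "F t = 0" "F' t = 0" if "t <= a" for t
  using not_supp[OF a(2)[OF that]] C1g_zero_outside_supp[OF C1c_C1g[OF F] a(2)[OF that]] .
 have "(LI t. F' t * indicator {a..0} t) = F 0 - F a"
 proof (rule integral_FTC_Icc_real)
  show "(F has_real_derivative F' t) (at t)" for t
   using C1gD[OF C1c_C1g[OF F], of t] by (simp add: has_field_derivative_def)
  show "isCont F' t" for t using C1g_cont[OF C1c_C1g[OF F]] by (simp add: continuous_on_eq_continuous_at)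
 qed (use a in auto)
 also have "(LI t. F' t * indicator {a..0} t) = half_int F'"
  unfolding half_int_def
 proof (rule integral_cong_AE)
  show "AE t in lborel. F' t * indicator {a..0} t = indicator {..<0} t * F' t"
   using AE_lborel_singleton[of "0::real"] by eventually_elim (use z a(1) in \<open>auto simp: indicator_def not_le\<close>)
 qed (use C1c_borel(2)[OF F] in simp_all)
 finally show ?thesis using z[of a] by simp
qed

lemma C1c_tensor:
 fixes f :: "real => real" and \<phi> :: "'p::euclidean_space => real"
 assumes f: "C1c f f'" and \<phi>: "C1c \<phi> k"
 shows "C1c (%x. f (fst x) * \<phi> (snd x)) (%x. (f' (fst x) * \<phi> (snd x), f (fst x) *R k (snd x)))"
  "supp (%x. f (fst x) * \<phi> (snd x)) \<subseteq> UNIV \<times> supp \<phi>"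
proof -
 have 1: "C1g (%x::real \<times> 'p. f (fst x)) (%x. (f' (fst x), 0))"
  by (rule C1g_comp[OF C1c_C1g[OF f], where T' = "%_ h. fst h"])
   (auto intro!: derivative_eq_intros continuous_intros continuous_on_compose2[OF C1g_cont[OF C1c_C1g[OF f]]] simp: inner_prod_def)
 have 2: "C1g (%x::real \<times> 'p. \<phi> (snd x)) (%x. (0, k (snd x)))"
  by (rule C1g_comp[OF C1c_C1g[OF \<phi>], where T' = "%_ h. snd h"])
   (auto intro!: derivative_eq_intros continuous_intros continuous_on_compose2[OF C1g_cont[OF C1c_C1g[OF \<phi>]]] simp: inner_prod_def)
 have "x \<in> supp f \<times> supp \<phi>" if "f (fst x) * \<phi> (snd x) ~= 0" for x
  using that not_supp[of "fst x" f] not_supp[of "snd x" \<phi>] by (cases x) auto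
 note sub = this
 have s: "supp (%x. f (fst x) * \<phi> (snd x)) \<subseteq> supp f \<times> supp \<phi>" by (rule supp_leI[OF closed_Times[OF closed_supp closed_supp] sub])
 have "compact (supp f \<times> supp \<phi>)" using f \<phi> by (simp add: C1c_def compact_Times)
 from compact_suppI[OF this sub] have "compact (supp (%x. f (fst x) * \<phi> (snd x)))" .
 thus "C1c (%x. f (fst x) * \<phi> (snd x)) (%x. (f' (fst x) * \<phi> (snd x), f (fst x) *R k (snd x)))"
  using C1g_mult[OF 1 2] by (simp add: C1c_def mult.commute)
 show "supp (%x. f (fst x) * \<phi> (snd x)) \<subseteq> UNIV \<times> supp \<phi>" using s by blast
qed

lemma L2_bounded_linear:
 assumes T: "bounded_linear T" and f: "L2 M f" shows "L2 M (%x. T (f x))"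
proof -
 obtain K where K: "!!x. norm (T x) <= norm x * K" using bounded_linear.bounded[OF T] by blast
 show ?thesis
 proof (rule L2_bound)
  have [measurable]: "T \<in> BM" by (intro bm_cont linear_continuous_on T)
  show "(%x. T (f x)) \<in> borel_measurable M" using f by measurable
  show "integrable M (%x. K^2 * (norm (f x))^2)" using L2_norm2_integrable[OF f] by simp
  show "AE x in M. (norm (T (f x)))^2 <= K^2 * (norm (f x))^2"
   by (rule AE_I2) (metis K power_mono norm_ge_zero power_mult_distrib mult.commute)
 qed
qed

lemma L2_tendsto_bounded_linear:
 assumes T: "bounded_linear T" and f: "L2_tendsto M F f" shows "L2_tendsto M (%n x. T (F n x)) (%x. T (f x))"
 unfolding L2_tendsto_def
proof (intro conjI allI)
 have L: "L2 M (F n)" "L2 M f" for n using f by (auto simp: L2_tendsto_def)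
 thus "L2 M (%x. T (F n x))" "L2 M (%x. T (f x))" for n by (auto intro: L2_bounded_linear[OF T])
 obtain K where K: "!!x. norm (T x) <= norm x * K" using bounded_linear.bounded[OF T] by blast
 have le: "sqn M (%x. T (F n x) - T (f x)) <= K^2 * sqn M (%x. F n x - f x)" for n
  unfolding ip_self integral_mult_right_zero[symmetric] linear_diff[OF bounded_linear.linear[OF T], symmetric]
 proof (rule integral_mono)
  show "integrable M (%x. (norm (T (F n x - f x)))^2)" "integrable M (%x. K^2 * (norm (F n x - f x))^2)"
   using L2_norm2_integrable[OF L2_bounded_linear[OF T L2_diff[OF L]]] L2_norm2_integrable[OF L2_diff[OF L]] by auto
  show "(norm (T (F n x - f x)))^2 <= K^2 * (norm (F n x - f x))^2" for x
   by (metis K power_mono norm_ge_zero power_mult_distrib mult.commute)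
 qed
 have "(%n. K^2 * sqn M (%x. F n x - f x)) \<longlonglongrightarrow> K\<^sup>2 * 0"
  using f by (intro tendsto_intros) (auto simp: L2_tendsto_def)
 hence "(%n. K^2 * sqn M (%x. F n x - f x)) \<longlonglongrightarrow> 0" by simp
 note lim0 = this
 show "(%n. sqn M (%x. T (F n x) - T (f x))) \<longlonglongrightarrow> 0"
  by (rule tendsto_sandwich[OF _ _ tendsto_const lim0]) (auto intro!: always_eventually ip_self_nonneg le)
qed

context coef
begin

lemma elliptic_section: "elliptic W B c C"
proof (rule elliptic.intro)
 show "(%x. B x (g x)) \<in> borel_measurable (lebesgue_on W)" if [measurable]: "g \<in> borel_measurable (lebesgue_on W)" for g
 proof -
  have [measurable]: "(%x. x) \<in> borel_measurable (lebesgue_on W)" by (rule borel_measurable_lebesgue_on) simp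
  show ?thesis by measurable
 qed
qed (use W B_lin B_sym B_ell B_bd c_pos in auto)

definition baseB :: "'p => 'p => 'p" where "baseB \<xi> \<eta> = snd (B \<xi> (0, \<eta>))"

lemma elliptic_base: "elliptic_problem W baseB c C"
proof (intro elliptic_problem.intro elliptic.intro)
 show "linear (baseB \<xi>)" for \<xi>
  using linear_compose[of "%\<eta>. (0, \<eta>)" "snd \<circ> B \<xi>"] linear_compose[OF B_lin linear_snd, of \<xi>]
  by (auto simp: baseB_def[abs_def] o_def linear_iff)
 show "(%x. baseB x (g x)) \<in> borel_measurable (lebesgue_on W)" if [measurable]: "g \<in> borel_measurable (lebesgue_on W)" for g
 proof -
  have [measurable]: "(%x. x) \<in> borel_measurable (lebesgue_on W)" by (rule borel_measurable_lebesgue_on) simp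
  have "(%x. B x (0, g x)) \<in> borel_measurable (lebesgue_on W)" by measurable
  from measurable_compose[OF this, of snd borel] show ?thesis unfolding baseB_def
   by (simp add: bm_cont continuous_on_snd)
 qed
 show "baseB \<xi> y \<bullet> z = y \<bullet> baseB \<xi> z" for \<xi> y z using B_sym[of \<xi> "(0, y)" "(0, z)"] by (simp add: baseB_def inner_prod_def)
 show "c * (norm y)^2 <= baseB \<xi> y \<bullet> y" for \<xi> y using B_ell[of "(0, y)" \<xi>] by (simp add: baseB_def inner_prod_def norm_Pair)
 show "norm (baseB \<xi> y) <= C * norm y" for \<xi> y
  using B_bd[of \<xi> "(0, y)"] norm_snd_le[of "snd (B \<xi> (0, y))" "fst (B \<xi> (0, y))"] by (simp add: baseB_def norm_Pair)
qed (use W c_pos in auto)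

lemma product_trial:
 fixes \<nu> :: 'm and \<phi>0 \<phi> :: "'p => real"
 assumes \<nu>: "norm \<nu> = 1" and f: "C1c f f'" "f 0 = 1" and \<psi>: "C1c \<psi> \<psi>'" "\<psi> 0 = 1"
  and f\<psi>: "!!t. f' t * \<psi> t = 0" "!!t. f' t * \<psi>' t = 0" "!!t. f t * \<psi> t = \<psi> t" "!!t. f t * \<psi>' t = \<psi>' t"
  and \<phi>0: "C1c \<phi>0 k0" "supp \<phi>0 \<inter> frontier W = {}" and \<phi>: "C1c \<phi> k" "supp \<phi> \<inter> frontier W = {}"
 defines "a == elliptic.en W B" and "i == ip (lebesgue_on W)"
  and "V1 == %\<xi>. (\<phi>0 \<xi> *R \<nu>, 0)" and "V2 == %\<xi>. (0, k0 \<xi>)" and "V3 == %\<xi>. (\<phi> \<xi> *R \<nu>, 0)" and "V4 == %\<xi>. (0, k \<xi>)"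
 assumes neg: "half_int (%t. (f' t)^2) * a V1 V1 + a V1 V2 + half_int (%t. (f t)^2) * (a V2 V2 - \<mu> * i \<phi>0 \<phi>0)
   + 2 * s * (a V2 V3 + half_int \<psi> * (a V2 V4 - \<mu> * i \<phi>0 \<phi>))
   + s^2 * (half_int (%t. (\<psi>' t)^2) * a V3 V3 + 2 * half_int (%t. \<psi> t * \<psi>' t) * a V3 V4 + half_int (%t. (\<psi> t)^2) * (a V4 V4 - \<mu> * i \<phi> \<phi>)) < 0"
 shows "Zd \<nu> < \<mu>"
proof -
 interpret F: elliptic W B c C by (rule elliptic_section)
 let ?M = "lebesgue_on W"
 have Wb: "W \<in> sets borel" using W by simp
 note L0 = C1c_L2[OF \<phi>0(1) Wb] and L1 = C1c_L2[OF \<phi>(1) Wb]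
 have bl: "bounded_linear (%r::real. (r *R \<nu>, 0 :: 'p))" "bounded_linear (%y::'p. (0 :: 'm, y))"
  by (auto intro!: bounded_linear_Pair bounded_linear_scaleR_left bounded_linear_zero bounded_linear_ident)
 have L: "L2 ?M V1" "L2 ?M V2" "L2 ?M V3" "L2 ?M V4"
  unfolding V1_def V2_def V3_def V4_def by (intro L2_bounded_linear[OF bl(1)] L2_bounded_linear[OF bl(2)] L0 L1)+
 define u where "u x = f (fst x) * \<phi>0 (snd x) + s * (\<psi> (fst x) * \<phi> (snd x))" for x
 define g where "g x = (f' (fst x) * \<phi>0 (snd x), f (fst x) *R k0 (snd x)) + s *R (\<psi>' (fst x) * \<phi> (snd x), \<psi> (fst x) *R k (snd x))" for x
 have u: "C1c u g" unfolding u_def[abs_def] g_def[abs_def] by (intro C1c_add C1c_scale C1c_tensor f \<psi> \<phi>0 \<phi>)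
 have us: "supp u \<inter> closure ({..<0} \<times> frontier W) = {}"
 proof -
  have "supp u \<subseteq> UNIV \<times> (supp \<phi>0 \<union> supp \<phi>)"
  proof (rule supp_leI)
   show "closed (UNIV \<times> (supp \<phi>0 \<union> supp \<phi>) :: (real \<times> 'p) set)" by (intro closed_Times closed_UNIV closed_Un closed_supp)
   fix x assume "u x ~= 0"
   hence "\<phi>0 (snd x) ~= 0 \<or> \<phi> (snd x) ~= 0" by (auto simp: u_def)
   thus "x \<in> UNIV \<times> (supp \<phi>0 \<union> supp \<phi>)" using not_supp[of "snd x" \<phi>0] not_supp[of "snd x" \<phi>] by (cases x) auto
  qed
  thus ?thesis using \<phi>0(2) \<phi>(2) by (auto simp: closure_lateral)
 qed
 define X where "X t \<xi> = f' t *R V1 \<xi> + f t *R V2 \<xi>" for t \<xi>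
 define Y where "Y t \<xi> = \<psi>' t *R V3 \<xi> + \<psi> t *R V4 \<xi>" for t \<xi>
 have LX: "L2 ?M (X t)" "L2 ?M (Y t)" for t unfolding X_def[abs_def] Y_def[abs_def] by (intro L2_add L2_scaleR L)+
 define e where "e t = a (%\<xi>. 1 *R X t \<xi> + s *R Y t \<xi>) (%\<xi>. 1 *R X t \<xi> + s *R Y t \<xi>)" for t
 define n where "n t = i (%\<xi>. f t *R \<phi>0 \<xi> + (s * \<psi> t) *R \<phi> \<xi>) (%\<xi>. f t *R \<phi>0 \<xi> + (s * \<psi> t) *R \<phi> \<xi>)" for t
 have gX: "dir_embed \<nu> (g (t, \<xi>)) = 1 *R X t \<xi> + s *R Y t \<xi>" for t \<xi>
  by (simp add: dir_embed_def g_def X_def Y_def V1_def V2_def V3_def V4_def scaleR_add_left)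
 have e: "e t = (f' t)^2 * a V1 V1 + 2 * (f t * f' t) * a V1 V2 + (f t)^2 * a V2 V2 + 2 * s * (\<psi>' t * a V2 V3 + \<psi> t * a V2 V4)
   + s^2 * ((\<psi>' t)^2 * a V3 V3 + 2 * (\<psi> t * \<psi>' t) * a V3 V4 + (\<psi> t)^2 * a V4 V4)" for t
 proof -
  have 1: "e t = a (X t) (X t) + 2 * s * a (X t) (Y t) + s^2 * a (Y t) (Y t)"
   unfolding e_def a_def F.en_quadratic[OF LX] by simp
  have 2: "a (X t) (X t) = (f' t)^2 * a V1 V1 + 2 * f' t * f t * a V1 V2 + (f t)^2 * a V2 V2"
   "a (Y t) (Y t) = (\<psi>' t)^2 * a V3 V3 + 2 * \<psi>' t * \<psi> t * a V3 V4 + (\<psi> t)^2 * a V4 V4"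
   unfolding X_def[abs_def] Y_def[abs_def] a_def using L by (simp_all only: F.en_quadratic)
  have "a (X t) (Y t) = (f' t * \<psi>' t) * a V1 V3 + (f' t * \<psi> t) * a V1 V4 + (f t * \<psi>' t) * a V2 V3 + (f t * \<psi> t) * a V2 V4"
   using L LX unfolding X_def[abs_def] Y_def[abs_def] a_def
   by (simp add: F.en_lin_left F.en_lin_right L2_add L2_scaleR algebra_simps)
  hence 3: "a (X t) (Y t) = \<psi>' t * a V2 V3 + \<psi> t * a V2 V4" unfolding f\<psi> by simp
  show ?thesis unfolding 1 2 3 by (simp add: algebra_simps)
 qed
 have n: "n t = (f t)^2 * i \<phi>0 \<phi>0 + 2 * s * (\<psi> t * i \<phi>0 \<phi>) + s^2 * ((\<psi> t)^2 * i \<phi> \<phi>)" for t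
 proof -
  have "n t = (f t)^2 * i \<phi>0 \<phi>0 + 2 * f t * (s * \<psi> t) * i \<phi>0 \<phi> + (s * \<psi> t)^2 * i \<phi> \<phi>"
   unfolding n_def i_def by (rule F.ip_quadratic[OF L0(1) L1(1)])
  also have "2 * f t * (s * \<psi> t) * i \<phi>0 \<phi> = 2 * s * ((f t * \<psi> t) * i \<phi>0 \<phi>)" by simp
  finally show ?thesis unfolding f\<psi> by (simp add: power_mult_distrib)
 qed
 have e0: "e t >= 0" and n0: "n t >= 0" for t
  unfolding e_def n_def a_def i_def by (intro F.en_nonneg ip_self_nonneg L2_add L2_scaleR LX)+
 note fc = C1g_cont_fun[OF C1c_C1g[OF f(1)]] C1g_cont[OF C1c_C1g[OF f(1)]] C1g_cont_fun[OF C1c_C1g[OF \<psi>(1)]] C1g_cont[OF C1c_C1g[OF \<psi>(1)]]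
 let ?K = "supp f \<union> supp \<psi>"
 have K: "compact ?K" using f \<psi> by (simp add: C1c_def compact_Un)
 have out: "f t = 0" "f' t = 0" "\<psi> t = 0" "\<psi>' t = 0" if "t \<notin> ?K" for t
  using that not_supp C1g_zero_outside_supp[OF C1c_C1g[OF f(1)]] C1g_zero_outside_supp[OF C1c_C1g[OF \<psi>(1)]] by blast+
 note hi = half_int_integrable[OF _ K]
 have I: "integrable lborel (%t. indicator {..<0} t * e t)" "integrable lborel (%t. indicator {..<0} t * n t)"
  unfolding e n by (rule hi; (intro continuous_intros fc)?; simp add: out)+
 have Ed: "Ed \<nu> g = ennreal (half_int e)" and N: "N2 {..<0} u = ennreal (half_int n)"
 proof -
  have [measurable]: "u \<in> BM" "g \<in> BM" using C1c_borel[OF u] .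
  have m: "(%x. ennreal (Q (snd x) (dir_embed \<nu> (g x))) * indicator ({..<0} \<times> W) x) \<in> BM"
   "(%x. ennreal ((u x)^2) * indicator ({..<0} \<times> W) x) \<in> BM" using strip_borel by measurable
  have sec: "(NI \<xi>. ennreal (r \<xi>) * indicator W \<xi>) = ennreal (\<integral>\<xi>. r \<xi> \<partial>?M)"
   if "integrable ?M r" "!!\<xi>. r \<xi> >= 0" for r
  proof -
   have "(NI \<xi>. ennreal (r \<xi>) * indicator W \<xi>) = (\<integral>\<^sup>+\<xi>. ennreal (r \<xi>) \<partial>?M)"
    using Wb by (simp add: nn_integral_restrict_space nn_integral_completion)
   thus ?thesis using nn_integral_eq_integral[OF that(1)] that(2) by simp
  qed
  have fin: "(NI t. ennreal (r t) * indicator {..<0} t) = ennreal (half_int r)"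
   if "integrable lborel (%t. indicator {..<0} t * r t)" "!!t. r t >= 0" for r
  proof -
   have "(NI t. ennreal (r t) * indicator {..<0} t) = (NI t. ennreal (indicator {..<0} t * r t))"
    by (intro nn_integral_cong) (auto simp: indicator_def)
   thus ?thesis using nn_integral_eq_integral[OF that(1)] that(2) by (simp add: half_int_def)
  qed
  have "Ed \<nu> g = (NI t. (NI \<xi>. ennreal (Q \<xi> (dir_embed \<nu> (g (t, \<xi>)))) * indicator W \<xi>) * indicator {..<0} t)"
   unfolding Ed_def nn_integral_pair[OF m(1)]
  proof (rule nn_integral_cong)
   fix t show "(NI y. ennreal (Q (snd (t, y)) (dir_embed \<nu> (g (t, y)))) * indicator ({..<0} \<times> W) (t, y)) = (NI \<xi>. ennreal (Q \<xi> (dir_embed \<nu> (g (t, \<xi>)))) * indicator W \<xi>) * indicator {..<0} t"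
    by (cases "t < 0") (auto simp: indicator_def)
  qed
  also have "... = (NI t. ennreal (e t) * indicator {..<0} t)"
  proof (intro nn_integral_cong arg_cong[where f = "%x. x * _"])
   fix t
   have "integrable ?M (%\<xi>. Q \<xi> (dir_embed \<nu> (g (t, \<xi>))))"
    unfolding Q_def gX by (rule L2_inner[OF F.L2_A]; intro L2_add L2_scaleR LX)
   from sec[OF this Q_nonneg]
   show "(NI \<xi>. ennreal (Q \<xi> (dir_embed \<nu> (g (t, \<xi>)))) * indicator W \<xi>) = ennreal (e t)"
    unfolding e_def a_def F.en_def ip_def Q_def gX .
  qed
  also have "... = ennreal (half_int e)" by (rule fin[OF I(1) e0])
  finally show "Ed \<nu> g = ennreal (half_int e)" .
  have "N2 {..<0} u = (NI t. (NI \<xi>. ennreal ((u (t, \<xi>))^2) * indicator W \<xi>) * indicator {..<0} t)"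
   unfolding N2_def nn_integral_pair[OF m(2)]
  proof (rule nn_integral_cong)
   fix t show "(NI y. ennreal ((u (t, y))^2) * indicator ({..<0} \<times> W) (t, y)) = (NI \<xi>. ennreal ((u (t, \<xi>))^2) * indicator W \<xi>) * indicator {..<0} t"
    by (cases "t < 0") (auto simp: indicator_def)
  qed
  also have "... = (NI t. ennreal (n t) * indicator {..<0} t)"
  proof (intro nn_integral_cong arg_cong[where f = "%x. x * _"])
   fix t
   have uu: "u (t, \<xi>) = f t *R \<phi>0 \<xi> + (s * \<psi> t) *R \<phi> \<xi>" for \<xi> by (simp add: u_def)
   have "integrable ?M (%\<xi>. (u (t, \<xi>))^2)"
    using L2_norm2_integrable[OF L2_add[OF L2_scaleR[OF L0(1), of "f t"] L2_scaleR[OF L1(1), of "s * \<psi> t"]]] unfolding uu by simp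
   from sec[OF this zero_le_power2]
   show "(NI \<xi>. ennreal ((u (t, \<xi>))^2) * indicator W \<xi>) = ennreal (n t)"
    unfolding n_def i_def ip_self uu by simp
  qed
  also have "... = ennreal (half_int n)" by (rule fin[OF I(2) n0])
  finally show "N2 {..<0} u = ennreal (half_int n)" .
 qed
 have h0: "half_int e >= 0" "half_int n >= 0"
  unfolding half_int_def using e0 n0 by (auto intro!: integral_nonneg_AE)
 have "ennreal (Zd \<nu>) * N2 {..<0} u <= Ed \<nu> g" by (rule Zd_le[OF \<nu> u us])
 hence le: "Zd \<nu> * half_int n <= half_int e"
  unfolding Ed N using h0 Zd_nonneg[OF \<nu>] by (simp add: ennreal_mult[symmetric])
 have ff: "half_int (%t. 2 * (f t * f' t)) = 1" and p': "half_int \<psi>' = 1"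
  using half_int_derivative[OF C1c_mult[OF f(1) C1c_C1g[OF f(1)]]] half_int_derivative[OF \<psi>(1)] f(2) \<psi>(2) by (simp_all add: mult.assoc)
 have int: "integrable lborel (%t. indicator {..<0} t * (f' t)^2)" "integrable lborel (%t. indicator {..<0} t * (2 * (f t * f' t)))"
  "integrable lborel (%t. indicator {..<0} t * (f t)^2)" "integrable lborel (%t. indicator {..<0} t * \<psi>' t)"
  "integrable lborel (%t. indicator {..<0} t * \<psi> t)" "integrable lborel (%t. indicator {..<0} t * (\<psi>' t)^2)"
  "integrable lborel (%t. indicator {..<0} t * (\<psi> t * \<psi>' t))" "integrable lborel (%t. indicator {..<0} t * (\<psi> t)^2)"
  by (rule hi; (intro continuous_intros fc)?; simp add: out)+
 have "half_int e - \<mu> * half_int n = (LI t. indicator {..<0} t * e t - \<mu> * (indicator {..<0} t * n t))"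
  unfolding half_int_def using I by simp
 also have "... = (LI t. a V1 V1 * (indicator {..<0} t * (f' t)^2) + a V1 V2 * (indicator {..<0} t * (2 * (f t * f' t))) 
   + (a V2 V2 - \<mu> * i \<phi>0 \<phi>0) * (indicator {..<0} t * (f t)^2) + (2 * s * a V2 V3) * (indicator {..<0} t * \<psi>' t)
   + (2 * s * (a V2 V4 - \<mu> * i \<phi>0 \<phi>)) * (indicator {..<0} t * \<psi> t) + (s^2 * a V3 V3) * (indicator {..<0} t * (\<psi>' t)^2)
   + (s^2 * 2 * a V3 V4) * (indicator {..<0} t * (\<psi> t * \<psi>' t)) + (s^2 * (a V4 V4 - \<mu> * i \<phi> \<phi>)) * (indicator {..<0} t * (\<psi> t)^2))"
  by (rule Bochner_Integration.integral_cong) (auto simp: e n algebra_simps)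
 also have "... = a V1 V1 * half_int (%t. (f' t)^2) + a V1 V2 * half_int (%t. 2 * (f t * f' t)) 
   + (a V2 V2 - \<mu> * i \<phi>0 \<phi>0) * half_int (%t. (f t)^2) + (2 * s * a V2 V3) * half_int \<psi>'
   + (2 * s * (a V2 V4 - \<mu> * i \<phi>0 \<phi>)) * half_int \<psi> + (s^2 * a V3 V3) * half_int (%t. (\<psi>' t)^2)
   + (s^2 * 2 * a V3 V4) * half_int (%t. \<psi> t * \<psi>' t) + (s^2 * (a V4 V4 - \<mu> * i \<phi> \<phi>)) * half_int (%t. (\<psi> t)^2)"
  unfolding half_int_def using int by simp
 also have "... < 0" using neg unfolding ff p' by (simp add: algebra_simps)
 finally have "half_int e < \<mu> * half_int n" by simp
 with le have "Zd \<nu> * half_int n < \<mu> * half_int n" by linarith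
 thus ?thesis using h0(2) by (metis mult_less_cancel_right not_less)
qed

lemma plateau:
 fixes R :: real
 assumes R: "R >= 1"
 shows "EX f f' :: real => real. C1c f f' & (ALL t. \<bar>t\<bar> <= 1 --> f t = 1 & f' t = 0) & half_int (%t. (f' t)^2) <= 128 / R"
proof -
 define m where "m t = (1/R) *R (t - 1)" for t :: real
 define p where "p t = (1/R) *R (- 1 - t)" for t :: real
 define f where "f t = pos2 (1 - pos2 (m t) - pos2 (p t))" for t
 define f' where "f' t = (2 * max 0 (1 - pos2 (m t) - pos2 (p t))) *R ((0 - (2 * max 0 (m t)) *R (1/R)) - (2 * max 0 (p t)) *R (- 1/R))" for t
 have "C1g m (%t. 1/R)" "C1g p (%t. - 1/R)"
  unfolding C1g_def m_def[abs_def] p_def[abs_def] using R by (auto intro!: derivative_eq_intros)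
 from C1g_pos2[OF C1g_diff[OF C1g_diff[OF C1g_const C1g_pos2[OF this(1)]] C1g_pos2[OF this(2)]], of 1]
 have g: "C1g f f'" unfolding f_def[abs_def] f'_def[abs_def] .
 have out: "f t = 0 & f' t = 0" if "t \<notin> {- (1 + R)..1 + R}" for t
 proof -
  have "max 0 (m t) >= 1 \<or> max 0 (p t) >= 1" using that R by (auto simp: m_def p_def field_simps)
  hence "1 - pos2 (m t) - pos2 (p t) <= 0" using pos2_nonneg[of "m t"] pos2_nonneg[of "p t"] unfolding pos2_def
   by (smt (verit) one_le_power)
  thus ?thesis by (simp add: f_def f'_def pos2_def)
 qed
 have c: "C1c f f'" unfolding C1c_def using g out by (intro conjI compact_suppI[of "{- (1 + R)..1 + R}"]) auto
 have one: "f t = 1 & f' t = 0" if "\<bar>t\<bar> <= 1" for t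
 proof -
  have "m t <= 0" "p t <= 0" using that R by (auto simp: m_def p_def divide_nonpos_pos)
  thus ?thesis by (simp add: f_def f'_def pos2_def)
 qed
 have b: "(f' t)^2 <= (8 / R)^2" for t
 proof (cases "t \<in> {- (1 + R)..1 + R}")
  case True
  have "max 0 (m t) <= 1" "max 0 (p t) <= 1" using True R by (auto simp: m_def p_def field_simps)
  hence "\<bar>0 - (2 * max 0 (m t)) *R (1/R) - (2 * max 0 (p t)) *R (- 1/R)\<bar> <= 4 * (1/R)"
   using R by (simp add: field_simps abs_le_iff) (auto simp: max_def)
  moreover have "\<bar>2 * max 0 (1 - pos2 (m t) - pos2 (p t))\<bar> <= 2" using pos2_nonneg[of "m t"] pos2_nonneg[of "p t"] by auto
  ultimately have "\<bar>f' t\<bar> <= 2 * (4 * (1/R))" unfolding f'_def real_scaleR_def abs_mult by (intro mult_mono) auto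
  hence "\<bar>f' t\<bar> <= \<bar>8 / R\<bar>" using R by simp
  thus ?thesis by (rule abs_le_square_iff[THEN iffD1])
 qed (use out in simp)
 have "half_int (%t. (f' t)^2) <= (LI t. indicator {- (1 + R)..0} t * (8 / R)^2)"
  unfolding half_int_def
 proof (rule integral_mono)
  show "integrable lborel (%t. indicator {..<0} t * (f' t)^2)"
   by (rule half_int_integrable[of _ "{- (1 + R)..1 + R}"]) (use C1g_cont[OF g] out in \<open>auto intro!: continuous_intros\<close>)
  show "indicator {..<0} t * (f' t)^2 <= indicator {- (1 + R)..0} t * (8 / R)^2" for t
   using b[of t] out[of t] R by (auto simp: indicator_def)
 qed (intro integrable_mult_left integrable_real_indicator; simp add: emeasure_lborel_Icc_eq)
 also have "... = (1 + R) * (8 / R)^2" using R by simp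
 also have "... <= (2 * R) * (8 / R)^2" using R by (intro mult_right_mono) auto
 also have "... = 128 / R" using R by (simp add: power2_eq_square)
 finally show ?thesis using c one by blast
qed

lemma strict_gap:
 assumes w: "weak_eigenfunction W (frontier W) baseB \<mu> w"
  and nz: "~(AE \<xi> in lebesgue_on W. fst (B \<xi> (0, weak_gradient W w \<xi>)) = 0)"
 shows "EX \<nu>. norm \<nu> = 1 & Zd \<nu> < \<mu>"
proof -
 interpret F: elliptic W B c C by (rule elliptic_section)
 interpret G: elliptic_problem W "frontier W" baseB c C by (rule elliptic_base)
 let ?M = "lebesgue_on W"
 define gw where "gw = weak_gradient W w"
 have aw: "adm W (frontier W) w gw" unfolding gw_def by (rule adm_weak_gradient) (use w in \<open>simp add: weak_eigenfunction_def\<close>)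
 note Lw = adm_L2[OF aw]
 have bl: "bounded_linear (%r::real. (r *R \<nu>, 0 :: 'p))" "bounded_linear (%y::'p. (0 :: 'm, y))" for \<nu> :: 'm
  by (auto intro!: bounded_linear_Pair bounded_linear_scaleR_left bounded_linear_zero bounded_linear_ident)
 define h where "h \<xi> = fst (B \<xi> (0, gw \<xi>))" for \<xi>
 have Lh: "L2 ?M (%\<xi>. h \<xi> \<bullet> b)" for b
  unfolding h_def by (rule L2_bounded_linear[OF bounded_linear_inner_left_comp[OF bounded_linear_fst] F.L2_A[OF L2_bounded_linear[OF bl(2) Lw(2)]]])
 have "EX b:Basis. ~(AE \<xi> in ?M. h \<xi> \<bullet> b = 0)"
 proof (rule ccontr)
  assume "~?thesis"
  hence "AE \<xi> in ?M. ALL b:Basis. h \<xi> \<bullet> b = 0" by (intro AE_finite_allI) auto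
  hence "AE \<xi> in ?M. h \<xi> = 0" by eventually_elim (auto intro: euclidean_eqI)
  thus False using nz unfolding h_def gw_def by blast
 qed
 then obtain b where b: "b \<in> Basis" "~(AE \<xi> in ?M. h \<xi> \<bullet> b = 0)" by blast
 obtain \<phi> where \<phi>: "\<phi> \<in> test_functions" "supp \<phi> \<subseteq> W" "(\<integral>\<xi>. (h \<xi> \<bullet> b) * \<phi> \<xi> \<partial>?M) ~= 0"
  using zero_if_orthogonal_test_functions[OF W(1) Lh, of b] b(2) by blast
 obtain k where k: "C1c \<phi> k" using test_function_gradient[OF \<phi>(1)] by blast
 have ks: "supp \<phi> \<inter> frontier W = {}" using \<phi>(2) W(1) by (auto simp: frontier_def interior_open)
 have ak: "adm W (frontier W) \<phi> k" by (rule C1c_adm[OF k W(1)]) (use ks in simp)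
 note Lk = adm_L2[OF ak]
 define \<nu> where "\<nu> = (if ip ?M w (%\<xi>. h \<xi> \<bullet> b) <= 0 then b else - b)"
 have \<nu>1: "norm \<nu> = 1" using b(1) by (simp add: \<nu>_def)
 have n1: "ip ?M w (%\<xi>. h \<xi> \<bullet> \<nu>) <= 0" by (auto simp: \<nu>_def ip_def)
 define X where "X = ip ?M (%\<xi>. h \<xi> \<bullet> \<nu>) \<phi>"
 have X: "X ~= 0" using \<phi>(3) by (auto simp: X_def \<nu>_def ip_def)
 let ?V = "%\<phi> \<xi>. (\<phi> \<xi> *R \<nu>, 0 :: 'p)" and ?U = "%g \<xi>. (0 :: 'm, g \<xi> :: 'p)"
 obtain u v where u: "!!n. C1c (u n) (v n)" "!!n. supp (u n) \<inter> closure (frontier W) = {}" "L2_tendsto ?M u w" "L2_tendsto ?M v gw"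
  by (rule adm_C1c_sequence[OF W(1) aw]) (rule that)
 note tV = L2_tendsto_bounded_linear[OF bl(1) u(3), of \<nu>] and tU = L2_tendsto_bounded_linear[OF bl(2) u(4)]
 have LV: "L2 ?M (?V \<phi>)" "L2 ?M (?U k)" by (intro L2_bounded_linear[OF bl(1)] L2_bounded_linear[OF bl(2)] Lk)+
 have base: "F.en (?U g) (?U g') = G.en g g'" for g g' by (simp add: F.en_def G.en_def ip_def baseB_def inner_prod_def)
 have eig: "F.en (?U gw) (?U g') = \<mu> * ip ?M w z" if "adm W (frontier W) z g'" for z g'
 proof -
  have "energy W baseB w z = G.en gw g'" using aw that by (intro G.energy_eq) (auto simp: adm_def)
  thus ?thesis using w that unfolding base by (simp add: weak_eigenfunction_def adm_def ip_def)
 qed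
 have e12: "F.en (?V w) (?U gw) = ip ?M w (%\<xi>. h \<xi> \<bullet> \<nu>)"
  unfolding F.en_sym[of "?V w"] by (simp add: F.en_def ip_def h_def inner_prod_def)
 have e23: "F.en (?U gw) (?V \<phi>) = X" by (simp add: F.en_def X_def ip_def h_def inner_prod_def mult.commute)
 define \<psi> :: "real => real" where "\<psi> = unit_bump"
 define \<psi>' :: "real => real" where "\<psi>' = unit_bump'"
 have \<psi>: "C1c \<psi> \<psi>'" "\<psi> 0 = 1" unfolding \<psi>_def \<psi>'_def by (simp_all add: unit_bump_C1c unit_bump_def pos2_def)
 have \<psi>0: "\<psi> t = 0 & \<psi>' t = 0" if "\<bar>t\<bar> > 1" for t
  using that abs_square_less_1[of t] by (auto simp: \<psi>_def \<psi>'_def unit_bump_def unit_bump'_def pos2_def max_def power2_eq_square)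
 define K where "K = half_int (%t. (\<psi>' t)^2) * F.en (?V \<phi>) (?V \<phi>) + 2 * half_int (%t. \<psi> t * \<psi>' t) * F.en (?V \<phi>) (?U k) + half_int (%t. (\<psi> t)^2) * (F.en (?U k) (?U k) - \<mu> * sqn ?M \<phi>)"
 define s where "s = - X / (\<bar>K\<bar> + 1)"
 have s: "2 * s * X + s^2 * K < 0"
 proof -
  have sX: "X = - s * (\<bar>K\<bar> + 1)" by (simp add: s_def add_nonneg_eq_0_iff)
  have "s^2 * K <= s^2 * (\<bar>K\<bar> + 1)" by (intro mult_left_mono) auto
  also have "... < 2 * (s^2 * (\<bar>K\<bar> + 1))"
  proof -
   have "s ~= 0" using X sX by auto
   thus ?thesis by (simp add: add_nonneg_pos)
  qed
  also have "... = - (2 * s * X)" unfolding sX by (simp add: power2_eq_square algebra_simps)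
  finally show ?thesis by simp
 qed
 define d where "d = - (2 * s * X + s^2 * K)"
 have d: "d > 0" using s by (simp add: d_def)
 define A0 where "A0 = F.en (?V w) (?V w)"
 have A0: "A0 >= 0" unfolding A0_def by (intro F.en_nonneg L2_bounded_linear[OF bl(1)] Lw)
 define R where "R = 1 + 128 * A0 / d"
 have R: "R >= 1" "128 / R * A0 < d" using A0 d by (auto simp: R_def field_simps)
 obtain f f' where f: "C1c f f'" "!!t. \<bar>t\<bar> <= 1 ==> f t = 1 & f' t = 0" "half_int (%t. (f' t)^2) <= 128 / R"
  using plateau[OF R(1)] by (elim exE conjE) blast
 have f\<psi>: "f' t * \<psi> t = 0" "f' t * \<psi>' t = 0" "f t * \<psi> t = \<psi> t" "f t * \<psi>' t = \<psi>' t" for t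
  using f(2)[of t] \<psi>0[of t] by (cases "\<bar>t\<bar> <= 1"; simp)+
 let ?J = "half_int (%t. (f' t)^2)" and ?J2 = "half_int (%t. (f t)^2)"
 have "(%n. ?J * F.en (?V (u n)) (?V (u n)) + F.en (?V (u n)) (?U (v n)) + ?J2 * (F.en (?U (v n)) (?U (v n)) - \<mu> * sqn ?M (u n))
   + 2 * s * (F.en (?U (v n)) (?V \<phi>) + half_int \<psi> * (F.en (?U (v n)) (?U k) - \<mu> * ip ?M (u n) \<phi>)) + s^2 * K)
  \<longlonglongrightarrow> ?J * A0 + F.en (?V w) (?U gw) + ?J2 * (F.en (?U gw) (?U gw) - \<mu> * sqn ?M w)
   + 2 * s * (F.en (?U gw) (?V \<phi>) + half_int \<psi> * (F.en (?U gw) (?U k) - \<mu> * ip ?M w \<phi>)) + s^2 * K"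
  unfolding A0_def
  by (intro tendsto_intros F.en_tendsto[OF tV] F.en_tendsto[OF tU] L2_tendsto_ip[OF u(3) u(3)] L2_tendsto_ip_right[OF u(3) Lk(1)]
    L2_tendsto_ip[OF F.L2_tendsto_A[OF tV] tU, folded F.en_def] L2_tendsto_ip_right[OF F.L2_tendsto_A[OF tU] LV(1), folded F.en_def]
    L2_tendsto_ip_right[OF F.L2_tendsto_A[OF tU] LV(2), folded F.en_def])
 moreover have "?J * A0 + F.en (?V w) (?U gw) + ?J2 * (F.en (?U gw) (?U gw) - \<mu> * sqn ?M w)
   + 2 * s * (F.en (?U gw) (?V \<phi>) + half_int \<psi> * (F.en (?U gw) (?U k) - \<mu> * ip ?M w \<phi>)) + s^2 * K < 0"
 proof -
  have "?J * A0 < d" using mult_right_mono[OF f(3) A0] R(2) by linarith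
  thus ?thesis using n1 unfolding eig[OF aw] eig[OF ak] e12 e23 d_def by simp
 qed
 ultimately have "\<forall>\<^sub>F n in sequentially. ?J * F.en (?V (u n)) (?V (u n)) + F.en (?V (u n)) (?U (v n)) + ?J2 * (F.en (?U (v n)) (?U (v n)) - \<mu> * sqn ?M (u n))
   + 2 * s * (F.en (?U (v n)) (?V \<phi>) + half_int \<psi> * (F.en (?U (v n)) (?U k) - \<mu> * ip ?M (u n) \<phi>)) + s^2 * K < 0"
  by (rule order_tendstoD(2))
 then obtain n where n: "?J * F.en (?V (u n)) (?V (u n)) + F.en (?V (u n)) (?U (v n)) + ?J2 * (F.en (?U (v n)) (?U (v n)) - \<mu> * sqn ?M (u n))
   + 2 * s * (F.en (?U (v n)) (?V \<phi>) + half_int \<psi> * (F.en (?U (v n)) (?U k) - \<mu> * ip ?M (u n) \<phi>)) + s^2 * K < 0"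
  using eventually_happens'[OF sequentially_bot] by blast
 have "supp (u n) \<inter> frontier W = {}" using u(2)[of n] by simp
 from product_trial[OF \<nu>1 f(1) _ \<psi> f\<psi> u(1) this k ks n[unfolded K_def]] f(2)[of 0] \<nu>1 show ?thesis by auto
qed

end

section \<open>Borel coefficients\<close>

lemma AE_lebesgue_on_negligible:
 assumes "AE x in lebesgue_on Om. P x" "Om \<in> sets lebesgue"
 shows "EX N. negligible N & (ALL x:Om - N. P x)"
proof -
 have "AE x in lebesgue. x \<in> Om --> P x" using assms by (simp add: AE_restrict_space_iff)
 then obtain N where "N \<in> null_sets lebesgue" "{x \<in> space lebesgue. ~(x \<in> Om --> P x)} \<subseteq> N"
  unfolding eventually_ae_filter by blast
 thus ?thesis by (intro exI[of _ N]) (auto simp: negligible_iff_null_sets)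
qed

lemma lebesgue_on_borel_version:
 fixes f :: "'a::euclidean_space => 'b::euclidean_space"
 assumes "f \<in> borel_measurable (lebesgue_on Om)" "Om \<in> sets lebesgue"
 shows "EX f' N. f' \<in> BM & negligible N & (ALL x:Om - N. f x = f' x)"
proof -
 have "f measurable_on Om" using assms by (simp add: measurable_on_iff_borel_measurable)
 then obtain N F where N: "negligible N" "!!n. contU (F n)" "!!x. x \<notin> N ==> (%n. F n x) \<longlonglongrightarrow> (if x \<in> Om then f x else 0)"
  unfolding measurable_on_def by blast
 have "(%x. lim (%n. F n x)) \<in> BM"
  by (intro borel_measurable_lim_metric bm_cont N)
 moreover have "f x = lim (%n. F n x)" if "x \<in> Om - N" for x using limI[OF N(3), of x] that by simp
 ultimately show ?thesis using N(1) by blast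
qed

lemma energy_cong:
 assumes el: "elliptic Om A' c C" and N: "negligible N" and eq: "!!x. x \<in> Om - N ==> A x = A' x" and uv: "u \<in> H1 Om" "v \<in> H1 Om"
 shows "energy Om A u v = energy Om A' u v"
proof -
 interpret elliptic Om A' c C by (rule el)
 let ?g = "weak_gradient Om u" and ?h = "weak_gradient Om v"
 have Om: "Om \<in> sets lebesgue" using borel_Om by simp
 have L: "L2 M ?g" "L2 M ?h" using has_weak_gradient_L2(2)[OF H1_weak_gradient] uv by auto
 have m: "(%x. A' x (?g x) \<bullet> ?h x) \<in> borel_measurable M"
  using L2_measurable[OF L2_A[OF L(1)]] L2_measurable[OF L(2)] by measurable
 hence "(%x. A' x (?g x) \<bullet> ?h x) measurable_on Om" by (simp add: measurable_on_iff_borel_measurable[OF Om])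
 from measurable_on_spike[OF this N, of "%x. A x (?g x) \<bullet> ?h x"] eq
 have m': "(%x. A x (?g x) \<bullet> ?h x) \<in> borel_measurable M" by (simp add: measurable_on_iff_borel_measurable[OF Om])
 have "AE x in lebesgue. x \<notin> N" using N by (auto simp: negligible_iff_null_sets intro: AE_not_in)
 hence "AE x in M. A x (?g x) \<bullet> ?h x = A' x (?g x) \<bullet> ?h x"
  using Om by (subst AE_restrict_space_iff) (auto elim!: eventually_mono simp: eq)
 thus ?thesis unfolding energy_def by (rule integral_cong_AE[OF m' m])
qed

lemma spectrum_cong:
 assumes "elliptic Om A' c C" "negligible N" "!!x. x \<in> Om - N ==> A x = A' x"
 shows "weak_eigenfunction Om ga A = weak_eigenfunction Om ga A'" "kth_eigenvalue Om ga A = kth_eigenvalue Om ga A'"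
  "rayleigh_inf Om ga A = rayleigh_inf Om ga A'"
proof -
 have e: "energy Om A u v = energy Om A' u v" if "u \<in> H1_vanishing Om ga" "v \<in> H1_vanishing Om ga" for u v
  by (rule energy_cong[OF assms]) (use that in \<open>auto simp: H1_vanishing_def\<close>)
 show w: "weak_eigenfunction Om ga A = weak_eigenfunction Om ga A'"
  unfolding weak_eigenfunction_def[abs_def] using e by (intro ext) auto
 show "kth_eigenvalue Om ga A = kth_eigenvalue Om ga A'" unfolding kth_eigenvalue_def[abs_def] w ..
 have "{energy Om A u u / (LINT x|lebesgue_on Om. (u x)^2) |u. u \<in> H1_vanishing Om ga & ~(AE x in lebesgue_on Om. u x = 0)}
  = {energy Om A' u u / (LINT x|lebesgue_on Om. (u x)^2) |u. u \<in> H1_vanishing Om ga & ~(AE x in lebesgue_on Om. u x = 0)}"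
  by (intro Collect_cong ex_cong) (metis e)
 thus "rayleigh_inf Om ga A = rayleigh_inf Om ga A'" unfolding rayleigh_inf_def by simp
qed

lemma linear_block_map: "linear (block_map A11 A12 A22)"
 by (rule linearI) (auto simp: block_map_def split_beta matrix_vector_right_distrib matrix_vector_mult_scaleR vector_matrix_left_distrib
   scaleR_vector_matrix_assoc[symmetric] scaleR_add_right)

lemma block_map_sym:
 assumes "transpose A11 = A11" "transpose A22 = A22"
 shows "block_map A11 A12 A22 x \<bullet> y = x \<bullet> block_map A11 A12 A22 y"
proof -
 have s: "(A *v a) \<bullet> b = a \<bullet> (A *v b)" if "transpose A = A" for A :: "real^'n^'n" and a b
  using dot_lmul_matrix[of a A b] transpose_matrix_vector[of A a] that by simp
 show ?thesis
  by (simp add: block_map_def split_beta inner_prod_def inner_add_left inner_add_right s[OF assms(1)] s[OF assms(2)]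
    dot_lmul_matrix inner_commute[of _ "_ v* _"] inner_commute[of "A12 *v _"])
qed

lemma block_map_measurable:
 fixes A11 :: "'a::topological_space => real^'m^'m" and A12 :: "'a => real^'p^'m"
 assumes [measurable]: "A11 \<in> BM" "A12 \<in> BM" "A22 \<in> BM"
 shows "(%p. block_map (A11 (fst p)) (A12 (fst p)) (A22 (fst p)) (snd p)) \<in> borel_measurable (borel \<Otimes>\<^sub>M borel)"
proof -
 have "contU (%q::(((real^'m^'m) \<times> (real^'p^'m)) \<times> (real^'p^'p)) \<times> ((real^'m) \<times> (real^'p)). 
   block_map (fst (fst (fst q))) (snd (fst (fst q))) (snd (fst q)) (snd q))"
  unfolding block_map_def split_beta matrix_vector_mult_def transpose_def by (intro continuous_intros)
 note c = bm_cont[OF this]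
 have "(%p :: 'a \<times> ((real^'m) \<times> (real^'p)). (((A11 (fst p), A12 (fst p)), A22 (fst p)), snd p)) \<in> borel_measurable (borel \<Otimes>\<^sub>M borel)"
  by (intro borel_measurable_Pair measurable_compose[OF measurable_fst] measurable_snd assms)
 from measurable_compose[OF this c] show ?thesis by simp
qed

lemma negligible_UNIV_times:
 fixes N :: "'p::euclidean_space set"
 assumes "N \<in> null_sets lborel" shows "negligible (UNIV \<times> N :: ('m::euclidean_space \<times> 'p) set)"
proof -
 have "emeasure (lborel \<Otimes>\<^sub>M lborel) (UNIV \<times> N :: ('m \<times> 'p) set) = 0"
  using assms by (subst lborel.emeasure_pair_measure_Times) auto
 moreover have "(UNIV \<times> N :: ('m \<times> 'p) set) \<in> sets (lborel \<Otimes>\<^sub>M lborel)" using assms by (intro pair_measureI) auto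
 ultimately have "(UNIV \<times> N :: ('m \<times> 'p) set) \<in> null_sets lborel" unfolding lborel_prod by auto
 thus ?thesis by (simp add: negligible_iff_null_sets null_sets_completionI)
qed

theorem theorem5:
  fixes \<omega>1 :: "(real^'m) set" and \<omega>2 :: "(real^'p) set"
    and A11 :: "real^'p \<Rightarrow> real^'m^'m"
    and A12 :: "real^'p \<Rightarrow> real^'p^'m"
    and A22 :: "real^'p \<Rightarrow> real^'p^'p"
    and cA CA :: real
  assumes "CARD('m) \<ge> 2"
    and "bounded_C1_domain \<omega>1" and "0 \<in> \<omega>1"
    and "bounded_C1_domain \<omega>2"
    and "A11 \<in> borel_measurable (lebesgue_on \<omega>2)"
    and "A12 \<in> borel_measurable (lebesgue_on \<omega>2)"
    and "A22 \<in> borel_measurable (lebesgue_on \<omega>2)"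
    and "\<And>\<xi>. \<xi> \<in> \<omega>2 \<Longrightarrow> transpose (A11 \<xi>) = A11 \<xi>"
    and "\<And>\<xi>. \<xi> \<in> \<omega>2 \<Longrightarrow> transpose (A22 \<xi>) = A22 \<xi>"
    and "cA > 0" and "CA > 0"
    and "AE \<xi> in lebesgue_on \<omega>2. \<forall>y. block_map (A11 \<xi>) (A12 \<xi>) (A22 \<xi>) y \<bullet> y \<ge> cA * (norm y)\<^sup>2"
    and "AE \<xi> in lebesgue_on \<omega>2. onorm (block_map (A11 \<xi>) (A12 \<xi>) (A22 \<xi>)) \<le> CA"
  shows "(\<forall>k>1. ((\<lambda>l. lambda_cyl \<omega>1 \<omega>2 A11 A12 A22 l k) \<longlongrightarrow>
                   (INF \<nu>\<in>sphere 0 1. Z_dir \<omega>2 A11 A12 A22 \<nu>)) at_top) \<and>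
         (\<forall>W. first_eigenfunction \<omega>2 A22 W \<longrightarrow>
              \<not> (AE \<xi> in lebesgue_on \<omega>2. A12 \<xi> *v weak_gradient \<omega>2 W \<xi> = 0) \<longrightarrow>
              (INF \<nu>\<in>sphere 0 1. Z_dir \<omega>2 A11 A12 A22 \<nu>) < mu1 \<omega>2 A22)"
proof -
 have o2: "open \<omega>2" "bounded \<omega>2" "\<omega>2 ~= {}" using assms(4) by (auto simp: bounded_C1_domain_def)
 have l2: "\<omega>2 \<in> sets lebesgue" using o2 by simp
 obtain B11 N1 where B11: "B11 \<in> BM" "negligible N1" "!!\<xi>. \<xi> \<in> \<omega>2 - N1 ==> A11 \<xi> = B11 \<xi>"
  using lebesgue_on_borel_version[OF assms(5) l2] by blast
 obtain B12 N2 where B12: "B12 \<in> BM" "negligible N2" "!!\<xi>. \<xi> \<in> \<omega>2 - N2 ==> A12 \<xi> = B12 \<xi>"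
  using lebesgue_on_borel_version[OF assms(6) l2] by blast
 obtain B22 N3 where B22: "B22 \<in> BM" "negligible N3" "!!\<xi>. \<xi> \<in> \<omega>2 - N3 ==> A22 \<xi> = B22 \<xi>"
  using lebesgue_on_borel_version[OF assms(7) l2] by blast
 obtain N4 where N4: "negligible N4" "!!\<xi> y. \<xi> \<in> \<omega>2 - N4 ==> cA * (norm y)^2 <= block_map (A11 \<xi>) (A12 \<xi>) (A22 \<xi>) y \<bullet> y"
  using AE_lebesgue_on_negligible[OF assms(12) l2] by blast
 obtain N5 where N5: "negligible N5" "!!\<xi>. \<xi> \<in> \<omega>2 - N5 ==> onorm (block_map (A11 \<xi>) (A12 \<xi>) (A22 \<xi>)) <= CA"
  using AE_lebesgue_on_negligible[OF assms(13) l2] by blast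
 have "negligible (N1 \<union> N2 \<union> N3 \<union> N4 \<union> N5)" using B11 B12 B22 N4 N5 by (intro negligible_Un)
 then obtain N where N: "N \<in> null_sets lborel" "N1 \<union> N2 \<union> N3 \<union> N4 \<union> N5 \<subseteq> N"
  unfolding negligible_iff_null_sets null_sets_completion_iff2 by blast
 define G where "G = \<omega>2 - N"
 have G [measurable]: "G \<in> sets borel" using N(1) o2(1) by (auto simp: G_def)
 define B where "B \<xi> y = (if \<xi> \<in> G then block_map (B11 \<xi>) (B12 \<xi>) (B22 \<xi>) y else cA *R y)" for \<xi> y
 have AB: "block_map (A11 \<xi>) (A12 \<xi>) (A22 \<xi>) = B \<xi>" if "\<xi> \<in> G" for \<xi>
 proof
  fix y
  have "\<xi> \<in> \<omega>2 - N1" "\<xi> \<in> \<omega>2 - N2" "\<xi> \<in> \<omega>2 - N3" using that N(2) by (auto simp: G_def)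
  from B11(3)[OF this(1)] B12(3)[OF this(2)] B22(3)[OF this(3)] that
  show "block_map (A11 \<xi>) (A12 \<xi>) (A22 \<xi>) y = B \<xi> y" by (simp add: B_def)
 qed
 have inN: "\<xi> \<in> \<omega>2 - N4" "\<xi> \<in> \<omega>2 - N5" if "\<xi> \<in> G" for \<xi> using that N(2) by (auto simp: G_def)
 have ub: "norm (B \<xi> y) <= CA * norm y" if "\<xi> \<in> G" for \<xi> y
 proof -
  have "bounded_linear (B \<xi>)" using linear_block_map AB[OF that] by (metis linear_conv_bounded_linear)
  hence "norm (B \<xi> y) <= onorm (B \<xi>) * norm y" by (rule onorm)
  also have "onorm (B \<xi>) <= CA" using N5(2)[OF inN(2)[OF that]] AB[OF that] by simp
  finally show ?thesis by (simp add: mult_right_mono)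
 qed
 have lb: "cA * (norm y)^2 <= B \<xi> y \<bullet> y" if "\<xi> \<in> G" for \<xi> y
  using N4(2)[OF inN(1)[OF that]] AB[OF that] by simp
 have "cA <= CA"
 proof -
  have "~negligible \<omega>2" by (rule open_not_negligible) (use o2 in auto)
  moreover have "negligible N" using N(1) by (simp add: negligible_iff_null_sets null_sets_completionI)
  ultimately obtain \<xi> where \<xi>: "\<xi> \<in> G" unfolding G_def using negligible_subset by blast
  obtain b :: "(real^'m) \<times> (real^'p)" where "b \<in> Basis" using nonempty_Basis by blast
  hence b: "norm b = 1" by simp
  have "cA <= B \<xi> b \<bullet> b" using lb[OF \<xi>, of b] b by simp
  also have "... <= norm (B \<xi> b) * norm b" by (rule norm_cauchy_schwarz)
  also have "... <= CA" using ub[OF \<xi>, of b] b by simp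
  finally show ?thesis .
 qed
 interpret coef B cA CA \<omega>2
 proof (rule coef.intro)
  show "linear (B \<xi>)" for \<xi>
  proof (cases "\<xi> \<in> G")
   case True
   thus ?thesis using linear_block_map AB by metis
  next
   case False
   hence "B \<xi> = (%y. cA *R y)" by (auto simp: B_def)
   thus ?thesis by (simp add: linear_iff algebra_simps)
  qed
  show "B \<xi> x \<bullet> y = x \<bullet> B \<xi> y" for \<xi> x y
  proof (cases "\<xi> \<in> G")
   case True
   hence "\<xi> \<in> \<omega>2" by (simp add: G_def)
   from block_map_sym[OF assms(8)[OF this] assms(9)[OF this], of "A12 \<xi>"] show ?thesis unfolding AB[OF True] .
  qed (simp add: B_def)
  show "cA * (norm y)^2 <= B \<xi> y \<bullet> y" for \<xi> y
   using lb[of \<xi> y] by (cases "\<xi> \<in> G") (auto simp: B_def dot_square_norm)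
  show "norm (B \<xi> y) <= CA * norm y" for \<xi> y
   using ub[of \<xi> y] \<open>cA <= CA\<close> assms(10) by (cases "\<xi> \<in> G") (auto simp: B_def mult_right_mono)
  show "(%p. B (fst p) (snd p)) \<in> borel_measurable (borel \<Otimes>\<^sub>M borel)"
   unfolding B_def by (intro measurable_If[OF block_map_measurable[OF B11(1) B12(1) B22(1)]]) measurable
 qed (use assms(10) o2 in auto)
 have cyl: "kth_eigenvalue (D \<times> \<omega>2) (D \<times> frontier \<omega>2) (%(X, \<xi>). block_map (A11 \<xi>) (A12 \<xi>) (A22 \<xi>)) = kth_eigenvalue (D \<times> \<omega>2) (D \<times> frontier \<omega>2) cylB"
  if "open D" for D
  by (rule spectrum_cong(2)[OF elliptic_problem.axioms[OF elliptic_cyl[OF that]] negligible_UNIV_times[OF N(1)]])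
   (auto simp: cylB_def AB G_def)
 have dir: "Z_dir \<omega>2 A11 A12 A22 \<nu> = Zd \<nu>" if "norm \<nu> = 1" for \<nu>
  unfolding Z_dir_def Zd_def
 proof (rule spectrum_cong(3)[OF elliptic_problem.axioms[OF elliptic_dir[OF that]] negligible_UNIV_times[OF N(1)]])
  fix x assume "x \<in> ({..<0::real} \<times> \<omega>2) - UNIV \<times> N"
  hence x: "snd x \<in> G" by (auto simp: G_def)
  show "(case x of (x, \<xi>) => directional_map \<nu> (A11 \<xi>) (A12 \<xi>) (A22 \<xi>)) = dirB \<nu> x"
  proof
   fix y :: "real \<times> (real^'p)"
   let ?M = "A12 (snd x)"
   have "(?M *v snd y) \<bullet> \<nu> = (\<nu> v* ?M) \<bullet> snd y" by (simp only: dot_lmul_matrix inner_commute[of "?M *v snd y" \<nu>])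
   moreover have "(fst y *R \<nu>) v* ?M = fst y *R (\<nu> v* ?M)" by (rule scaleR_vector_matrix_assoc)
   ultimately show "(case x of (x, \<xi>) => directional_map \<nu> (A11 \<xi>) (A12 \<xi>) (A22 \<xi>)) y = dirB \<nu> x y"
    unfolding dirB_def AB[OF x, symmetric] dir_embed_def block_map_def directional_map_def split_beta
    by (simp add: inner_add_left matrix_vector_mult_scaleR mult.commute)
  qed
 qed
 have base: "weak_eigenfunction \<omega>2 (frontier \<omega>2) (%\<xi> \<eta>. A22 \<xi> *v \<eta>) = weak_eigenfunction \<omega>2 (frontier \<omega>2) baseB"
 proof (rule spectrum_cong(1)[OF elliptic_problem.axioms[OF elliptic_base]])
  show "negligible N" using N(1) by (simp add: negligible_iff_null_sets null_sets_completionI)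
  show "(%\<eta>. A22 \<xi> *v \<eta>) = baseB \<xi>" if "\<xi> \<in> \<omega>2 - N" for \<xi>
   using AB[of \<xi>, symmetric] that by (auto simp: baseB_def G_def block_map_def)
 qed
 have INF_eq: "(INF \<nu>\<in>sphere 0 1. Z_dir \<omega>2 A11 A12 A22 \<nu>) = (INF \<nu>\<in>sphere 0 1. Zd \<nu>)"
  by (rule arg_cong[where f = Inf], rule image_cong) (auto simp: dir)
 have "((%l. lambda_cyl \<omega>1 \<omega>2 A11 A12 A22 l k) \<longlongrightarrow> (INF \<nu>\<in>sphere 0 1. Zd \<nu>)) at_top" if "k > 1" for k
 proof -
  have "\<forall>\<^sub>F l in at_top. kth_eigenvalue ((*\<^sub>R) l ` \<omega>1 \<times> \<omega>2) ((*\<^sub>R) l ` \<omega>1 \<times> frontier \<omega>2) cylB k = lambda_cyl \<omega>1 \<omega>2 A11 A12 A22 l k"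
   using eventually_gt_at_top[of 0]
  proof eventually_elim
   fix l :: real assume "l > 0"
   hence "open ((*\<^sub>R) l ` \<omega>1)" using assms(2) by (intro open_scaling) (auto simp: bounded_C1_domain_def)
   thus "kth_eigenvalue ((*\<^sub>R) l ` \<omega>1 \<times> \<omega>2) ((*\<^sub>R) l ` \<omega>1 \<times> frontier \<omega>2) cylB k = lambda_cyl \<omega>1 \<omega>2 A11 A12 A22 l k"
    unfolding lambda_cyl_def by (simp add: cyl)
  qed
  moreover have "((%l. kth_eigenvalue ((*\<^sub>R) l ` \<omega>1 \<times> \<omega>2) ((*\<^sub>R) l ` \<omega>1 \<times> frontier \<omega>2) cylB k) \<longlongrightarrow> (INF \<nu>\<in>sphere 0 1. Zd \<nu>)) at_top"
   by (rule kth_eigenvalue_limit[OF assms(2)]) (use assms(1) that in auto)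
  ultimately show ?thesis by (rule Lim_transform_eventually[rotated])
 qed
 moreover have "(INF \<nu>\<in>sphere 0 1. Zd \<nu>) < mu1 \<omega>2 A22"
  if W: "first_eigenfunction \<omega>2 A22 W" and nz: "~(AE \<xi> in lebesgue_on \<omega>2. A12 \<xi> *v weak_gradient \<omega>2 W \<xi> = 0)" for W
 proof -
  have w: "weak_eigenfunction \<omega>2 (frontier \<omega>2) baseB (mu1 \<omega>2 A22) W" using W unfolding first_eigenfunction_def base by blast
  have "~(AE \<xi> in lebesgue_on \<omega>2. fst (B \<xi> (0, weak_gradient \<omega>2 W \<xi>)) = 0)"
  proof
   assume z: "AE \<xi> in lebesgue_on \<omega>2. fst (B \<xi> (0, weak_gradient \<omega>2 W \<xi>)) = 0"
   have "AE \<xi> in lebesgue. \<xi> \<notin> N" using N(1) by (intro AE_not_in null_sets_completionI)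
   hence "AE \<xi> in lebesgue_on \<omega>2. \<xi> \<in> G" using l2 by (subst AE_restrict_space_iff) (auto elim!: eventually_mono simp: G_def)
   with z have "AE \<xi> in lebesgue_on \<omega>2. A12 \<xi> *v weak_gradient \<omega>2 W \<xi> = 0"
    by eventually_elim (auto simp: AB[symmetric] block_map_def)
   with nz show False by blast
  qed
  from strict_gap[OF w this] obtain \<nu> where \<nu>: "norm \<nu> = 1" "Zd \<nu> < mu1 \<omega>2 A22" by blast
  have "(INF \<nu>\<in>sphere 0 1. Zd \<nu>) <= Zd \<nu>"
   by (rule cINF_lower[OF bdd_belowI[of _ 0]]) (use Zd_nonneg \<nu> in auto)
  with \<nu>(2) show ?thesis by linarith
 qed
 ultimately show ?thesis unfolding INF_eq by blast
qed

end
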